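(* Let $0<a<b<1$ and $\gamma>0$. For $n\in\mathbb{N}^*$ consider $$\partial_tg_n-\partial_x^2g_n+(n\pi)^2|x|^{2\gamma}g_n=0\ \text{in }(0,T)\times(-1,1),\quad g_n(t,\pm1)=0,\quad g_n(0,\cdot)=g_{0,n}\in L^2(-1,1).$$ (1) If $\gamma\in(0,1)$, this system is observable in $(a,b)$ in any time $T>0$ uniformly with respect to $n\in\mathbb{N}^*$. (2) If $\gamma=1$, there exists $T^*>0$ such that for every $T>T^*$ the system is observable in $(a,b)$ in time $T$ uniformly with respect to $n$, and for every $T<T^*$ it is not. (3) If $\gamma>1$, for no $T>0$ is the system observable in $(a,b)$ in time $T$ uniformly with respect to $n$.
   Context: The system is observable in $(a,b)$ in time $T$ uniformly with respect to $n\in\mathbb{N}^*$ if there exists $C>0$ such that for every $n\in\mathbb{N}^*$ and every $g_{0,n}\in L^2(-1,1)$, the (weak) solution satisfies $\int_{-1}^1|g_n(T,x)|^2dx\le C\int_0^T\int_a^b|g_n(t,x)|^2dxdt$. *)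

theory Defs
  imports "HOL-Analysis.Analysis"
begin

definition L2 :: "(real \<Rightarrow> real) \<Rightarrow> bool" where
  "L2 f \<longleftrightarrow> set_borel_measurable lborel {-1..1} f
      \<and> set_integrable lborel {-1..1} (\<lambda>x. (f x)^2)"

text \<open>f belongs to H^1_0(-1,1) with weak derivative h (one-dimensional
  characterisation: f is the primitive of an L^2 function and vanishes at both ends).\<close>
definition H10_deriv :: "(real \<Rightarrow> real) \<Rightarrow> (real \<Rightarrow> real) \<Rightarrow> bool" where
  "H10_deriv f h \<longleftrightarrow> L2 h
      \<and> (\<forall>x\<in>{-1..1}. f x = (LBINT y=-1..ereal x. h y))
      \<and> f 1 = 0"

text \<open>Weak solution on [0,T] of
  d_t g - d_x^2 g + (n pi)^2 |x|^(2 gamma) g = 0, g(t,+-1)=0, g(0)=g0: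
  g in C([0,T];L^2) \<inter> L^2(0,T;H^1_0) satisfying the variational identity
  tested against every H^1_0 function, in integrated-in-time form.\<close>
definition weak_sol ::
  "real \<Rightarrow> nat \<Rightarrow> real \<Rightarrow> (real \<Rightarrow> real) \<Rightarrow> (real \<Rightarrow> real \<Rightarrow> real) \<Rightarrow> bool" where
  "weak_sol \<gamma> n T g0 g \<longleftrightarrow>
     case_prod g \<in> borel_measurable borel
     \<and> (\<forall>t\<in>{0..T}. L2 (g t))
     \<and> (\<forall>t\<in>{0..T}. ((\<lambda>s. LBINT x=-1..1. (g s x - g t x)^2) \<longlongrightarrow> 0) (at t within {0..T}))
     \<and> (LBINT x=-1..1. (g 0 x - g0 x)^2) = 0
     \<and> (\<exists>gx. case_prod gx \<in> borel_measurable borel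
           \<and> (AE t in lborel. t \<in> {0..T} \<longrightarrow> H10_deriv (g t) (gx t))
           \<and> interval_lebesgue_integrable lborel 0 (ereal T) (\<lambda>t. (LBINT x=-1..1. (gx t x)^2))
           \<and> (\<forall>\<phi> \<psi>. H10_deriv \<phi> \<psi> \<longrightarrow> (\<forall>t\<in>{0..T}.
                (LBINT x=-1..1. g t x * \<phi> x) - (LBINT x=-1..1. g0 x * \<phi> x)
                + (LBINT s=0..ereal t. (LBINT x=-1..1.
                     gx s x * \<psi> x + (real n * pi)^2 * \<bar>x\<bar> powr (2*\<gamma>) * g s x * \<phi> x))
                = 0)))"

definition observable :: "real \<Rightarrow> real \<Rightarrow> real \<Rightarrow> real \<Rightarrow> bool" where
  "observable \<gamma> a b T \<longleftrightarrow>
     (\<exists>C>0. \<forall>n::nat. n \<ge> 1 \<longrightarrow> (\<forall>g0 g. L2 g0 \<longrightarrow> weak_sol \<gamma> n T g0 g \<longrightarrow>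
        (LBINT x=-1..1. (g T x)^2)
          \<le> C * (LBINT t=0..ereal T. (LBINT x=ereal a..ereal b. (g t x)^2))))"

end

theory Submission
  imports Defs "HOL-Complex_Analysis.Great_Picard"
begin

text \<open>
  Expand a solution in Dirichlet eigenfunctions \<open>\<phi>\<^sub>k\<close> of \<open>A = -d\<^sup>2/dx\<^sup>2 + V\<close>, \<open>V = (n\<pi>)\<^sup>2 |x|\<^sup>2\<^sup>\<gamma>\<close>; eigenvalues
  are the zeros of the entire function \<open>f(s) = y\<^sub>s(1)\<close>, where \<open>-y\<^sub>s'' + V y\<^sub>s = s y\<^sub>s\<close>, \<open>y\<^sub>s(-1) = 0\<close>,
  \<open>y\<^sub>s'(-1) = 1\<close>.

  For a finite sum \<open>u = \<Sum> c\<^sub>k e\<^bsup>-kt\<^esup> \<phi>\<^sub>k\<close> and fixed \<open>x\<close>, removing all exponents but one by Blaschke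
  factors bounds \<open>|c\<^sub>k \<phi>\<^sub>k(x)|\<close> by the \<open>L\<^sup>2(0,\<infinity>)\<close> norm of \<open>u(\<cdot>,x)\<close> times
  \<open>\<Prod>\<^sub>j (k + j) / |k - j|\<close>. Dividing the power series of \<open>f\<close> by its zeros bounds the product by
  \<open>e\<^bsup>C(n + \<surd>k)\<^esup>\<close>, because \<open>f'(k) = \<integral> y\<^sub>k\<^sup>2 / y\<^sub>k'(1)\<close> and \<open>\<integral>\<^sub>a\<^sup>b \<phi>\<^sub>k\<^sup>2\<close> are controlled by the energy
  of the differential equation. The contribution of times after \<open>T\<close> is at most \<open>\<parallel>u(T)\<parallel>\<^sup>2\<close> over the lowest
  eigenvalue, which is of order \<open>n\<^bsup>2/(1+\<gamma>)\<^esup>\<close>, and it is absorbed as soon as the dissipation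
  \<open>e\<^bsup>-2kT\<^esup>\<close> beats \<open>e\<^bsup>Cn\<^esup>\<close>: for large \<open>n\<close> if \<open>\<gamma> < 1\<close>, for large \<open>T\<close> if \<open>\<gamma> = 1\<close>. The finitely many
  remaining \<open>n\<close> for \<open>\<gamma> < 1\<close> are handled by first discarding the low modes and then putting them back one
  at a time.

  Conversely the lowest eigenfunction has mass \<open>e\<^bsup>-cn\<^esup>\<close> on \<open>(a,b)\<close> and decays in time only like
  \<open>exp(-C n\<^bsup>2/(1+\<gamma>)\<^esup> t)\<close>, which contradicts observability if \<open>\<gamma> > 1\<close>, or if \<open>\<gamma> = 1\<close> and \<open>T\<close> is small.
\<close>

section \<open>Volterra integrals\<close>

text \<open>Uniformity in n is the obstacle: for large n every constant has to be explicit in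
  \<open>\<nu> = n pi\<close>, so those estimates rest on positive power series, energy growth and
  Blaschke factors, all with numerical constants. The two parts of the exponent C(n + sqrt k) are
  paid in different currencies: sqrt k is absorbed by kT for every T > 0 through Young's inequality,
  whereas n can be paid only by the bottom of the spectrum. The spectral theory of the Dirichlet
  operator is built from the shooting function. What weak solutions need from it is that their time
  slices are limits of finite eigenfunction sums; a constant that does not depend on the number of
  modes then passes to the limit.\<close>

definition vol :: "(real \<Rightarrow> real) \<Rightarrow> real \<Rightarrow> real" where
  "vol r x = integral {-1..x} (\<lambda>z. (x - z) * r z)"

lemma continuous_on_Icc_sub:
  fixes r :: "real \<Rightarrow> real"
  assumes "continuous_on {-1..1} r" "x \<le> 1"
  shows "continuous_on {-1..x} r"
  using assms by (auto intro: continuous_on_subset)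

lemma integrable_Icc_sub:
  fixes r :: "real \<Rightarrow> real"
  assumes "continuous_on {-1..1} r" "x \<le> 1"
  shows "r integrable_on {-1..x}"
  using continuous_on_Icc_sub[OF assms] by (rule integrable_continuous_real)

text \<open>\<open>vol r\<close> is Cauchy's formula for the double primitive of \<open>r\<close>
  with vanishing value and slope at -1. Taking x out of the kernel makes it differentiable by the
  fundamental theorem alone, without differentiating under the integral.\<close>

lemma vol_eq:
  assumes r: "continuous_on {-1..1} r" and "x \<le> 1"
  shows "vol r x = x * integral {-1..x} r - integral {-1..x} (\<lambda>z. z * r z)"
proof -
  have c: "continuous_on {-1..x} r"
    using continuous_on_Icc_sub[OF assms] .
  have "vol r x = integral {-1..x} (\<lambda>z. x * r z - z * r z)"
    by (simp add: vol_def algebra_simps)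
  also have "\<dots> = integral {-1..x} (\<lambda>z. x * r z) - integral {-1..x} (\<lambda>z. z * r z)"
    by (intro integral_diff integrable_continuous_real continuous_intros c)
  finally show ?thesis by simp
qed

lemma vol_minus1 [simp]: "vol r (-1) = 0"
  by (simp add: vol_def)

lemma has_real_derivative_integral:
  fixes r :: "real \<Rightarrow> real"
  assumes "continuous_on {-1..1} r" "x \<in> {-1..1}"
  shows "((\<lambda>x. integral {-1..x} r) has_real_derivative r x) (at x within {-1..1})"
  using assms by (rule integral_has_real_derivative)

lemma has_real_derivative_vol:
  assumes r: "continuous_on {-1..1} r" and x: "x \<in> {-1..1}"
  shows "(vol r has_real_derivative integral {-1..x} r) (at x within {-1..1})"
proof -
  have "((\<lambda>x. x * integral {-1..x} r - integral {-1..x} (\<lambda>z. z * r z))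
      has_real_derivative (1 * integral {-1..x} r + r x * x - x * r x)) (at x within {-1..1})"
    by (intro derivative_intros has_real_derivative_integral continuous_intros r x)
  then have "((\<lambda>x. x * integral {-1..x} r - integral {-1..x} (\<lambda>z. z * r z))
      has_real_derivative integral {-1..x} r) (at x within {-1..1})"
    by simp
  then show ?thesis
    unfolding has_field_derivative_def
    by (rule has_derivative_transform[OF x, rotated]) (simp add: vol_eq[OF r])
qed

lemma continuous_on_vol:
  assumes "continuous_on {-1..1} r"
  shows "continuous_on {-1..1} (vol r)"
  by (rule DERIV_continuous_on[OF has_real_derivative_vol[OF assms]])

lemma vol_mono:
  assumes "continuous_on {-1..1} r" "continuous_on {-1..1} s" "x \<in> {-1..1}"
    and "\<And>z. z \<in> {-1..1} \<Longrightarrow> r z \<le> s z"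
  shows "vol r x \<le> vol s x"
  unfolding vol_def using assms
  by (intro integral_le integrable_Icc_sub continuous_intros mult_left_mono) auto

lemma vol_nonneg:
  assumes "continuous_on {-1..1} r" "x \<in> {-1..1}" "\<And>z. z \<in> {-1..1} \<Longrightarrow> 0 \<le> r z"
  shows "0 \<le> vol r x"
  using vol_mono[of "\<lambda>_. 0" r x] assms by (simp add: vol_def)

lemma vol_cmult [simp]: "vol (\<lambda>z. c * r z) x = c * vol r x"
  by (simp add: vol_def mult.left_commute[of _ c])

lemma vol_add:
  assumes "continuous_on {-1..1} r" "continuous_on {-1..1} s" "x \<in> {-1..1}"
  shows "vol (\<lambda>z. r z + s z) x = vol r x + vol s x"
proof -
  have "vol (\<lambda>z. r z + s z) x = integral {-1..x} (\<lambda>z. (x - z) * r z + (x - z) * s z)"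
    by (simp add: vol_def algebra_simps)
  also have "\<dots> = vol r x + vol s x"
    unfolding vol_def using assms
    by (intro integral_add integrable_Icc_sub continuous_intros) auto
  finally show ?thesis .
qed

lemma vol_uminus [simp]: "vol (\<lambda>z. - r z) x = - vol r x"
  by (simp add: vol_def)

lemma abs_vol_le:
  assumes "continuous_on {-1..1} r" "continuous_on {-1..1} s" "x \<in> {-1..1}"
    and "\<And>z. z \<in> {-1..1} \<Longrightarrow> \<bar>r z\<bar> \<le> s z"
  shows "\<bar>vol r x\<bar> \<le> vol s x"
proof -
  have "vol r x \<le> vol s x" "vol (\<lambda>z. - r z) x \<le> vol s x"
    using assms by (intro vol_mono continuous_intros; force simp: abs_le_iff)+
  then show ?thesis by simp
qed

text \<open>The double primitive of w^2 exp(2w(z+1)) is exp(2w(x+1))/4 up to boundary terms of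
  favourable sign. So w^2 \<open>vol\<close> has norm at most 1/4 with respect to the weight
  exp(2w(z+1)), which drives both the Gronwall bound and the Neumann series.\<close>

lemma vol_exp_le:
  assumes w: "w > 0" and x: "x \<in> {-1..1}"
  shows "vol (\<lambda>z. w\<^sup>2 * exp (2 * w * (z + 1))) x \<le> exp (2 * w * (x + 1)) / 4"
proof -
  let ?F = "\<lambda>z. ((x - z) * w / 2 + 1 / 4) * exp (2 * w * (z + 1))"
  have "((\<lambda>z. (x - z) * (w\<^sup>2 * exp (2 * w * (z + 1)))) has_integral (?F x - ?F (-1))) {-1..x}"
  proof (rule fundamental_theorem_of_calculus)
    fix z assume "z \<in> {-1..x}"
    have "(?F has_real_derivative (x - z) * (w\<^sup>2 * exp (2 * w * (z + 1)))) (at z within {-1..x})"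
      by (auto intro!: derivative_eq_intros simp: field_simps power2_eq_square)
    then show "(?F has_vector_derivative (x - z) * (w\<^sup>2 * exp (2 * w * (z + 1)))) (at z within {-1..x})"
      unfolding has_real_derivative_iff_has_vector_derivative .
  qed (use x in auto)
  then have "vol (\<lambda>z. w\<^sup>2 * exp (2 * w * (z + 1))) x = ?F x - ?F (-1)"
    unfolding vol_def by (rule integral_unique)
  also have "\<dots> \<le> ?F x"
  proof -
    have "0 \<le> w * (x + 1)" using w x by simp
    then show ?thesis by simp
  qed
  finally show ?thesis by simp
qed

text \<open>Bielecki's weighted norm: the best C with |Y| <= C exp(2w(x+1)) is attained at some m.
  There the hypothesis gives C <= c + C/4 after division by exp(2w(m+1)) >= 1, whence the factor
  4/3.\<close>

lemma vol_gronwall: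
  assumes Y: "continuous_on {-1..1} Y" and w: "w > 0" and c: "c \<ge> 0"
    and le: "\<And>x. x \<in> {-1..1} \<Longrightarrow> \<bar>Y x\<bar> \<le> c + w\<^sup>2 * vol (\<lambda>z. \<bar>Y z\<bar>) x"
    and x: "x \<in> {-1..1}"
  shows "\<bar>Y x\<bar> \<le> 4 / 3 * c * exp (2 * w * (x + 1))"
proof -
  let ?g = "\<lambda>x. \<bar>Y x\<bar> * exp (- (2 * w * (x + 1)))"
  have "continuous_on {-1..1} ?g"
    by (intro continuous_intros Y)
  then obtain m where m: "m \<in> {-1..1}" "\<And>x. x \<in> {-1..1} \<Longrightarrow> ?g x \<le> ?g m"
    using continuous_attains_sup[of "{-1..1::real}" ?g] by fastforce
  define C where "C = ?g m"
  have C: "\<bar>Y z\<bar> \<le> C * exp (2 * w * (z + 1))" if "z \<in> {-1..1}" for z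
  proof -
    have "\<bar>Y z\<bar> = ?g z * exp (2 * w * (z + 1))"
      by (simp add: exp_minus)
    also have "\<dots> \<le> C * exp (2 * w * (z + 1))"
      unfolding C_def by (intro mult_right_mono m that) simp
    finally show ?thesis .
  qed
  have "\<bar>Y m\<bar> \<le> c + vol (\<lambda>z. w\<^sup>2 * \<bar>Y z\<bar>) m"
    using le[OF m(1)] by simp
  also have "vol (\<lambda>z. w\<^sup>2 * \<bar>Y z\<bar>) m \<le> vol (\<lambda>z. C * (w\<^sup>2 * exp (2 * w * (z + 1)))) m"
    using C m(1) by (intro vol_mono continuous_intros Y) (auto simp: mult.left_commute[of C] intro!: mult_left_mono)
  also have "\<dots> = C * vol (\<lambda>z. w\<^sup>2 * exp (2 * w * (z + 1))) m"
    by (rule vol_cmult)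
  also have "\<dots> \<le> C * (exp (2 * w * (m + 1)) / 4)"
    by (intro mult_left_mono vol_exp_le w m) (simp add: C_def)
  also have "\<bar>Y m\<bar> = C * exp (2 * w * (m + 1))"
    by (simp add: C_def exp_minus)
  finally have "3 / 4 * C * exp (2 * w * (m + 1)) \<le> c"
    by simp
  moreover have "C \<ge> 0" by (simp add: C_def)
  moreover have "exp (2 * w * (m + 1)) \<ge> 1"
    using m w by simp
  ultimately have "3 / 4 * C \<le> c"
    using mult_left_mono[of 1 "exp (2 * w * (m + 1))" "3 / 4 * C"] by linarith
  then have "C \<le> 4 / 3 * c" by simp
  then have "C * exp (2 * w * (x + 1)) \<le> 4 / 3 * c * exp (2 * w * (x + 1))"
    by (intro mult_right_mono) auto
  with C[OF x] show ?thesis by linarith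
qed

lemma vol_sums:
  fixes r :: "nat \<Rightarrow> real \<Rightarrow> real"
  assumes r: "\<And>m. continuous_on {-1..1} (r m)"
    and B: "\<And>m z. z \<in> {-1..1} \<Longrightarrow> \<bar>r m z\<bar> \<le> B m" "summable B" and x: "x \<in> {-1..1}"
  shows "(\<lambda>m. vol (r m) x) sums vol (\<lambda>z. \<Sum>m. r m z) x"
proof -
  have ul: "uniform_limit {-1..x} (\<lambda>n z. \<Sum>m<n. (x - z) * r m z) (\<lambda>z. \<Sum>m. (x - z) * r m z) sequentially"
  proof (rule Weierstrass_m_test)
    fix m z assume z: "z \<in> {-1..x}"
    have "\<bar>(x - z) * r m z\<bar> \<le> 2 * B m"
      unfolding abs_mult using z x B(1)[of z m] by (intro mult_mono) auto
    then show "norm ((x - z) * r m z) \<le> 2 * B m" by simp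
  qed (use B(2) in \<open>auto intro: summable_mult\<close>)
  have cont: "continuous_on {-1..x} (\<lambda>z. \<Sum>m<n. (x - z) * r m z)" for n
    using x by (intro continuous_intros continuous_on_Icc_sub[OF r]) auto
  obtain I J where I: "\<And>n. ((\<lambda>z. \<Sum>m<n. (x - z) * r m z) has_integral I n) {-1..x}"
    and J: "((\<lambda>z. \<Sum>m. (x - z) * r m z) has_integral J) {-1..x}" "I \<longlonglongrightarrow> J"
    using uniform_limit_integral[OF ul cont] by auto
  have "I = (\<lambda>n. \<Sum>m<n. vol (r m) x)"
  proof
    fix n
    have "I n = integral {-1..x} (\<lambda>z. \<Sum>m<n. (x - z) * r m z)"
      using integral_unique[OF I] by simp
    also have "\<dots> = (\<Sum>m<n. vol (r m) x)"
      unfolding vol_def using x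
      by (intro integral_sum integrable_Icc_sub continuous_intros r) auto
    finally show "I n = (\<Sum>m<n. vol (r m) x)" .
  qed
  moreover have "J = vol (\<lambda>z. \<Sum>m. r m z) x"
  proof -
    have "summable (\<lambda>m. r m z)" if "z \<in> {-1..1}" for z
      using B that by (intro summable_comparison_test[OF _ B(2)]) auto
    then have "(\<Sum>m. (x - z) * r m z) = (x - z) * (\<Sum>m. r m z)" if "z \<in> {-1..x}" for z
      using that x by (intro suminf_mult) auto
    then show ?thesis
      using integral_unique[OF J(1)] integral_cong[of "{-1..x}" "\<lambda>z. \<Sum>m. (x - z) * r m z" "\<lambda>z. (x - z) * (\<Sum>m. r m z)"]
      by (simp add: vol_def)
  qed
  ultimately show ?thesis
    using J(2) by (simp add: sums_def)
qed

lemma continuous_on_suminf: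
  fixes r :: "nat \<Rightarrow> real \<Rightarrow> real"
  assumes r: "\<And>m. continuous_on S (r m)"
    and B: "\<And>m z. z \<in> S \<Longrightarrow> \<bar>r m z\<bar> \<le> B m" "summable B"
  shows "continuous_on S (\<lambda>z. \<Sum>m. r m z)"
proof (rule uniform_limit_theorem)
  show "uniform_limit S (\<lambda>n z. \<Sum>m<n. r m z) (\<lambda>z. \<Sum>m. r m z) sequentially"
    using B by (intro Weierstrass_m_test) auto
  show "\<forall>\<^sub>F n in sequentially. continuous_on S (\<lambda>z. \<Sum>m<n. r m z)"
    by (intro always_eventually allI continuous_intros r)
qed simp

section \<open>Dividing a power series by its zeros\<close>

text \<open>A substitute for Jensen's formula on real coefficients: in the weighted norm sum |a_m|
  R^m, dividing a power series by s - l at a zero l costs at most 1/(R - l), the value of 1/(s - l)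
  at s = R.\<close>

lemma powser_divide_zero:
  fixes a :: "nat \<Rightarrow> real"
  assumes sa: "summable (\<lambda>m. \<bar>a m\<bar> * R ^ m)" and l: "0 < l" "l < R"
    and zero: "(\<Sum>m. a m * l ^ m) = 0"
  obtains b where "summable (\<lambda>m. \<bar>b m\<bar> * R ^ m)"
    "(\<Sum>m. \<bar>b m\<bar> * R ^ m) \<le> (\<Sum>m. \<bar>a m\<bar> * R ^ m) / (R - l)"
    "\<And>s. \<bar>s\<bar> \<le> R \<Longrightarrow> (\<Sum>m. a m * s ^ m) = (s - l) * (\<Sum>m. b m * s ^ m)"
proof -
  define n where "n = (\<Sum>m. \<bar>a m\<bar> * R ^ m)"
  \<comment> \<open>Synthetic division started from infinity: the tail sums solve
    \<open>b_rec\<close>, and the vanishing of the series at l enters through the constant term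
    \<open>a0\<close>.\<close>
  define b where "b m = (\<Sum>i. a (m + 1 + i) * l ^ i)" for m
  \<comment> \<open>The same recursion driven by |a|. It dominates |b|, and its weighted partial
    sums telescope in \<open>part\<close>.\<close>
  define c where "c m = (\<Sum>i. \<bar>a (m + 1 + i)\<bar> * l ^ i)" for m
  have R: "R > 0" using l by simp
  have tail: "summable (\<lambda>i. \<bar>a (m + i)\<bar> * R ^ (m + i))" for m
    using summable_iff_shift[of "\<lambda>m. \<bar>a m\<bar> * R ^ m" m] sa by (simp add: add.commute)
  have le: "\<bar>a (m + i)\<bar> * l ^ i * R ^ m \<le> \<bar>a (m + i)\<bar> * R ^ (m + i)" for m i
  proof -
    have "l ^ i \<le> R ^ i" using l by (intro power_mono) auto
    then have "\<bar>a (m + i)\<bar> * l ^ i * R ^ m \<le> \<bar>a (m + i)\<bar> * R ^ i * R ^ m"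
      using R by (intro mult_right_mono mult_left_mono) auto
    then show ?thesis by (simp add: power_add mult_ac)
  qed
  have sc': "summable (\<lambda>i. \<bar>a (m + i)\<bar> * l ^ i)" for m
  proof -
    have "summable (\<lambda>i. \<bar>a (m + i)\<bar> * l ^ i * R ^ m)"
    proof (rule summable_comparison_test'[OF tail[of m], of 0])
      fix i
      have "0 \<le> \<bar>a (m + i)\<bar> * l ^ i * R ^ m" using l R by simp
      then show "norm (\<bar>a (m + i)\<bar> * l ^ i * R ^ m) \<le> \<bar>a (m + i)\<bar> * R ^ (m + i)"
        using le[of m i] by simp
    qed
    moreover have "R ^ m \<noteq> 0" using R by simp
    ultimately show ?thesis
      using summable_cmult_iff[of "R ^ m" "\<lambda>i. \<bar>a (m + i)\<bar> * l ^ i"] R by (auto simp: mult.commute)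
  qed
  have sb': "summable (\<lambda>i. a (m + i) * l ^ i)" for m
  proof (rule summable_comparison_test'[OF sc'[of m], of 0])
    fix i show "norm (a (m + i) * l ^ i) \<le> \<bar>a (m + i)\<bar> * l ^ i"
      using l by (simp add: abs_mult)
  qed
  have b_rec: "b m = a (Suc m) + l * b (Suc m)" for m
  proof -
    have "b m = a (m + 1 + 0) * l ^ 0 + (\<Sum>i. a (m + 1 + Suc i) * l ^ Suc i)"
      unfolding b_def using suminf_split_head[OF sb'[of "m+1"]] by simp
    also have "(\<Sum>i. a (m + 1 + Suc i) * l ^ Suc i) = (\<Sum>i. l * (a (Suc m + 1 + i) * l ^ i))"
      by (simp add: mult_ac)
    also have "\<dots> = l * b (Suc m)"
      unfolding b_def by (intro suminf_mult sb')
    finally show ?thesis by simp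
  qed
  have c_rec: "c m = \<bar>a (Suc m)\<bar> + l * c (Suc m)" for m
  proof -
    have "c m = \<bar>a (m + 1 + 0)\<bar> * l ^ 0 + (\<Sum>i. \<bar>a (m + 1 + Suc i)\<bar> * l ^ Suc i)"
      unfolding c_def using suminf_split_head[OF sc'[of "m+1"]] by simp
    also have "(\<Sum>i. \<bar>a (m + 1 + Suc i)\<bar> * l ^ Suc i) = (\<Sum>i. l * (\<bar>a (Suc m + 1 + i)\<bar> * l ^ i))"
      by (simp add: mult_ac)
    also have "\<dots> = l * c (Suc m)"
      unfolding c_def by (intro suminf_mult sc')
    finally show ?thesis by simp
  qed
  have bc: "\<bar>b m\<bar> \<le> c m" for m
    unfolding b_def c_def using summable_rabs[of "\<lambda>i. a (m + 1 + i) * l ^ i"] sc'[of "m+1"] l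
    by (simp add: abs_mult)
  have a0: "a 0 = - (l * b 0)"
  proof -
    have "0 = a 0 + (\<Sum>i. a (Suc i) * l ^ Suc i)"
      using suminf_split_head[OF sb'[of 0]] zero by simp
    also have "(\<Sum>i. a (Suc i) * l ^ Suc i) = (\<Sum>i. l * (a (0 + 1 + i) * l ^ i))"
      by (simp add: mult_ac)
    also have "\<dots> = l * b 0"
      unfolding b_def by (intro suminf_mult sb')
    finally show ?thesis by simp
  qed
  have part: "(R - l) * (\<Sum>m<N. c m * R ^ m) = (\<Sum>m=1..N. \<bar>a m\<bar> * R ^ m) + l * c N * R ^ N - l * c 0" for N
  proof (induction N)
    case (Suc N)
    have "(R - l) * (\<Sum>m<Suc N. c m * R ^ m) =
       (\<Sum>m=1..N. \<bar>a m\<bar> * R ^ m) + c N * R ^ Suc N - l * c 0"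
      using Suc by (simp add: algebra_simps)
    also have "c N * R ^ Suc N = \<bar>a (Suc N)\<bar> * R ^ Suc N + l * c (Suc N) * R ^ Suc N"
      by (subst c_rec) (simp add: algebra_simps)
    finally show ?case by simp
  qed simp
  have cN: "l * c N * R ^ N \<le> n - (\<Sum>m\<le>N. \<bar>a m\<bar> * R ^ m)" for N
  proof -
    have "l * c N * R ^ N \<le> c N * R ^ (N + 1)"
    proof -
      have "0 \<le> c N" using bc[of N] by linarith
      then have "l * (c N * R ^ N) \<le> R * (c N * R ^ N)"
        using l R by (intro mult_right_mono) auto
      then show ?thesis by (simp add: mult_ac)
    qed
    also have "\<dots> = (\<Sum>i. \<bar>a (N + 1 + i)\<bar> * l ^ i * R ^ (N + 1))"
      unfolding c_def by (intro suminf_mult2 sc')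
    also have "\<dots> \<le> (\<Sum>i. \<bar>a (N + 1 + i)\<bar> * R ^ (N + 1 + i))"
      by (intro suminf_le le tail summable_mult2 sc')
    also have "\<dots> = n - (\<Sum>m<N+1. \<bar>a m\<bar> * R ^ m)"
      unfolding n_def using suminf_minus_initial_segment[OF sa, of "N+1"] by (simp add: add.commute)
    also have "{..<N+1} = {..N}" by auto
    finally show ?thesis .
  qed
  have bound: "(\<Sum>m<N. \<bar>b m\<bar> * R ^ m) \<le> n / (R - l)" for N
  proof -
    have "(\<Sum>m\<le>N. \<bar>a m\<bar> * R ^ m) = \<bar>a 0\<bar> + (\<Sum>m=1..N. \<bar>a m\<bar> * R ^ m)"
      by (simp add: atMost_atLeast0 sum.atLeast_Suc_atMost)
    then have "(R - l) * (\<Sum>m<N. c m * R ^ m) \<le> n - l * c 0"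
      using part[of N] cN[of N] by simp
    also have "\<dots> \<le> n" using l bc[of 0] by simp
    finally have "(\<Sum>m<N. c m * R ^ m) \<le> n / (R - l)"
      using l by (simp add: field_simps)
    moreover have "(\<Sum>m<N. \<bar>b m\<bar> * R ^ m) \<le> (\<Sum>m<N. c m * R ^ m)"
      using bc R by (intro sum_mono mult_right_mono) auto
    ultimately show ?thesis by simp
  qed
  have sb: "summable (\<lambda>m. \<bar>b m\<bar> * R ^ m)"
    using bound R by (intro summableI_nonneg_bounded) auto
  show thesis
  proof
    show "(\<Sum>m. \<bar>b m\<bar> * R ^ m) \<le> (\<Sum>m. \<bar>a m\<bar> * R ^ m) / (R - l)"
      using suminf_le_const[OF sb bound] by (simp add: n_def)
    fix s assume s: "\<bar>s\<bar> \<le> R"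
    have sp: "summable (\<lambda>m. b m * s ^ m)"
    proof (rule summable_rabs_cancel, rule summable_comparison_test'[OF sb, of 0])
      fix m show "norm \<bar>b m * s ^ m\<bar> \<le> \<bar>b m\<bar> * R ^ m"
        using s by (auto simp: abs_mult power_abs intro!: mult_left_mono power_mono)
    qed
    have "(\<lambda>m. a (Suc m) * s ^ Suc m) sums (s * (\<Sum>m. b m * s ^ m) - l * ((\<Sum>m. b m * s ^ m) - b 0))"
    proof -
      have 1: "(\<lambda>m. s * (b m * s ^ m)) sums (s * (\<Sum>m. b m * s ^ m))"
        by (intro sums_mult summable_sums sp)
      have 2: "(\<lambda>m. b (Suc m) * s ^ Suc m) sums ((\<Sum>m. b m * s ^ m) - b 0)"
        using summable_sums[OF sp] sums_Suc_iff[of "\<lambda>m. b m * s ^ m"] by simp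
      have "(\<lambda>m. s * (b m * s ^ m) - l * (b (Suc m) * s ^ Suc m)) sums
         (s * (\<Sum>m. b m * s ^ m) - l * ((\<Sum>m. b m * s ^ m) - b 0))"
        by (intro sums_diff 1 sums_mult 2)
      moreover have "s * (b m * s ^ m) - l * (b (Suc m) * s ^ Suc m) = a (Suc m) * s ^ Suc m" for m
        by (subst b_rec) (simp add: algebra_simps)
      ultimately show ?thesis by simp
    qed
    then have "(\<lambda>m. a m * s ^ m) sums ((s * (\<Sum>m. b m * s ^ m) - l * ((\<Sum>m. b m * s ^ m) - b 0)) + a 0 * s ^ 0)"
      by (subst (asm) sums_Suc_iff) simp
    then show "(\<Sum>m. a m * s ^ m) = (s - l) * (\<Sum>m. b m * s ^ m)"
      by (simp add: sums_iff a0 algebra_simps)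
  qed (rule sb)
qed

lemma powser_divide_zeros:
  fixes a :: "nat \<Rightarrow> real"
  assumes "finite J" and sa: "summable (\<lambda>m. \<bar>a m\<bar> * R ^ m)"
    and J: "\<And>l. l \<in> J \<Longrightarrow> 0 < l \<and> l < R \<and> (\<Sum>m. a m * l ^ m) = 0"
  shows "\<exists>b. summable (\<lambda>m. \<bar>b m\<bar> * R ^ m) \<and>
    (\<Sum>m. \<bar>b m\<bar> * R ^ m) \<le> (\<Sum>m. \<bar>a m\<bar> * R ^ m) / (\<Prod>l\<in>J. R - l) \<and>
    (\<forall>s. \<bar>s\<bar> \<le> R \<longrightarrow> (\<Sum>m. a m * s ^ m) = (\<Prod>l\<in>J. s - l) * (\<Sum>m. b m * s ^ m))"
  using assms(1) J
proof (induction J rule: finite_induct)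
  case empty
  show ?case using sa by (intro exI[of _ a]) auto
next
  case (insert l J)
  then obtain b where b: "summable (\<lambda>m. \<bar>b m\<bar> * R ^ m)"
    "(\<Sum>m. \<bar>b m\<bar> * R ^ m) \<le> (\<Sum>m. \<bar>a m\<bar> * R ^ m) / (\<Prod>l\<in>J. R - l)"
    "\<And>s. \<bar>s\<bar> \<le> R \<Longrightarrow> (\<Sum>m. a m * s ^ m) = (\<Prod>l\<in>J. s - l) * (\<Sum>m. b m * s ^ m)"
    by auto
  have l: "0 < l" "l < R" "(\<Sum>m. a m * l ^ m) = 0" using insert.prems[of l] by auto
  have "(\<Prod>l'\<in>J. l - l') \<noteq> 0" using insert by auto
  then have "(\<Sum>m. b m * l ^ m) = 0" using b(3)[of l] l by simp
  then obtain c where c: "summable (\<lambda>m. \<bar>c m\<bar> * R ^ m)"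
    "(\<Sum>m. \<bar>c m\<bar> * R ^ m) \<le> (\<Sum>m. \<bar>b m\<bar> * R ^ m) / (R - l)"
    "\<And>s. \<bar>s\<bar> \<le> R \<Longrightarrow> (\<Sum>m. b m * s ^ m) = (s - l) * (\<Sum>m. c m * s ^ m)"
    by (rule powser_divide_zero[OF b(1) l(1,2)]) (rule that)
  have "(\<Sum>m. \<bar>c m\<bar> * R ^ m) \<le> ((\<Sum>m. \<bar>a m\<bar> * R ^ m) / (\<Prod>l\<in>J. R - l)) / (R - l)"
    using c(2) divide_right_mono[OF b(2), of "R - l"] l by linarith
  then show ?case
    using c(1,3) b(3) insert.hyps by (intro exI[of _ c]) (auto simp: mult_ac)
qed

lemma powser_abs_le:
  fixes b :: "nat \<Rightarrow> real"
  assumes "summable (\<lambda>m. \<bar>b m\<bar> * R ^ m)" "\<bar>s\<bar> \<le> R"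
  shows "\<bar>\<Sum>m. b m * s ^ m\<bar> \<le> (\<Sum>m. \<bar>b m\<bar> * R ^ m)"
proof -
  have le: "\<bar>b m * s ^ m\<bar> \<le> \<bar>b m\<bar> * R ^ m" for m
    using assms(2) by (auto simp: abs_mult power_abs intro!: mult_left_mono power_mono)
  have "summable (\<lambda>m. \<bar>b m * s ^ m\<bar>)"
    using le by (intro summable_comparison_test'[OF assms(1), of 0]) auto
  then show ?thesis
    using summable_rabs suminf_le[OF le _ assms(1)] by fastforce
qed

section \<open>The initial value problem\<close>

text \<open>For small gamma the potential is not differentiable at 0, so no derivative of
  \<open>V\<close> appears anywhere. Since \<open>V\<close> enters the bounds only through
  \<open>\<nu>\<close>, uniformity in n can be read off from the constants.\<close>

locale sturm =
  fixes V :: "real \<Rightarrow> real" and \<nu> :: real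
  assumes V_cont: "continuous_on {-1..1} V"
    and V_nonneg: "x \<in> {-1..1} \<Longrightarrow> 0 \<le> V x"
    and V_le: "x \<in> {-1..1} \<Longrightarrow> V x \<le> \<nu>\<^sup>2"
    and nu: "1 \<le> \<nu>"
begin

definition K :: "(real \<Rightarrow> real) \<Rightarrow> real \<Rightarrow> real" where
  "K h = vol (\<lambda>z. V z * h z)"

text \<open>The Neumann series of the Volterra equation u = h + \<open>K\<close> u. Its terms are
  nonnegative when \<open>h\<close> is, and this sign is inherited by the coefficients
  \<open>p\<close>.\<close>

definition Sol :: "(real \<Rightarrow> real) \<Rightarrow> real \<Rightarrow> real" where
  "Sol h x = (\<Sum>m. (K ^^ m) h x)"

lemma K_Suc: "(K ^^ Suc m) h = vol (\<lambda>z. V z * (K ^^ m) h z)"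
  unfolding funpow.simps o_def by (rule K_def)

lemma K_iter:
  assumes h: "continuous_on {-1..1} h" and C: "\<And>z. z \<in> {-1..1} \<Longrightarrow> \<bar>h z\<bar> \<le> C"
  shows "continuous_on {-1..1} ((K ^^ m) h) \<and>
    (\<forall>x\<in>{-1..1}. \<bar>(K ^^ m) h x\<bar> \<le> C * (1/4) ^ m * exp (2 * \<nu> * (x + 1)))"
proof (induction m)
  case 0
  have "C \<ge> 0" using C[of 0] by auto
  moreover have "1 \<le> exp (2 * \<nu> * (x + 1))" if "x \<in> {-1..1}" for x
    using that nu by simp
  ultimately show ?case
    using h C by (auto intro: order_trans[OF _ mult_left_mono[of 1]])
next
  case (Suc m)
  let ?D = "C * (1/4) ^ m"
  have C0: "C \<ge> 0" using C[of 0] by auto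
  from Suc have c: "continuous_on {-1..1} ((K ^^ m) h)"
    and b: "\<And>x. x \<in> {-1..1} \<Longrightarrow> \<bar>(K ^^ m) h x\<bar> \<le> ?D * exp (2 * \<nu> * (x + 1))" by auto
  have "\<bar>(K ^^ Suc m) h x\<bar> \<le> C * (1/4) ^ Suc m * exp (2 * \<nu> * (x + 1))" if x: "x \<in> {-1..1}" for x
  proof -
    have "\<bar>(K ^^ Suc m) h x\<bar> \<le> vol (\<lambda>z. ?D * (\<nu>\<^sup>2 * exp (2 * \<nu> * (z + 1)))) x"
      unfolding K_Suc
    proof (intro abs_vol_le continuous_intros V_cont x c)
      fix z :: real assume z: "z \<in> {-1..1}"
      have "\<bar>V z * (K ^^ m) h z\<bar> \<le> \<nu>\<^sup>2 * (?D * exp (2 * \<nu> * (z + 1)))"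
        unfolding abs_mult using V_le[OF z] V_nonneg[OF z] b[OF z] by (intro mult_mono) auto
      then show "\<bar>V z * (K ^^ m) h z\<bar> \<le> ?D * (\<nu>\<^sup>2 * exp (2 * \<nu> * (z + 1)))"
        by (simp add: mult_ac)
    qed
    also have "\<dots> = ?D * vol (\<lambda>z. \<nu>\<^sup>2 * exp (2 * \<nu> * (z + 1))) x"
      by (rule vol_cmult)
    also have "\<dots> \<le> ?D * (exp (2 * \<nu> * (x + 1)) / 4)"
      using C0 nu by (intro mult_left_mono vol_exp_le x) auto
    finally show ?thesis by simp
  qed
  moreover have "continuous_on {-1..1} ((K ^^ Suc m) h)"
    unfolding K_Suc by (intro continuous_on_vol continuous_intros V_cont c)
  ultimately show ?case by blast
qed

lemma Sol_props:
  assumes h: "continuous_on {-1..1} h"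
  shows "continuous_on {-1..1} (Sol h)"
    and "x \<in> {-1..1} \<Longrightarrow> Sol h x = h x + vol (\<lambda>z. V z * Sol h z) x"
    and "(\<And>z. z \<in> {-1..1} \<Longrightarrow> 0 \<le> h z) \<Longrightarrow> x \<in> {-1..1} \<Longrightarrow> 0 \<le> Sol h x"
proof -
  obtain C where C: "\<And>z. z \<in> {-1..1} \<Longrightarrow> \<bar>h z\<bar> \<le> C"
    using compact_imp_bounded[OF compact_continuous_image[OF h compact_Icc]]
    unfolding bounded_iff by (metis imageI real_norm_def)
  have C0: "C \<ge> 0" using C[of 0] by auto
  have c: "continuous_on {-1..1} ((K ^^ m) h)" for m
    using K_iter[OF h C] by blast
  define B where "B m = C * (1/4) ^ m * exp (4 * \<nu>)" for m :: nat
  have b: "\<bar>(K ^^ m) h z\<bar> \<le> B m" if z: "z \<in> {-1..1}" for m z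
  proof -
    have "\<bar>(K ^^ m) h z\<bar> \<le> C * (1/4) ^ m * exp (2 * \<nu> * (z + 1))"
      using K_iter[OF h C] z by blast
    also have "\<dots> \<le> B m"
      unfolding B_def using C0 z nu by (intro mult_left_mono) auto
    finally show ?thesis .
  qed
  have sB: "summable B"
    unfolding B_def by (intro summable_mult2 summable_mult summable_geometric) simp
  show cont: "continuous_on {-1..1} (Sol h)"
    unfolding Sol_def using continuous_on_suminf[of "{-1..1}" "\<lambda>m. (K ^^ m) h", OF c b sB] by simp
  have sum: "summable (\<lambda>m. (K ^^ m) h z)" if "z \<in> {-1..1}" for z
    using b[OF that] by (intro summable_comparison_test[OF _ sB]) auto
  show "Sol h x = h x + vol (\<lambda>z. V z * Sol h z) x" if x: "x \<in> {-1..1}"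
  proof -
    have "(\<lambda>m. vol (\<lambda>z. V z * (K ^^ m) h z) x) sums vol (\<lambda>z. \<Sum>m. V z * (K ^^ m) h z) x"
    proof (rule vol_sums[where B = "\<lambda>m. \<nu>\<^sup>2 * B m"])
      fix m z assume z: "z \<in> {-1..1::real}"
      show "\<bar>V z * (K ^^ m) h z\<bar> \<le> \<nu>\<^sup>2 * B m"
        unfolding abs_mult using V_le[OF z] V_nonneg[OF z] b[OF z] by (intro mult_mono) auto
    qed (auto intro!: continuous_intros V_cont c summable_mult sB x simp del: atLeastAtMost_iff)
    moreover have "vol (\<lambda>z. \<Sum>m. V z * (K ^^ m) h z) x = vol (\<lambda>z. V z * Sol h z) x"
      unfolding vol_def Sol_def using x sum by (intro integral_cong) (auto simp: suminf_mult)
    ultimately have "(\<lambda>m. (K ^^ Suc m) h x) sums vol (\<lambda>z. V z * Sol h z) x"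
      by (simp only: K_Suc)
    moreover have "(\<lambda>m. (K ^^ Suc m) h x) sums (Sol h x - h x)"
      using summable_sums[OF sum[OF x]] sums_Suc_iff[of "\<lambda>m. (K ^^ m) h x"] by (simp add: Sol_def)
    ultimately show ?thesis
      using sums_unique2 by fastforce
  qed
  show "0 \<le> Sol h x" if pos: "\<And>z. z \<in> {-1..1} \<Longrightarrow> 0 \<le> h z" and x: "x \<in> {-1..1}"
  proof -
    have "\<forall>z\<in>{-1..1}. 0 \<le> (K ^^ m) h z" for m
    proof (induction m)
      case (Suc m)
      show ?case
        unfolding K_Suc using Suc
        by (auto intro!: vol_nonneg continuous_intros V_cont mult_nonneg_nonneg V_nonneg c)
    qed (use pos in simp)
    then show ?thesis
      unfolding Sol_def using x sum by (intro suminf_nonneg) auto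
  qed
qed

text \<open>Coefficients of the shooting function in powers of -s: p_0'' = V p_0 and p_(m+1)'' = V
  p_(m+1) + p_m. Expanding in -s makes them all nonnegative, so the series at -s = R is also the sum
  of the absolute values.\<close>

primrec p :: "nat \<Rightarrow> real \<Rightarrow> real" where
  "p 0 = Sol (\<lambda>x. x + 1)"
| "p (Suc m) = Sol (vol (p m))"

lemma p_cont: "continuous_on {-1..1} (p m)"
  by (induction m) (auto intro!: Sol_props continuous_intros continuous_on_vol)

lemma p_0: "x \<in> {-1..1} \<Longrightarrow> p 0 x = (x + 1) + vol (\<lambda>z. V z * p 0 z) x"
  unfolding p.simps by (rule Sol_props(2)) (auto intro!: continuous_intros)

lemma p_Suc: "x \<in> {-1..1} \<Longrightarrow> p (Suc m) x = vol (p m) x + vol (\<lambda>z. V z * p (Suc m) z) x"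
  unfolding p.simps by (rule Sol_props(2)) (auto intro!: continuous_on_vol p_cont)

lemma p_nonneg: "x \<in> {-1..1} \<Longrightarrow> 0 \<le> p m x"
proof (induction m arbitrary: x)
  case 0
  show ?case unfolding p.simps by (rule Sol_props(3)) (use 0 in \<open>auto intro!: continuous_intros\<close>)
next
  case (Suc m)
  show ?case unfolding p.simps
    by (rule Sol_props(3)[OF continuous_on_vol[OF p_cont] vol_nonneg[OF p_cont]]) (use Suc in auto)
qed

declare p.simps [simp del]

text \<open>At -s = R the series sums to a solution of u'' = (V + R) u, whose growth is governed by
  sqrt(\<open>\<nu>\<close>^2 + R). This growth of order 1/2 in R is the origin of sqrt k in the
  final exponent.\<close>

lemma p_partial_sum_le:
  assumes R: "R \<ge> 0" and x: "x \<in> {-1..1}"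
  shows "(\<Sum>m<N. p m x * R ^ m) \<le> 3 * exp (4 * sqrt (\<nu>\<^sup>2 + R))"
proof -
  define Y where "Y N x = (\<Sum>m<N. p m x * R ^ m)" for N x
  define w where "w = sqrt (\<nu>\<^sup>2 + R)"
  have w: "w > 0" "w\<^sup>2 = \<nu>\<^sup>2 + R" using R nu by (auto simp: w_def add_pos_nonneg)
  have Yc: "continuous_on {-1..1} (Y N)" for N
    unfolding Y_def by (intro continuous_intros p_cont)
  have Yn: "0 \<le> Y N x" if "x \<in> {-1..1}" for N x
    unfolding Y_def using R p_nonneg[OF that] by (intro sum_nonneg) auto
  have Ymono: "Y N x \<le> Y (Suc N) x" if "x \<in> {-1..1}" for N x
    unfolding Y_def using R p_nonneg[OF that] by simp
  \<comment> \<open>The partial sum with N + 1 terms is driven by the one with N terms. Since the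
    terms are nonnegative the latter is dominated by the former, and Gronwall closes on a single
    function.\<close>
  have eq: "Y (Suc N) x = (x + 1) + vol (\<lambda>z. V z * Y (Suc N) z) x + R * vol (Y N) x"
    if x: "x \<in> {-1..1}" for N x
  proof (induction N)
    case 0
    then show ?case using p_0[OF x] by (simp add: Y_def vol_def)
  next
    case (Suc N)
    have "vol (\<lambda>z. V z * Y (Suc (Suc N)) z) x
        = vol (\<lambda>z. V z * Y (Suc N) z + R ^ Suc N * (V z * p (Suc N) z)) x"
      by (simp add: Y_def algebra_simps)
    also have "\<dots> = vol (\<lambda>z. V z * Y (Suc N) z) x + R ^ Suc N * vol (\<lambda>z. V z * p (Suc N) z) x"
      using x by (subst vol_add) (auto intro!: continuous_intros V_cont Yc p_cont)
    finally have 1: "vol (\<lambda>z. V z * Y (Suc (Suc N)) z) x = \<dots>" .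
    have "vol (Y (Suc N)) x = vol (\<lambda>z. Y N z + R ^ N * p N z) x"
      by (simp add: Y_def[abs_def] algebra_simps)
    also have "\<dots> = vol (Y N) x + R ^ N * vol (p N) x"
      using x by (subst vol_add) (auto intro!: continuous_intros Yc p_cont)
    finally have 2: "vol (Y (Suc N)) x = \<dots>" .
    have "Y (Suc (Suc N)) x = Y (Suc N) x + R ^ Suc N * p (Suc N) x"
      by (simp add: Y_def)
    then show ?case
      unfolding 1 2 using Suc p_Suc[OF x, of N] by (simp add: algebra_simps)
  qed
  have "\<bar>Y (Suc N) x\<bar> \<le> 4 / 3 * 2 * exp (2 * w * (x + 1))"
  proof (rule vol_gronwall[OF Yc w(1) _ _ x])
    fix x :: real assume x: "x \<in> {-1..1}"
    have "vol (\<lambda>z. V z * Y (Suc N) z) x \<le> vol (\<lambda>z. \<nu>\<^sup>2 * Y (Suc N) z) x"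
      using x Yn V_le by (intro vol_mono continuous_intros V_cont Yc mult_right_mono) auto
    moreover have "vol (Y N) x \<le> vol (Y (Suc N)) x"
      using x Ymono by (intro vol_mono Yc) auto
    ultimately have "Y (Suc N) x \<le> 2 + \<nu>\<^sup>2 * vol (Y (Suc N)) x + R * vol (Y (Suc N)) x"
      using eq[OF x, of N] x R mult_left_mono[of "vol (Y N) x" "vol (Y (Suc N)) x" R] by simp
    moreover have "vol (Y (Suc N)) x = vol (\<lambda>z. \<bar>Y (Suc N) z\<bar>) x"
      unfolding vol_def using Yn x by (intro integral_cong) auto
    ultimately show "\<bar>Y (Suc N) x\<bar> \<le> 2 + w\<^sup>2 * vol (\<lambda>z. \<bar>Y (Suc N) z\<bar>) x"
      using Yn[OF x, of "Suc N"] by (simp add: w(2) algebra_simps)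
  qed simp
  also have "\<dots> \<le> 3 * exp (4 * w)"
    using w x by (intro mult_mono) auto
  finally have "Y (Suc N) x \<le> 3 * exp (4 * w)" by simp
  with Ymono[OF x, of N] show ?thesis by (simp add: Y_def w_def)
qed

lemma p_summable:
  assumes "R \<ge> 0" "x \<in> {-1..1}"
  shows "summable (\<lambda>m. p m x * R ^ m)" "(\<Sum>m. p m x * R ^ m) \<le> 3 * exp (4 * sqrt (\<nu>\<^sup>2 + R))"
proof -
  show s: "summable (\<lambda>m. p m x * R ^ m)"
    using assms p_nonneg by (intro summableI_nonneg_bounded[OF _ p_partial_sum_le]) auto
  show "(\<Sum>m. p m x * R ^ m) \<le> 3 * exp (4 * sqrt (\<nu>\<^sup>2 + R))"
    by (rule suminf_le_const[OF s p_partial_sum_le[OF assms]])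
qed

text \<open>Cauchy's estimate from the positive series at radius 2|s| + 1; the geometric ratio 1/2
  gives uniform convergence in x.\<close>

lemma p_term_le:
  assumes x: "x \<in> {-1..1}"
  shows "\<bar>p m x * (- s) ^ m\<bar> \<le> 3 * exp (4 * sqrt (\<nu>\<^sup>2 + (2 * \<bar>s\<bar> + 1))) * (1/2) ^ m"
proof -
  let ?R = "2 * \<bar>s\<bar> + 1"
  have "p m x * ?R ^ m \<le> (\<Sum>m. p m x * ?R ^ m)"
    using sum_le_suminf[OF p_summable(1)[of ?R x], of "{m}"] x p_nonneg[OF x] by simp
  also have "\<dots> \<le> 3 * exp (4 * sqrt (\<nu>\<^sup>2 + ?R))"
    by (rule p_summable(2)) (use x in auto)
  finally have 1: "p m x * ?R ^ m \<le> 3 * exp (4 * sqrt (\<nu>\<^sup>2 + ?R))" .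
  have "\<bar>s\<bar> ^ m \<le> (?R * (1/2)) ^ m" by (intro power_mono) auto
  then have "p m x * \<bar>s\<bar> ^ m \<le> p m x * (?R ^ m * (1/2) ^ m)"
    unfolding power_mult_distrib[symmetric] by (intro mult_left_mono p_nonneg x)
  also have "\<dots> \<le> 3 * exp (4 * sqrt (\<nu>\<^sup>2 + ?R)) * (1/2) ^ m"
    using mult_right_mono[OF 1, of "(1/2)^m"] by (simp add: mult_ac)
  finally show ?thesis using p_nonneg[OF x] by (simp add: abs_mult power_abs)
qed

definition y :: "real \<Rightarrow> real \<Rightarrow> real" where
  "y s x = (\<Sum>m. p m x * (- s) ^ m)"

definition dy :: "real \<Rightarrow> real \<Rightarrow> real" where
  "dy s x = 1 + integral {-1..x} (\<lambda>z. (V z - s) * y s z)"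

lemma summable_half: "summable (\<lambda>m. D * (1/2) ^ m :: real)"
  by (intro summable_mult summable_geometric) simp

lemma y_summable: "x \<in> {-1..1} \<Longrightarrow> summable (\<lambda>m. p m x * (- s) ^ m)"
  using p_term_le by (intro summable_comparison_test[OF _ summable_half]) auto

lemma y_cont: "continuous_on {-1..1} (y s)"
  unfolding y_def
  by (rule continuous_on_suminf[OF _ p_term_le summable_half]) (auto intro!: continuous_intros p_cont)

lemma y_eq:
  assumes x: "x \<in> {-1..1}"
  shows "y s x = (x + 1) + vol (\<lambda>z. (V z - s) * y s z) x"
proof -
  define D where "D = 3 * exp (4 * sqrt (\<nu>\<^sup>2 + (2 * \<bar>s\<bar> + 1)))"
  have 1: "(\<lambda>m. vol (\<lambda>z. p m z * (- s) ^ m) x) sums vol (y s) x"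
    unfolding y_def
    by (rule vol_sums[OF _ p_term_le summable_half x]) (auto intro!: continuous_intros p_cont)
  have "(\<lambda>m. vol (\<lambda>z. V z * (p m z * (- s) ^ m)) x) sums vol (\<lambda>z. \<Sum>m. V z * (p m z * (- s) ^ m)) x"
  proof (rule vol_sums[where B = "\<lambda>m. \<nu>\<^sup>2 * (D * (1/2) ^ m)"])
    fix m z assume z: "z \<in> {-1..1::real}"
    show "\<bar>V z * (p m z * (- s) ^ m)\<bar> \<le> \<nu>\<^sup>2 * (D * (1/2) ^ m)"
      unfolding abs_mult[of "V z"] D_def using V_le[OF z] V_nonneg[OF z]
      by (intro mult_mono p_term_le z) auto
  qed (auto intro!: continuous_intros V_cont p_cont summable_mult summable_geometric x simp del: atLeastAtMost_iff)
  moreover have "vol (\<lambda>z. \<Sum>m. V z * (p m z * (- s) ^ m)) x = vol (\<lambda>z. V z * y s z) x"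
    unfolding vol_def y_def using x y_summable by (intro integral_cong) (auto simp: suminf_mult)
  ultimately have 2: "(\<lambda>m. vol (\<lambda>z. V z * (p m z * (- s) ^ m)) x) sums vol (\<lambda>z. V z * y s z) x" by simp
  have s2': "(\<lambda>m. vol (\<lambda>z. V z * (p (Suc m) z * (- s) ^ Suc m)) x) sums
      (vol (\<lambda>z. V z * y s z) x - vol (\<lambda>z. V z * p 0 z) x)"
    using 2 sums_Suc_iff[of "\<lambda>m. vol (\<lambda>z. V z * (p m z * (- s) ^ m)) x"] by simp
  \<comment> \<open>The series of -s p_m and of V p_(m+1) are paired with an index shift, because
    the source term of \<open>p (Suc m)\<close> is \<open>p m\<close>.\<close>
  have "(\<lambda>m. - s * vol (\<lambda>z. p m z * (- s) ^ m) x + vol (\<lambda>z. V z * (p (Suc m) z * (- s) ^ Suc m)) x) sums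
     (- s * vol (y s) x + (vol (\<lambda>z. V z * y s z) x - vol (\<lambda>z. V z * p 0 z) x))"
    by (intro sums_add sums_mult 1 s2')
  moreover have "- s * vol (\<lambda>z. p m z * (- s) ^ m) x + vol (\<lambda>z. V z * (p (Suc m) z * (- s) ^ Suc m)) x
      = p (Suc m) x * (- s) ^ Suc m" for m
  proof -
    have A: "vol (\<lambda>z. p m z * (- s) ^ m) x = (- s) ^ m * vol (p m) x"
      using vol_cmult[of "(- s) ^ m" "p m" x] by (simp add: mult.commute)
    have B: "vol (\<lambda>z. V z * (p (Suc m) z * (- s) ^ Suc m)) x = (- s) ^ Suc m * vol (\<lambda>z. V z * p (Suc m) z) x"
      using vol_cmult[of "(- s) ^ Suc m" "\<lambda>z. V z * p (Suc m) z" x] by (simp only: mult_ac)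
    show ?thesis
      unfolding A B p_Suc[OF x, of m] by (simp add: algebra_simps)
  qed
  ultimately have "(\<lambda>m. p (Suc m) x * (- s) ^ Suc m) sums
     (- s * vol (y s) x + (vol (\<lambda>z. V z * y s z) x - vol (\<lambda>z. V z * p 0 z) x))" by simp
  moreover have "(\<lambda>m. p (Suc m) x * (- s) ^ Suc m) sums (y s x - p 0 x)"
    using summable_sums[OF y_summable[OF x]] sums_Suc_iff[of "\<lambda>m. p m x * (- s) ^ m"] by (simp add: y_def)
  ultimately have "y s x - p 0 x = - s * vol (y s) x + (vol (\<lambda>z. V z * y s z) x - vol (\<lambda>z. V z * p 0 z) x)"
    using sums_unique2 by blast
  moreover have "vol (\<lambda>z. (V z - s) * y s z) x = vol (\<lambda>z. V z * y s z + (- s) * y s z) x"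
    by (simp add: algebra_simps)
  moreover have "\<dots> = vol (\<lambda>z. V z * y s z) x + (- s) * vol (y s) x"
    using x by (subst vol_add) (auto intro!: continuous_intros V_cont y_cont simp del: mult_minus_left)
  ultimately show ?thesis
    using p_0[OF x] by simp
qed

lemma y_deriv:
  assumes x: "x \<in> {-1..1}"
  shows "(y s has_real_derivative dy s x) (at x within {-1..1})"
proof -
  have "((\<lambda>x. (x + 1) + vol (\<lambda>z. (V z - s) * y s z) x) has_real_derivative dy s x) (at x within {-1..1})"
    unfolding dy_def
    by (auto intro!: derivative_eq_intros has_real_derivative_vol continuous_intros V_cont y_cont x simp del: atLeastAtMost_iff)
  then show ?thesis
    unfolding has_field_derivative_def
    by (rule has_derivative_transform[OF x, rotated]) (rule y_eq)
qed

lemma dy_deriv: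
  assumes x: "x \<in> {-1..1}"
  shows "(dy s has_real_derivative (V x - s) * y s x) (at x within {-1..1})"
  unfolding dy_def[abs_def]
  by (auto intro!: derivative_eq_intros has_real_derivative_integral continuous_intros V_cont y_cont x simp del: atLeastAtMost_iff)

lemma dy_cont: "continuous_on {-1..1} (dy s)"
  by (rule DERIV_continuous_on[OF dy_deriv])

lemma y_init [simp]: "y s (-1) = 0" "dy s (-1) = 1"
  by (auto simp: y_eq dy_def)

text \<open>Serves to let s tend to an eigenvalue inside an integral. The factor m r^(m-1) expected
  for a difference of powers is traded for (r + 1)^m, so that the positive series at radius r + 1
  sums the error.\<close>

lemma y_lipschitz:
  assumes x: "x \<in> {-1..1}" and st: "\<bar>s\<bar> \<le> r" "\<bar>t\<bar> \<le> r"
  shows "\<bar>y s x - y t x\<bar> \<le> \<bar>s - t\<bar> * (3 * exp (4 * sqrt (\<nu>\<^sup>2 + (r + 1))))"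
proof -
  have r: "r \<ge> 0" using st by linarith
  have pw: "\<bar>(- s) ^ m - (- t) ^ m\<bar> \<le> \<bar>s - t\<bar> * (r + 1) ^ m" for m
  proof (induction m)
    case (Suc m)
    have "(- s) ^ Suc m - (- t) ^ Suc m = (- s) * ((- s) ^ m - (- t) ^ m) + (t - s) * (- t) ^ m"
      by (simp add: algebra_simps)
    also have "\<bar>\<dots>\<bar> \<le> \<bar>s\<bar> * \<bar>(- s) ^ m - (- t) ^ m\<bar> + \<bar>s - t\<bar> * \<bar>t\<bar> ^ m"
      by (rule order_trans[OF abs_triangle_ineq]) (simp add: abs_mult power_abs abs_minus_commute)
    also have "\<dots> \<le> r * (\<bar>s - t\<bar> * (r + 1) ^ m) + \<bar>s - t\<bar> * (r + 1) ^ m"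
      using Suc st r by (intro add_mono mult_mono power_mono) auto
    finally show ?case by (simp add: algebra_simps)
  qed simp
  have s1: "summable (\<lambda>m. \<bar>s - t\<bar> * (p m x * (r + 1) ^ m))"
    using r x by (intro summable_mult p_summable) auto
  have le: "\<bar>p m x * (- s) ^ m - p m x * (- t) ^ m\<bar> \<le> \<bar>s - t\<bar> * (p m x * (r + 1) ^ m)" for m
  proof -
    have "\<bar>p m x * (- s) ^ m - p m x * (- t) ^ m\<bar> = \<bar>p m x\<bar> * \<bar>(- s) ^ m - (- t) ^ m\<bar>"
      by (simp only: right_diff_distrib[symmetric] abs_mult)
    also have "\<dots> \<le> p m x * (\<bar>s - t\<bar> * (r + 1) ^ m)"
      using pw[of m] p_nonneg[OF x, of m] by (intro mult_mono) auto
    also have "\<dots> = \<bar>s - t\<bar> * (p m x * (r + 1) ^ m)" by (rule mult.left_commute)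
    finally show ?thesis .
  qed
  have s2: "summable (\<lambda>m. \<bar>p m x * (- s) ^ m - p m x * (- t) ^ m\<bar>)"
    using le by (intro summable_comparison_test'[OF s1, of 0]) auto
  have "y s x - y t x = (\<Sum>m. p m x * (- s) ^ m - p m x * (- t) ^ m)"
    unfolding y_def by (intro suminf_diff y_summable x)
  also have "\<bar>\<dots>\<bar> \<le> (\<Sum>m. \<bar>p m x * (- s) ^ m - p m x * (- t) ^ m\<bar>)"
    by (rule summable_rabs[OF s2])
  also have "\<dots> \<le> (\<Sum>m. \<bar>s - t\<bar> * (p m x * (r + 1) ^ m))"
    by (rule suminf_le[OF le s2 s1])
  also have "\<dots> = \<bar>s - t\<bar> * (\<Sum>m. p m x * (r + 1) ^ m)"
    using r x by (intro suminf_mult p_summable) auto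
  also have "\<dots> \<le> \<bar>s - t\<bar> * (3 * exp (4 * sqrt (\<nu>\<^sup>2 + (r + 1))))"
    using r x by (intro mult_left_mono p_summable) auto
  finally show ?thesis .
qed

end

section \<open>Energy identities for the Dirichlet problem\<close>

lemma ftc:
  fixes F :: "real \<Rightarrow> real"
  assumes "a \<le> b" "\<And>x. x \<in> {a..b} \<Longrightarrow> (F has_real_derivative f x) (at x within {a..b})"
  shows "(f has_integral (F b - F a)) {a..b}"
  using assms by (intro fundamental_theorem_of_calculus)
    (auto simp: has_real_derivative_iff_has_vector_derivative[symmetric])

lemma deriv_mono:
  fixes F :: "real \<Rightarrow> real"
  assumes "a \<le> b" "\<And>x. x \<in> {a..b} \<Longrightarrow> (F has_real_derivative f x) (at x within {a..b})"
    and "\<And>x. x \<in> {a..b} \<Longrightarrow> 0 \<le> f x"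
  shows "F a \<le> F b"
  using has_integral_nonneg[OF ftc[OF assms(1,2)] assms(3)] by simp

lemma integral_lincomb:
  fixes f g :: "real \<Rightarrow> real"
  assumes "continuous_on {a..b} f" "continuous_on {a..b} g"
  shows "integral {a..b} (\<lambda>x. c * f x + d * g x) = c * integral {a..b} f + d * integral {a..b} g"
proof -
  have "integral {a..b} (\<lambda>x. c * f x + d * g x) = integral {a..b} (\<lambda>x. c * f x) + integral {a..b} (\<lambda>x. d * g x)"
    using assms by (intro integral_add integrable_continuous_real continuous_intros)
  then show ?thesis by simp
qed

lemma integral_cont_mono:
  fixes f g :: "real \<Rightarrow> real"
  assumes "continuous_on {a..b} f" "continuous_on {a..b} g" "\<And>x. x \<in> {a..b} \<Longrightarrow> f x \<le> g x"
  shows "integral {a..b} f \<le> integral {a..b} g"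
  using assms by (intro integral_le integrable_continuous_real)

lemma exp_growth:
  fixes F :: "real \<Rightarrow> real"
  assumes d: "\<And>x. x \<in> {-1..1} \<Longrightarrow> (F has_real_derivative f x) (at x within {-1..1})"
    and le: "\<And>x. x \<in> {-1..1} \<Longrightarrow> f x \<le> k * F x" and x: "x \<in> {-1..1}"
  shows "F x \<le> F (-1) * exp (k * (x + 1))"
proof -
  have "- (F (-1) * exp (- (k * (-1 + 1)))) \<le> - (F x * exp (- (k * (x + 1))))"
  proof (rule deriv_mono[where F = "\<lambda>z. - (F z * exp (- (k * (z + 1))))" and a = "-1" and b = x
        and f = "\<lambda>z. (k * F z - f z) * exp (- (k * (z + 1)))"])
    fix z assume z: "z \<in> {-1..x}"
    have "(F has_real_derivative f z) (at z within {-1..x})"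
      using x z by (intro has_field_derivative_subset[OF d]) auto
    then show "((\<lambda>z. - (F z * exp (- (k * (z + 1))))) has_real_derivative (k * F z - f z) * exp (- (k * (z + 1))))
        (at z within {-1..x})"
      by (auto intro!: derivative_eq_intros simp: algebra_simps)
    show "0 \<le> (k * F z - f z) * exp (- (k * (z + 1)))"
      using le[of z] x z by (intro mult_nonneg_nonneg) auto
  qed (use x in auto)
  then have "F x * exp (- (k * (x + 1))) \<le> F (-1)" by simp
  then have "F x * exp (- (k * (x + 1))) * exp (k * (x + 1)) \<le> F (-1) * exp (k * (x + 1))"
    by (rule mult_right_mono) simp
  then show ?thesis by (simp add: mult.assoc exp_add[symmetric])
qed

text \<open>Integrate the derivative of x u^2 and complete the square; x^2 <= 1 is all that is used
  of the interval. The constant 4 is cruder than the sharp 4/pi^2, but it only has to keep the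
  spectrum away from 0.\<close>

lemma poincare:
  assumes u: "\<And>x. x \<in> {-1..1} \<Longrightarrow> (u has_real_derivative u' x) (at x within {-1..1})"
    and u': "continuous_on {-1..1} u'" and bc: "u (-1) = 0" "u 1 = 0"
  shows "integral {-1..1} (\<lambda>x. (u x)\<^sup>2) \<le> 4 * integral {-1..1} (\<lambda>x. (u' x)\<^sup>2)"
proof -
  have uc: "continuous_on {-1..1} u" by (rule DERIV_continuous_on[OF u])
  let ?f = "\<lambda>x. (u x)\<^sup>2 + 2 * x * u x * u' x"
  have "(?f has_integral (1 * (u 1)\<^sup>2 - (-1) * (u (-1))\<^sup>2)) {-1..1}"
    by (rule ftc[where F = "\<lambda>x. x * (u x)\<^sup>2"])
       (auto intro!: derivative_eq_intros u simp: algebra_simps)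
  then have "integral {-1..1} ?f = 0" using bc by (simp add: integral_unique)
  moreover have "integral {-1..1} (\<lambda>x. 1/2 * (u x)\<^sup>2 + (-2) * (u' x)\<^sup>2) \<le> integral {-1..1} ?f"
  proof (intro integral_cont_mono continuous_intros uc u')
    fix x :: real assume x: "x \<in> {-1..1}"
    have "0 \<le> (u x + 2 * x * u' x)\<^sup>2" by simp
    then have "- 4 * x * u x * u' x \<le> (u x)\<^sup>2 + 4 * (x\<^sup>2 * (u' x)\<^sup>2)"
      by (simp add: power2_eq_square algebra_simps)
    moreover have "x\<^sup>2 * (u' x)\<^sup>2 \<le> 1 * (u' x)\<^sup>2"
      using x by (intro mult_right_mono) (auto simp: abs_square_le_1)
    ultimately show "1/2 * (u x)\<^sup>2 + (-2) * (u' x)\<^sup>2 \<le> ?f x" by simp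
  qed
  moreover have "integral {-1..1} (\<lambda>x. 1/2 * (u x)\<^sup>2 + (-2) * (u' x)\<^sup>2)
      = 1/2 * integral {-1..1} (\<lambda>x. (u x)\<^sup>2) + (-2) * integral {-1..1} (\<lambda>x. (u' x)\<^sup>2)"
    by (intro integral_lincomb continuous_intros uc u')
  ultimately show ?thesis by simp
qed

text \<open>The integral of the cutoff of \<open>local_mass_ge\<close>. The double zeros at both
  ends kill the boundary terms there, and the interval enters that bound through this number
  alone.\<close>

definition cutoff_mass :: "real \<Rightarrow> real \<Rightarrow> real" where
  "cutoff_mass a b = integral {a..b} (\<lambda>x. (x - a)\<^sup>2 * (b - x)\<^sup>2)"

lemma cutoff_mass_pos:
  assumes "a < b"
  shows "0 < cutoff_mass a b"
proof -
  have c: "continuous_on {a..b} (\<lambda>x. (x - a)\<^sup>2 * (b - x)\<^sup>2)" by (intro continuous_intros)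
  have "0 \<le> cutoff_mass a b"
    unfolding cutoff_mass_def by (intro integral_nonneg integrable_continuous_real c) simp
  moreover have "cutoff_mass a b \<noteq> 0"
  proof
    assume "cutoff_mass a b = 0"
    then have "\<forall>x\<in>{a..b}. (x - a)\<^sup>2 * (b - x)\<^sup>2 = 0"
      unfolding cutoff_mass_def using integral_eq_0_iff[OF c assms] by simp
    from bspec[OF this, of "(a + b) / 2"] show False using assms by simp
  qed
  ultimately show ?thesis by simp
qed

section \<open>The Dirichlet operator: form identities, a priori bounds and solvability\<close>

context sturm
begin

lemma y_zero: "x \<in> {-1..1} \<Longrightarrow> y 0 x = p 0 x"
  unfolding y_def using powser_zero[of "\<lambda>m. p m x"] by simp

lemma y_0_1_ge: "2 \<le> y 0 1"
proof -
  have "0 \<le> vol (\<lambda>z. (V z - 0) * y 0 z) 1"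
    by (intro vol_nonneg continuous_intros V_cont y_cont)
       (auto simp: y_zero intro!: mult_nonneg_nonneg V_nonneg p_nonneg)
  then show ?thesis using y_eq[of 1 0] by simp
qed

text \<open>\<open>u\<close> lies in the domain of the Dirichlet operator A = -d^2/dx^2 + V and A u
  = h. With \<open>h\<close> continuous all derivatives are classical, and \<open>u'\<close> is
  carried along as data.\<close>

definition DA :: "(real \<Rightarrow> real) \<Rightarrow> (real \<Rightarrow> real) \<Rightarrow> (real \<Rightarrow> real) \<Rightarrow> bool" where
  "DA u u' h \<longleftrightarrow> continuous_on {-1..1} h \<and>
     (\<forall>x\<in>{-1..1}. (u has_real_derivative u' x) (at x within {-1..1}) \<and>
        (u' has_real_derivative (V x * u x - h x)) (at x within {-1..1})) \<and>
     u (-1) = 0 \<and> u 1 = 0"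

lemma DA_D:
  assumes "DA u u' h"
  shows "\<And>x. x \<in> {-1..1} \<Longrightarrow> (u has_real_derivative u' x) (at x within {-1..1})"
    "\<And>x. x \<in> {-1..1} \<Longrightarrow> (u' has_real_derivative (V x * u x - h x)) (at x within {-1..1})"
    "u (-1) = 0" "u 1 = 0" "continuous_on {-1..1} h" "continuous_on {-1..1} u" "continuous_on {-1..1} u'"
  using assms unfolding DA_def by (auto intro: DERIV_continuous_on)

lemma DA_lincomb:
  assumes "DA u u' h" "DA w w' k"
  shows "DA (\<lambda>x. c * u x + d * w x) (\<lambda>x. c * u' x + d * w' x) (\<lambda>x. c * h x + d * k x)"
  unfolding DA_def
proof (intro conjI ballI)
  show "continuous_on {-1..1} (\<lambda>x. c * h x + d * k x)"
    by (intro continuous_intros DA_D(5)[OF assms(1)] DA_D(5)[OF assms(2)])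
  fix x :: real assume x: "x \<in> {-1..1}"
  show "((\<lambda>x. c * u x + d * w x) has_real_derivative c * u' x + d * w' x) (at x within {-1..1})"
    by (auto intro!: derivative_eq_intros DA_D(1)[OF assms(1) x] DA_D(1)[OF assms(2) x])
  show "((\<lambda>x. c * u' x + d * w' x) has_real_derivative V x * (c * u x + d * w x) - (c * h x + d * k x)) (at x within {-1..1})"
    by (auto intro!: derivative_eq_intros DA_D(2)[OF assms(1) x] DA_D(2)[OF assms(2) x] simp: algebra_simps)
qed (simp_all add: DA_D[OF assms(1)] DA_D[OF assms(2)])

lemma DA_form:
  assumes u: "DA u u' h"
    and w: "\<And>x. x \<in> {-1..1} \<Longrightarrow> (w has_real_derivative w' x) (at x within {-1..1})"
    and w': "continuous_on {-1..1} w'" and bc: "w (-1) = 0" "w 1 = 0"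
  shows "integral {-1..1} (\<lambda>x. u' x * w' x + V x * u x * w x) = integral {-1..1} (\<lambda>x. h x * w x)"
proof -
  note D = DA_D[OF u]
  have wc: "continuous_on {-1..1} w" by (rule DERIV_continuous_on[OF w])
  have "((\<lambda>x. (u' x * w' x + V x * u x * w x) - h x * w x) has_integral (u' 1 * w 1 - u' (-1) * w (-1))) {-1..1}"
    by (rule ftc[where F = "\<lambda>x. u' x * w x"])
       (auto intro!: derivative_eq_intros D(2) w simp: algebra_simps)
  then have "integral {-1..1} (\<lambda>x. (u' x * w' x + V x * u x * w x) - h x * w x) = 0"
    using bc by (simp add: integral_unique)
  moreover have "integral {-1..1} (\<lambda>x. (u' x * w' x + V x * u x * w x) - h x * w x)
     = integral {-1..1} (\<lambda>x. u' x * w' x + V x * u x * w x) - integral {-1..1} (\<lambda>x. h x * w x)"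
    by (intro integral_diff integrable_continuous_real continuous_intros D(5-) V_cont wc w')
  ultimately show ?thesis by simp
qed

lemma DA_sym:
  assumes u: "DA u u' h" and w: "DA w w' k"
  shows "integral {-1..1} (\<lambda>x. h x * w x) = integral {-1..1} (\<lambda>x. k x * u x)"
  using DA_form[OF u DA_D(1,7,3,4)[OF w]] DA_form[OF w DA_D(1,7,3,4)[OF u]]
  by (simp add: mult_ac)

lemma DA_energy:
  assumes u: "DA u u' h"
  shows "integral {-1..1} (\<lambda>x. (u' x)\<^sup>2 + V x * (u x)\<^sup>2) = integral {-1..1} (\<lambda>x. h x * u x)"
  using DA_form[OF u DA_D(1,7,3,4)[OF u]] by (simp add: power2_eq_square mult_ac)

lemma DA_bounds:
  assumes u: "DA u u' h"
  shows "integral {-1..1} (\<lambda>x. (u x)\<^sup>2) \<le> 16 * integral {-1..1} (\<lambda>x. (h x)\<^sup>2)"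
    and "integral {-1..1} (\<lambda>x. (u' x)\<^sup>2) \<le> 9 * integral {-1..1} (\<lambda>x. (h x)\<^sup>2)"
    and "0 \<le> integral {-1..1} (\<lambda>x. h x * u x)"
proof -
  note D = DA_D[OF u]
  have P: "integral {-1..1} (\<lambda>x. (u x)\<^sup>2) \<le> 4 * integral {-1..1} (\<lambda>x. (u' x)\<^sup>2)"
    by (rule poincare[OF D(1,7,3,4)])
  have Q: "integral {-1..1} (\<lambda>x. (u' x)\<^sup>2) \<le> integral {-1..1} (\<lambda>x. h x * u x)"
    unfolding DA_energy[OF u, symmetric]
    by (intro integral_cont_mono continuous_intros D V_cont) (auto simp: V_nonneg)
  have "0 \<le> integral {-1..1} (\<lambda>x. (u' x)\<^sup>2)"
    by (intro integral_nonneg integrable_continuous_real continuous_intros D) auto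
  with Q show "0 \<le> integral {-1..1} (\<lambda>x. h x * u x)" by simp
  have AG: "integral {-1..1} (\<lambda>x. h x * u x) \<le> integral {-1..1} (\<lambda>x. t/2 * (h x)\<^sup>2 + 1/(2*t) * (u x)\<^sup>2)" if "t > 0" for t :: real
  proof (intro integral_cont_mono continuous_intros D)
    fix x :: real
    have "0 \<le> (t * h x - u x)\<^sup>2 / (2 * t)" using that by simp
    also have "(t * h x - u x)\<^sup>2 / (2 * t) = t/2 * (h x)\<^sup>2 + 1/(2*t) * (u x)\<^sup>2 - h x * u x"
      using that by (simp add: field_simps power2_eq_square)
    finally show "h x * u x \<le> t/2 * (h x)\<^sup>2 + 1/(2*t) * (u x)\<^sup>2" by simp
  qed
  have L: "integral {-1..1} (\<lambda>x. t/2 * (h x)\<^sup>2 + 1/(2*t) * (u x)\<^sup>2)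
      = t/2 * integral {-1..1} (\<lambda>x. (h x)\<^sup>2) + 1/(2*t) * integral {-1..1} (\<lambda>x. (u x)\<^sup>2)" for t
    by (intro integral_lincomb continuous_intros D)
  \<comment> \<open>With t = 4 the chain gives U <= 4(2H + U/8) = 8H + U/2 for the squared norms U
    of u and H of h. With t = 1 below, the energy is at most H/2 + 16H/2, rounded up to 9H.\<close>
  show U: "integral {-1..1} (\<lambda>x. (u x)\<^sup>2) \<le> 16 * integral {-1..1} (\<lambda>x. (h x)\<^sup>2)"
    using P Q AG[of 4] L[of 4] by simp
  show "integral {-1..1} (\<lambda>x. (u' x)\<^sup>2) \<le> 9 * integral {-1..1} (\<lambda>x. (h x)\<^sup>2)"
    using U Q AG[of 1] L[of 1]
      integral_nonneg[OF integrable_continuous_real[OF continuous_on_power[OF D(5), of 2]]] by simp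
qed

text \<open>Completing the square with a logarithmic derivative \<open>\<Phi>\<close> bounds the form from below.\<close>

lemma form_lower_bound:
  assumes u: "\<And>x. x \<in> {-1..1} \<Longrightarrow> (u has_real_derivative u' x) (at x within {-1..1})"
    and u': "continuous_on {-1..1} u'" and bc: "u (-1) = 0" "u 1 = 0"
    and \<Phi>: "\<And>x. x \<in> {-1..1} \<Longrightarrow> (\<Phi> has_real_derivative \<Phi>' x) (at x within {-1..1})"
    and \<Phi>': "continuous_on {-1..1} \<Phi>'"
    and m: "\<And>x. x \<in> {-1..1} \<Longrightarrow> m \<le> \<Phi>' x - (\<Phi> x)\<^sup>2 + V x"
  shows "m * integral {-1..1} (\<lambda>x. (u x)\<^sup>2) \<le> integral {-1..1} (\<lambda>x. (u' x)\<^sup>2 + V x * (u x)\<^sup>2)"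
proof -
  have uc: "continuous_on {-1..1} u" by (rule DERIV_continuous_on[OF u])
  have \<Phi>c: "continuous_on {-1..1} \<Phi>" by (rule DERIV_continuous_on[OF \<Phi>])
  let ?f = "\<lambda>x. \<Phi>' x * (u x)\<^sup>2 + \<Phi> x * (2 * u x * u' x)"
  have "(?f has_integral (\<Phi> 1 * (u 1)\<^sup>2 - \<Phi> (-1) * (u (-1))\<^sup>2)) {-1..1}"
    by (rule ftc[where F = "\<lambda>x. \<Phi> x * (u x)\<^sup>2"])
       (auto intro!: derivative_eq_intros u \<Phi> simp: algebra_simps)
  then have "integral {-1..1} ?f = 0" using bc by (simp add: integral_unique)
  moreover have "integral {-1..1} (\<lambda>x. m * (u x)\<^sup>2 + (-1) * ?f x) \<le> integral {-1..1} (\<lambda>x. (u' x)\<^sup>2 + V x * (u x)\<^sup>2)"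
  proof (intro integral_cont_mono continuous_intros uc u' \<Phi>c \<Phi>' V_cont)
    fix x :: real assume x: "x \<in> {-1..1}"
    have "m * (u x)\<^sup>2 \<le> (\<Phi>' x - (\<Phi> x)\<^sup>2 + V x) * (u x)\<^sup>2"
      using m[OF x] by (intro mult_right_mono) auto
    moreover have "0 \<le> (u' x + \<Phi> x * u x)\<^sup>2" by simp
    ultimately show "m * (u x)\<^sup>2 + (-1) * ?f x \<le> (u' x)\<^sup>2 + V x * (u x)\<^sup>2"
      by (simp add: power2_eq_square algebra_simps)
  qed
  moreover have "integral {-1..1} (\<lambda>x. m * (u x)\<^sup>2 + (-1) * ?f x)
      = m * integral {-1..1} (\<lambda>x. (u x)\<^sup>2) + (-1) * integral {-1..1} ?f"
    by (intro integral_lincomb continuous_intros uc u' \<Phi>c \<Phi>')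
  ultimately show ?thesis by simp
qed

text \<open>Shooting: solve with zero value and slope at -1, then subtract the multiple of
  \<open>y 0\<close> that corrects the value at 1. This is possible because \<open>y 0 1\<close> is
  at least 2.\<close>

lemma DA_exists:
  assumes h: "continuous_on {-1..1} h"
  shows "\<exists>u u'. DA u u' h"
proof -
  define w where "w = Sol (\<lambda>x. - vol h x)"
  have c: "continuous_on {-1..1} (\<lambda>x. - vol h x)"
    by (intro continuous_intros continuous_on_vol h)
  have wc: "continuous_on {-1..1} w" unfolding w_def by (rule Sol_props(1)[OF c])
  have weq: "w x = - vol h x + vol (\<lambda>z. V z * w z) x" if "x \<in> {-1..1}" for x
    unfolding w_def by (rule Sol_props(2)[OF c that])
  define w' where "w' x = - integral {-1..x} h + integral {-1..x} (\<lambda>z. V z * w z)" for x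
  have w1: "(w has_real_derivative w' x) (at x within {-1..1})" if x: "x \<in> {-1..1}" for x
  proof -
    have "((\<lambda>x. - vol h x + vol (\<lambda>z. V z * w z) x) has_real_derivative w' x) (at x within {-1..1})"
      unfolding w'_def
      by (intro derivative_intros has_real_derivative_vol continuous_intros V_cont wc h x)
    then show ?thesis
      unfolding has_field_derivative_def by (rule has_derivative_transform[OF x, rotated]) (rule weq)
  qed
  have w2: "(w' has_real_derivative (- h x + V x * w x)) (at x within {-1..1})" if x: "x \<in> {-1..1}" for x
    unfolding w'_def[abs_def]
    by (intro derivative_intros has_real_derivative_integral continuous_intros V_cont wc h x)
  have w0: "w (-1) = 0" using weq[of "-1"] by simp
  define c where "c = w 1 / y 0 1"
  have "DA (\<lambda>x. w x - c * y 0 x) (\<lambda>x. w' x - c * dy 0 x) h"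
    unfolding DA_def
  proof (intro conjI ballI h)
    fix x :: real assume x: "x \<in> {-1..1}"
    show "((\<lambda>x. w x - c * y 0 x) has_real_derivative w' x - c * dy 0 x) (at x within {-1..1})"
      by (auto intro!: derivative_eq_intros w1[OF x] y_deriv[OF x])
    show "((\<lambda>x. w' x - c * dy 0 x) has_real_derivative V x * (w x - c * y 0 x) - h x) (at x within {-1..1})"
      by (auto intro!: derivative_eq_intros w2[OF x] dy_deriv[OF x] simp: algebra_simps)
  qed (use w0 y_0_1_ge in \<open>auto simp: c_def\<close>)
  then show ?thesis by blast
qed

section \<open>Eigenvalues\<close>

text \<open>The weight that balances u and u' in the energy: (freq l)^2 + V - l lies between 0 and 2
  (freq l)^2. All exponential bounds are expressed through it, and it is at most
  \<open>\<nu>\<close> + sqrt l.\<close>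

definition freq :: "real \<Rightarrow> real" where
  "freq l = sqrt (l + \<nu>\<^sup>2)"

lemma freq:
  assumes "0 \<le> l"
  shows "1 \<le> freq l" "(freq l)\<^sup>2 = l + \<nu>\<^sup>2" "freq l \<le> \<nu> + sqrt l" "\<nu> \<le> freq l" "sqrt l \<le> freq l"
proof -
  have n: "0 \<le> \<nu>\<^sup>2" by simp
  show "(freq l)\<^sup>2 = l + \<nu>\<^sup>2" using assms by (simp add: freq_def)
  show n2: "\<nu> \<le> freq l" unfolding freq_def using assms nu by (intro real_le_rsqrt) auto
  then show "1 \<le> freq l" using nu by simp
  show "freq l \<le> \<nu> + sqrt l"
    unfolding freq_def using sqrt_add_le_add_sqrt[of l "\<nu>\<^sup>2"] assms nu by simp
  show "sqrt l \<le> freq l" unfolding freq_def by simp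
qed

text \<open>The energy satisfies |E'| <= 2 w E with w = \<open>freq l\<close>, in both directions.
  The backward bound is a quantitative unique continuation: a solution cannot be small together with
  its derivative at any point.\<close>

lemma ode_energy:
  assumes l: "0 \<le> l"
    and u: "\<And>x. x \<in> {-1..1} \<Longrightarrow> (u has_real_derivative u' x) (at x within {-1..1})"
    and u': "\<And>x. x \<in> {-1..1} \<Longrightarrow> (u' has_real_derivative (V x - l) * u x) (at x within {-1..1})"
    and x: "x \<in> {-1..1}"
  defines "En \<equiv> \<lambda>x. (freq l)\<^sup>2 * (u x)\<^sup>2 + (u' x)\<^sup>2"
  shows "En x \<le> En (-1) * exp (2 * freq l * (x + 1))"
    and "En (-1) \<le> En x * exp (2 * freq l * (x + 1))"
proof -
  let ?w = "freq l"
  define D where "D x = 2 * (?w\<^sup>2 + V x - l) * (u x * u' x)" for x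
  have dE: "(En has_real_derivative D x) (at x within {-1..1})" if "x \<in> {-1..1}" for x
    unfolding En_def D_def
    by (auto intro!: derivative_eq_intros u[OF that] u'[OF that] simp: algebra_simps)
  have bd: "\<bar>D x\<bar> \<le> 2 * ?w * En x" if x: "x \<in> {-1..1}" for x
  proof -
    have c: "0 \<le> ?w\<^sup>2 + V x - l" "?w\<^sup>2 + V x - l \<le> 2 * ?w\<^sup>2"
      using V_nonneg[OF x] V_le[OF x] freq(2)[OF l] l by auto
    have "0 \<le> (?w * \<bar>u x\<bar> - \<bar>u' x\<bar>)\<^sup>2" by simp
    then have "2 * ?w * (\<bar>u x\<bar> * \<bar>u' x\<bar>) \<le> En x"
      by (simp add: En_def power2_diff power_mult_distrib algebra_simps)
    then have "2 * ?w * (2 * ?w * (\<bar>u x\<bar> * \<bar>u' x\<bar>)) \<le> 2 * ?w * En x"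
      using freq(1)[OF l] by (intro mult_left_mono) auto
    moreover have "\<bar>D x\<bar> \<le> 2 * (2 * ?w\<^sup>2) * (\<bar>u x\<bar> * \<bar>u' x\<bar>)"
      using c unfolding D_def abs_mult by (intro mult_mono) auto
    ultimately show ?thesis by (simp add: power2_eq_square algebra_simps)
  qed
  show "En x \<le> En (-1) * exp (2 * ?w * (x + 1))"
    using bd by (intro exp_growth[OF dE _ x]) (auto simp: abs_le_iff)
  have "- En x \<le> - En (-1) * exp (- (2 * ?w) * (x + 1))"
  proof (rule exp_growth[where f = "\<lambda>x. - D x", OF _ _ x])
    fix x :: real assume x: "x \<in> {-1..1}"
    show "((\<lambda>x. - En x) has_real_derivative - D x) (at x within {-1..1})"
      by (intro derivative_intros dE x)
    show "- D x \<le> - (2 * ?w) * - En x" using bd[OF x] by simp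
  qed
  then have "En (-1) * exp (- (2 * ?w) * (x + 1)) \<le> En x" by simp
  then have "En (-1) * exp (- (2 * ?w) * (x + 1)) * exp (2 * ?w * (x + 1)) \<le> En x * exp (2 * ?w * (x + 1))"
    by (rule mult_right_mono) simp
  then show "En (-1) \<le> En x * exp (2 * ?w * (x + 1))"
    by (simp add: mult.assoc exp_add[symmetric])
qed

lemma y_energy:
  assumes l: "0 \<le> l" and x: "x \<in> {-1..1}"
  shows "(freq l)\<^sup>2 * (y l x)\<^sup>2 + (dy l x)\<^sup>2 \<le> exp (4 * freq l)"
    and "exp (- (4 * freq l)) \<le> (freq l)\<^sup>2 * (y l x)\<^sup>2 + (dy l x)\<^sup>2"
proof -
  let ?w = "freq l" and ?En = "(freq l)\<^sup>2 * (y l x)\<^sup>2 + (dy l x)\<^sup>2"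
  have e: "exp (2 * ?w * (x + 1)) \<le> exp (4 * ?w)"
    using x freq(1)[OF l] by simp
  note A = ode_energy[OF l y_deriv dy_deriv x]
  have "?En \<le> exp (2 * ?w * (x + 1))" using A(1) by simp
  then show "?En \<le> exp (4 * ?w)" using e by (rule order_trans)
  have "1 \<le> ?En * exp (2 * ?w * (x + 1))" using A(2) by simp
  also have "\<dots> \<le> ?En * exp (4 * ?w)" using e by (intro mult_left_mono) auto
  finally have "1 * exp (- (4 * ?w)) \<le> ?En * exp (4 * ?w) * exp (- (4 * ?w))" by (intro mult_right_mono) auto
  then show "exp (- (4 * ?w)) \<le> ?En" by (simp add: mult.assoc exp_add[symmetric])
qed

lemma ode_unique:
  assumes l: "0 \<le> l"
    and u: "\<And>x. x \<in> {-1..1} \<Longrightarrow> (u has_real_derivative u' x) (at x within {-1..1})"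
    and u': "\<And>x. x \<in> {-1..1} \<Longrightarrow> (u' has_real_derivative (V x - l) * u x) (at x within {-1..1})"
    and bc: "u (-1) = 0" and x: "x \<in> {-1..1}"
  shows "u x = u' (-1) * y l x"
proof -
  define c where "c = u' (-1)"
  let ?d = "\<lambda>x. u x - c * y l x" and ?d' = "\<lambda>x. u' x - c * dy l x"
  have "(freq l)\<^sup>2 * (?d x)\<^sup>2 + (?d' x)\<^sup>2 \<le> ((freq l)\<^sup>2 * (?d (-1))\<^sup>2 + (?d' (-1))\<^sup>2) * exp (2 * freq l * (x + 1))"
  proof (rule ode_energy(1)[OF l _ _ x])
    fix x :: real assume x: "x \<in> {-1..1}"
    show "(?d has_real_derivative ?d' x) (at x within {-1..1})"
      by (auto intro!: derivative_eq_intros u[OF x] y_deriv[OF x])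
    show "(?d' has_real_derivative (V x - l) * ?d x) (at x within {-1..1})"
      by (auto intro!: derivative_eq_intros u'[OF x] dy_deriv[OF x] simp: algebra_simps)
  qed
  also have "\<dots> = 0" using bc by (simp add: c_def)
  finally have "(freq l)\<^sup>2 * (?d x)\<^sup>2 \<le> 0" using zero_le_power2[of "?d' x"] by linarith
  moreover have "0 < (freq l)\<^sup>2" using freq(1)[OF l] by simp
  ultimately have "(?d x)\<^sup>2 \<le> 0" by (simp add: mult_le_0_iff)
  then show ?thesis by (simp add: c_def)
qed

definition E :: "real set" where
  "E = {l. y l 1 = 0}"

lemma DA_eig: "l \<in> E \<Longrightarrow> DA (y l) (dy l) (\<lambda>x. l * y l x)"
  unfolding DA_def E_def
proof (intro conjI ballI)
  fix x :: real assume x: "x \<in> {-1..1}"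
  show "(dy l has_real_derivative V x * y l x - l * y l x) (at x within {-1..1})"
    using dy_deriv[OF x] by (simp add: algebra_simps)
qed (auto intro!: continuous_intros y_cont y_deriv)

definition nrm :: "real \<Rightarrow> real" where
  "nrm l = integral {-1..1} (\<lambda>x. (y l x)\<^sup>2)"

lemma nrm_nonneg: "0 \<le> nrm l"
  unfolding nrm_def by (intro integral_nonneg integrable_continuous_real continuous_intros y_cont) auto

lemma nrm_pos: "0 < nrm l"
proof -
  have "nrm l \<noteq> 0"
  proof
    assume "nrm l = 0"
    then have z: "\<forall>x\<in>{-1..1}. (y l x)\<^sup>2 = 0"
      unfolding nrm_def by (subst (asm) integral_eq_0_iff) (auto intro!: continuous_intros y_cont)
    then have "vol (\<lambda>z. (V z - l) * y l z) 0 = vol (\<lambda>z. 0 * 0) 0"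
      unfolding vol_def by (intro integral_cong) auto
    then have "y l 0 = 1" using y_eq[of 0 l] by (simp add: vol_def)
    with z show False by force
  qed
  with nrm_nonneg show ?thesis by (simp add: less_le)
qed

lemma eig_energy: "l \<in> E \<Longrightarrow> integral {-1..1} (\<lambda>x. (dy l x)\<^sup>2 + V x * (y l x)\<^sup>2) = l * nrm l"
  using DA_energy[OF DA_eig] by (simp add: nrm_def power2_eq_square mult.assoc)

lemma eig_ge:
  assumes l: "l \<in> E"
  shows "1/4 \<le> l"
proof -
  note D = DA_D[OF DA_eig[OF l]]
  have "nrm l \<le> 4 * integral {-1..1} (\<lambda>x. (dy l x)\<^sup>2)"
    unfolding nrm_def by (rule poincare[OF D(1,7,3,4)])
  also have "integral {-1..1} (\<lambda>x. (dy l x)\<^sup>2) \<le> integral {-1..1} (\<lambda>x. (dy l x)\<^sup>2 + V x * (y l x)\<^sup>2)"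
    by (intro integral_cont_mono continuous_intros D V_cont) (auto simp: V_nonneg)
  finally have "1/4 * nrm l \<le> l * nrm l" using eig_energy[OF l] by simp
  then show ?thesis using nrm_pos[of l] by simp
qed

lemma nrm_le:
  assumes l: "0 \<le> l"
  shows "nrm l \<le> 2 * exp (4 * freq l)"
proof -
  have "nrm l \<le> integral {-1..1} (\<lambda>x::real. exp (4 * freq l))"
    unfolding nrm_def
  proof (intro integral_cont_mono continuous_intros y_cont)
    fix x :: real assume x: "x \<in> {-1..1}"
    have "1 * (y l x)\<^sup>2 \<le> (freq l)\<^sup>2 * (y l x)\<^sup>2"
      using freq(1)[OF l] by (intro mult_right_mono) auto
    then show "(y l x)\<^sup>2 \<le> exp (4 * freq l)" using y_energy(1)[OF l x] zero_le_power2[of "dy l x"] by linarith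
  qed
  then show ?thesis by simp
qed

lemma dy_le:
  assumes l: "0 \<le> l"
  shows "\<bar>dy l 1\<bar> \<le> exp (2 * freq l)"
proof -
  have "(dy l 1)\<^sup>2 \<le> (freq l)\<^sup>2 * (y l 1)\<^sup>2 + (dy l 1)\<^sup>2" by simp
  also have "\<dots> \<le> exp (4 * freq l)" using y_energy(1)[OF l, of 1] by simp
  also have "\<dots> = (exp (2 * freq l))\<^sup>2" by (simp add: exp_double[symmetric])
  finally show ?thesis by (metis abs_exp_cancel abs_le_square_iff)
qed

text \<open>The cutoff \<open>\<eta>\<close> absorbs the boundary terms, so the energy on \<open>[a,b]\<close> is controlled by the mass alone.\<close>

lemma local_mass_ge:
  assumes l: "0 \<le> l" and ab: "-1 \<le> a" "a < b" "b \<le> 1" "b - a \<le> 1"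
  shows "cutoff_mass a b / 4 * exp (- (6 * freq l)) \<le> integral {a..b} (\<lambda>x. (y l x)\<^sup>2)"
proof -
  let ?w = "freq l"
  define \<eta> where "\<eta> x = (x - a)\<^sup>2 * (b - x)\<^sup>2" for x :: real
  define \<eta>1 where "\<eta>1 x = 2 * (x - a) * (b - x)\<^sup>2 - 2 * (x - a)\<^sup>2 * (b - x)" for x :: real
  define \<eta>2 where "\<eta>2 x = 2 * (b - x)\<^sup>2 - 8 * (x - a) * (b - x) + 2 * (x - a)\<^sup>2" for x :: real
  \<comment> \<open>This is the derivative of \<eta> y y' - \<eta>' y^2 / 2. Its integral over [a,b]
    vanishes, which trades \<eta> y'^2 for multiples of y^2.\<close>
  define f where "f x = \<eta> x * (dy l x)\<^sup>2 + \<eta> x * (V x - l) * (y l x)\<^sup>2 - 1/2 * \<eta>2 x * (y l x)\<^sup>2" for x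
  have sub: "{a..b} \<subseteq> {-1..1}" using ab by auto
  have c: "continuous_on {a..b} (y l)" "continuous_on {a..b} (dy l)" "continuous_on {a..b} V"
    by (rule continuous_on_subset[OF y_cont sub] continuous_on_subset[OF dy_cont sub]
        continuous_on_subset[OF V_cont sub])+
  have ec: "continuous_on {a..b} \<eta>" "continuous_on {a..b} \<eta>2"
    unfolding \<eta>_def[abs_def] \<eta>2_def[abs_def] by (auto intro!: continuous_intros)
  have fc: "continuous_on {a..b} f"
    unfolding f_def[abs_def] by (intro continuous_intros c ec)
  have "(f has_integral ((\<eta> b * (y l b * dy l b) - 1/2 * \<eta>1 b * (y l b)\<^sup>2)
      - (\<eta> a * (y l a * dy l a) - 1/2 * \<eta>1 a * (y l a)\<^sup>2))) {a..b}"
  proof (rule ftc)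
    fix x assume x: "x \<in> {a..b}"
    then have x1: "x \<in> {-1..1}" using sub by auto
    have 1: "(y l has_real_derivative dy l x) (at x within {a..b})"
      by (rule has_field_derivative_subset[OF y_deriv[OF x1] sub])
    have 2: "(dy l has_real_derivative (V x - l) * y l x) (at x within {a..b})"
      by (rule has_field_derivative_subset[OF dy_deriv[OF x1] sub])
    have 3: "(\<eta> has_real_derivative \<eta>1 x) (at x within {a..b})"
      unfolding \<eta>_def[abs_def] \<eta>1_def by (auto intro!: derivative_eq_intros simp: algebra_simps)
    have 4: "(\<eta>1 has_real_derivative \<eta>2 x) (at x within {a..b})"
      unfolding \<eta>1_def[abs_def] \<eta>2_def
      by (auto intro!: derivative_eq_intros simp: algebra_simps power2_eq_square)
    show "((\<lambda>x. \<eta> x * (y l x * dy l x) - 1/2 * \<eta>1 x * (y l x)\<^sup>2) has_real_derivative f x) (at x within {a..b})"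
      unfolding f_def
      by (auto intro!: derivative_eq_intros 1 2 3 4 simp: algebra_simps power2_eq_square)
  qed (use ab in simp)
  then have f0: "integral {a..b} f = 0"
    by (simp add: integral_unique \<eta>_def \<eta>1_def)
  have "exp (- (4 * ?w)) * cutoff_mass a b = integral {a..b} (\<lambda>x. exp (- (4 * ?w)) * \<eta> x)"
    by (simp add: cutoff_mass_def \<eta>_def)
  also have "\<dots> \<le> integral {a..b} (\<lambda>x. 1 * f x + (4 * ?w\<^sup>2) * (y l x)\<^sup>2)"
  proof (intro integral_cont_mono continuous_intros c ec fc)
    fix x assume x: "x \<in> {a..b}"
    then have x1: "x \<in> {-1..1}" using sub by auto
    have sq: "(x - a)\<^sup>2 \<le> 1" "(b - x)\<^sup>2 \<le> 1"
      using x ab by (auto simp: abs_square_le_1)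
    have e: "0 \<le> \<eta> x" "\<eta> x \<le> 1" "\<eta>2 x \<le> 4"
      using sq x mult_mono[OF sq] by (auto simp: \<eta>_def \<eta>2_def intro: order_trans[of _ "2 * (b - x)\<^sup>2 + 2 * (x - a)\<^sup>2"])
    have "exp (- (4 * ?w)) * \<eta> x \<le> (?w\<^sup>2 * (y l x)\<^sup>2 + (dy l x)\<^sup>2) * \<eta> x"
      by (intro mult_right_mono y_energy l x1 e)
    also have "\<dots> = f x + (\<eta> x * (?w\<^sup>2 + l - V x) + 1/2 * \<eta>2 x) * (y l x)\<^sup>2"
      by (simp add: f_def algebra_simps)
    also have "\<dots> \<le> f x + (4 * ?w\<^sup>2) * (y l x)\<^sup>2"
    proof -
      have w1: "1 \<le> ?w\<^sup>2" using freq(1)[OF l] by simp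
      have lw: "l \<le> ?w\<^sup>2" using freq(2)[OF l] by simp
      have "\<eta> x * (?w\<^sup>2 + l - V x) \<le> \<eta> x * (2 * ?w\<^sup>2)"
        using lw V_nonneg[OF x1] e by (intro mult_left_mono) auto
      also have "\<dots> \<le> 1 * (2 * ?w\<^sup>2)" using e by (intro mult_right_mono) auto
      finally have "\<eta> x * (?w\<^sup>2 + l - V x) + 1/2 * \<eta>2 x \<le> 4 * ?w\<^sup>2"
        using e(3) w1 by simp
      then show ?thesis by (simp add: mult_right_mono)
    qed
    finally show "exp (- (4 * ?w)) * \<eta> x \<le> 1 * f x + (4 * ?w\<^sup>2) * (y l x)\<^sup>2" by simp
  qed
  also have "\<dots> = 1 * integral {a..b} f + (4 * ?w\<^sup>2) * integral {a..b} (\<lambda>x. (y l x)\<^sup>2)"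
    by (intro integral_lincomb continuous_intros fc c)
  finally have A: "exp (- (4 * ?w)) * cutoff_mass a b \<le> 4 * ?w\<^sup>2 * integral {a..b} (\<lambda>x. (y l x)\<^sup>2)"
    using f0 by simp
  have I0: "0 \<le> integral {a..b} (\<lambda>x. (y l x)\<^sup>2)"
    by (intro integral_nonneg integrable_continuous_real continuous_intros c) auto
  \<comment> \<open>The factor w^2 is absorbed by exp(2w), which turns the rate 4 into the rate
    6.\<close>
  have "?w \<le> exp ?w" using exp_ge_add_one_self[of ?w] by linarith
  then have "?w\<^sup>2 \<le> (exp ?w)\<^sup>2" using freq(1)[OF l] by (intro power_mono) auto
  also have "\<dots> = exp (2 * ?w)" by (simp add: exp_double)
  finally have "4 * ?w\<^sup>2 * integral {a..b} (\<lambda>x. (y l x)\<^sup>2) \<le> 4 * exp (2 * ?w) * integral {a..b} (\<lambda>x. (y l x)\<^sup>2)"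
    using I0 by (intro mult_right_mono) auto
  with A have "exp (- (4 * ?w)) * cutoff_mass a b \<le> 4 * exp (2 * ?w) * integral {a..b} (\<lambda>x. (y l x)\<^sup>2)" by simp
  then have "exp (- (4 * ?w)) * cutoff_mass a b * exp (- (2 * ?w)) / 4
      \<le> 4 * exp (2 * ?w) * integral {a..b} (\<lambda>x. (y l x)\<^sup>2) * exp (- (2 * ?w)) / 4"
    by (intro divide_right_mono mult_right_mono) auto
  moreover have "exp (- (4 * ?w)) * cutoff_mass a b * exp (- (2 * ?w)) / 4 = cutoff_mass a b / 4 * exp (- (6 * ?w))"
    by (simp add: exp_add[symmetric] mult_ac flip: exp_add)
  moreover have "4 * exp (2 * ?w) * integral {a..b} (\<lambda>x. (y l x)\<^sup>2) * exp (- (2 * ?w)) / 4 = integral {a..b} (\<lambda>x. (y l x)\<^sup>2)"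
    by (simp add: exp_minus)
  ultimately show ?thesis by simp
qed

text \<open>Two uses: at another eigenvalue s it yields orthogonality, and as s tends to l it yields
  the derivative of the characteristic function, f'(l) = |y_l|^2 / y_l'(1).\<close>

lemma wronskian:
  assumes l: "l \<in> E"
  shows "(s - l) * integral {-1..1} (\<lambda>x. y l x * y s x) = dy l 1 * y s 1"
proof -
  have "((\<lambda>x. (l - s) * (y l x * y s x)) has_integral
     ((y l 1 * dy s 1 - dy l 1 * y s 1) - (y l (-1) * dy s (-1) - dy l (-1) * y s (-1)))) {-1..1}"
    by (rule ftc[where F = "\<lambda>x. y l x * dy s x - dy l x * y s x"])
       (auto intro!: derivative_eq_intros y_deriv dy_deriv simp: algebra_simps)
  from integral_unique[OF this]
  have "integral {-1..1} (\<lambda>x. (l - s) * (y l x * y s x)) = - (dy l 1 * y s 1)"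
    using l by (simp add: E_def)
  then have "(l - s) * integral {-1..1} (\<lambda>x. y l x * y s x) = - (dy l 1 * y s 1)"
    by (simp only: integral_mult_right)
  then show ?thesis by (simp add: algebra_simps)
qed

lemma eig_orth:
  assumes "l \<in> E" "k \<in> E" "l \<noteq> k"
  shows "integral {-1..1} (\<lambda>x. y l x * y k x) = 0"
  using wronskian[OF assms(1), of k] assms by (simp add: E_def)

lemma dy_1_nonzero:
  assumes "l \<in> E"
  shows "dy l 1 \<noteq> 0"
  using y_energy(2)[of l 1] eig_ge[OF assms] assms by (auto simp: E_def)

text \<open>The quotient f(s)/(s - l) takes the value f'(l) at l. Its power series is continuous
  there, and off l the quotient is the integral in \<open>wronskian\<close> times
  1/\<open>dy l 1\<close>, so its limit is found without differentiating the solution in s.\<close>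

lemma quotient_at_eigenvalue:
  assumes l: "l \<in> E" "l < R" and b: "summable (\<lambda>m. \<bar>b m\<bar> * R ^ m)"
    and eq: "\<And>s. \<bar>s\<bar> \<le> R \<Longrightarrow> y s 1 = (s - l) * (\<Sum>m. b m * s ^ m)"
  shows "(\<Sum>m. b m * l ^ m) = nrm l / dy l 1"
proof -
  let ?H = "\<lambda>s. \<Sum>m. b m * s ^ m" and ?G = "\<lambda>s. integral {-1..1} (\<lambda>x. y l x * y s x) / dy l 1"
  have l0: "0 < l" using eig_ge[OF l(1)] by simp
  have sR: "summable (\<lambda>m. b m * R ^ m)"
  proof (rule summable_comparison_test'[OF b, of 0])
    fix m show "norm (b m * R ^ m) \<le> \<bar>b m\<bar> * R ^ m" using l l0 by (simp add: abs_mult)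
  qed
  have "isCont ?H l"
    by (rule isCont_powser[OF sR]) (use l l0 in simp)
  then have lim1: "?H \<midarrow>l\<rightarrow> ?H l" by (simp add: isCont_def)
  define C where "C = 3 * exp (4 * sqrt (\<nu>\<^sup>2 + (2 * l + 1)))"
  define A where "A = integral {-1..1} (\<lambda>x. \<bar>y l x\<bar>)"
  have "(\<lambda>s. integral {-1..1} (\<lambda>x. y l x * y s x)) \<midarrow>l\<rightarrow> nrm l"
  proof (rule LIM_I)
    fix r :: real assume r: "r > 0"
    have A0: "0 \<le> A * C" unfolding A_def C_def
      by (intro mult_nonneg_nonneg integral_nonneg integrable_continuous_real continuous_intros y_cont) auto
    have est: "\<bar>integral {-1..1} (\<lambda>x. y l x * y s x) - nrm l\<bar> \<le> \<bar>s - l\<bar> * (A * C)" if s: "\<bar>s - l\<bar> < l" for s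
    proof -
      have "integral {-1..1} (\<lambda>x. y l x * y s x) - nrm l = integral {-1..1} (\<lambda>x. y l x * y s x - (y l x)\<^sup>2)"
        unfolding nrm_def by (intro integral_diff[symmetric] integrable_continuous_real continuous_intros y_cont)
      also have "\<bar>\<dots>\<bar> \<le> integral {-1..1} (\<lambda>x. (\<bar>s - l\<bar> * C) * \<bar>y l x\<bar>)"
        unfolding real_norm_def[symmetric]
      proof (rule integral_norm_bound_integral)
        fix x :: real assume x: "x \<in> {-1..1}"
        have "\<bar>y s x - y l x\<bar> \<le> \<bar>s - l\<bar> * C"
          unfolding C_def using s l0 by (intro y_lipschitz x) auto
        then have "\<bar>y l x\<bar> * \<bar>y s x - y l x\<bar> \<le> \<bar>y l x\<bar> * (\<bar>s - l\<bar> * C)"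
          by (intro mult_left_mono) auto
        then show "norm (y l x * y s x - (y l x)\<^sup>2) \<le> norm (s - l) * C * norm (y l x)"
          by (simp add: power2_eq_square right_diff_distrib[symmetric] abs_mult mult.commute)
      qed (auto intro!: integrable_continuous_real continuous_intros y_cont)
      finally show ?thesis by (simp add: A_def mult_ac)
    qed
    define d where "d = min l (r / (A * C + 1))"
    have "d > 0" using l0 r A0 by (simp add: d_def)
    moreover have "norm (integral {-1..1} (\<lambda>x. y l x * y s x) - nrm l) < r" if s: "s \<noteq> l \<and> norm (s - l) < d" for s
    proof -
      have sl: "\<bar>s - l\<bar> < l" "\<bar>s - l\<bar> < r / (A * C + 1)" using s by (auto simp: d_def)
      have "\<bar>s - l\<bar> * (A * C) \<le> \<bar>s - l\<bar> * (A * C + 1)" by (simp add: algebra_simps)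
      also have "\<dots> < r" using sl(2) A0 by (simp add: field_simps)
      finally show ?thesis using est[OF sl(1)] by simp
    qed
    ultimately show "\<exists>d>0. \<forall>s. s \<noteq> l \<and> norm (s - l) < d \<longrightarrow> norm (integral {-1..1} (\<lambda>x. y l x * y s x) - nrm l) < r"
      by blast
  qed
  then have lim2: "?G \<midarrow>l\<rightarrow> nrm l / dy l 1"
    by (intro tendsto_intros dy_1_nonzero l)
  have "\<forall>\<^sub>F s in at l. ?G s = ?H s"
  proof -
    have "\<forall>\<^sub>F s in at l. s \<in> {0<..<R}"
      using l l0 by (intro eventually_at_in_open') auto
    moreover have "\<forall>\<^sub>F s in at l. s \<noteq> l" by (simp add: eventually_at_filter)
    ultimately show ?thesis
    proof eventually_elim
      case (elim s)
      then have "(s - l) * (integral {-1..1} (\<lambda>x. y l x * y s x)) = dy l 1 * ((s - l) * ?H s)"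
        using wronskian[OF l(1), of s] eq[of s] by simp
      then have "integral {-1..1} (\<lambda>x. y l x * y s x) = dy l 1 * ?H s"
        using elim by simp
      then show ?case using dy_1_nonzero[OF l(1)] by simp
    qed
  qed
  then have "?H \<midarrow>l\<rightarrow> nrm l / dy l 1"
    using lim2 tendsto_cong by force
  then show ?thesis using lim1 LIM_unique by blast
qed

section \<open>Spacing of the eigenvalues\<close>


definition fc :: "nat \<Rightarrow> real" where
  "fc m = p m 1 * (-1) ^ m"

lemma y_1_powser: "y s 1 = (\<Sum>m. fc m * s ^ m)"
proof -
  have "(- s) ^ m = (-1) ^ m * s ^ m" for m
    by (metis mult_minus1 power_mult_distrib)
  then show ?thesis by (simp add: y_def fc_def mult.assoc)
qed

lemma abs_fc: "\<bar>fc m\<bar> = p m 1"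
  using p_nonneg[of 1 m] by (simp add: fc_def abs_mult power_abs)

lemma fc_summable:
  assumes "0 \<le> R"
  shows "summable (\<lambda>m. \<bar>fc m\<bar> * R ^ m)"
    and "(\<Sum>m. \<bar>fc m\<bar> * R ^ m) \<le> 3 * exp (4 * sqrt (\<nu>\<^sup>2 + R))"
  unfolding abs_fc using p_summable[OF assms, of 1] by auto

text \<open>Jensen's counting argument: divide out the zeros with radius R = 4r and evaluate at s =
  0, where f is at least 2. Each zero l <= r gains a factor (R - l)/l >= 3 >= e, while f grows at
  most like exp(4 sqrt(\<open>\<nu>\<close>^2 + 4r)).\<close>

lemma card_eig_le:
  assumes J: "finite J" "J \<subseteq> E" "\<And>l. l \<in> J \<Longrightarrow> l \<le> r" and r: "0 < r"
  shows "real (card J) \<le> 5 * \<nu> + 8 * sqrt r"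
proof -
  let ?R = "4 * r" and ?N = "\<Sum>m. \<bar>fc m\<bar> * (4 * r) ^ m"
  have R: "0 \<le> ?R" using r by simp
  have pos: "0 < l" "\<bar>l\<bar> = l" if "l \<in> J" for l using eig_ge[of l] J(2) that by auto
  have z: "0 < l \<and> l < ?R \<and> (\<Sum>m. fc m * l ^ m) = 0" if "l \<in> J" for l
  proof -
    have "y l 1 = 0" using J(2) that by (auto simp: E_def)
    then show ?thesis using pos(1)[OF that] J(3)[OF that] r by (simp add: y_1_powser)
  qed
  obtain b where b: "summable (\<lambda>m. \<bar>b m\<bar> * ?R ^ m)"
    "(\<Sum>m. \<bar>b m\<bar> * ?R ^ m) \<le> ?N / (\<Prod>l\<in>J. ?R - l)"
    "\<forall>s. \<bar>s\<bar> \<le> ?R \<longrightarrow> (\<Sum>m. fc m * s ^ m) = (\<Prod>l\<in>J. s - l) * (\<Sum>m. b m * s ^ m)"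
    using powser_divide_zeros[OF J(1) fc_summable(1)[OF R] z] by auto
  have pl: "0 < (\<Prod>l\<in>J. l)" using pos by (intro prod_pos) auto
  have "y 0 1 = (\<Prod>l\<in>J. 0 - l) * (\<Sum>m. b m * 0 ^ m)"
    unfolding y_1_powser by (rule b(3)[rule_format]) (use r in simp)
  moreover have "\<bar>\<Prod>l\<in>J. 0 - l\<bar> = (\<Prod>l\<in>J. l)"
    unfolding abs_prod by (intro prod.cong) (auto simp: pos)
  ultimately have "\<bar>y 0 1\<bar> = (\<Prod>l\<in>J. l) * \<bar>\<Sum>m. b m * 0 ^ m\<bar>"
    by (simp only: abs_mult)
  also have "\<dots> \<le> (\<Prod>l\<in>J. l) * (?N / (\<Prod>l\<in>J. ?R - l))"
    using powser_abs_le[OF b(1), of 0] r pl b(2) by (intro mult_left_mono) auto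
  also have "\<dots> \<le> (\<Prod>l\<in>J. l) * (?N / (\<Prod>l\<in>J. 3 * l))"
  proof -
    have "(\<Prod>l\<in>J. 3 * l) \<le> (\<Prod>l\<in>J. ?R - l)"
      using pos J(3) by (intro prod_mono) force
    moreover have "0 < (\<Prod>l\<in>J. 3 * l)" using pos by (intro prod_pos) auto
    moreover have "0 \<le> ?N" using r by (intro suminf_nonneg fc_summable) auto
    ultimately show ?thesis using pl by (intro mult_left_mono divide_left_mono) (auto intro: mult_pos_pos)
  qed
  also have "\<dots> = ?N / 3 ^ card J" using pl by (simp add: prod.distrib)
  finally have "2 \<le> ?N / 3 ^ card J" using y_0_1_ge by linarith
  then have "2 * 3 ^ card J \<le> ?N" by (simp only: pos_le_divide_eq zero_less_power zero_less_numeral)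
  also have "\<dots> \<le> 3 * exp (4 * sqrt (\<nu>\<^sup>2 + ?R))" by (rule fc_summable(2)[OF R])
  finally have "3 ^ card J \<le> 3/2 * exp (4 * sqrt (\<nu>\<^sup>2 + ?R))" by simp
  also have "\<dots> \<le> exp 1 * exp (4 * sqrt (\<nu>\<^sup>2 + ?R))"
    using exp_ge_add_one_self[of "1::real"] by (intro mult_right_mono) auto
  finally have "3 ^ card J \<le> exp (1 + 4 * sqrt (\<nu>\<^sup>2 + ?R))" by (simp add: exp_add)
  moreover have "exp (real (card J)) \<le> 3 ^ card J"
    using power_mono[OF exp_le, of "card J"] by (simp add: exp_of_nat_mult[symmetric])
  ultimately have "exp (real (card J)) \<le> exp (1 + 4 * sqrt (\<nu>\<^sup>2 + ?R))" by linarith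
  then have "real (card J) \<le> 1 + 4 * sqrt (\<nu>\<^sup>2 + ?R)" by simp
  also have "sqrt (\<nu>\<^sup>2 + ?R) \<le> \<nu> + 2 * sqrt r"
    using sqrt_add_le_add_sqrt[of "\<nu>\<^sup>2" ?R] r nu by (simp add: real_sqrt_mult)
  finally show ?thesis using nu by simp
qed

lemma finite_eig: "finite {l \<in> E. l \<le> r}"
proof (rule ccontr)
  assume inf: "infinite {l \<in> E. l \<le> r}"
  obtain n :: nat where n: "5 * \<nu> + 8 * sqrt (max r 1) < real n" using reals_Archimedean2 by blast
  obtain J where J: "finite J" "card J = n" "J \<subseteq> {l \<in> E. l \<le> r}"
    using infinite_arbitrarily_large[OF inf] by blast
  have "real (card J) \<le> 5 * \<nu> + 8 * sqrt (max r 1)"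
    by (rule card_eig_le) (use J in \<open>auto simp: le_max_iff_disj\<close>)
  with n J show False by simp
qed

text \<open>Blocks [\<rho>, 4\<rho>) are summed by induction on their number. The constants are
  those that the recursion reproduces: 5 + 7/4 <= 7 for the first term and 16 + 32/2 = 32 for the
  second.\<close>

lemma sum_inverse_eig_le:
  assumes J: "finite J" "J \<subseteq> E" and \<rho>: "0 < \<rho>"
  shows "(\<Sum>l\<in>{l\<in>J. \<rho> \<le> l}. 1 / l) \<le> 7 * \<nu> / \<rho> + 32 / sqrt \<rho>"
proof -
  have main: "\<forall>\<rho>>0. (\<forall>l\<in>J. l < 4 ^ N * \<rho>) \<longrightarrow> (\<Sum>l\<in>{l\<in>J. \<rho> \<le> l}. 1 / l) \<le> 7 * \<nu> / \<rho> + 32 / sqrt \<rho>" for N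
  proof (induction N)
    case 0
    show ?case
    proof (intro allI impI)
      fix \<rho> :: real assume \<rho>: "0 < \<rho>" "\<forall>l\<in>J. l < 4 ^ 0 * \<rho>"
      then have "{l\<in>J. \<rho> \<le> l} = {}" by auto
      then show "(\<Sum>l\<in>{l\<in>J. \<rho> \<le> l}. 1 / l) \<le> 7 * \<nu> / \<rho> + 32 / sqrt \<rho>"
        using \<rho> nu by (simp only: sum.empty) simp
    qed
  next
    case (Suc N)
    show ?case
    proof (intro allI impI)
      fix \<rho> :: real assume \<rho>: "0 < \<rho>" "\<forall>l\<in>J. l < 4 ^ Suc N * \<rho>"
      have IH: "(\<Sum>l\<in>{l\<in>J. 4 * \<rho> \<le> l}. 1 / l) \<le> 7 * \<nu> / (4 * \<rho>) + 32 / sqrt (4 * \<rho>)"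
        using Suc[rule_format, of "4 * \<rho>"] \<rho> by (simp add: mult_ac)
      have split: "{l\<in>J. \<rho> \<le> l} = {l\<in>J. \<rho> \<le> l \<and> l < 4 * \<rho>} \<union> {l\<in>J. 4 * \<rho> \<le> l}"
        using \<rho> by auto
      have "(\<Sum>l\<in>{l\<in>J. \<rho> \<le> l}. 1 / l) = (\<Sum>l\<in>{l\<in>J. \<rho> \<le> l \<and> l < 4 * \<rho>}. 1 / l) + (\<Sum>l\<in>{l\<in>J. 4 * \<rho> \<le> l}. 1 / l)"
        unfolding split using J(1) by (intro sum.union_disjoint) auto
      also have "(\<Sum>l\<in>{l\<in>J. \<rho> \<le> l \<and> l < 4 * \<rho>}. 1 / l) \<le> real (card {l\<in>J. \<rho> \<le> l \<and> l < 4 * \<rho>}) * (1 / \<rho>)"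
        using \<rho> by (intro sum_bounded_above) (auto simp: field_simps)
      also have "\<dots> \<le> (5 * \<nu> + 8 * sqrt (4 * \<rho>)) * (1 / \<rho>)"
        using J \<rho> by (intro mult_right_mono card_eig_le) auto
      finally have "(\<Sum>l\<in>{l\<in>J. \<rho> \<le> l}. 1 / l) \<le> (5 * \<nu> + 16 * sqrt \<rho>) * (1 / \<rho>) + (7 * \<nu> / (4 * \<rho>) + 16 / sqrt \<rho>)"
        using IH by (simp add: real_sqrt_mult)
      also have "(5 * \<nu> + 16 * sqrt \<rho>) * (1 / \<rho>) = 5 * \<nu> / \<rho> + 16 / sqrt \<rho>"
      proof -
        have "sqrt \<rho> / \<rho> = 1 / sqrt \<rho>" using \<rho> by (simp add: field_simps)
        then show ?thesis by (simp add: add_divide_distrib)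
      qed
      also have "5 * \<nu> / \<rho> + 16 / sqrt \<rho> + (7 * \<nu> / (4 * \<rho>) + 16 / sqrt \<rho>) \<le> 7 * \<nu> / \<rho> + 32 / sqrt \<rho>"
      proof -
        have "5 * \<nu> / \<rho> + 7 * \<nu> / (4 * \<rho>) \<le> 7 * \<nu> / \<rho>" using \<rho> nu by (simp add: field_simps)
        moreover have "16 / sqrt \<rho> + 16 / sqrt \<rho> = 32 / sqrt \<rho>" by simp
        ultimately show ?thesis by linarith
      qed
      finally show "(\<Sum>l\<in>{l\<in>J. \<rho> \<le> l}. 1 / l) \<le> 7 * \<nu> / \<rho> + 32 / sqrt \<rho>" .
    qed
  qed
  define M where "M = Max (insert 1 J)"
  have M: "l \<le> M" if "l \<in> J" for l using J that by (simp add: M_def)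
  obtain N where N: "M / \<rho> < 4 ^ N" using real_arch_pow[of 4 "M / \<rho>"] by auto
  then have "M < 4 ^ N * \<rho>" using \<rho> by (simp add: field_simps)
  with M have "\<forall>l\<in>J. l < 4 ^ N * \<rho>" by force
  then show ?thesis using main \<rho> by blast
qed

abbreviation \<kappa>0 :: real where "\<kappa>0 \<equiv> cutoff_mass 0 1"

lemma nrm_ge:
  assumes "0 \<le> l"
  shows "\<kappa>0 / 4 * exp (- (6 * freq l)) \<le> nrm l"
proof -
  have "\<kappa>0 / 4 * exp (- (6 * freq l)) \<le> integral {0..1} (\<lambda>x. (y l x)\<^sup>2)"
    using assms by (intro local_mass_ge) auto
  also have "\<dots> \<le> nrm l"
    unfolding nrm_def
    by (intro integral_subset_le integrable_continuous_real continuous_intros continuous_on_subset[OF y_cont]) auto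
  finally show ?thesis .
qed

text \<open>Divide f first by s - k, where the quotient at k is f'(k), and then by the remaining
  zeros. The radius 7k is chosen because 7k - j >= k + j exactly when j <= 3k, so the division cost
  produces the numerators k + j.\<close>

lemma eig_product_near:
  assumes J: "finite J" "J \<subseteq> E" and k: "k \<in> E" "k \<notin> J" and near: "\<And>j. j \<in> J \<Longrightarrow> j < 3 * k"
  shows "(\<Prod>j\<in>J. (k + j) / \<bar>k - j\<bar>) \<le> 8 / \<kappa>0 * exp (20 * freq k)"
proof -
  let ?R = "7 * k" and ?N = "\<Sum>m. \<bar>fc m\<bar> * (7 * k) ^ m"
  have kq: "1/4 \<le> k" using eig_ge[OF k(1)] .
  then have k0: "0 < k" "0 \<le> k" by auto
  have pos: "0 < j" if "j \<in> J" for j using eig_ge[of j] J(2) that by auto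
  have R: "0 \<le> ?R" "k < ?R" using k0 by auto
  have zk: "(\<Sum>m. fc m * k ^ m) = 0" using k by (simp add: y_1_powser[symmetric] E_def)
  obtain b where b: "summable (\<lambda>m. \<bar>b m\<bar> * ?R ^ m)"
    "(\<Sum>m. \<bar>b m\<bar> * ?R ^ m) \<le> ?N / (?R - k)"
    "\<And>s. \<bar>s\<bar> \<le> ?R \<Longrightarrow> (\<Sum>m. fc m * s ^ m) = (s - k) * (\<Sum>m. b m * s ^ m)"
    by (rule powser_divide_zero[OF fc_summable(1)[OF R(1)] k0(1) R(2) zk]) (rule that)
  have bk: "(\<Sum>m. b m * k ^ m) = nrm k / dy k 1"
    by (rule quotient_at_eigenvalue[OF k(1) R(2) b(1)]) (use b(3) in \<open>simp add: y_1_powser\<close>)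
  have z: "0 < j \<and> j < ?R \<and> (\<Sum>m. b m * j ^ m) = 0" if j: "j \<in> J" for j
  proof -
    have "j < ?R" using near[OF j] k0 by simp
    moreover have "(j - k) * (\<Sum>m. b m * j ^ m) = 0"
      using b(3)[of j] pos[OF j] \<open>j < ?R\<close> J(2) j by (auto simp: y_1_powser[symmetric] E_def)
    moreover have "j \<noteq> k" using j k by auto
    ultimately show ?thesis using pos[OF j] by simp
  qed
  obtain c where c: "summable (\<lambda>m. \<bar>c m\<bar> * ?R ^ m)"
    "(\<Sum>m. \<bar>c m\<bar> * ?R ^ m) \<le> (\<Sum>m. \<bar>b m\<bar> * ?R ^ m) / (\<Prod>l\<in>J. ?R - l)"
    "\<forall>s. \<bar>s\<bar> \<le> ?R \<longrightarrow> (\<Sum>m. b m * s ^ m) = (\<Prod>l\<in>J. s - l) * (\<Sum>m. c m * s ^ m)"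
    using powser_divide_zeros[OF J(1) b(1) z] by auto
  let ?P = "\<Prod>j\<in>J. \<bar>k - j\<bar>"
  have P0: "0 < ?P" using k by (intro prod_pos) auto
  have Q0: "0 < (\<Prod>j\<in>J. k + j)" using k0 pos by (intro prod_pos) (auto intro: add_pos_pos)
  have N0: "0 \<le> ?N" using k0 by (intro suminf_nonneg fc_summable) auto
  have "\<bar>nrm k / dy k 1\<bar> = ?P * \<bar>\<Sum>m. c m * k ^ m\<bar>"
    using c(3)[rule_format, of k] k0 unfolding bk[symmetric] by (simp add: abs_mult abs_prod)
  also have "\<dots> \<le> ?P * (\<Sum>m. \<bar>c m\<bar> * ?R ^ m)"
    using powser_abs_le[OF c(1), of k] k0 P0 by (intro mult_left_mono) auto
  also have "\<dots> \<le> ?P * (?N / (6 * k) / (\<Prod>j\<in>J. k + j))"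
  proof -
    have "(\<Prod>j\<in>J. k + j) \<le> (\<Prod>l\<in>J. ?R - l)"
      using pos k0 near by (intro prod_mono) force
    then have "?N / (6 * k) / (\<Prod>l\<in>J. ?R - l) \<le> ?N / (6 * k) / (\<Prod>j\<in>J. k + j)"
      using Q0 N0 k0 by (intro divide_left_mono) (auto intro!: mult_pos_pos divide_nonneg_nonneg)
    moreover have "(\<Sum>m. \<bar>c m\<bar> * ?R ^ m) \<le> ?N / (6 * k) / (\<Prod>l\<in>J. ?R - l)"
    proof -
      have "(\<Prod>l\<in>J. ?R - l) \<ge> 0" using z by (intro prod_nonneg) force
      then show ?thesis using c(2) divide_right_mono[OF b(2)] by fastforce
    qed
    ultimately show ?thesis using P0 by (intro mult_left_mono) auto
  qed
  finally have A: "\<bar>nrm k / dy k 1\<bar> \<le> ?P * (?N / (6 * k) / (\<Prod>j\<in>J. k + j))" .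
  have d0: "0 < \<bar>dy k 1\<bar>" using dy_1_nonzero[OF k(1)] by simp
  have "(\<Prod>j\<in>J. (k + j) / \<bar>k - j\<bar>) = (\<Prod>j\<in>J. k + j) / ?P" by (rule prod_dividef)
  also have "\<dots> \<le> ?N / (6 * k) * \<bar>dy k 1\<bar> / nrm k"
    using A P0 Q0 k0 d0 nrm_pos[of k] by (simp add: abs_divide field_simps)
  \<comment> \<open>The rate 20 collects 12 from the growth of f at radius 7k, 2 from
    \<open>dy_le\<close> and 6 from \<open>nrm_ge\<close>.\<close>
  also have "\<dots> \<le> (3 * exp (12 * freq k)) / (6 * (1/4)) * exp (2 * freq k) / (\<kappa>0 / 4 * exp (- (6 * freq k)))"
  proof -
    have "sqrt (\<nu>\<^sup>2 + 7 * k) \<le> 3 * freq k"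
    proof (rule real_le_lsqrt)
      show "\<nu>\<^sup>2 + 7 * k \<le> (3 * freq k)\<^sup>2" using freq(2)[OF k0(2)] k0 by (simp add: power_mult_distrib)
    qed (use freq(1)[OF k0(2)] in simp)
    then have "3 * exp (4 * sqrt (\<nu>\<^sup>2 + ?R)) \<le> 3 * exp (12 * freq k)" by simp
    with fc_summable(2)[OF R(1)] have "?N \<le> 3 * exp (12 * freq k)" by (rule order_trans)
    moreover have "\<kappa>0 > 0" by (rule cutoff_mass_pos) simp
    ultimately show ?thesis
      using N0 kq k0 dy_le[OF k0(2)] nrm_ge[OF k0(2)] nrm_pos[of k]
      by (intro frac_le mult_mono) auto
  qed
  also have "\<dots> = 8 / \<kappa>0 * exp (20 * freq k)"
  proof -
    have "exp (20 * freq k) = exp (12 * freq k) * exp (2 * freq k) * exp (6 * freq k)"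
      by (simp add: exp_add[symmetric])
    then show ?thesis by (simp add: exp_minus field_simps)
  qed
  finally show ?thesis .
qed

text \<open>The division argument needs a radius comparable to k, so eigenvalues beyond 3k are
  treated by counting: there each factor is at most 1 + 3k/j, and \<open>sum_inverse_eig_le\<close>
  bounds the sum of the 1/j. The rate 63 is 7 + 32 * 7/4, with 7/4 for sqrt 3.\<close>

lemma eig_product_le:
  assumes J: "finite J" "J \<subseteq> E" and k: "k \<in> E"
  shows "(\<Prod>j\<in>J-{k}. (k + j) / \<bar>k - j\<bar>) \<le> 8 / \<kappa>0 * exp (83 * freq k)"
proof -
  have kq: "1/4 \<le> k" using eig_ge[OF k] .
  then have k0: "0 < k" "0 \<le> k" by auto
  let ?J1 = "{j \<in> J - {k}. j < 3 * k}" and ?J2 = "{j \<in> J. 3 * k \<le> j}"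
  have "(\<Prod>j\<in>J-{k}. (k + j) / \<bar>k - j\<bar>) = (\<Prod>j\<in>?J1 \<union> ?J2. (k + j) / \<bar>k - j\<bar>)"
    using k0 by (intro prod.cong) auto
  also have "\<dots> = (\<Prod>j\<in>?J1. (k + j) / \<bar>k - j\<bar>) * (\<Prod>j\<in>?J2. (k + j) / \<bar>k - j\<bar>)"
    using J by (intro prod.union_disjoint) auto
  also have "\<dots> \<le> 8 / \<kappa>0 * exp (20 * freq k) * exp (63 * freq k)"
  proof (intro mult_mono)
    show "(\<Prod>j\<in>?J1. (k + j) / \<bar>k - j\<bar>) \<le> 8 / \<kappa>0 * exp (20 * freq k)"
      using J k by (intro eig_product_near) auto
    have "(\<Prod>j\<in>?J2. (k + j) / \<bar>k - j\<bar>) \<le> (\<Prod>j\<in>?J2. exp (3 * k * (1 / j)))"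
    proof (rule prod_mono, safe)
      fix j assume j: "j \<in> J" "3 * k \<le> j"
      then show "0 \<le> (k + j) / \<bar>k - j\<bar>" using k0 by simp
      have "(k + j) / \<bar>k - j\<bar> \<le> 1 + 3 * k * (1 / j)"
        using j k0 by (simp add: field_simps abs_if)
      also have "\<dots> \<le> exp (3 * k * (1 / j))" by (rule exp_ge_add_one_self)
      finally show "(k + j) / \<bar>k - j\<bar> \<le> exp (3 * k * (1 / j))" .
    qed
    also have "\<dots> = exp (3 * k * (\<Sum>j\<in>?J2. 1 / j))"
      using J by (simp add: exp_sum[symmetric] sum_distrib_left)
    also have "\<dots> \<le> exp (63 * freq k)"
    proof -
      have "3 * k * (\<Sum>j\<in>?J2. 1 / j) \<le> 3 * k * (7 * \<nu> / (3 * k) + 32 / sqrt (3 * k))"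
        using k0 by (intro mult_left_mono sum_inverse_eig_le J) auto
      also have "\<dots> = 7 * \<nu> + 32 * sqrt (3 * k)"
      proof -
        have "3 * k / sqrt (3 * k) = sqrt (3 * k)" using k0 by (intro real_div_sqrt) auto
        then have "3 * k * (32 / sqrt (3 * k)) = 32 * sqrt (3 * k)" by simp
        then show ?thesis using k0 by (simp add: distrib_left)
      qed
      also have "\<dots> \<le> 63 * freq k"
      proof -
        have "sqrt 3 \<le> 7/4" by (rule real_le_lsqrt) (auto simp: power2_eq_square)
        then have "sqrt (3 * k) \<le> 7/4 * sqrt k" using k0 by (simp add: real_sqrt_mult mult_right_mono)
        then show ?thesis using freq(4,5)[OF k0(2)] by linarith
      qed
      finally show ?thesis by simp
    qed
    finally show "(\<Prod>j\<in>?J2. (k + j) / \<bar>k - j\<bar>) \<le> exp (63 * freq k)" .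
    show "0 \<le> 8 / \<kappa>0 * exp (20 * freq k)"
      using cutoff_mass_pos[of 0 1] by simp
    have "0 < j" if "j \<in> J" for j using eig_ge[of j] J(2) that by auto
    then show "0 \<le> (\<Prod>j\<in>?J2. (k + j) / \<bar>k - j\<bar>)"
      using k0 by (intro prod_nonneg) auto
  qed
  also have "\<dots> = 8 / \<kappa>0 * exp (83 * freq k)" by (simp add: exp_add[symmetric])
  finally show ?thesis .
qed

end

section \<open>Cauchy matrices\<close>

text \<open>For positive exponents this is the squared norm in L^2(0,infinity) of the sum of a_j
  exp(-jt). The algebraic form allows Blaschke factors to act on the coefficients without any
  integral.\<close>

definition cauchy_form :: "real set \<Rightarrow> (real \<Rightarrow> real) \<Rightarrow> real" where
  "cauchy_form J a = (\<Sum>i\<in>J. \<Sum>j\<in>J. a i * a j / (i + j))"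

text \<open>On \<open>\<Sum> a\<^sub>j e\<^sup>-\<^sup>j\<^sup>t\<close> the map \<open>a\<^sub>j \<mapsto> a\<^sub>j (j - q) / (j + q)\<close> is a Blaschke factor, a contraction of
  \<open>L\<^sup>2(0,\<infinity>)\<close> that removes the exponent \<open>q\<close>.\<close>

lemma cauchy_form_blaschke:
  assumes "\<And>j. j \<in> J \<Longrightarrow> 0 < j" "0 < q"
  shows "cauchy_form J (\<lambda>j. a j * ((j - q) / (j + q))) \<le> cauchy_form J a"
proof -
  have "cauchy_form J a - cauchy_form J (\<lambda>j. a j * ((j - q) / (j + q)))
     = (\<Sum>i\<in>J. \<Sum>j\<in>J. a i * a j / (i + j) - a i * ((i - q) / (i + q)) * (a j * ((j - q) / (j + q))) / (i + j))"
    by (simp add: cauchy_form_def sum_subtractf)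
  also have "\<dots> = (\<Sum>i\<in>J. \<Sum>j\<in>J. 2 * q * ((a i / (i + q)) * (a j / (j + q))))"
  proof (intro sum.cong refl)
    fix i j assume "i \<in> J" "j \<in> J"
    then have "0 < i" "0 < j" using assms by auto
    then have nz: "i + j \<noteq> 0" "i + q \<noteq> 0" "j + q \<noteq> 0" using assms by auto
    show "a i * a j / (i + j) - a i * ((i - q) / (i + q)) * (a j * ((j - q) / (j + q))) / (i + j)
        = 2 * q * ((a i / (i + q)) * (a j / (j + q)))"
      using nz by (simp add: divide_simps) (simp add: algebra_simps)
  qed
  also have "\<dots> = 2 * q * (\<Sum>i\<in>J. a i / (i + q))\<^sup>2"
  proof -
    have "(\<Sum>i\<in>J. a i / (i + q))\<^sup>2 = (\<Sum>i\<in>J. \<Sum>j\<in>J. (a i / (i + q)) * (a j / (j + q)))"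
      by (simp only: power2_eq_square sum_product)
    then show ?thesis by (simp only: sum_distrib_left)
  qed
  also have "\<dots> \<ge> 0" using assms by simp
  finally show ?thesis by simp
qed

lemma cauchy_form_blaschke_prod:
  assumes J: "\<And>j. j \<in> J \<Longrightarrow> 0 < j" and P: "finite P" "\<And>q. q \<in> P \<Longrightarrow> 0 < q"
  shows "cauchy_form J (\<lambda>j. a j * (\<Prod>q\<in>P. (j - q) / (j + q))) \<le> cauchy_form J a"
  using P
proof (induction P rule: finite_induct)
  case (insert q P)
  have "cauchy_form J (\<lambda>j. a j * (\<Prod>q\<in>insert q P. (j - q) / (j + q)))
     = cauchy_form J (\<lambda>j. a j * (\<Prod>q\<in>P. (j - q) / (j + q)) * ((j - q) / (j + q)))"
    using insert.hyps by (simp add: mult_ac)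
  also have "\<dots> \<le> cauchy_form J (\<lambda>j. a j * (\<Prod>q\<in>P. (j - q) / (j + q)))"
    by (rule cauchy_form_blaschke) (use J insert.prems in auto)
  also have "\<dots> \<le> cauchy_form J a" using insert by auto
  finally show ?case .
qed simp

text \<open>Removing every exponent in turn brings the form down to 0 and never increases
  it.\<close>

lemma cauchy_form_nonneg:
  assumes "finite J" "\<And>j. j \<in> J \<Longrightarrow> 0 < j"
  shows "0 \<le> cauchy_form J a"
proof -
  have "(\<Prod>q\<in>J. (j - q) / (j + q)) = 0" if "j \<in> J" for j
    using assms(1) that by (intro prod_zero) auto
  then have "cauchy_form J (\<lambda>j. a j * (\<Prod>q\<in>J. (j - q) / (j + q))) = 0"
    by (simp add: cauchy_form_def)
  then show ?thesis using cauchy_form_blaschke_prod[of J J a] assms by simp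
qed

lemma cauchy_form_ge:
  assumes J: "finite J" "\<And>j. j \<in> J \<Longrightarrow> 0 < j" and k: "k \<in> J"
  shows "(a k * (\<Prod>q\<in>J-{k}. (k - q) / (k + q)))\<^sup>2 / (2 * k) \<le> cauchy_form J a"
proof -
  define c where "c j = a j * (\<Prod>q\<in>J-{k}. (j - q) / (j + q))" for j
  have z: "c j = 0" if "j \<in> J" "j \<noteq> k" for j
  proof -
    have "(\<Prod>q\<in>J-{k}. (j - q) / (j + q)) = 0"
      by (rule prod_zero) (use J(1) that in \<open>auto intro!: bexI[of _ j]\<close>)
    then show ?thesis by (simp add: c_def)
  qed
  have in1: "(\<Sum>j\<in>J. c i * c j / (i + j)) = c i * c k / (i + k)" for i
  proof -
    have "(\<Sum>j\<in>J. c i * c j / (i + j)) = (\<Sum>j\<in>{k}. c i * c j / (i + j))"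
      by (rule sum.mono_neutral_right) (use J k z in auto)
    then show ?thesis by simp
  qed
  have "cauchy_form J c = (\<Sum>i\<in>{k}. c i * c k / (i + k))"
    unfolding cauchy_form_def in1 by (rule sum.mono_neutral_right) (use J k z in auto)
  then have "cauchy_form J c = (c k)\<^sup>2 / (2 * k)" by (simp add: power2_eq_square)
  moreover have "cauchy_form J c \<le> cauchy_form J a"
    unfolding c_def by (rule cauchy_form_blaschke_prod) (use J in auto)
  ultimately show ?thesis by (simp add: c_def)
qed

section \<open>Observability of finite eigenfunction sums\<close>

lemma integral_exp_neg:
  fixes s T :: real
  assumes "0 < s" "0 \<le> T"
  shows "((\<lambda>t. exp (- (s * t))) has_integral (1 - exp (- (s * T))) / s) {0..T}"
proof -
  have "((\<lambda>t. exp (- (s * t))) has_integral (- exp (- (s * T)) / s - - exp (- (s * 0)) / s)) {0..T}"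
    by (rule ftc[where F = "\<lambda>t. - exp (- (s * t)) / s"])
       (use assms in \<open>auto intro!: derivative_eq_intros\<close>)
  then show ?thesis by (simp add: diff_divide_distrib)
qed

lemma integral_sq_add_le:
  fixes f g :: "real \<Rightarrow> real"
  assumes "continuous_on {a..b} f" "continuous_on {a..b} g"
  shows "integral {a..b} (\<lambda>x. (f x + g x)\<^sup>2) \<le> 2 * integral {a..b} (\<lambda>x. (f x)\<^sup>2) + 2 * integral {a..b} (\<lambda>x. (g x)\<^sup>2)"
proof -
  have "integral {a..b} (\<lambda>x. (f x + g x)\<^sup>2) \<le> integral {a..b} (\<lambda>x. 2 * (f x)\<^sup>2 + 2 * (g x)\<^sup>2)"
  proof (intro integral_cont_mono continuous_intros assms)
    fix x show "(f x + g x)\<^sup>2 \<le> 2 * (f x)\<^sup>2 + 2 * (g x)\<^sup>2"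
      using sum_squares_bound[of "f x" "g x"] by (simp add: power2_sum)
  qed
  then show ?thesis using integral_lincomb[of a b "\<lambda>x. (f x)\<^sup>2" "\<lambda>x. (g x)\<^sup>2" 2 2] assms
    by (simp add: continuous_intros)
qed

context sturm
begin

definition phi :: "real \<Rightarrow> real \<Rightarrow> real" where
  "phi k x = y k x / sqrt (nrm k)"

lemma phi_cont: "continuous_on {-1..1} (phi k)"
  unfolding phi_def using nrm_pos[of k] by (auto intro!: continuous_intros y_cont)

lemma phi_cont_sub: "{a..b} \<subseteq> {-1..1} \<Longrightarrow> continuous_on {a..b} (phi k)"
  by (rule continuous_on_subset[OF phi_cont])

lemma phi_orth:
  assumes "j \<in> E" "k \<in> E"
  shows "integral {-1..1} (\<lambda>x. phi j x * phi k x) = (if j = k then 1 else 0)"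
proof -
  have "integral {-1..1} (\<lambda>x. phi j x * phi k x) = integral {-1..1} (\<lambda>x. (1 / (sqrt (nrm j) * sqrt (nrm k))) * (y j x * y k x))"
    by (simp add: phi_def)
  also have "\<dots> = (1 / (sqrt (nrm j) * sqrt (nrm k))) * integral {-1..1} (\<lambda>x. y j x * y k x)"
    by (rule integral_mult_right)
  also have "\<dots> = (if j = k then 1 else 0)"
    using eig_orth[OF assms] nrm_pos[of k] nrm_def[of k] by (auto simp: power2_eq_square)
  finally show ?thesis .
qed

definition uu :: "real set \<Rightarrow> (real \<Rightarrow> real) \<Rightarrow> real \<Rightarrow> real \<Rightarrow> real" where
  "uu J c t x = (\<Sum>k\<in>J. c k * exp (- (k * t)) * phi k x)"

definition BB :: "real \<Rightarrow> real \<Rightarrow> real \<Rightarrow> real \<Rightarrow> real" where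
  "BB a b i j = integral {a..b} (\<lambda>x. phi i x * phi j x)"

definition obs :: "real \<Rightarrow> real \<Rightarrow> real \<Rightarrow> real set \<Rightarrow> (real \<Rightarrow> real) \<Rightarrow> real" where
  "obs a b T J c = integral {0..T} (\<lambda>t. integral {a..b} (\<lambda>x. (uu J c t x)\<^sup>2))"

lemma uu_cont: "{a..b} \<subseteq> {-1..1} \<Longrightarrow> continuous_on {a..b} (uu J c t)"
  unfolding uu_def by (intro continuous_intros phi_cont_sub)

lemma integral_double_sum:
  assumes ab: "{a..b} \<subseteq> {-1..1}"
  shows "integral {a..b} (\<lambda>x. \<Sum>i\<in>J. \<Sum>j\<in>J. g i j * (phi i x * phi j x)) = (\<Sum>i\<in>J. \<Sum>j\<in>J. g i j * BB a b i j)"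
proof (cases "finite J")
  case True
  have I: "(\<lambda>x. g i j * (phi i x * phi j x)) integrable_on {a..b}" for i j
    by (intro integrable_continuous_real continuous_intros phi_cont_sub ab)
  have "integral {a..b} (\<lambda>x. \<Sum>i\<in>J. \<Sum>j\<in>J. g i j * (phi i x * phi j x))
     = (\<Sum>i\<in>J. integral {a..b} (\<lambda>x. \<Sum>j\<in>J. g i j * (phi i x * phi j x)))"
    using True by (intro integral_sum integrable_sum I) auto
  also have "\<dots> = (\<Sum>i\<in>J. \<Sum>j\<in>J. integral {a..b} (\<lambda>x. g i j * (phi i x * phi j x)))"
    using True by (intro sum.cong refl integral_sum I) auto
  finally show ?thesis by (simp only: BB_def integral_mult_right)
qed simp

lemma uu_sq: "(uu J c t x)\<^sup>2 = (\<Sum>i\<in>J. \<Sum>j\<in>J. (c i * c j * exp (- ((i + j) * t))) * (phi i x * phi j x))"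
proof -
  have "(uu J c t x)\<^sup>2 = (\<Sum>i\<in>J. \<Sum>j\<in>J. (c i * exp (- (i * t)) * phi i x) * (c j * exp (- (j * t)) * phi j x))"
    unfolding uu_def power2_eq_square sum_product ..
  also have "\<dots> = (\<Sum>i\<in>J. \<Sum>j\<in>J. (c i * c j * exp (- ((i + j) * t))) * (phi i x * phi j x))"
  proof (intro sum.cong refl)
    fix i j
    have e: "exp (- ((i + j) * t)) = exp (- (i * t)) * exp (- (j * t))"
      by (simp add: exp_add[symmetric] algebra_simps)
    show "(c i * exp (- (i * t)) * phi i x) * (c j * exp (- (j * t)) * phi j x)
        = (c i * c j * exp (- ((i + j) * t))) * (phi i x * phi j x)"
      unfolding e by (simp only: mult_ac)
  qed
  finally show ?thesis .
qed

lemma integral_uu_sq: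
  assumes ab: "{a..b} \<subseteq> {-1..1}"
  shows "integral {a..b} (\<lambda>x. (uu J c t x)\<^sup>2) = (\<Sum>i\<in>J. \<Sum>j\<in>J. (c i * c j * exp (- ((i + j) * t))) * BB a b i j)"
  unfolding uu_sq by (rule integral_double_sum[OF ab])

lemma sum_BB_full:
  assumes J: "finite J" "J \<subseteq> E"
  shows "(\<Sum>i\<in>J. \<Sum>j\<in>J. g i j * BB (-1) 1 i j) = (\<Sum>i\<in>J. g i i)"
proof (rule sum.cong[OF refl])
  fix i assume i: "i \<in> J"
  have "(\<Sum>j\<in>J. g i j * BB (-1) 1 i j) = (\<Sum>j\<in>{i}. g i j * BB (-1) 1 i j)"
    by (rule sum.mono_neutral_right) (use J i phi_orth in \<open>auto simp: BB_def subset_iff\<close>)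
  also have "\<dots> = g i i" using phi_orth[of i i] i J by (simp add: BB_def subset_iff)
  finally show "(\<Sum>j\<in>J. g i j * BB (-1) 1 i j) = g i i" .
qed

lemma integral_uu_sq_full:
  assumes J: "finite J" "J \<subseteq> E"
  shows "integral {-1..1} (\<lambda>x. (uu J c t x)\<^sup>2) = (\<Sum>k\<in>J. (c k * exp (- (k * t)))\<^sup>2)"
proof -
  have "(\<Sum>i\<in>J. c i * c i * exp (- ((i + i) * t))) = (\<Sum>k\<in>J. (c k * exp (- (k * t)))\<^sup>2)"
  proof (intro sum.cong refl)
    fix i
    have e: "exp (- ((i + i) * t)) = exp (- (i * t)) * exp (- (i * t))"
      by (simp add: exp_add[symmetric] algebra_simps)
    show "c i * c i * exp (- ((i + i) * t)) = (c i * exp (- (i * t)))\<^sup>2"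
      unfolding e power2_eq_square by (simp only: mult_ac)
  qed
  then show ?thesis
    by (subst integral_uu_sq) (auto simp: sum_BB_full[OF J])
qed

lemma local_integral_uu_sq_le:
  assumes ab: "{a..b} \<subseteq> {-1..1}"
  shows "integral {a..b} (\<lambda>x. (uu J c t x)\<^sup>2) \<le> integral {-1..1} (\<lambda>x. (uu J c t x)\<^sup>2)"
  by (intro integral_subset_le ab integrable_continuous_real continuous_intros uu_cont) auto

lemma integral_uu_sq_nonneg:
  assumes ab: "{a..b} \<subseteq> {-1..1}"
  shows "0 \<le> integral {a..b} (\<lambda>x. (uu J c t x)\<^sup>2)"
  by (intro integral_nonneg integrable_continuous_real continuous_intros uu_cont ab) auto

lemma local_mass_cont:
  assumes ab: "{a..b} \<subseteq> {-1..1}"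
  shows "continuous_on S (\<lambda>t. integral {a..b} (\<lambda>x. (uu J c t x)\<^sup>2))"
  unfolding integral_uu_sq[OF ab] by (intro continuous_intros)

lemma obs_nonneg:
  assumes ab: "{a..b} \<subseteq> {-1..1}"
  shows "0 \<le> obs a b T J c"
  unfolding obs_def
  by (intro integral_nonneg integrable_continuous_real local_mass_cont ab integral_uu_sq_nonneg)

lemma obs_formula:
  assumes ab: "{a..b} \<subseteq> {-1..1}" and J: "finite J" "J \<subseteq> E" and T: "0 \<le> T"
  shows "obs a b T J c = (\<Sum>i\<in>J. \<Sum>j\<in>J. c i * c j * BB a b i j * ((1 - exp (- ((i + j) * T))) / (i + j)))"
proof -
  have "((\<lambda>t. \<Sum>i\<in>J. \<Sum>j\<in>J. (c i * c j * BB a b i j) * exp (- ((i + j) * t))) has_integral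
     (\<Sum>i\<in>J. \<Sum>j\<in>J. (c i * c j * BB a b i j) * ((1 - exp (- ((i + j) * T))) / (i + j)))) {0..T}"
  proof (intro has_integral_sum J has_integral_mult_right integral_exp_neg T)
    fix i j assume "i \<in> J" "j \<in> J"
    then show "0 < i + j" using eig_ge[of i] eig_ge[of j] J(2) by force
  qed
  then show ?thesis
    unfolding obs_def integral_uu_sq[OF ab] by (simp add: integral_unique mult_ac)
qed

text \<open>The cost of recovering mode k. The rate is 178 = 2 + 2 * 83 + 10: the factor k, the
  squared product over the other modes, and the local mass of the eigenfunction. The prefactor is
  1024 = 2 * 8^2 * 8.\<close>

definition Mb :: "real \<Rightarrow> real \<Rightarrow> real \<Rightarrow> real" where
  "Mb a b k = 1024 / (\<kappa>0\<^sup>2 * cutoff_mass a b) * exp (178 * freq k)"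

lemma BB_ge:
  assumes k: "k \<in> E" and ab: "-1 \<le> a" "a < b" "b \<le> 1" "b - a \<le> 1"
  shows "cutoff_mass a b / 8 * exp (- (10 * freq k)) \<le> BB a b k k"
proof -
  have k0: "0 \<le> k" using eig_ge[OF k] by simp
  have "BB a b k k = integral {a..b} (\<lambda>x. (1 / nrm k) * (y k x)\<^sup>2)"
    using nrm_pos[of k] by (simp add: BB_def phi_def power2_eq_square)
  also have "\<dots> = (1 / nrm k) * integral {a..b} (\<lambda>x. (y k x)\<^sup>2)" by (rule integral_mult_right)
  finally have B: "BB a b k k = integral {a..b} (\<lambda>x. (y k x)\<^sup>2) / nrm k" by simp
  have "cutoff_mass a b / 4 * exp (- (6 * freq k)) / (2 * exp (4 * freq k)) \<le> integral {a..b} (\<lambda>x. (y k x)\<^sup>2) / nrm k"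
  proof (rule frac_le)
    have "0 \<le> cutoff_mass a b / 4 * exp (- (6 * freq k))" using cutoff_mass_pos[OF ab(2)] by simp
    then show "0 \<le> integral {a..b} (\<lambda>x. (y k x)\<^sup>2)" using local_mass_ge[OF k0 ab] by (rule order_trans)
  qed (use local_mass_ge[OF k0 ab] nrm_le[OF k0] nrm_pos[of k] in auto)
  moreover have "cutoff_mass a b / 4 * exp (- (6 * freq k)) / (2 * exp (4 * freq k)) = cutoff_mass a b / 8 * exp (- (10 * freq k))"
  proof -
    have e: "exp (- (10 * freq k)) = exp (- (6 * freq k)) / exp (4 * freq k)" by (simp add: exp_diff[symmetric])
    show ?thesis unfolding e by simp
  qed
  ultimately show ?thesis unfolding B by (simp only:)
qed

text \<open>The Cauchy form estimate is applied for each fixed x to the coefficients c_i phi_i(x)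
  and then integrated over (a,b). The space variable thus causes no coupling, although the
  eigenfunctions are not orthogonal on (a,b).\<close>

lemma mode_bound:
  assumes J: "finite J" "J \<subseteq> E" and k: "k \<in> J" and T: "0 \<le> T"
    and ab: "-1 \<le> a" "a < b" "b \<le> 1" "b - a \<le> 1"
  shows "(c k)\<^sup>2 \<le> Mb a b k * (obs a b T J c + (\<Sum>i\<in>J. (c i * exp (- (i * T)))\<^sup>2 / (2 * i)))"
proof -
  have sub: "{a..b} \<subseteq> {-1..1}" using ab by auto
  have pos: "0 < j" if "j \<in> J" for j using eig_ge[of j] J(2) that by auto
  have kE: "k \<in> E" and k0: "0 < k" "0 \<le> k" using J k pos[OF k] by auto
  define G where "G d = (\<Sum>i\<in>J. \<Sum>j\<in>J. (d i * d j / (i + j)) * BB a b i j)" for d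
  have cf: "cauchy_form J (\<lambda>i. d i * phi i x) = (\<Sum>i\<in>J. \<Sum>j\<in>J. (d i * d j / (i + j)) * (phi i x * phi j x))" for d x
    unfolding cauchy_form_def by (intro sum.cong refl) simp
  have cfc: "continuous_on {a'..b'} (\<lambda>x. cauchy_form J (\<lambda>i. d i * phi i x))" if "{a'..b'} \<subseteq> {-1..1}" for a' b' d
    unfolding cf by (intro continuous_intros phi_cont_sub that)
  have G: "G d = integral {a..b} (\<lambda>x. cauchy_form J (\<lambda>i. d i * phi i x))" for d
    unfolding cf G_def by (rule integral_double_sum[OF sub, symmetric])
  define P where "P = (\<Prod>q\<in>J-{k}. (k + q) / \<bar>k - q\<bar>)"
  define Q where "Q = (\<Prod>q\<in>J-{k}. (k - q) / (k + q))"
  have P0: "0 < P" unfolding P_def using pos k0 by (intro prod_pos) (auto intro!: divide_pos_pos add_pos_pos)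
  have QP: "Q\<^sup>2 * P\<^sup>2 = 1"
  proof -
    have "\<bar>Q\<bar> * P = (\<Prod>q\<in>J-{k}. \<bar>(k - q) / (k + q)\<bar> * ((k + q) / \<bar>k - q\<bar>))"
      unfolding Q_def P_def abs_prod by (rule prod.distrib[symmetric])
    also have "\<dots> = (\<Prod>q\<in>J-{k}. 1)"
    proof (intro prod.cong refl)
      fix q assume q: "q \<in> J - {k}"
      then have "0 < k + q" "\<bar>k - q\<bar> \<noteq> 0" using pos[of q] k0 by auto
      then show "\<bar>(k - q) / (k + q)\<bar> * ((k + q) / \<bar>k - q\<bar>) = 1" by (simp add: abs_divide)
    qed
    finally have "(\<bar>Q\<bar> * P)\<^sup>2 = 1" by simp
    then show ?thesis by (simp add: power_mult_distrib)
  qed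
  have "(c k)\<^sup>2 * Q\<^sup>2 / (2 * k) * BB a b k k = integral {a..b} (\<lambda>x. (c k)\<^sup>2 * Q\<^sup>2 / (2 * k) * (phi k x * phi k x))"
    by (simp only: BB_def integral_mult_right)
  also have "\<dots> \<le> integral {a..b} (\<lambda>x. cauchy_form J (\<lambda>i. c i * phi i x))"
  proof (intro integral_cont_mono cfc sub continuous_intros phi_cont_sub)
    fix x
    have "(c k)\<^sup>2 * Q\<^sup>2 / (2 * k) * (phi k x * phi k x) = (c k * phi k x * Q)\<^sup>2 / (2 * k)"
      by (simp add: power2_eq_square mult_ac)
    also have "\<dots> \<le> cauchy_form J (\<lambda>i. c i * phi i x)"
      unfolding Q_def by (rule cauchy_form_ge[OF J(1) pos k])
    finally show "(c k)\<^sup>2 * Q\<^sup>2 / (2 * k) * (phi k x * phi k x) \<le> cauchy_form J (\<lambda>i. c i * phi i x)" .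
  qed
  finally have low: "(c k)\<^sup>2 * Q\<^sup>2 / (2 * k) * BB a b k k \<le> G c" by (simp only: G)
  let ?d = "\<lambda>i. c i * exp (- (i * T))"
  \<comment> \<open>\<open>G c\<close> is the observation over all positive times. Splitting at T
    leaves the same form evaluated at the coefficients of time T.\<close>
  have "G c = obs a b T J c + G ?d"
    unfolding obs_formula[OF sub J T] G_def sum.distrib[symmetric]
  proof (intro sum.cong refl)
    fix i j assume "i \<in> J" "j \<in> J"
    then have ij: "i + j \<noteq> 0" using pos[of i] pos[of j] by simp
    have e: "exp (- ((i + j) * T)) = exp (- (i * T)) * exp (- (j * T))"
      by (simp add: exp_add[symmetric] algebra_simps)
    show "c i * c j / (i + j) * BB a b i j = c i * c j * BB a b i j * ((1 - exp (- ((i + j) * T))) / (i + j))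
        + ?d i * ?d j / (i + j) * BB a b i j"
      unfolding e by (simp add: diff_divide_distrib algebra_simps)
  qed
  \<comment> \<open>The Cauchy form is nonnegative at each x, so the integral may be extended to
    (-1,1), where orthogonality makes it diagonal.\<close>
  moreover have "G ?d \<le> (\<Sum>i\<in>J. (?d i)\<^sup>2 / (2 * i))"
  proof -
    have n: "0 \<le> cauchy_form J (\<lambda>i. ?d i * phi i x)" for x
      by (rule cauchy_form_nonneg[OF J(1) pos])
    have "G ?d \<le> integral {-1..1} (\<lambda>x. cauchy_form J (\<lambda>i. ?d i * phi i x))"
      unfolding G
      using n by (intro integral_subset_le sub integrable_continuous_real cfc) auto
    also have "\<dots> = (\<Sum>i\<in>J. \<Sum>j\<in>J. (?d i * ?d j / (i + j)) * BB (-1) 1 i j)"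
      unfolding cf by (rule integral_double_sum) simp
    also have "\<dots> = (\<Sum>i\<in>J. ?d i * ?d i / (i + i))" by (rule sum_BB_full[OF J])
    also have "\<dots> = (\<Sum>i\<in>J. (?d i)\<^sup>2 / (2 * i))" by (simp add: power2_eq_square)
    finally show ?thesis .
  qed
  ultimately have up: "G c \<le> obs a b T J c + (\<Sum>i\<in>J. (?d i)\<^sup>2 / (2 * i))" by simp
  let ?O = "obs a b T J c + (\<Sum>i\<in>J. (?d i)\<^sup>2 / (2 * i))"
  have O0: "0 \<le> ?O"
    using obs_nonneg[OF sub] pos by (intro add_nonneg_nonneg sum_nonneg divide_nonneg_nonneg) (auto simp: less_imp_le)
  have km: "0 < cutoff_mass a b" "0 < \<kappa>0" using cutoff_mass_pos[OF ab(2)] cutoff_mass_pos[of 0 1] by auto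
  define L where "L = cutoff_mass a b / 8 * exp (- (10 * freq k))"
  have L: "0 < L" "L \<le> BB a b k k" unfolding L_def using BB_ge[OF kE ab] km by auto
  have "(c k)\<^sup>2 * Q\<^sup>2 / (2 * k) * L \<le> (c k)\<^sup>2 * Q\<^sup>2 / (2 * k) * BB a b k k"
    using L k0 by (intro mult_left_mono) auto
  with low up have 1: "(c k)\<^sup>2 * Q\<^sup>2 / (2 * k) * L \<le> ?O" by linarith
  have "(c k)\<^sup>2 = ((c k)\<^sup>2 * Q\<^sup>2 / (2 * k) * L) * (2 * k * P\<^sup>2 / L)"
  proof -
    have "((c k)\<^sup>2 * Q\<^sup>2 / (2 * k) * L) * (2 * k * P\<^sup>2 / L) = (c k)\<^sup>2 * (Q\<^sup>2 * P\<^sup>2)"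
      using k0 L(1) by (simp add: field_simps)
    then show ?thesis using QP by simp
  qed
  also have "\<dots> \<le> ?O * (2 * k * P\<^sup>2 / L)"
    using 1 L(1) k0 by (intro mult_right_mono) auto
  also have "\<dots> \<le> ?O * Mb a b k"
  proof (intro mult_left_mono O0)
    have Pb: "P \<le> 8 / \<kappa>0 * exp (83 * freq k)" unfolding P_def by (rule eig_product_le[OF J kE])
    have kw: "k \<le> exp (2 * freq k)"
    proof -
      have fe: "freq k \<le> exp (freq k)" using exp_ge_add_one_self[of "freq k"] by linarith
      have "k \<le> (freq k)\<^sup>2" using freq(2)[OF k0(2)] by simp
      also have "\<dots> \<le> (exp (freq k))\<^sup>2"
        using freq(1)[OF k0(2)] by (intro power_mono fe) auto
      also have "\<dots> = exp (2 * freq k)" by (simp add: exp_double)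
      finally show ?thesis .
    qed
    have "2 * k * P\<^sup>2 / L \<le> 2 * exp (2 * freq k) * (8 / \<kappa>0 * exp (83 * freq k))\<^sup>2 / L"
      using kw Pb P0 L(1) k0 by (intro divide_right_mono mult_mono power_mono) auto
    also have "\<dots> = Mb a b k"
    proof -
      have e: "exp (178 * freq k) = exp (2 * freq k) * (exp (83 * freq k) * exp (83 * freq k)) * exp (10 * freq k)"
        by (simp add: exp_add[symmetric])
      show ?thesis
        unfolding Mb_def L_def e using km by (simp add: exp_minus power_mult_distrib power2_eq_square field_simps)
    qed
    finally show "2 * k * P\<^sup>2 / L \<le> Mb a b k" .
  qed
  finally show ?thesis by (simp only: mult.commute)
qed

text \<open>Absorption: eigenvalues are at least 1/4, so the tail Y is at most 2X. From X <= (O +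
  Y)/4 it follows that 4X <= O + 2X.\<close>

lemma high_modes:
  assumes J: "finite J" "J \<subseteq> E" and T: "0 \<le> T"
    and ab: "-1 \<le> a" "a < b" "b \<le> 1" "b - a \<le> 1"
    and small: "(\<Sum>k\<in>J. exp (- (2 * k * T)) * Mb a b k) \<le> 1/4"
  shows "(\<Sum>k\<in>J. (c k * exp (- (k * T)))\<^sup>2) \<le> obs a b T J c"
proof -
  let ?X = "\<Sum>k\<in>J. (c k * exp (- (k * T)))\<^sup>2" and ?Y = "\<Sum>i\<in>J. (c i * exp (- (i * T)))\<^sup>2 / (2 * i)"
  let ?O = "obs a b T J c"
  have q: "1/4 \<le> i" if "i \<in> J" for i using eig_ge[of i] J(2) that by auto
  have "?Y \<le> (\<Sum>i\<in>J. 2 * (c i * exp (- (i * T)))\<^sup>2)"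
  proof (rule sum_mono)
    fix i assume "i \<in> J"
    then have "(c i * exp (- (i * T)))\<^sup>2 / (2 * i) \<le> (c i * exp (- (i * T)))\<^sup>2 / (1/2)"
      using q[of i] by (intro divide_left_mono) auto
    then show "(c i * exp (- (i * T)))\<^sup>2 / (2 * i) \<le> 2 * (c i * exp (- (i * T)))\<^sup>2" by simp
  qed
  then have Y: "?Y \<le> 2 * ?X" by (simp add: sum_distrib_left)
  have Y0: "0 \<le> ?Y" using q by (intro sum_nonneg divide_nonneg_nonneg) force+
  have O0: "0 \<le> ?O" using ab by (intro obs_nonneg) auto
  have "?X \<le> (\<Sum>k\<in>J. (exp (- (2 * k * T)) * Mb a b k) * (?O + ?Y))"
  proof (rule sum_mono)
    fix k assume k: "k \<in> J"
    have "(c k * exp (- (k * T)))\<^sup>2 = (c k)\<^sup>2 * exp (- (2 * k * T))"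
      by (simp add: power_mult_distrib exp_double[symmetric] mult.assoc)
    also have "\<dots> \<le> (Mb a b k * (?O + ?Y)) * exp (- (2 * k * T))"
      by (intro mult_right_mono mode_bound J k T ab) simp
    finally show "(c k * exp (- (k * T)))\<^sup>2 \<le> (exp (- (2 * k * T)) * Mb a b k) * (?O + ?Y)"
      by (simp only: mult_ac)
  qed
  also have "\<dots> = (\<Sum>k\<in>J. exp (- (2 * k * T)) * Mb a b k) * (?O + ?Y)" by (simp only: sum_distrib_right)
  also have "\<dots> \<le> 1/4 * (?O + ?Y)" using small O0 Y0 by (intro mult_right_mono) auto
  finally have X: "?X \<le> 1/4 * (?O + ?Y)" .
  from X have "4 * ?X \<le> ?O + ?Y" by simp
  also have "\<dots> \<le> ?O + 2 * ?X" using Y by simp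
  finally have "2 * ?X \<le> ?O" by simp
  moreover have "0 \<le> ?X" by (intro sum_nonneg) simp
  ultimately have "?X \<le> 2 * ?X" by simp
  then show ?thesis using \<open>2 * ?X \<le> ?O\<close> by (rule order_trans)
qed

text \<open>The decay 2kT is spent in three parts: kT is at least \<Lambda> T, half of kT absorbs
  178 sqrt k at the price 178^2/(2T) = 15842/T, and the other half leaves 2/(kT), which is summable.
  The constant 184 is 2(28 + 64).\<close>

lemma mode_sum_le:
  assumes J: "finite J" "J \<subseteq> E" and T: "0 < T" and \<Lambda>: "\<And>k. k \<in> J \<Longrightarrow> \<Lambda> \<le> k" and ab: "a < b"
  shows "(\<Sum>k\<in>J. exp (- (2 * k * T)) * Mb a b k) \<le>
     1024 / (\<kappa>0\<^sup>2 * cutoff_mass a b) * exp (178 * \<nu> - \<Lambda> * T + 15842 / T) * (184 * \<nu> / T)"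
proof -
  let ?C = "1024 / (\<kappa>0\<^sup>2 * cutoff_mass a b)"
  let ?e = "exp (178 * \<nu> - \<Lambda> * T + 15842 / T)"
  have C0: "0 \<le> ?C" using cutoff_mass_pos[OF ab] by simp
  have q: "1/4 \<le> i" if "i \<in> J" for i using eig_ge[of i] J(2) that by auto
  have "(\<Sum>k\<in>J. exp (- (2 * k * T)) * Mb a b k) \<le> (\<Sum>k\<in>J. ?C * ?e * (2 / T) * (1 / k))"
  proof (rule sum_mono)
    fix k assume k: "k \<in> J"
    have k0: "0 < k" "0 \<le> k" using q[OF k] by auto
    have "0 \<le> (sqrt (k * T) - 178 / sqrt T)\<^sup>2" by simp
    also have "\<dots> = k * T - 2 * (178 * sqrt k) + 178\<^sup>2 / T"
      using k0 T by (simp add: power2_diff real_sqrt_mult power_divide power_mult_distrib)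
    finally have ag: "178 * sqrt k \<le> k * T / 2 + 15842 / T" by (simp add: power2_eq_square)
    have "k * T \<ge> \<Lambda> * T" using \<Lambda>[OF k] T by simp
    with ag have "- (2 * k * T) + 178 * freq k \<le> (178 * \<nu> - \<Lambda> * T + 15842 / T) + (- (k * T / 2))"
      using freq(3)[OF k0(2)] by (simp add: algebra_simps)
    then have "exp (- (2 * k * T) + 178 * freq k) \<le> exp ((178 * \<nu> - \<Lambda> * T + 15842 / T) + (- (k * T / 2)))"
      by simp
    also have "\<dots> = ?e * exp (- (k * T / 2))" by (rule exp_add)
    also have "\<dots> \<le> ?e * (2 / T * (1 / k))"
    proof (intro mult_left_mono)
      have z: "0 < k * T / 2" using k0 T by simp
      have "k * T / 2 \<le> exp (k * T / 2)" using exp_ge_add_one_self[of "k * T / 2"] by linarith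
      then have "inverse (exp (k * T / 2)) \<le> inverse (k * T / 2)" by (rule le_imp_inverse_le) (rule z)
      moreover have "inverse (k * T / 2) = 2 / T * (1 / k)" by simp
      ultimately show "exp (- (k * T / 2)) \<le> 2 / T * (1 / k)" by (simp only: exp_minus)
    qed simp
    finally have "?C * exp (- (2 * k * T) + 178 * freq k) \<le> ?C * (?e * (2 / T * (1 / k)))"
      by (rule mult_left_mono[OF _ C0])
    then show "exp (- (2 * k * T)) * Mb a b k \<le> ?C * ?e * (2 / T) * (1 / k)"
      unfolding Mb_def exp_add by (simp only: mult_ac)
  qed
  also have "\<dots> = ?C * ?e * (2 / T) * (\<Sum>k\<in>J. 1 / k)" by (simp only: sum_distrib_left)
  also have "\<dots> \<le> ?C * ?e * (2 / T) * (92 * \<nu>)"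
  proof (intro mult_left_mono)
    have "{l \<in> J. 1/4 \<le> l} = J" using q by auto
    then have "(\<Sum>k\<in>J. 1 / k) \<le> 7 * \<nu> / (1/4) + 32 / sqrt (1/4)"
      using sum_inverse_eig_le[OF J, of "1/4"] by simp
    also have "sqrt (1/4) = (1/2 :: real)" by (simp add: real_sqrt_divide)
    finally show "(\<Sum>k\<in>J. 1 / k) \<le> 92 * \<nu>" using nu by simp
  qed (use C0 T in auto)
  also have "\<dots> = ?C * ?e * (184 * \<nu> / T)" by simp
  finally show ?thesis .
qed

section \<open>Discarding finitely many modes and restoring them one at a time\<close>

definition obsv :: "real \<Rightarrow> real \<Rightarrow> real set \<Rightarrow> real \<Rightarrow> bool" where
  "obsv a b F T \<longleftrightarrow> (\<exists>C\<ge>0. \<forall>J c. finite J \<longrightarrow> J \<subseteq> E - F \<longrightarrow>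
     (\<Sum>k\<in>J. (c k * exp (- (k * T)))\<^sup>2) \<le> C * obs a b T J c)"

text \<open>Monotonicity of exp(-kh) settles all k > i + 1 at once; the remaining eigenvalues are
  finite in number.\<close>

lemma exp_gap:
  assumes i: "i \<in> E" and h: "0 < h"
  obtains \<delta> where "0 < \<delta>" "\<And>k. k \<in> E \<Longrightarrow> k \<noteq> i \<Longrightarrow> \<delta> \<le> \<bar>exp (- (k * h)) - exp (- (i * h))\<bar>"
proof -
  define A where "A = {k \<in> E. k \<le> i + 1} - {i}"
  have fin: "finite A" unfolding A_def using finite_eig by auto
  define g where "g k = \<bar>exp (- (k * h)) - exp (- (i * h))\<bar>" for k
  define \<delta> where "\<delta> = Min (insert (exp (- (i * h)) - exp (- ((i + 1) * h))) (g ` A))"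
  have "0 < \<delta>"
    unfolding \<delta>_def using fin h by (subst Min_gr_iff) (auto simp: g_def A_def)
  moreover have "\<delta> \<le> g k" if k: "k \<in> E" "k \<noteq> i" for k
  proof (cases "k \<le> i + 1")
    case True
    then show ?thesis unfolding \<delta>_def using fin k by (intro Min_le) (auto simp: A_def)
  next
    case False
    have "\<delta> \<le> exp (- (i * h)) - exp (- ((i + 1) * h))"
      unfolding \<delta>_def using fin by (intro Min_le) auto
    also have "\<dots> \<le> exp (- (i * h)) - exp (- (k * h))" using False h by simp
    also have "\<dots> \<le> g k" by (simp add: g_def)
    finally show ?thesis .
  qed
  ultimately show thesis using that unfolding g_def by blast
qed

text \<open>The combination \<open>u(t + h) - e\<^sup>-\<^sup>i\<^sup>h u(t)\<close> removes the mode \<open>i\<close> and scales the others away from zero.\<close>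

lemma obsv_remove_mode:
  assumes i: "i \<in> E" and h: "0 < h" and T1: "0 \<le> T1"
    and ab: "-1 \<le> a" "a < b" "b \<le> 1" "b - a \<le> 1"
    and O: "obsv a b (insert i F) T1"
  shows "obsv a b F (T1 + h)"
proof -
  have sub: "{a..b} \<subseteq> {-1..1}" using ab by auto
  obtain C where C: "C \<ge> 0" "\<And>J c. finite J \<Longrightarrow> J \<subseteq> E - insert i F \<Longrightarrow>
     (\<Sum>k\<in>J. (c k * exp (- (k * T1)))\<^sup>2) \<le> C * obs a b T1 J c"
    using O unfolding obsv_def by blast
  obtain \<delta> where \<delta>: "0 < \<delta>" "\<And>k. k \<in> E \<Longrightarrow> k \<noteq> i \<Longrightarrow> \<delta> \<le> \<bar>exp (- (k * h)) - exp (- (i * h))\<bar>"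
    using exp_gap[OF i h] by blast
  define A where "A = 4 * C / \<delta>\<^sup>2"
  have A0: "0 \<le> A" using C \<delta> by (simp add: A_def)
  define B where "B = BB a b i i"
  have B0: "0 < B"
  proof -
    have "0 < cutoff_mass a b / 8 * exp (- (10 * freq i))" using cutoff_mass_pos[OF ab(2)] by simp
    also have "\<dots> \<le> B" unfolding B_def by (rule BB_ge[OF i ab])
    finally show ?thesis .
  qed
  define C' where "C' = A + (2 + 2 * h * A) / (h * B)"
  have i0: "0 < i" using eig_ge[OF i] by simp
  have "(\<Sum>k\<in>J. (c k * exp (- (k * (T1 + h))))\<^sup>2) \<le> C' * obs a b (T1 + h) J c"
    if J: "finite J" "J \<subseteq> E - F" for J c
  proof -
    let ?O = "obs a b (T1 + h) J c" and ?J = "J - {i}"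
    have JE: "J \<subseteq> E" "?J \<subseteq> E" "finite ?J" using J by auto
    have pos: "0 < j" if "j \<in> J" for j using eig_ge[of j] JE that by auto
    define D where "D t = integral {a..b} (\<lambda>x. (uu J c t x)\<^sup>2)" for t
    have Dc: "continuous_on S D" for S unfolding D_def[abs_def] by (rule local_mass_cont[OF sub])
    have D0: "0 \<le> D t" for t unfolding D_def by (rule integral_uu_sq_nonneg[OF sub])
    have OD: "?O = integral {0..T1 + h} D" by (simp add: obs_def D_def[abs_def])
    have part: "integral {s..t} D \<le> ?O" if "0 \<le> s" "t \<le> T1 + h" for s t
      unfolding OD using that D0
      by (intro integral_subset_le integrable_continuous_real Dc) auto
    define e where "e k = c k * (exp (- (k * h)) - exp (- (i * h)))" for k
    have ue: "uu ?J e t x = uu J c (t + h) x + (- exp (- (i * h))) * uu J c t x" for t x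
    proof -
      have "uu ?J e t x = uu J e t x"
        unfolding uu_def by (rule sum.mono_neutral_left) (use J in \<open>auto simp: e_def\<close>)
      also have "\<dots> = (\<Sum>k\<in>J. c k * exp (- (k * (t + h))) * phi k x + (- exp (- (i * h))) * (c k * exp (- (k * t)) * phi k x))"
        unfolding uu_def e_def
      proof (intro sum.cong refl)
        fix k
        have ex: "exp (- (k * (t + h))) = exp (- (k * t)) * exp (- (k * h))"
          by (simp add: exp_add[symmetric] algebra_simps)
        show "c k * (exp (- (k * h)) - exp (- (i * h))) * exp (- (k * t)) * phi k x
           = c k * exp (- (k * (t + h))) * phi k x + (- exp (- (i * h))) * (c k * exp (- (k * t)) * phi k x)"
          unfolding ex by (simp add: algebra_simps)
      qed
      finally show ?thesis by (simp only: uu_def sum.distrib sum_distrib_left)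
    qed
    have "obs a b T1 ?J e \<le> integral {0..T1} (\<lambda>t. 2 * D (t + h) + 2 * D t)"
      unfolding obs_def
    proof (intro integral_cont_mono local_mass_cont sub continuous_intros Dc)
      fix t
      have "integral {a..b} (\<lambda>x. (uu ?J e t x)\<^sup>2)
          \<le> 2 * integral {a..b} (\<lambda>x. (uu J c (t + h) x)\<^sup>2) + 2 * integral {a..b} (\<lambda>x. ((- exp (- (i * h))) * uu J c t x)\<^sup>2)"
        unfolding ue by (intro integral_sq_add_le continuous_intros uu_cont sub)
      also have "integral {a..b} (\<lambda>x. ((- exp (- (i * h))) * uu J c t x)\<^sup>2) = (exp (- (i * h)))\<^sup>2 * D t"
        unfolding D_def power_mult_distrib by (simp only: integral_mult_right power2_minus)
      also have "\<dots> \<le> 1 * D t"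
        using i0 h D0[of t] by (intro mult_right_mono) (auto simp: abs_square_le_1)
      finally show "integral {a..b} (\<lambda>x. (uu ?J e t x)\<^sup>2) \<le> 2 * D (t + h) + 2 * D t"
        by (simp add: D_def)
    next
      show "continuous_on {0..T1} (\<lambda>t. D (t + h))"
        by (rule continuous_on_compose2[OF Dc[of UNIV]]) (auto intro!: continuous_intros)
    qed
    also have "\<dots> = 2 * integral {0..T1} (\<lambda>t. D (t + h)) + 2 * integral {0..T1} D"
      by (intro integral_lincomb Dc continuous_on_compose2[OF Dc[of UNIV]]) (auto intro!: continuous_intros)
    \<comment> \<open>The shifted observation runs over [h, T1 + h], so both pieces fit into the
      observation up to time T1 + h.\<close>
    also have "integral {0..T1} (\<lambda>t. D (t + h)) = integral {h..T1 + h} D"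
      using integral_shift_Icc_real[of 0 T1 D h] by (simp add: o_def add.commute)
    also have "2 * integral {h..T1 + h} D + 2 * integral {0..T1} D \<le> 4 * ?O"
      using part[of h "T1 + h"] part[of 0 T1] h T1 by simp
    finally have "C * obs a b T1 ?J e \<le> C * (4 * ?O)" using C(1) by (rule mult_left_mono)
    moreover have "(\<Sum>k\<in>?J. (e k * exp (- (k * T1)))\<^sup>2) \<le> C * obs a b T1 ?J e"
      using J by (intro C(2)) auto
    moreover have "\<delta>\<^sup>2 * (\<Sum>k\<in>?J. (c k * exp (- (k * T1)))\<^sup>2) \<le> (\<Sum>k\<in>?J. (e k * exp (- (k * T1)))\<^sup>2)"
      unfolding sum_distrib_left
    proof (rule sum_mono)
      fix k assume k: "k \<in> ?J"
      have "\<delta>\<^sup>2 \<le> (exp (- (k * h)) - exp (- (i * h)))\<^sup>2"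
        using \<delta>(1) \<delta>(2)[of k] k JE by (intro abs_le_square_iff[THEN iffD1]) auto
      then have "\<delta>\<^sup>2 * (c k * exp (- (k * T1)))\<^sup>2 \<le> (exp (- (k * h)) - exp (- (i * h)))\<^sup>2 * (c k * exp (- (k * T1)))\<^sup>2"
        by (rule mult_right_mono) simp
      then show "\<delta>\<^sup>2 * (c k * exp (- (k * T1)))\<^sup>2 \<le> (e k * exp (- (k * T1)))\<^sup>2"
        by (simp add: e_def power_mult_distrib mult_ac)
    qed
    ultimately have "\<delta>\<^sup>2 * (\<Sum>k\<in>?J. (c k * exp (- (k * T1)))\<^sup>2) \<le> C * (4 * ?O)" by linarith
    then have rest: "(\<Sum>k\<in>?J. (c k * exp (- (k * T1)))\<^sup>2) \<le> A * ?O"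
      using \<delta>(1) by (simp add: A_def field_simps)
    have later: "(\<Sum>k\<in>?J. (c k * exp (- (k * t)))\<^sup>2) \<le> A * ?O" if t: "T1 \<le> t" for t
    proof -
      have "(\<Sum>k\<in>?J. (c k * exp (- (k * t)))\<^sup>2) \<le> (\<Sum>k\<in>?J. (c k * exp (- (k * T1)))\<^sup>2)"
      proof (rule sum_mono)
        fix k assume "k \<in> ?J"
        then have "exp (- (k * t)) \<le> exp (- (k * T1))" using pos[of k] t by simp
        then have "(c k)\<^sup>2 * (exp (- (k * t)))\<^sup>2 \<le> (c k)\<^sup>2 * (exp (- (k * T1)))\<^sup>2"
          by (intro mult_left_mono power_mono) auto
        then show "(c k * exp (- (k * t)))\<^sup>2 \<le> (c k * exp (- (k * T1)))\<^sup>2" by (simp only: power_mult_distrib)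
      qed
      with rest show ?thesis by simp
    qed
    \<comment> \<open>On [T1, T1 + h] the other modes are already controlled. Subtracting them from
      u isolates mode i, whose local mass \<open>B\<close> is positive.\<close>
    have mode: "(c i * exp (- (i * (T1 + h))))\<^sup>2 \<le> (2 + 2 * h * A) / (h * B) * ?O" if iJ: "i \<in> J"
    proof -
      let ?m = "(c i * exp (- (i * (T1 + h))))\<^sup>2 * B"
      have "h * ?m = integral {T1..T1 + h} (\<lambda>t::real. ?m)" using h by simp
      also have "\<dots> \<le> integral {T1..T1 + h} (\<lambda>t. 2 * D t + (2 * (A * ?O)) * 1)"
      proof (intro integral_cont_mono continuous_intros Dc)
        fix t assume t: "t \<in> {T1..T1 + h}"
        have "exp (- (i * (T1 + h))) \<le> exp (- (i * t))" using i0 t by simp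
        then have "(c i)\<^sup>2 * (exp (- (i * (T1 + h))))\<^sup>2 \<le> (c i)\<^sup>2 * (exp (- (i * t)))\<^sup>2"
          by (intro mult_left_mono power_mono) auto
        then have "?m \<le> (c i * exp (- (i * t)))\<^sup>2 * B"
          using B0 by (intro mult_right_mono) (auto simp: power_mult_distrib)
        also have "\<dots> = integral {a..b} (\<lambda>x. (c i * exp (- (i * t)))\<^sup>2 * (phi i x * phi i x))"
          unfolding B_def BB_def by (simp only: integral_mult_right)
        also have "\<dots> = integral {a..b} (\<lambda>x. (uu J c t x + (- uu ?J c t x))\<^sup>2)"
        proof (intro integral_cong)
          fix x
          have "uu J c t x = c i * exp (- (i * t)) * phi i x + uu ?J c t x"
            unfolding uu_def by (rule sum.remove[OF J(1) iJ])
          then have "uu J c t x + (- uu ?J c t x) = c i * exp (- (i * t)) * phi i x" by simp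
          then show "(c i * exp (- (i * t)))\<^sup>2 * (phi i x * phi i x) = (uu J c t x + (- uu ?J c t x))\<^sup>2"
            by (simp only: power2_eq_square mult_ac)
        qed
        also have "\<dots> \<le> 2 * integral {a..b} (\<lambda>x. (uu J c t x)\<^sup>2) + 2 * integral {a..b} (\<lambda>x. (- uu ?J c t x)\<^sup>2)"
          by (intro integral_sq_add_le continuous_intros uu_cont sub)
        also have "integral {a..b} (\<lambda>x. (- uu ?J c t x)\<^sup>2) \<le> A * ?O"
          using local_integral_uu_sq_le[OF sub, of ?J c t] integral_uu_sq_full[OF JE(3,2), of c t] later[of t] t
          by simp
        finally show "?m \<le> 2 * D t + (2 * (A * ?O)) * 1" by (simp add: D_def)
      qed
      also have "\<dots> = 2 * integral {T1..T1 + h} D + (2 * (A * ?O)) * integral {T1..T1 + h} (\<lambda>t. 1)"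
        by (intro integral_lincomb Dc continuous_intros)
      also have "\<dots> \<le> 2 * ?O + (2 * (A * ?O)) * h"
        using part[of T1 "T1 + h"] T1 h by simp
      finally have "h * ?m \<le> 2 * ?O + (2 * (A * ?O)) * h" .
      then show ?thesis using h B0 by (simp add: field_simps)
    qed
    show ?thesis
    proof (cases "i \<in> J")
      case True
      have "(\<Sum>k\<in>J. (c k * exp (- (k * (T1 + h))))\<^sup>2)
         = (c i * exp (- (i * (T1 + h))))\<^sup>2 + (\<Sum>k\<in>?J. (c k * exp (- (k * (T1 + h))))\<^sup>2)"
        by (rule sum.remove[OF J(1) True])
      also have "\<dots> \<le> (2 + 2 * h * A) / (h * B) * ?O + A * ?O"
        using mode[OF True] later[of "T1 + h"] h by linarith
      finally show ?thesis by (simp add: C'_def algebra_simps)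
    next
      case False
      then have "?J = J" by auto
      then have "(\<Sum>k\<in>J. (c k * exp (- (k * (T1 + h))))\<^sup>2) \<le> A * ?O"
        using later[of "T1 + h"] h by simp
      also have "\<dots> \<le> C' * ?O"
        using A0 h B0 obs_nonneg[OF sub] unfolding C'_def by (intro mult_right_mono) auto
      finally show ?thesis .
    qed
  qed
  moreover have "0 \<le> C'" using A0 h B0 by (simp add: C'_def)
  ultimately show ?thesis unfolding obsv_def by blast
qed

text \<open>Each restored mode costs a positive but arbitrarily small time. The induction claims all
  T > T0 together, so that a step can spend half of the excess T - T0.\<close>

lemma obsv_remove_modes:
  assumes "finite F" "F \<subseteq> E" and T0: "0 \<le> T0"
    and ab: "-1 \<le> a" "a < b" "b \<le> 1" "b - a \<le> 1"
    and "\<And>T. T0 < T \<Longrightarrow> obsv a b F T"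
  shows "\<forall>T>T0. obsv a b {} T"
  using assms(1,2,8)
proof (induction F rule: finite_induct)
  case (insert i F)
  have "obsv a b F T" if T: "T0 < T" for T
  proof -
    have "obsv a b F ((T0 + T) / 2 + (T - T0) / 2)"
      using insert.prems T T0 ab by (intro obsv_remove_mode[of i]) auto
    moreover have "(T0 + T) / 2 + (T - T0) / 2 = T" by (simp add: field_simps)
    ultimately show ?thesis by simp
  qed
  then show ?case using insert by auto
qed simp

text \<open>The constant obtained here is not controlled in \<open>\<nu>\<close>. The lemma serves
  the finitely many n for which dissipation does not yet beat the cost.\<close>

lemma obsv_any_time:
  assumes T: "0 < T" and ab: "-1 \<le> a" "a < b" "b \<le> 1" "b - a \<le> 1"
  shows "obsv a b {} T"
proof -
  define T0 where "T0 = T / 2"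
  have T0: "0 < T0" "T0 < T" using T by (auto simp: T0_def)
  define Z where "Z = 1024 / (\<kappa>0\<^sup>2 * cutoff_mass a b) * exp (178 * \<nu> + 15842 / T0) * (184 * \<nu> / T0)"
  have Z0: "0 < Z" unfolding Z_def using cutoff_mass_pos[OF ab(2)] cutoff_mass_pos[of 0 1] T0 nu by simp
  \<comment> \<open>The cut makes \<Lambda> T0 = 4Z, and Z exp(-4Z) <= 1/4.\<close>
  define \<Lambda> where "\<Lambda> = 4 * Z / T0"
  have L0: "0 \<le> \<Lambda>" using Z0 T0 by (simp add: \<Lambda>_def)
  have Zs: "Z * exp (- (\<Lambda> * T0)) \<le> 1/4"
  proof -
    have "\<Lambda> * T0 = 4 * Z" using T0 by (simp add: \<Lambda>_def)
    moreover have "4 * Z \<le> exp (4 * Z)" using exp_ge_add_one_self[of "4 * Z"] by linarith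
    ultimately show ?thesis by (simp add: exp_minus field_simps)
  qed
  let ?F = "{l \<in> E. l \<le> \<Lambda>}"
  have "\<forall>T>T0. obsv a b {} T"
  proof (rule obsv_remove_modes[where F = ?F])
    fix T assume T: "T0 < T"
    have "(\<Sum>k\<in>J. (c k * exp (- (k * T)))\<^sup>2) \<le> 1 * obs a b T J c" if J: "finite J" "J \<subseteq> E - ?F" for J c
    proof -
      have "(\<Sum>k\<in>J. exp (- (2 * k * T)) * Mb a b k)
          \<le> 1024 / (\<kappa>0\<^sup>2 * cutoff_mass a b) * exp (178 * \<nu> - \<Lambda> * T + 15842 / T) * (184 * \<nu> / T)"
        using J T T0 ab by (intro mode_sum_le) auto
      also have "\<dots> \<le> 1024 / (\<kappa>0\<^sup>2 * cutoff_mass a b) * exp (178 * \<nu> - \<Lambda> * T0 + 15842 / T0) * (184 * \<nu> / T0)"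
      proof (intro mult_mono)
        have "\<Lambda> * T0 \<le> \<Lambda> * T" using L0 T by (intro mult_left_mono) auto
        moreover have "15842 / T \<le> 15842 / T0" using T T0 by (intro divide_left_mono) auto
        ultimately show "exp (178 * \<nu> - \<Lambda> * T + 15842 / T) \<le> exp (178 * \<nu> - \<Lambda> * T0 + 15842 / T0)" by simp
        show "184 * \<nu> / T \<le> 184 * \<nu> / T0" using T T0 nu by (intro divide_left_mono) auto
      qed (use cutoff_mass_pos[OF ab(2)] T T0 nu in auto)
      also have "\<dots> = Z * exp (- (\<Lambda> * T0))"
      proof -
        have "exp (178 * \<nu> - \<Lambda> * T0 + 15842 / T0) = exp (178 * \<nu> + 15842 / T0) * exp (- (\<Lambda> * T0))"
          by (simp add: exp_add[symmetric])
        then show ?thesis unfolding Z_def by (simp only: mult_ac)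
      qed
      also have "\<dots> \<le> 1/4" by (rule Zs)
      finally have "(\<Sum>k\<in>J. exp (- (2 * k * T)) * Mb a b k) \<le> 1/4" .
      then show ?thesis using J T T0 ab by (simp only: mult_1) (intro high_modes; auto)
    qed
    then show "obsv a b ?F T" unfolding obsv_def by (intro exI[of _ 1]) auto
  qed (use finite_eig T0 ab in auto)
  then show ?thesis using T0 by blast
qed

section \<open>The spectral gap above a finite set of modes\<close>


text \<open>Young's inequality with a free t stands in for Cauchy-Schwarz; optimising over t would
  give the Hoelder exponent 1/2. It supplies the equicontinuity for Arzela-Ascoli.\<close>

lemma DA_modulus:
  assumes u: "DA u u' h" and h: "integral {-1..1} (\<lambda>x. (h x)\<^sup>2) \<le> 1"
    and xz: "x \<in> {-1..1}" "z \<in> {-1..1}" and t: "0 < t"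
  shows "\<bar>u x - u z\<bar> \<le> 9 * t / 2 + \<bar>x - z\<bar> / (2 * t)"
proof -
  have main: "\<bar>u z - u x\<bar> \<le> 9 * t / 2 + (z - x) / (2 * t)" if xz: "-1 \<le> x" "x \<le> z" "z \<le> 1" for x z
  proof -
    have sub: "{x..z} \<subseteq> {-1..1}" using xz by auto
    have c: "continuous_on {x..z} u'" by (rule continuous_on_subset[OF DA_D(7)[OF u] sub])
    have "(u' has_integral (u z - u x)) {x..z}"
      using xz by (intro ftc has_field_derivative_subset[OF DA_D(1)[OF u] sub]) auto
    then have "\<bar>u z - u x\<bar> = \<bar>integral {x..z} u'\<bar>" by (simp add: integral_unique)
    also have "\<dots> \<le> integral {x..z} (\<lambda>s. (t/2) * (u' s)\<^sup>2 + (1/(2*t)) * 1)"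
      unfolding real_norm_def[symmetric]
    proof (rule integral_norm_bound_integral)
      fix s
      have "0 \<le> (t * \<bar>u' s\<bar> - 1)\<^sup>2 / (2 * t)" using t by simp
      also have "\<dots> = (t/2) * (u' s)\<^sup>2 + (1/(2*t)) * 1 - \<bar>u' s\<bar>"
        using t by (simp add: power2_diff power_mult_distrib field_simps) (simp add: power2_eq_square)
      finally show "norm (u' s) \<le> (t/2) * (u' s)\<^sup>2 + (1/(2*t)) * 1" by simp
    qed (auto intro!: integrable_continuous_real continuous_intros c)
    also have "\<dots> = (t/2) * integral {x..z} (\<lambda>s. (u' s)\<^sup>2) + (1/(2*t)) * integral {x..z} (\<lambda>s. 1)"
      by (intro integral_lincomb continuous_intros c)
    also have "\<dots> \<le> (t/2) * 9 + (1/(2*t)) * (z - x)"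
    proof (intro add_mono mult_left_mono)
      have "integral {x..z} (\<lambda>s. (u' s)\<^sup>2) \<le> integral {-1..1} (\<lambda>s. (u' s)\<^sup>2)"
        by (intro integral_subset_le sub integrable_continuous_real continuous_intros c DA_D(7)[OF u]) auto
      also have "\<dots> \<le> 9" using DA_bounds(2)[OF u] h by simp
      finally show "integral {x..z} (\<lambda>s. (u' s)\<^sup>2) \<le> 9" .
    qed (use t xz in auto)
    finally show ?thesis by (simp add: mult.commute)
  qed
  show ?thesis
  proof (cases "x \<le> z")
    case True
    then show ?thesis using main[of x z] xz by (simp add: abs_minus_commute)
  next
    case False
    then show ?thesis using main[of z x] xz by simp
  qed
qed

definition orth :: "real set \<Rightarrow> (real \<Rightarrow> real) \<Rightarrow> bool" where
  "orth J h \<longleftrightarrow> (\<forall>k\<in>J. integral {-1..1} (\<lambda>x. h x * y k x) = 0)"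

lemma orth_DA:
  assumes "DA u u' h" "orth J h" "J \<subseteq> E"
  shows "orth J u"
  unfolding orth_def
proof
  fix k assume k: "k \<in> J"
  then have kE: "k \<in> E" using assms by auto
  have "0 = integral {-1..1} (\<lambda>x. k * (u x * y k x))"
    using DA_sym[OF assms(1) DA_eig[OF kE]] assms(2) k by (simp add: orth_def mult_ac)
  then have "k * integral {-1..1} (\<lambda>x. u x * y k x) = 0" by (simp only: integral_mult_right)
  then show "integral {-1..1} (\<lambda>x. u x * y k x) = 0" using eig_ge[OF kE] by simp
qed

lemma integral_sq_cont_zero:
  fixes f :: "real \<Rightarrow> real"
  assumes "continuous_on {-1..1} f" "integral {-1..1} (\<lambda>x. (f x)\<^sup>2) \<le> 0" "x \<in> {-1..1}"
  shows "f x = 0"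
proof -
  have "0 \<le> integral {-1..1} (\<lambda>x. (f x)\<^sup>2)"
    by (intro integral_nonneg integrable_continuous_real continuous_intros assms) auto
  then have "integral {-1..1} (\<lambda>x. (f x)\<^sup>2) = 0" using assms(2) by simp
  then have "\<forall>x\<in>{-1..1}. (f x)\<^sup>2 = 0"
    by (subst (asm) integral_eq_0_iff) (auto intro!: continuous_intros assms)
  with assms(3) show ?thesis by auto
qed

lemma integral_sq_cmult:
  fixes f :: "real \<Rightarrow> real"
  shows "integral S (\<lambda>x. (c * f x)\<^sup>2) = c\<^sup>2 * integral S (\<lambda>x. (f x)\<^sup>2)"
  unfolding power_mult_distrib by (rule integral_mult_right)

text \<open>The supremum of this set is the squared norm of the inverse of A on continuous functions
  orthogonal to the modes in \<open>J\<close>.\<close>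

definition gap_values :: "real set \<Rightarrow> real set" where
  "gap_values J = {integral {-1..1} (\<lambda>x. (u x)\<^sup>2) | u. \<exists>u' h. DA u u' h \<and> orth J h \<and> integral {-1..1} (\<lambda>x. (h x)\<^sup>2) \<le> 1}"

lemma gap_values_bdd: "bdd_above (gap_values J)"
  unfolding gap_values_def by (rule bdd_aboveI[where M = 16]) (use DA_bounds(1) in force)

lemma gap_sup_scaled:
  assumes u: "DA u u' h" and o: "orth J h"
  shows "integral {-1..1} (\<lambda>x. (u x)\<^sup>2) \<le> Sup (gap_values J) * integral {-1..1} (\<lambda>x. (h x)\<^sup>2)"
proof (cases "integral {-1..1} (\<lambda>x. (h x)\<^sup>2) = 0")
  case True
  then show ?thesis using DA_bounds(1)[OF u] by simp
next
  case False
  let ?H = "integral {-1..1} (\<lambda>x. (h x)\<^sup>2)"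
  have "0 \<le> ?H" by (intro integral_nonneg integrable_continuous_real continuous_intros DA_D(5)[OF u]) auto
  with False have H: "0 < ?H" by simp
  define c where "c = 1 / sqrt ?H"
  have c2: "c\<^sup>2 * ?H = 1" using H by (simp add: c_def power_divide)
  have "DA (\<lambda>x. c * u x + 0 * u x) (\<lambda>x. c * u' x + 0 * u' x) (\<lambda>x. c * h x + 0 * h x)"
    by (rule DA_lincomb[OF u u])
  then have "DA (\<lambda>x. c * u x) (\<lambda>x. c * u' x) (\<lambda>x. c * h x)" by simp
  moreover have "orth J (\<lambda>x. c * h x)"
    using o unfolding orth_def by (simp add: mult.assoc)
  ultimately have "integral {-1..1} (\<lambda>x. (c * u x)\<^sup>2) \<in> gap_values J"
    unfolding gap_values_def using c2
    by (intro CollectI exI[of _ "\<lambda>x. c * u x"] conjI refl exI[of _ "\<lambda>x. c * u' x"] exI[of _ "\<lambda>x. c * h x"])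
       (auto simp: integral_sq_cmult)
  then have "c\<^sup>2 * integral {-1..1} (\<lambda>x. (u x)\<^sup>2) \<le> Sup (gap_values J)"
    using cSup_upper[OF _ gap_values_bdd] by (simp add: integral_sq_cmult)
  then have "c\<^sup>2 * integral {-1..1} (\<lambda>x. (u x)\<^sup>2) * ?H \<le> Sup (gap_values J) * ?H"
    using H by (intro mult_right_mono) auto
  moreover have "c\<^sup>2 * integral {-1..1} (\<lambda>x. (u x)\<^sup>2) * ?H = (c\<^sup>2 * ?H) * integral {-1..1} (\<lambda>x. (u x)\<^sup>2)"
    by (simp only: mult_ac)
  ultimately show ?thesis using c2 by simp
qed

lemma gap_sup_nonneg: "0 \<le> Sup (gap_values J)"
proof (rule cSup_upper[OF _ gap_values_bdd])
  have "DA (\<lambda>x. 0) (\<lambda>x. 0) (\<lambda>x. 0)" unfolding DA_def by auto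
  then show "0 \<in> gap_values J"
    unfolding gap_values_def by (intro CollectI exI[of _ "\<lambda>x. 0"] conjI exI) (auto simp: orth_def)
qed

text \<open>A maximising sequence for the inverse operator on the orthogonal complement converges, by
  Arzela-Ascoli, to an eigenvector of its square.\<close>

lemma gap_extremal:
  assumes J: "J \<subseteq> E" and m: "m = Sup (gap_values J)" "0 < m"
  obtains g z z' q q' where "DA z z' g" "DA q q' z" "orth J g" "0 < integral {-1..1} (\<lambda>x. (g x)\<^sup>2)"
    "\<And>x. x \<in> {-1..1} \<Longrightarrow> q x = m * g x"
proof -
  let ?I = "\<lambda>f. integral {-1..1} (\<lambda>x. (f x)\<^sup>2)"
  have ne: "gap_values J \<noteq> {}"
  proof
    assume "gap_values J = {}"
    moreover have "DA (\<lambda>x. 0) (\<lambda>x. 0) (\<lambda>x. 0)" unfolding DA_def by auto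
    ultimately show False
      unfolding gap_values_def by (auto simp: orth_def dest!: spec[of _ "\<lambda>x. 0"])
  qed
  have "\<exists>u u' h. DA u u' h \<and> orth J h \<and> ?I h \<le> 1 \<and> m - 1 / real (Suc n) < ?I u" for n
  proof -
    have "m - 1 / real (Suc n) < Sup (gap_values J)" using m by simp
    then obtain v where "v \<in> gap_values J" "m - 1 / real (Suc n) < v"
      using less_cSup_iff[OF ne gap_values_bdd] by blast
    then show ?thesis unfolding gap_values_def by blast
  qed
  then obtain U U' H where UH: "\<And>n. DA (U n) (U' n) (H n)" "\<And>n. orth J (H n)" "\<And>n. ?I (H n) \<le> 1"
    "\<And>n. m - 1 / real (Suc n) < ?I (U n)"
    by metis
  have Uc: "continuous_on {-1..1} (U n)" and Hc: "continuous_on {-1..1} (H n)" for n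
    using DA_D(5,6)[OF UH(1)] by auto
  have Uo: "orth J (U n)" for n by (rule orth_DA[OF UH(1,2) J])
  obtain g r where g: "continuous_on {-1..1} g" "strict_mono (r :: nat \<Rightarrow> nat)"
    "\<And>e. 0 < e \<Longrightarrow> \<exists>N. \<forall>n x. n \<ge> N \<and> x \<in> {-1..1} \<longrightarrow> norm (U (r n) x - g x) < e"
  proof (rule Arzela_Ascoli[of "{-1..1::real}" U 6])
    \<comment> \<open>With t = 1 the modulus measured from the endpoint -1 is at most 9/2 +
      1.\<close>
    show "norm (U n x) \<le> 6" if "x \<in> {-1..1}" for n x
    proof -
      have "\<bar>U n x - U n (-1)\<bar> \<le> 9 * 1 / 2 + \<bar>x - (-1)\<bar> / (2 * 1)"
        by (rule DA_modulus[OF UH(1,3) that]) auto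
      moreover have "\<bar>x - (-1)\<bar> \<le> 2" using that by auto
      moreover have "U n (-1) = 0" by (rule DA_D(3)[OF UH(1)])
      ultimately show ?thesis by simp
    qed
    show "\<exists>d. 0 < d \<and> (\<forall>n y. y \<in> {-1..1} \<and> norm (x - y) < d \<longrightarrow> norm (U n x - U n y) < e)"
      if x: "x \<in> {-1..1}" and e: "0 < e" for x e :: real
    proof (intro exI[of _ "e\<^sup>2 / 9"] conjI allI impI)
      show "0 < e\<^sup>2 / 9" using e by simp
      fix n and y :: real assume y: "y \<in> {-1..1} \<and> norm (x - y) < e\<^sup>2 / 9"
      \<comment> \<open>The choice t = e/9 makes the first term e/2, and the radius e^2/9 keeps the
        second below e/2.\<close>
      have "\<bar>U n x - U n y\<bar> \<le> 9 * (e / 9) / 2 + \<bar>x - y\<bar> / (2 * (e / 9))"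
        using y e by (intro DA_modulus[OF UH(1,3) x]) auto
      also have "\<dots> < e / 2 + (e\<^sup>2 / 9) / (2 * (e / 9))"
        using y e by (intro add_le_less_mono divide_strict_right_mono) auto
      also have "\<dots> = e" using e by (simp add: power2_eq_square field_simps)
      finally show "norm (U n x - U n y) < e" by simp
    qed
  qed auto
  define \<epsilon> where "\<epsilon> n = ?I (\<lambda>x. U (r n) x - g x)" for n
  have \<epsilon>0: "0 \<le> \<epsilon> n" for n
    unfolding \<epsilon>_def by (intro integral_nonneg integrable_continuous_real continuous_intros Uc g) auto
  have \<epsilon>lim: "\<epsilon> \<longlonglongrightarrow> 0"
  proof (rule LIMSEQ_I)
    fix e :: real assume e: "0 < e"
    define d where "d = sqrt (e / 4)"
    have d: "0 < d" "d\<^sup>2 = e / 4" using e by (auto simp: d_def)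
    obtain N where N: "\<And>n x. n \<ge> N \<Longrightarrow> x \<in> {-1..1} \<Longrightarrow> norm (U (r n) x - g x) < d"
      using g(3)[OF d(1)] by blast
    have "norm (\<epsilon> n - 0) < e" if n: "n \<ge> N" for n
    proof -
      have "\<epsilon> n \<le> integral {-1..1} (\<lambda>x::real. d\<^sup>2)"
        unfolding \<epsilon>_def
      proof (intro integral_cont_mono continuous_intros Uc g)
        fix x :: real assume "x \<in> {-1..1}"
        then have "\<bar>U (r n) x - g x\<bar> \<le> \<bar>d\<bar>" using N[OF n, of x] d by simp
        then show "(U (r n) x - g x)\<^sup>2 \<le> d\<^sup>2" by (simp only: abs_le_square_iff)
      qed
      then show ?thesis using \<epsilon>0[of n] e d(2) by simp
    qed
    then show "\<exists>no. \<forall>n\<ge>no. norm (\<epsilon> n - 0) < e" by blast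
  qed
  obtain z z' where z: "DA z z' g" using DA_exists[OF g(1)] by blast
  obtain q q' where q: "DA q q' z" using DA_exists[OF DA_D(6)[OF z]] by blast
  have inv: "1 / real (Suc (r n)) \<le> 1 / real (Suc n)" for n
    using seq_suble[OF g(2), of n] by (intro divide_left_mono) auto
  have Ulow: "m - inverse (real (Suc n)) < ?I (U (r n))" for n
    using UH(4)[of "r n"] inv[of n] unfolding inverse_eq_divide by linarith
  have "orth J g"
    unfolding orth_def
  proof
    fix k assume k: "k \<in> J"
    \<comment> \<open>Young's inequality with a free parameter: for fixed e the limit in n is taken
      first, and then e tends to 0.\<close>
    have est: "\<bar>integral {-1..1} (\<lambda>x. g x * y k x)\<bar> \<le> e / 2 * (nrm k) + \<epsilon> n / (2 * e)" if e: "0 < e" for e :: real and n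
    proof -
      have "integral {-1..1} (\<lambda>x. 1 * (g x * y k x) + (-1) * (U (r n) x * y k x))
          = 1 * integral {-1..1} (\<lambda>x. g x * y k x) + (-1) * integral {-1..1} (\<lambda>x. U (r n) x * y k x)"
        by (intro integral_lincomb continuous_intros g Uc y_cont)
      then have "\<bar>integral {-1..1} (\<lambda>x. g x * y k x)\<bar> = \<bar>integral {-1..1} (\<lambda>x. 1 * (g x * y k x) + (-1) * (U (r n) x * y k x))\<bar>"
        using Uo[of "r n"] k by (simp add: orth_def)
      also have "\<dots> \<le> integral {-1..1} (\<lambda>x. (e/2) * (y k x)\<^sup>2 + (1/(2*e)) * (U (r n) x - g x)\<^sup>2)"
        unfolding real_norm_def[symmetric]
      proof (rule integral_norm_bound_integral)
        fix x
        have "0 \<le> (e * \<bar>y k x\<bar> - \<bar>U (r n) x - g x\<bar>)\<^sup>2 / (2 * e)" using e by simp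
        also have "\<dots> = (e/2) * (y k x)\<^sup>2 + (1/(2*e)) * (U (r n) x - g x)\<^sup>2 - \<bar>U (r n) x - g x\<bar> * \<bar>y k x\<bar>"
        proof -
          have "(e * s - t)\<^sup>2 / (2 * e) = (e/2) * s\<^sup>2 + (1/(2*e)) * t\<^sup>2 - t * s" for s t :: real
            using e by (simp add: power2_eq_square field_simps)
          from this[of "\<bar>y k x\<bar>" "\<bar>U (r n) x - g x\<bar>"] show ?thesis by simp
        qed
        finally have "\<bar>U (r n) x - g x\<bar> * \<bar>y k x\<bar> \<le> (e/2) * (y k x)\<^sup>2 + (1/(2*e)) * (U (r n) x - g x)\<^sup>2" by simp
        moreover have "1 * (g x * y k x) + (-1) * (U (r n) x * y k x) = - ((U (r n) x - g x) * y k x)"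
          by (simp add: algebra_simps)
        ultimately show "norm (1 * (g x * y k x) + (-1) * (U (r n) x * y k x)) \<le> (e/2) * (y k x)\<^sup>2 + (1/(2*e)) * (U (r n) x - g x)\<^sup>2"
          by (simp only: norm_minus_cancel real_norm_def abs_mult abs_minus_cancel)
      qed (use e in \<open>auto intro!: integrable_continuous_real continuous_intros g Uc y_cont\<close>)
      also have "\<dots> = (e/2) * integral {-1..1} (\<lambda>x. (y k x)\<^sup>2) + (1/(2*e)) * \<epsilon> n"
        unfolding \<epsilon>_def by (intro integral_lincomb continuous_intros g Uc y_cont)
      finally show ?thesis by (simp add: nrm_def)
    qed
    have small: "\<bar>integral {-1..1} (\<lambda>x. g x * y k x)\<bar> \<le> e / 2 * (nrm k)" if e: "0 < e" for e
    proof (rule LIMSEQ_le_const)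
      show "(\<lambda>n. e / 2 * nrm k + \<epsilon> n / (2 * e)) \<longlonglongrightarrow> e / 2 * nrm k"
        using tendsto_add[OF tendsto_const tendsto_divide[OF \<epsilon>lim tendsto_const[of "2 * e"]], of "e / 2 * nrm k"] e by simp
    qed (use est[OF e] in blast)
    have "\<bar>integral {-1..1} (\<lambda>x. g x * y k x)\<bar> \<le> 0 + d" if d: "0 < d" for d
    proof -
      have "\<bar>integral {-1..1} (\<lambda>x. g x * y k x)\<bar> \<le> (2 * d / nrm k) / 2 * nrm k"
        by (rule small) (use d nrm_pos[of k] in simp)
      also have "\<dots> = 0 + d" using nrm_pos[of k] by simp
      finally show ?thesis .
    qed
    then have "\<bar>integral {-1..1} (\<lambda>x. g x * y k x)\<bar> \<le> 0" by (rule field_le_epsilon)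
    then show "integral {-1..1} (\<lambda>x. g x * y k x) = 0" by simp
  qed
  moreover have "0 < ?I g"
  proof -
    have "m \<le> 2 * ?I g"
    proof (rule LIMSEQ_le_const)
      have "(\<lambda>n. 2 * \<epsilon> n + 2 * ?I g + inverse (real (Suc n))) \<longlonglongrightarrow> 2 * 0 + 2 * ?I g + 0"
        by (intro tendsto_intros \<epsilon>lim LIMSEQ_inverse_real_of_nat)
      then show "(\<lambda>n. 2 * \<epsilon> n + 2 * ?I g + inverse (real (Suc n))) \<longlonglongrightarrow> 2 * ?I g" by simp
      have "m \<le> 2 * \<epsilon> n + 2 * ?I g + inverse (real (Suc n))" for n
      proof -
        have "?I (\<lambda>x. (U (r n) x - g x) + g x) \<le> 2 * ?I (\<lambda>x. U (r n) x - g x) + 2 * ?I g"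
          by (intro integral_sq_add_le continuous_intros Uc g)
        then have "?I (U (r n)) \<le> 2 * \<epsilon> n + 2 * ?I g" by (simp add: \<epsilon>_def)
        then show ?thesis using Ulow[of n] by linarith
      qed
      then show "\<exists>N. \<forall>n\<ge>N. m \<le> 2 * \<epsilon> n + 2 * ?I g + inverse (real (Suc n))" by blast
    qed
    then show ?thesis using m by simp
  qed
  moreover have "q x = m * g x" if x: "x \<in> {-1..1}" for x
  proof -
    have qc: "continuous_on {-1..1} q" by (rule DA_D(6)[OF q])
    have bnd: "?I (\<lambda>x. q x - m * g x) \<le> 1024 * \<epsilon> n + 64 * (m * inverse (real (Suc n))) + 2 * m\<^sup>2 * \<epsilon> n" for n
    proof -
      let ?U = "U (r n)" and ?H = "H (r n)"
      obtain W W' where W: "DA W W' ?U" using DA_exists[OF Uc] by blast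
      obtain X X' where X: "DA X X' W" using DA_exists[OF DA_D(6)[OF W]] by blast
      have Wc: "continuous_on {-1..1} W" and Xc: "continuous_on {-1..1} X" using DA_D(6)[OF W] DA_D(6)[OF X] by auto
      have zW: "DA (\<lambda>x. 1 * z x + (-1) * W x) (\<lambda>x. 1 * z' x + (-1) * W' x) (\<lambda>x. 1 * g x + (-1) * ?U x)"
        by (rule DA_lincomb[OF z W])
      have qX: "DA (\<lambda>x. 1 * q x + (-1) * X x) (\<lambda>x. 1 * q' x + (-1) * X' x) (\<lambda>x. 1 * z x + (-1) * W x)"
        by (rule DA_lincomb[OF q X])
      have XU: "DA (\<lambda>x. 1 * X x + (- m) * ?U x) (\<lambda>x. 1 * X' x + (- m) * U' (r n) x) (\<lambda>x. 1 * W x + (- m) * ?H x)"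
        by (rule DA_lincomb[OF X UH(1)])
      have sw: "?I (\<lambda>x. 1 * g x + (-1) * ?U x) = \<epsilon> n"
        unfolding \<epsilon>_def by (intro integral_cong) (simp add: power2_eq_square algebra_simps)
      have i1: "?I (\<lambda>x. 1 * q x + (-1) * X x) \<le> 256 * \<epsilon> n"
        using DA_bounds(1)[OF qX] DA_bounds(1)[OF zW] unfolding sw by linarith
      \<comment> \<open>Here A U = H and A W = U, so symmetry gives <H,W> = |U|^2 and |W - mH|^2 =
        |W|^2 - 2m|U|^2 + m^2|H|^2 <= m(m - |U|^2). This is small because U nearly maximises.
        Applying the inverse once more, X is close to m U.\<close>
      have "?I (\<lambda>x. 1 * W x + (- m) * ?H x) = integral {-1..1} (\<lambda>x. 1 * (1 * (W x)\<^sup>2 + (- 2 * m) * (?H x * W x)) + m\<^sup>2 * (?H x)\<^sup>2)"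
        by (intro integral_cong) (simp add: power2_eq_square algebra_simps)
      also have "\<dots> = 1 * integral {-1..1} (\<lambda>x. 1 * (W x)\<^sup>2 + (- 2 * m) * (?H x * W x)) + m\<^sup>2 * ?I ?H"
        by (intro integral_lincomb continuous_intros Wc Hc)
      also have "integral {-1..1} (\<lambda>x. 1 * (W x)\<^sup>2 + (- 2 * m) * (?H x * W x)) = 1 * ?I W + (- 2 * m) * integral {-1..1} (\<lambda>x. ?H x * W x)"
        by (intro integral_lincomb continuous_intros Wc Hc)
      also have "integral {-1..1} (\<lambda>x. ?H x * W x) = ?I ?U"
        using DA_sym[OF UH(1) W] by (simp add: power2_eq_square)
      finally have eq: "?I (\<lambda>x. 1 * W x + (- m) * ?H x) = ?I W - 2 * m * ?I ?U + m\<^sup>2 * ?I ?H" by simp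
      have "?I W \<le> m * ?I ?U" unfolding m(1) by (rule gap_sup_scaled[OF W Uo])
      moreover have "m\<^sup>2 * ?I ?H \<le> m\<^sup>2 * 1" using UH(3) by (intro mult_left_mono) auto
      ultimately have "?I (\<lambda>x. 1 * W x + (- m) * ?H x) \<le> m * (m - ?I ?U)"
        unfolding eq by (simp add: algebra_simps power2_eq_square)
      also have "\<dots> \<le> m * inverse (real (Suc n))"
      proof (rule mult_left_mono)
        show "m - ?I ?U \<le> inverse (real (Suc n))" using Ulow[of n] by linarith
      qed (use m(2) in simp)
      finally have i2: "?I (\<lambda>x. 1 * X x + (- m) * ?U x) \<le> 16 * (m * inverse (real (Suc n)))"
        using DA_bounds(1)[OF XU] by linarith
      have i3: "?I (\<lambda>x. m * (?U x - g x)) = m\<^sup>2 * \<epsilon> n" unfolding \<epsilon>_def by (rule integral_sq_cmult)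
      have "?I (\<lambda>x. q x - m * g x) = ?I (\<lambda>x. ((1 * q x + (-1) * X x) + (1 * X x + (- m) * ?U x)) + m * (?U x - g x))"
        by (intro integral_cong) (simp add: algebra_simps)
      also have "\<dots> \<le> 2 * ?I (\<lambda>x. (1 * q x + (-1) * X x) + (1 * X x + (- m) * ?U x)) + 2 * ?I (\<lambda>x. m * (?U x - g x))"
        by (intro integral_sq_add_le continuous_intros qc Xc Uc g)
      finally have s1: "?I (\<lambda>x. q x - m * g x) \<le> 2 * ?I (\<lambda>x. (1 * q x + (-1) * X x) + (1 * X x + (- m) * ?U x)) + 2 * ?I (\<lambda>x. m * (?U x - g x))" .
      have s2: "?I (\<lambda>x. (1 * q x + (-1) * X x) + (1 * X x + (- m) * ?U x)) \<le> 2 * ?I (\<lambda>x. 1 * q x + (-1) * X x) + 2 * ?I (\<lambda>x. 1 * X x + (- m) * ?U x)"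
        by (intro integral_sq_add_le continuous_intros qc Xc Uc g)
      have arith: "A \<le> 1024 * e + 64 * w + 2 * m\<^sup>2 * e"
        if "A \<le> 2 * B + 2 * C" "B \<le> 2 * D + 2 * F" "D \<le> 256 * e" "F \<le> 16 * w" "C = m\<^sup>2 * e" for A B C D F e w :: real
        using that by (simp add: mult.assoc)
      show ?thesis by (rule arith[OF s1 s2 i1 i2 i3])
    qed
    have "?I (\<lambda>x. q x - m * g x) \<le> 0"
    proof (rule LIMSEQ_le_const)
      have "(\<lambda>n. 1024 * \<epsilon> n + 64 * (m * inverse (real (Suc n))) + 2 * m\<^sup>2 * \<epsilon> n) \<longlonglongrightarrow> 1024 * 0 + 64 * (m * 0) + 2 * m\<^sup>2 * 0"
        by (intro tendsto_intros \<epsilon>lim LIMSEQ_inverse_real_of_nat)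
      then show "(\<lambda>n. 1024 * \<epsilon> n + 64 * (m * inverse (real (Suc n))) + 2 * m\<^sup>2 * \<epsilon> n) \<longlonglongrightarrow> 0" by simp
    qed (use bnd in blast)
    then have "q x - m * g x = 0"
      by (intro integral_sq_cont_zero[OF _ _ x] continuous_intros qc g)
    then show ?thesis by simp
  qed
  ultimately show thesis using that z q by blast
qed

text \<open>If the gap failed, the extremal g would satisfy A^(-2) g = \<mu>^2 g with 1/\<mu> <
  \<Lambda>. Factoring, t = \<mu> A^(-1) g + A^(-2) g satisfies A t = t/\<mu>. It is then an
  eigenfunction among the modes to which g, and hence t, is orthogonal.\<close>

lemma spectral_gap:
  assumes L: "0 < \<Lambda>" and J: "J = {l \<in> E. l \<le> \<Lambda>}" and u: "DA u u' h" and o: "orth J h"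
  shows "\<Lambda>\<^sup>2 * integral {-1..1} (\<lambda>x. (u x)\<^sup>2) \<le> integral {-1..1} (\<lambda>x. (h x)\<^sup>2)"
proof (rule ccontr)
  let ?I = "\<lambda>f. integral {-1..1} (\<lambda>x. (f x)\<^sup>2)"
  assume neg: "\<not> ?thesis"
  have JE: "J \<subseteq> E" using J by auto
  define m where "m = Sup (gap_values J)"
  have m0: "0 \<le> m" unfolding m_def by (rule gap_sup_nonneg)
  have H0: "0 \<le> ?I h" by (intro integral_nonneg integrable_continuous_real continuous_intros DA_D(5)[OF u]) auto
  have "?I u \<le> m * ?I h" unfolding m_def by (rule gap_sup_scaled[OF u o])
  then have "\<Lambda>\<^sup>2 * ?I u \<le> \<Lambda>\<^sup>2 * (m * ?I h)" by (rule mult_left_mono) simp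
  have ar: "1 < L2 * m" if "\<not> L2 * A \<le> B" "L2 * A \<le> L2 * (m * B)" "0 \<le> B" for L2 A B :: real
  proof (rule ccontr)
    assume "\<not> 1 < L2 * m"
    then have "(L2 * m) * B \<le> 1 * B" using that(3) by (intro mult_right_mono) auto
    then show False using that by (simp add: mult.assoc)
  qed
  have ml: "1 < \<Lambda>\<^sup>2 * m"
    by (rule ar[OF neg _ H0]) fact
  then have mpos: "0 < m" using m0 by (cases "m = 0") auto
  obtain g z z' q q' where g: "DA z z' g" "DA q q' z" "orth J g" "0 < ?I g"
    "\<And>x. x \<in> {-1..1} \<Longrightarrow> q x = m * g x"
    by (rule gap_extremal[OF JE m_def mpos]) (rule that)
  define \<mu> where "\<mu> = sqrt m"
  have \<mu>: "0 < \<mu>" "\<mu>\<^sup>2 = m" using mpos by (auto simp: \<mu>_def)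
  have \<mu>L: "1 / \<mu> < \<Lambda>"
  proof -
    have "1\<^sup>2 < (\<Lambda> * \<mu>)\<^sup>2" using ml \<mu> by (simp add: power_mult_distrib)
    then have "1 < \<Lambda> * \<mu>" using L \<mu> by (intro power_less_imp_less_base[of 1 2]) auto
    then show ?thesis using \<mu> by (simp add: field_simps)
  qed
  let ?l = "1 / \<mu>"
  define t where "t x = \<mu> * z x + 1 * q x" for x
  define t' where "t' x = \<mu> * z' x + 1 * q' x" for x
  have t: "DA t t' (\<lambda>x. \<mu> * g x + 1 * z x)"
    unfolding t_def[abs_def] t'_def[abs_def] by (rule DA_lincomb[OF g(1,2)])
  have te: "\<mu> * g x + 1 * z x = ?l * t x" if "x \<in> {-1..1}" for x
    using g(5)[OF that] \<mu> by (simp add: t_def power2_eq_square[symmetric] field_simps)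
  have ty: "t x = t' (-1) * y ?l x" if x: "x \<in> {-1..1}" for x
  proof (rule ode_unique[OF _ DA_D(1)[OF t] _ DA_D(3)[OF t] x])
    fix x :: real assume x: "x \<in> {-1..1}"
    show "(t' has_real_derivative (V x - ?l) * t x) (at x within {-1..1})"
      using DA_D(2)[OF t x] te[OF x] by (simp add: algebra_simps)
  qed (use \<mu> in auto)
  have gc: "continuous_on {-1..1} g" "continuous_on {-1..1} z" using DA_D(5,6)[OF g(1)] by auto
  \<comment> \<open>Positivity of the inverse: t = 0 would mean A^(-1) g = -\<mu> g, which makes the
    product of g with A^(-1) g negative.\<close>
  have c0: "t' (-1) \<noteq> 0"
  proof
    assume "t' (-1) = 0"
    then have "z x = - \<mu> * g x" if "x \<in> {-1..1}" for x using ty[OF that] te[OF that] by simp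
    then have "integral {-1..1} (\<lambda>x. g x * z x) = integral {-1..1} (\<lambda>x. (- \<mu>) * (g x)\<^sup>2)"
      by (intro integral_cong) (simp add: power2_eq_square)
    also have "\<dots> = (- \<mu>) * ?I g" by (rule integral_mult_right)
    also have "\<dots> < 0" using \<mu> g(4) by simp
    finally show False using DA_bounds(3)[OF g(1)] by simp
  qed
  have lE: "?l \<in> E" using ty[of 1] DA_D(4)[OF t] c0 by (simp add: E_def)
  with \<mu>L J have lJ: "?l \<in> J" by simp
  have "integral {-1..1} (\<lambda>x. \<mu> * (g x * y ?l x) + 1 * (z x * y ?l x))
      = \<mu> * integral {-1..1} (\<lambda>x. g x * y ?l x) + 1 * integral {-1..1} (\<lambda>x. z x * y ?l x)"
    by (intro integral_lincomb continuous_intros gc y_cont)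
  also have "\<dots> = 0" using g(3) orth_DA[OF g(1,3) JE] lJ by (simp add: orth_def)
  finally have "0 = integral {-1..1} (\<lambda>x. \<mu> * (g x * y ?l x) + 1 * (z x * y ?l x))" by simp
  also have "\<dots> = integral {-1..1} (\<lambda>x. (?l * t' (-1)) * (y ?l x)\<^sup>2)"
  proof (intro integral_cong)
    fix x :: real assume x: "x \<in> {-1..1}"
    have "\<mu> * (g x * y ?l x) + 1 * (z x * y ?l x) = (\<mu> * g x + 1 * z x) * y ?l x" by (simp add: algebra_simps)
    also have "\<dots> = (?l * t' (-1)) * (y ?l x)\<^sup>2"
      unfolding te[OF x] ty[OF x] by (simp only: power2_eq_square mult_ac)
    finally show "\<mu> * (g x * y ?l x) + 1 * (z x * y ?l x) = (?l * t' (-1)) * (y ?l x)\<^sup>2" .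
  qed
  also have "\<dots> = (?l * t' (-1)) * nrm ?l" unfolding nrm_def by (rule integral_mult_right)
  finally show False using c0 \<mu> nrm_pos[of ?l] by simp
qed

end

section \<open>Square integrable functions\<close>

text \<open>The bridge between the Lebesgue interval integrals in which solutions are defined and
  the gauge integrals in which the estimates are made.\<close>

lemma LBINT_eq_integral:
  fixes F :: "real \<Rightarrow> real"
  assumes "set_integrable lborel {-1..1} F"
  shows "(LBINT x=-1..1. F x) = integral {-1..1} F"
proof -
  have "(LBINT x=ereal (-1)..ereal 1. F x) = integral {-1..1} F"
    by (rule interval_integral_eq_integral) (use assms in auto)
  then show ?thesis by (simp add: one_ereal_def)
qed

lemma L2_mult:
  assumes "L2 f" "L2 g"
  shows "set_integrable lborel {-1..1} (\<lambda>x. f x * g x)"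
proof -
  let ?A = "{-1..1::real}"
  have mf: "(\<lambda>x. indicat_real ?A x *\<^sub>R f x) \<in> borel_measurable lborel"
    and mg: "(\<lambda>x. indicat_real ?A x *\<^sub>R g x) \<in> borel_measurable lborel"
    using assms by (auto simp: L2_def set_borel_measurable_def)
  have If: "integrable lborel (\<lambda>x. indicat_real ?A x *\<^sub>R (f x)\<^sup>2 + indicat_real ?A x *\<^sub>R (g x)\<^sup>2)"
    using assms by (auto simp: L2_def set_integrable_def)
  have eq: "(\<lambda>x. indicat_real ?A x *\<^sub>R (f x * g x)) = (\<lambda>x. (indicat_real ?A x *\<^sub>R f x) * (indicat_real ?A x *\<^sub>R g x))"
    by (auto simp: indicator_def)
  show ?thesis
    unfolding set_integrable_def
  proof (rule Bochner_Integration.integrable_bound[OF If])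
    show "(\<lambda>x. indicat_real ?A x *\<^sub>R (f x * g x)) \<in> borel_measurable lborel"
      unfolding eq by (intro borel_measurable_times mf mg)
    show "AE x in lborel. norm (indicat_real ?A x *\<^sub>R (f x * g x)) \<le> norm (indicat_real ?A x *\<^sub>R (f x)\<^sup>2 + indicat_real ?A x *\<^sub>R (g x)\<^sup>2)"
    proof (rule AE_I2)
      fix x
      have "2 * \<bar>f x\<bar> * \<bar>g x\<bar> \<le> \<bar>f x\<bar>\<^sup>2 + \<bar>g x\<bar>\<^sup>2" by (rule sum_squares_bound)
      moreover have "0 \<le> \<bar>f x\<bar> * \<bar>g x\<bar>" by simp
      ultimately have "\<bar>f x * g x\<bar> \<le> (f x)\<^sup>2 + (g x)\<^sup>2" unfolding abs_mult power2_abs by linarith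
      then show "norm (indicat_real ?A x *\<^sub>R (f x * g x)) \<le> norm (indicat_real ?A x *\<^sub>R (f x)\<^sup>2 + indicat_real ?A x *\<^sub>R (g x)\<^sup>2)"
        by (auto simp: indicator_def)
    qed
  qed
qed

lemma L2_integrable:
  assumes "L2 f" "L2 g"
  shows "(\<lambda>x. f x * g x) integrable_on {-1..1}"
  using set_borel_integral_eq_integral(1)[OF L2_mult[OF assms]] .

lemma L2_sq_integrable: "L2 f \<Longrightarrow> (\<lambda>x. (f x)\<^sup>2) integrable_on {-1..1}"
  using L2_integrable[of f f] by (simp add: power2_eq_square)

lemma L2_LBINT:
  assumes "L2 f" "L2 g"
  shows "(LBINT x=-1..1. f x * g x) = integral {-1..1} (\<lambda>x. f x * g x)"
  by (rule LBINT_eq_integral[OF L2_mult[OF assms]])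

lemma L2_LBINT_sq:
  assumes "L2 f"
  shows "(LBINT x=-1..1. (f x)\<^sup>2) = integral {-1..1} (\<lambda>x. (f x)\<^sup>2)"
  using L2_LBINT[OF assms assms] by (simp add: power2_eq_square)

lemma L2_lincomb:
  assumes "L2 f" "L2 g"
  shows "L2 (\<lambda>x. c * f x + d * g x)"
proof -
  let ?A = "{-1..1::real}"
  have mf: "(\<lambda>x. indicat_real ?A x *\<^sub>R f x) \<in> borel_measurable lborel"
    and mg: "(\<lambda>x. indicat_real ?A x *\<^sub>R g x) \<in> borel_measurable lborel"
    using assms by (auto simp: L2_def set_borel_measurable_def)
  have eq: "(\<lambda>x. indicat_real ?A x *\<^sub>R (c * f x + d * g x)) = (\<lambda>x. c * (indicat_real ?A x *\<^sub>R f x) + d * (indicat_real ?A x *\<^sub>R g x))"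
    by (auto simp: indicator_def)
  have "set_borel_measurable lborel ?A (\<lambda>x. c * f x + d * g x)"
    unfolding set_borel_measurable_def eq by (intro borel_measurable_add borel_measurable_times borel_measurable_const mf mg)
  moreover have "set_integrable lborel ?A (\<lambda>x. (c * c) * (f x * f x) + ((2 * c * d) * (f x * g x) + (d * d) * (g x * g x)))"
    by (intro set_integral_add(1) set_integrable_mult_right L2_mult assms)
  moreover have "(\<lambda>x. (c * f x + d * g x)\<^sup>2) = (\<lambda>x. (c * c) * (f x * f x) + ((2 * c * d) * (f x * g x) + (d * d) * (g x * g x)))"
    by (rule ext) (simp add: power2_eq_square algebra_simps)
  ultimately show ?thesis by (simp add: L2_def)
qed

lemma L2_diff: "L2 f \<Longrightarrow> L2 g \<Longrightarrow> L2 (\<lambda>x. f x - g x)"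
  using L2_lincomb[of f g 1 "-1"] by simp

lemma L2_cont:
  assumes "continuous_on {-1..1} f"
  shows "L2 f"
proof -
  have "(\<lambda>x. indicat_real {-1..1} x *\<^sub>R f x) \<in> borel_measurable borel"
    by (rule borel_measurable_continuous_on_indicator) (use assms in auto)
  moreover have "set_integrable lborel {-1..1} (\<lambda>x. (f x)\<^sup>2)"
    by (rule borel_integrable_atLeastAtMost') (intro continuous_intros assms)
  ultimately show ?thesis by (simp add: L2_def set_borel_measurable_def)
qed

lemma L2_abs: "L2 f \<Longrightarrow> L2 (\<lambda>x. \<bar>f x\<bar>)"
proof -
  assume f: "L2 f"
  have "(\<lambda>x. indicat_real {-1..1} x *\<^sub>R f x) \<in> borel_measurable lborel"
    using f by (auto simp: L2_def set_borel_measurable_def)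
  then have "(\<lambda>x. \<bar>indicat_real {-1..1} x *\<^sub>R f x\<bar>) \<in> borel_measurable lborel" by (rule borel_measurable_abs)
  moreover have "(\<lambda>x. \<bar>indicat_real {-1..1} x *\<^sub>R f x\<bar>) = (\<lambda>x. indicat_real {-1..1} x *\<^sub>R \<bar>f x\<bar>)"
    by (auto simp: indicator_def)
  ultimately show ?thesis using f by (auto simp: L2_def set_borel_measurable_def)
qed

lemma integral_L2_lincomb:
  assumes "L2 f" "L2 g" "L2 w"
  shows "integral {-1..1} (\<lambda>x. (c * f x + d * g x) * w x)
    = c * integral {-1..1} (\<lambda>x. f x * w x) + d * integral {-1..1} (\<lambda>x. g x * w x)"
proof -
  have "integral {-1..1} (\<lambda>x. (c * f x + d * g x) * w x) = integral {-1..1} (\<lambda>x. c * (f x * w x) + d * (g x * w x))"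
    by (simp add: algebra_simps)
  also have "\<dots> = integral {-1..1} (\<lambda>x. c * (f x * w x)) + integral {-1..1} (\<lambda>x. d * (g x * w x))"
    by (intro integral_add integrable_on_mult_right L2_integrable assms)
  finally show ?thesis by simp
qed

lemma integral_L2_sq_add_le:
  assumes "L2 f" "L2 g"
  shows "integral {-1..1} (\<lambda>x. (f x + g x)\<^sup>2) \<le> 2 * integral {-1..1} (\<lambda>x. (f x)\<^sup>2) + 2 * integral {-1..1} (\<lambda>x. (g x)\<^sup>2)"
proof -
  have "L2 (\<lambda>x. f x + g x)" using L2_lincomb[OF assms, of 1 1] by simp
  then have "integral {-1..1} (\<lambda>x. (f x + g x)\<^sup>2) \<le> integral {-1..1} (\<lambda>x. 2 * (f x)\<^sup>2 + 2 * (g x)\<^sup>2)"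
  proof (intro integral_le L2_sq_integrable integrable_add integrable_on_mult_right assms)
    fix x show "(f x + g x)\<^sup>2 \<le> 2 * (f x)\<^sup>2 + 2 * (g x)\<^sup>2"
      using sum_squares_bound[of "f x" "g x"] by (simp add: power2_sum)
  qed
  also have "\<dots> = integral {-1..1} (\<lambda>x. 2 * (f x)\<^sup>2) + integral {-1..1} (\<lambda>x. 2 * (g x)\<^sup>2)"
    by (intro integral_add integrable_on_mult_right L2_sq_integrable assms)
  finally show ?thesis by simp
qed

section \<open>Integration by parts in \<open>H\<^sub>0\<^sup>1\<close>\<close>

lemma H10_D:
  assumes "H10_deriv f h"
  shows "L2 h" "\<And>x. x \<in> {-1..1} \<Longrightarrow> f x = integral {-1..x} h" "continuous_on {-1..1} f"
    "f (-1) = 0" "f 1 = 0" "L2 f" "h integrable_on {-1..1}" "(\<lambda>x. \<bar>h x\<bar>) integrable_on {-1..1}"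
proof -
  show h: "L2 h" and "f 1 = 0" using assms by (auto simp: H10_deriv_def)
  have one: "L2 (\<lambda>x. 1)" by (rule L2_cont) simp
  have si: "set_integrable lborel {-1..1} h" using L2_mult[OF h one] by simp
  show hi: "h integrable_on {-1..1}" using L2_integrable[OF h one] by simp
  show "(\<lambda>x. \<bar>h x\<bar>) integrable_on {-1..1}" using L2_integrable[OF L2_abs[OF h] one] by simp
  show f: "f x = integral {-1..x} h" if x: "x \<in> {-1..1}" for x
  proof -
    have "set_integrable lborel {-1..x} h"
      by (rule set_integrable_subset[OF si]) (use x in auto)
    then have "(LBINT y=ereal (-1)..ereal x. h y) = integral {-1..x} h"
      by (intro interval_integral_eq_integral) (use x in auto)
    moreover have "f x = (LBINT y=-1..ereal x. h y)" using assms x by (auto simp: H10_deriv_def)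
    ultimately show ?thesis by (simp add: one_ereal_def)
  qed
  show "f (-1) = 0" using f[of "-1"] by simp
  have "continuous_on {-1..1} (\<lambda>x. integral {-1..x} h)" by (rule indefinite_integral_continuous_1[OF hi])
  then show c: "continuous_on {-1..1} f" by (rule continuous_on_eq) (simp add: f)
  show "L2 f" by (rule L2_cont[OF c])
qed

text \<open>The defect in the product rule is \<open>o(z - x)\<close> because \<open>h\<close> is integrable, so its primitive has zero derivative everywhere.\<close>

lemma H10_by_parts:
  assumes f: "H10_deriv f h"
    and \<psi>: "\<And>x. x \<in> {-1..1} \<Longrightarrow> (\<psi> has_real_derivative \<psi>' x) (at x within {-1..1})"
    and \<psi>': "continuous_on {-1..1} \<psi>'"
  shows "integral {-1..1} (\<lambda>x. h x * \<psi> x) = - integral {-1..1} (\<lambda>x. f x * \<psi>' x)"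
proof -
  note H = H10_D[OF f]
  have \<psi>c: "continuous_on {-1..1} \<psi>" by (rule DERIV_continuous_on[OF \<psi>])
  obtain L0 where L0: "\<And>x. x \<in> {-1..1} \<Longrightarrow> \<bar>\<psi>' x\<bar> \<le> L0"
    using compact_imp_bounded[OF compact_continuous_image[OF \<psi>' compact_Icc]]
    unfolding bounded_iff by (metis imageI real_norm_def)
  define L where "L = \<bar>L0\<bar>"
  have L: "0 \<le> L" "\<And>x. x \<in> {-1..1} \<Longrightarrow> \<bar>\<psi>' x\<bar> \<le> L"
    by (simp add: L_def) (use L0 in \<open>unfold L_def, blast intro: order_trans[OF _ abs_ge_self]\<close>)
  define A where "A x = integral {-1..x} (\<lambda>s. \<bar>h s\<bar>)" for x
  define D where "D x = f x * \<psi> x - integral {-1..x} (\<lambda>s. h s * \<psi> s + f s * \<psi>' s)" for x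
  have i1: "(\<lambda>s. h s * \<psi> s) integrable_on {-1..1}" by (rule L2_integrable[OF H(1) L2_cont[OF \<psi>c]])
  have i2: "(\<lambda>s. f s * \<psi>' s) integrable_on {-1..1}" by (rule L2_integrable[OF H(6) L2_cont[OF \<psi>']])
  have i3: "(\<lambda>s. h s * \<psi> s + f s * \<psi>' s) integrable_on {-1..1}" by (intro integrable_add i1 i2)
  have Ac: "continuous_on {-1..1} A" unfolding A_def[abs_def] by (rule indefinite_integral_continuous_1[OF H(8)])
  have sub_int: "k integrable_on {x..z}" if "k integrable_on {-1..1}" "-1 \<le> x" "z \<le> 1" for k :: "real \<Rightarrow> real" and x z
    using integrable_on_subinterval[OF that(1), of x z] that by auto
  have split: "integral {-1..z} k - integral {-1..x} k = integral {x..z} k"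
    if "k integrable_on {-1..1}" "-1 \<le> x" "x \<le> z" "z \<le> 1" for k :: "real \<Rightarrow> real" and x z
    using Henstock_Kurzweil_Integration.integral_combine[of "-1" x z k] sub_int[OF that(1), of "-1" z] that by simp
  have key: "\<bar>D z - D x\<bar> \<le> (2 * L) * (z - x) * (A z - A x)" if xz: "-1 \<le> x" "x \<le> z" "z \<le> 1" for x z
  proof -
    have sub: "{x..z} \<subseteq> {-1..1}" using xz by auto
    have fz: "f s - f x = integral {x..s} h" if "x \<le> s" "s \<le> z" for s
      using split[OF H(7), of x s] H(2)[of s] H(2)[of x] xz that by simp
    have AA: "A s - A x = integral {x..s} (\<lambda>s. \<bar>h s\<bar>)" if "x \<le> s" "s \<le> z" for s
      unfolding A_def using split[OF H(8), of x s] xz that by simp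
    have Amono: "A s \<le> A z" if "x \<le> s" "s \<le> z" for s
    proof -
      have "A z - A s = integral {s..z} (\<lambda>s. \<bar>h s\<bar>)"
        unfolding A_def using split[OF H(8), of s z] xz that by simp
      also have "\<dots> \<ge> 0" using xz that by (intro integral_nonneg sub_int[OF H(8)]) auto
      finally show ?thesis by simp
    qed
    have \<psi>ftc: "(\<psi>' has_integral (\<psi> s - \<psi> r)) {r..s}" if "x \<le> r" "r \<le> s" "s \<le> z" for r s
      by (rule ftc) (use that xz in \<open>auto intro!: has_field_derivative_subset[OF \<psi>]\<close>)
    have \<psi>lip: "\<bar>\<psi> z - \<psi> s\<bar> \<le> L * (z - x)" if s: "x \<le> s" "s \<le> z" for s
    proof -
      have "\<bar>\<psi> z - \<psi> s\<bar> = norm (integral {s..z} \<psi>')" using integral_unique[OF \<psi>ftc[OF s order_refl]] by simp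
      also have "\<dots> \<le> integral {s..z} (\<lambda>_. L)"
        by (intro integral_norm_bound_integral sub_int[OF integrable_continuous_real[OF \<psi>']] integrable_const_ivl) (use s xz L in auto)
      also have "\<dots> = L * (z - s)" using s by simp
      also have "\<dots> \<le> L * (z - x)" using s L by (intro mult_left_mono) auto
      finally show ?thesis .
    qed
    \<comment> \<open>Write the increment of f \<psi> as \<psi>(z) times the increment of f plus
      f(x) times the increment of \<psi>; both coefficients then differ from those under the
      integral by small amounts.\<close>
    have "D z - D x = \<psi> z * integral {x..z} h + f x * integral {x..z} \<psi>' - integral {x..z} (\<lambda>s. h s * \<psi> s + f s * \<psi>' s)"
    proof -
      have F: "integral {x..z} h = f z - f x" using fz[of z] xz by simp
      have P: "integral {x..z} \<psi>' = \<psi> z - \<psi> x" using integral_unique[OF \<psi>ftc[of x z]] xz by simp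
      show ?thesis unfolding D_def F P split[OF i3 xz, symmetric] by (simp add: algebra_simps)
    qed
    also have "\<dots> = integral {x..z} (\<lambda>s. \<psi> z * h s + f x * \<psi>' s - (h s * \<psi> s + f s * \<psi>' s))"
    proof -
      have "integral {x..z} (\<lambda>s. \<psi> z * h s + f x * \<psi>' s - (h s * \<psi> s + f s * \<psi>' s))
        = integral {x..z} (\<lambda>s. \<psi> z * h s + f x * \<psi>' s) - integral {x..z} (\<lambda>s. h s * \<psi> s + f s * \<psi>' s)"
        by (intro integral_diff integrable_add integrable_on_mult_right sub_int[OF H(7)] sub_int[OF i3] sub_int[OF i1]
            sub_int[OF i2] sub_int[OF integrable_continuous_real[OF \<psi>']]) (use xz in auto)
      also have "integral {x..z} (\<lambda>s. \<psi> z * h s + f x * \<psi>' s) = integral {x..z} (\<lambda>s. \<psi> z * h s) + integral {x..z} (\<lambda>s. f x * \<psi>' s)"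
        by (intro integral_add integrable_on_mult_right sub_int[OF H(7)] sub_int[OF integrable_continuous_real[OF \<psi>']]) (use xz in auto)
      finally show ?thesis by simp
    qed
    finally have De: "D z - D x = integral {x..z} (\<lambda>s. \<psi> z * h s + f x * \<psi>' s - (h s * \<psi> s + f s * \<psi>' s))" .
    have "\<bar>D z - D x\<bar> \<le> integral {x..z} (\<lambda>s. L * (z - x) * \<bar>h s\<bar> + (A z - A x) * L)"
      unfolding De
      unfolding real_norm_def[symmetric]
    proof (rule integral_norm_bound_integral)
      fix s assume s: "s \<in> {x..z}"
      then have s1: "s \<in> {-1..1}" using sub by auto
      have "\<bar>f s - f x\<bar> \<le> integral {x..s} (\<lambda>s. \<bar>h s\<bar>)"
        unfolding fz[of s, OF s[THEN atLeastAtMost_iff[THEN iffD1], THEN conjunct1] s[THEN atLeastAtMost_iff[THEN iffD1], THEN conjunct2]]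
          real_norm_def[symmetric]
        by (intro integral_norm_bound_integral sub_int[OF H(7)]) (use s xz sub_int[OF H(8), of x s] in auto)
      also have "\<dots> = A s - A x" using AA[of s] s by simp
      also have "\<dots> \<le> A z - A x" using Amono[of s] s by simp
      finally have fl: "\<bar>f s - f x\<bar> \<le> A z - A x" .
      have "\<psi> z * h s + f x * \<psi>' s - (h s * \<psi> s + f s * \<psi>' s) = (\<psi> z - \<psi> s) * h s + (- (f s - f x)) * \<psi>' s"
        by (simp add: algebra_simps)
      also have "\<bar>\<dots>\<bar> \<le> \<bar>\<psi> z - \<psi> s\<bar> * \<bar>h s\<bar> + \<bar>f s - f x\<bar> * \<bar>\<psi>' s\<bar>"
        by (rule order_trans[OF abs_triangle_ineq]) (simp only: abs_mult abs_minus_cancel order_refl)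
      also have "\<dots> \<le> L * (z - x) * \<bar>h s\<bar> + (A z - A x) * L"
        using \<psi>lip[of s] s L(2)[OF s1] L(1) fl xz Amono[of x] by (intro add_mono mult_mono) auto
      finally show "norm (\<psi> z * h s + f x * \<psi>' s - (h s * \<psi> s + f s * \<psi>' s)) \<le> L * (z - x) * norm (h s) + (A z - A x) * L" by simp
    next
      show "(\<lambda>s. \<psi> z * h s + f x * \<psi>' s - (h s * \<psi> s + f s * \<psi>' s)) integrable_on {x..z}"
        by (intro integrable_diff integrable_add integrable_on_mult_right sub_int[OF H(7)] sub_int[OF i3] sub_int[OF i1]
            sub_int[OF i2] sub_int[OF integrable_continuous_real[OF \<psi>']]) (use xz in auto)
      have "(\<lambda>s. L * (z - x) * \<bar>h s\<bar> + (A z - A x) * L) integrable_on {x..z}"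
        by (intro integrable_add integrable_on_mult_right sub_int[OF H(8)] integrable_const_ivl) (use xz in auto)
      then show "(\<lambda>s. L * (z - x) * norm (h s) + (A z - A x) * L) integrable_on {x..z}" by simp
    qed
    also have "\<dots> = integral {x..z} (\<lambda>s. L * (z - x) * \<bar>h s\<bar>) + integral {x..z} (\<lambda>s. (A z - A x) * L)"
      by (rule integral_add[OF integrable_on_mult_right[OF sub_int[OF H(8) xz(1,3)]] integrable_const_ivl])
    also have "\<dots> = (2 * L) * (z - x) * (A z - A x)"
    proof -
      have e1: "integral {x..z} (\<lambda>s. L * (z - x) * \<bar>h s\<bar>) = L * (z - x) * (A z - A x)"
        unfolding AA[OF xz(2) order_refl] by (rule integral_mult_right)
      have e2: "integral {x..z} (\<lambda>s. (A z - A x) * L) = (z - x) * ((A z - A x) * L)"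
        using xz by simp
      show ?thesis unfolding e1 e2 by (simp add: algebra_simps)
    qed
    finally show ?thesis .
  qed
  have dD: "(D has_real_derivative 0) (at x within {-1..1})" if x: "x \<in> {-1..1}" for x
    unfolding has_field_derivative_iff
  proof (rule Lim_null_comparison)
    show "\<forall>\<^sub>F z in at x within {-1..1}. norm ((D z - D x) / (z - x)) \<le> (2 * L) * \<bar>A z - A x\<bar>"
      unfolding eventually_at_filter
    proof (rule always_eventually, intro allI impI)
      fix z assume z: "z \<noteq> x" "z \<in> {-1..1}"
      have "\<bar>D z - D x\<bar> \<le> (2 * L) * \<bar>z - x\<bar> * \<bar>A z - A x\<bar>"
      proof (cases "x \<le> z")
        case True
        have "\<bar>D z - D x\<bar> \<le> (2 * L) * (z - x) * (A z - A x)" using key[of x z] True x z by auto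
        also have "\<dots> \<le> (2 * L) * (z - x) * \<bar>A z - A x\<bar>"
          using True L(1) by (intro mult_left_mono abs_ge_self mult_nonneg_nonneg) auto
        also have "z - x = \<bar>z - x\<bar>" using True by simp
        finally show ?thesis .
      next
        case False
        have "\<bar>D x - D z\<bar> \<le> (2 * L) * (x - z) * (A x - A z)" using key[of z x] False x z by auto
        also have "\<dots> \<le> (2 * L) * (x - z) * \<bar>A x - A z\<bar>"
          using False L(1) by (intro mult_left_mono abs_ge_self mult_nonneg_nonneg) auto
        also have "x - z = \<bar>x - z\<bar>" using False by simp
        finally show ?thesis by (simp only: abs_minus_commute)
      qed
      then show "norm ((D z - D x) / (z - x)) \<le> (2 * L) * \<bar>A z - A x\<bar>"
        using z by (simp add: abs_divide pos_divide_le_eq mult_ac)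
    qed
    have "(A \<longlongrightarrow> A x) (at x within {-1..1})" using Ac x by (simp add: continuous_on_def)
    then have "((\<lambda>z. (2 * L) * \<bar>A z - A x\<bar>) \<longlongrightarrow> (2 * L) * \<bar>A x - A x\<bar>) (at x within {-1..1})"
      by (intro tendsto_intros)
    then show "((\<lambda>z. (2 * L) * \<bar>A z - A x\<bar>) \<longlongrightarrow> 0) (at x within {-1..1})" by simp
  qed
  have "((\<lambda>x. 0) has_integral (D 1 - D (-1))) {-1..1::real}"
    by (rule ftc[where F = D and f = "\<lambda>x. 0" and a = "-1" and b = 1]) (use dD in auto)
  then have "D 1 = D (-1)" using has_integral_unique[OF _ has_integral_0] by fastforce
  then have "integral {-1..1} (\<lambda>s. h s * \<psi> s + f s * \<psi>' s) = 0" by (simp add: D_def H)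
  moreover have "integral {-1..1} (\<lambda>s. h s * \<psi> s + f s * \<psi>' s) = integral {-1..1} (\<lambda>s. h s * \<psi> s) + integral {-1..1} (\<lambda>s. f s * \<psi>' s)"
    by (intro integral_add i1 i2)
  ultimately show ?thesis by simp
qed

section \<open>Completeness of the eigenfunctions\<close>

context sturm
begin

definition cf :: "(real \<Rightarrow> real) \<Rightarrow> real \<Rightarrow> real" where
  "cf f k = integral {-1..1} (\<lambda>x. f x * phi k x)"

text \<open>By orthonormality this is the squared distance of \<open>f\<close> from the span of the
  modes in \<open>J\<close>. The coefficient form makes monotonicity in \<open>J\<close> and in time
  immediate.\<close>

definition defect :: "real set \<Rightarrow> (real \<Rightarrow> real) \<Rightarrow> real" where
  "defect J f = integral {-1..1} (\<lambda>x. (f x)\<^sup>2) - (\<Sum>k\<in>J. (cf f k)\<^sup>2)"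

lemma uu_L2: "L2 (uu J c t)"
  by (rule L2_cont) (rule uu_cont, simp)

lemma integral_mult_uu:
  assumes f: "L2 f" and J: "finite J"
  shows "integral {-1..1} (\<lambda>x. f x * uu J c t x) = (\<Sum>k\<in>J. c k * exp (- (k * t)) * cf f k)"
proof -
  have "integral {-1..1} (\<lambda>x. f x * uu J c t x) = integral {-1..1} (\<lambda>x. \<Sum>k\<in>J. (c k * exp (- (k * t))) * (f x * phi k x))"
    unfolding uu_def sum_distrib_left by (intro integral_cong sum.cong refl) (simp only: mult_ac)
  also have "\<dots> = (\<Sum>k\<in>J. integral {-1..1} (\<lambda>x. (c k * exp (- (k * t))) * (f x * phi k x)))"
    by (intro integral_sum J integrable_on_mult_right L2_integrable f L2_cont phi_cont)
  finally show ?thesis by (simp only: cf_def integral_mult_right)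
qed

text \<open>Stated with the factors exp(-kt) so that it applies directly to a solution at time t and
  the finite sum with the coefficients of time 0.\<close>

lemma distance_to_uu:
  assumes f: "L2 f" and J: "finite J" "J \<subseteq> E" and c: "\<And>k. k \<in> J \<Longrightarrow> cf f k = c k * exp (- (k * t))"
  shows "integral {-1..1} (\<lambda>x. (f x - uu J c t x)\<^sup>2) = defect J f"
proof -
  have "(\<lambda>x. (f x - uu J c t x)\<^sup>2) = (\<lambda>x. (f x)\<^sup>2 - 2 * (f x * uu J c t x) + (uu J c t x)\<^sup>2)"
    by (rule ext) (simp add: power2_eq_square algebra_simps)
  then have "integral {-1..1} (\<lambda>x. (f x - uu J c t x)\<^sup>2) = integral {-1..1} (\<lambda>x. (f x)\<^sup>2 - 2 * (f x * uu J c t x) + (uu J c t x)\<^sup>2)"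
    by simp
  also have "\<dots> = integral {-1..1} (\<lambda>x. (f x)\<^sup>2 - 2 * (f x * uu J c t x)) + integral {-1..1} (\<lambda>x. (uu J c t x)\<^sup>2)"
    by (intro integral_add integrable_diff integrable_on_mult_right L2_sq_integrable L2_integrable f uu_L2)
  also have "integral {-1..1} (\<lambda>x. (f x)\<^sup>2 - 2 * (f x * uu J c t x))
      = integral {-1..1} (\<lambda>x. (f x)\<^sup>2) - integral {-1..1} (\<lambda>x. 2 * (f x * uu J c t x))"
    by (intro integral_diff integrable_on_mult_right L2_sq_integrable L2_integrable f uu_L2)
  also have "integral {-1..1} (\<lambda>x. 2 * (f x * uu J c t x)) = 2 * (\<Sum>k\<in>J. c k * exp (- (k * t)) * cf f k)"
    by (simp only: integral_mult_right integral_mult_uu[OF f J(1)])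
  also have "(\<Sum>k\<in>J. c k * exp (- (k * t)) * cf f k) = (\<Sum>k\<in>J. (cf f k)\<^sup>2)"
    by (intro sum.cong refl) (simp add: c power2_eq_square)
  also have "integral {-1..1} (\<lambda>x. (uu J c t x)\<^sup>2) = (\<Sum>k\<in>J. (cf f k)\<^sup>2)"
    unfolding integral_uu_sq_full[OF J] by (intro sum.cong refl) (simp add: c)
  finally show ?thesis by (simp add: defect_def)
qed

lemma distance_to_projection:
  assumes f: "L2 f" and J: "finite J" "J \<subseteq> E"
  shows "integral {-1..1} (\<lambda>x. (f x - uu J (cf f) 0 x)\<^sup>2) = defect J f"
  by (rule distance_to_uu[OF assms]) simp

lemma defect_nonneg:
  assumes f: "L2 f" and J: "finite J" "J \<subseteq> E"
  shows "0 \<le> defect J f"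
  unfolding distance_to_projection[OF assms, symmetric]
  by (intro integral_nonneg L2_sq_integrable L2_diff f uu_L2) auto

lemma defect_mono:
  assumes "finite J" "I \<subseteq> J"
  shows "defect J f \<le> defect I f"
  unfolding defect_def using assms by (simp add: sum_mono2)

lemma defect_add_le:
  assumes f: "L2 f" "L2 w" and J: "finite J" "J \<subseteq> E"
  shows "defect J f \<le> 2 * integral {-1..1} (\<lambda>x. (f x - w x)\<^sup>2) + 2 * defect J w"
proof -
  have d: "L2 (\<lambda>x. f x - w x)" by (rule L2_diff[OF f])
  have cfd: "cf f k = cf (\<lambda>x. f x - w x) k + cf w k" for k
    using integral_L2_lincomb[OF d f(2) L2_cont[OF phi_cont], of 1 1 k] by (simp add: cf_def)
  have "uu J (cf f) 0 x = uu J (cf (\<lambda>x. f x - w x)) 0 x + uu J (cf w) 0 x" for x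
    unfolding uu_def sum.distrib[symmetric] by (intro sum.cong refl) (simp add: cfd algebra_simps)
  then have "defect J f = integral {-1..1} (\<lambda>x. ((f x - w x - uu J (cf (\<lambda>x. f x - w x)) 0 x) + (w x - uu J (cf w) 0 x))\<^sup>2)"
    unfolding distance_to_projection[OF f(1) J, symmetric] by (simp add: algebra_simps)
  also have "\<dots> \<le> 2 * integral {-1..1} (\<lambda>x. (f x - w x - uu J (cf (\<lambda>x. f x - w x)) 0 x)\<^sup>2) + 2 * integral {-1..1} (\<lambda>x. (w x - uu J (cf w) 0 x)\<^sup>2)"
    by (intro integral_L2_sq_add_le L2_diff f uu_L2)
  also have "\<dots> = 2 * defect J (\<lambda>x. f x - w x) + 2 * defect J w"
    by (simp only: distance_to_projection[OF d J] distance_to_projection[OF f(2) J])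
  also have "defect J (\<lambda>x. f x - w x) \<le> integral {-1..1} (\<lambda>x. (f x - w x)\<^sup>2)"
    unfolding defect_def by (simp add: sum_nonneg)
  finally show ?thesis by simp
qed

text \<open>A property of a single function, because density is used only for the time slices of a
  weak solution.\<close>

definition complete_for :: "(real \<Rightarrow> real) \<Rightarrow> bool" where
  "complete_for f \<longleftrightarrow> (\<forall>\<epsilon>>0. \<exists>J. finite J \<and> J \<subseteq> E \<and> defect J f < \<epsilon>)"

text \<open>\<open>w\<close> has only a weak derivative, so the spectral gap does not apply to the
  remainder r directly. It applies to q = A^(-1) r, and integration by parts turns <w,r> into the
  form of w and q; Young's inequality with weight \<Lambda> then leaves half of |r|^2.\<close>

lemma H10_defect_le:
  assumes w: "H10_deriv w w'" and L: "0 < \<Lambda>"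
  shows "defect {l \<in> E. l \<le> \<Lambda>} w \<le> integral {-1..1} (\<lambda>x. (w' x)\<^sup>2 + V x * (w x)\<^sup>2) / \<Lambda>"
proof -
  note H = H10_D[OF w]
  let ?J = "{l \<in> E. l \<le> \<Lambda>}"
  have J: "finite ?J" "?J \<subseteq> E" using finite_eig by auto
  define r where "r x = 1 * w x + (-1) * uu ?J (cf w) 0 x" for x
  have rw: "r x = w x - uu ?J (cf w) 0 x" for x by (simp add: r_def)
  have rc: "continuous_on {-1..1} r" unfolding r_def[abs_def] by (intro continuous_intros H uu_cont) simp
  have rL: "L2 r" by (rule L2_cont[OF rc])
  have Q: "integral {-1..1} (\<lambda>x. (r x)\<^sup>2) = defect ?J w"
    unfolding rw by (rule distance_to_projection[OF H(6) J])
  have cfr: "cf r k = 0" if k: "k \<in> ?J" for k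
  proof -
    have "cf r k = 1 * cf w k + (-1) * integral {-1..1} (\<lambda>x. uu ?J (cf w) 0 x * phi k x)"
      unfolding cf_def r_def by (rule integral_L2_lincomb[OF H(6) uu_L2 L2_cont[OF phi_cont]])
    also have "integral {-1..1} (\<lambda>x. uu ?J (cf w) 0 x * phi k x) = integral {-1..1} (\<lambda>x. phi k x * uu ?J (cf w) 0 x)"
      by (simp only: mult.commute)
    also have "\<dots> = (\<Sum>j\<in>?J. cf w j * exp (- (j * 0)) * cf (phi k) j)"
      by (rule integral_mult_uu[OF L2_cont[OF phi_cont] J(1)])
    also have "\<dots> = (\<Sum>j\<in>?J. if j = k then cf w j else 0)"
      using k by (intro sum.cong refl) (auto simp: cf_def phi_orth)
    also have "\<dots> = cf w k" using k J(1) by simp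
    finally show ?thesis by simp
  qed
  have o: "orth ?J r"
    unfolding orth_def
  proof
    fix k assume "k \<in> ?J"
    then have "0 = integral {-1..1} (\<lambda>x. (1 / sqrt (nrm k)) * (r x * y k x))" using cfr by (simp add: cf_def phi_def)
    also have "\<dots> = (1 / sqrt (nrm k)) * integral {-1..1} (\<lambda>x. r x * y k x)" by (rule integral_mult_right)
    finally show "integral {-1..1} (\<lambda>x. r x * y k x) = 0" using nrm_pos[of k] by simp
  qed
  obtain q q' where q: "DA q q' r" using DA_exists[OF rc] by blast
  note D = DA_D[OF q]
  let ?R = "integral {-1..1} (\<lambda>x. (r x)\<^sup>2)"
  have gap: "\<Lambda>\<^sup>2 * integral {-1..1} (\<lambda>x. (q x)\<^sup>2) \<le> ?R" by (rule spectral_gap[OF L refl q o])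
  have Eq: "integral {-1..1} (\<lambda>x. (q' x)\<^sup>2 + V x * (q x)\<^sup>2) \<le> ?R / \<Lambda>"
  proof -
    have "integral {-1..1} (\<lambda>x. r x * q x) \<le> integral {-1..1} (\<lambda>x. (1/(2*\<Lambda>)) * (r x)\<^sup>2 + (\<Lambda>/2) * (q x)\<^sup>2)"
    proof (intro integral_cont_mono continuous_intros rc D)
      fix x
      have "0 \<le> (r x - \<Lambda> * q x)\<^sup>2 / (2 * \<Lambda>)" using L by simp
      also have "\<dots> = (1/(2*\<Lambda>)) * (r x)\<^sup>2 + (\<Lambda>/2) * (q x)\<^sup>2 - r x * q x"
        using L by (simp add: power2_eq_square field_simps)
      finally show "r x * q x \<le> (1/(2*\<Lambda>)) * (r x)\<^sup>2 + (\<Lambda>/2) * (q x)\<^sup>2" by simp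
    qed
    also have "\<dots> = (1/(2*\<Lambda>)) * ?R + (\<Lambda>/2) * integral {-1..1} (\<lambda>x. (q x)\<^sup>2)"
      by (intro integral_lincomb continuous_intros rc D)
    also have "(\<Lambda>/2) * integral {-1..1} (\<lambda>x. (q x)\<^sup>2) \<le> (1/(2*\<Lambda>)) * ?R"
      using gap L by (simp add: field_simps power2_eq_square)
    finally have "integral {-1..1} (\<lambda>x. r x * q x) \<le> ?R / \<Lambda>" by (simp add: field_simps)
    then show ?thesis unfolding DA_energy[OF q] .
  qed
  let ?W = "integral {-1..1} (\<lambda>x. (w' x)\<^sup>2 + V x * (w x)\<^sup>2)"
  have Vw: "L2 (\<lambda>x. V x * w x)" by (intro L2_cont continuous_intros V_cont H)
  have iW: "(\<lambda>x. (w' x)\<^sup>2 + V x * (w x)\<^sup>2) integrable_on {-1..1}"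
    using L2_integrable[OF Vw H(6)]
    by (intro integrable_add L2_sq_integrable H) (simp add: power2_eq_square mult.assoc)
  have iq: "(\<lambda>x. (q' x)\<^sup>2 + V x * (q x)\<^sup>2) integrable_on {-1..1}"
    by (intro integrable_continuous_real continuous_intros D V_cont)
  have "integral {-1..1} (\<lambda>x. w' x * q' x) = - integral {-1..1} (\<lambda>x. w x * (V x * q x - r x))"
    by (rule H10_by_parts[OF w D(2)]) (assumption, intro continuous_intros V_cont D rc)
  moreover have "integral {-1..1} (\<lambda>x. w x * (V x * q x - r x)) = integral {-1..1} (\<lambda>x. V x * w x * q x) - integral {-1..1} (\<lambda>x. w x * r x)"
  proof -
    have "integral {-1..1} (\<lambda>x. w x * (V x * q x - r x)) = integral {-1..1} (\<lambda>x. V x * w x * q x - w x * r x)"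
      by (simp add: algebra_simps)
    also have "\<dots> = integral {-1..1} (\<lambda>x. V x * w x * q x) - integral {-1..1} (\<lambda>x. w x * r x)"
      by (intro integral_diff integrable_continuous_real continuous_intros V_cont H D rc)
    finally show ?thesis .
  qed
  moreover have "integral {-1..1} (\<lambda>x. w' x * q' x + V x * w x * q x) = integral {-1..1} (\<lambda>x. w' x * q' x) + integral {-1..1} (\<lambda>x. V x * w x * q x)"
    by (rule integral_add[OF L2_integrable[OF H(1) L2_cont[OF D(7)]] L2_integrable[OF Vw L2_cont[OF D(6)]]])
  ultimately have wr: "integral {-1..1} (\<lambda>x. w x * r x) = integral {-1..1} (\<lambda>x. w' x * q' x + V x * w x * q x)" by simp
  have "integral {-1..1} (\<lambda>x. w' x * q' x + V x * w x * q x)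
      \<le> integral {-1..1} (\<lambda>x. (1/(2*\<Lambda>)) * ((w' x)\<^sup>2 + V x * (w x)\<^sup>2) + (\<Lambda>/2) * ((q' x)\<^sup>2 + V x * (q x)\<^sup>2))"
  proof (rule integral_le)
    show "(\<lambda>x. w' x * q' x + V x * w x * q x) integrable_on {-1..1}"
      by (intro integrable_add L2_integrable[OF H(1) L2_cont[OF D(7)]] L2_integrable[OF Vw L2_cont[OF D(6)]])
    show "(\<lambda>x. (1/(2*\<Lambda>)) * ((w' x)\<^sup>2 + V x * (w x)\<^sup>2) + (\<Lambda>/2) * ((q' x)\<^sup>2 + V x * (q x)\<^sup>2)) integrable_on {-1..1}"
      by (rule integrable_add[OF integrable_on_mult_right[OF iW] integrable_on_mult_right[OF iq]])
  next
    fix x :: real assume x: "x \<in> {-1..1}"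
    have ag: "s * t \<le> (1/(2*\<Lambda>)) * s\<^sup>2 + (\<Lambda>/2) * t\<^sup>2" for s t :: real
    proof -
      have "0 \<le> (s - \<Lambda> * t)\<^sup>2 / (2 * \<Lambda>)" using L by simp
      also have "\<dots> = (1/(2*\<Lambda>)) * s\<^sup>2 + (\<Lambda>/2) * t\<^sup>2 - s * t"
        using L by (simp add: power2_eq_square field_simps)
      finally show ?thesis by simp
    qed
    have "V x * (w x * q x) \<le> V x * ((1/(2*\<Lambda>)) * (w x)\<^sup>2 + (\<Lambda>/2) * (q x)\<^sup>2)"
      by (intro mult_left_mono ag V_nonneg x)
    with ag[of "w' x" "q' x"]
    have "w' x * q' x + V x * (w x * q x) \<le> ((1/(2*\<Lambda>)) * (w' x)\<^sup>2 + (\<Lambda>/2) * (q' x)\<^sup>2) + V x * ((1/(2*\<Lambda>)) * (w x)\<^sup>2 + (\<Lambda>/2) * (q x)\<^sup>2)"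
      by (rule add_mono)
    also have "\<dots> = (1/(2*\<Lambda>)) * ((w' x)\<^sup>2 + V x * (w x)\<^sup>2) + (\<Lambda>/2) * ((q' x)\<^sup>2 + V x * (q x)\<^sup>2)"
      by (simp add: distrib_left mult_ac)
    finally show "w' x * q' x + V x * w x * q x \<le> (1/(2*\<Lambda>)) * ((w' x)\<^sup>2 + V x * (w x)\<^sup>2) + (\<Lambda>/2) * ((q' x)\<^sup>2 + V x * (q x)\<^sup>2)"
      by (simp only: mult.assoc)
  qed
  also have "\<dots> = integral {-1..1} (\<lambda>x. (1/(2*\<Lambda>)) * ((w' x)\<^sup>2 + V x * (w x)\<^sup>2)) + integral {-1..1} (\<lambda>x. (\<Lambda>/2) * ((q' x)\<^sup>2 + V x * (q x)\<^sup>2))"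
    by (rule integral_add[OF integrable_on_mult_right[OF iW] integrable_on_mult_right[OF iq]])
  also have "\<dots> = (1/(2*\<Lambda>)) * ?W + (\<Lambda>/2) * integral {-1..1} (\<lambda>x. (q' x)\<^sup>2 + V x * (q x)\<^sup>2)"
    by (simp only: integral_mult_right)
  also have "\<dots> \<le> (1/(2*\<Lambda>)) * ?W + (\<Lambda>/2) * (?R / \<Lambda>)"
    using Eq L by (intro add_left_mono mult_left_mono) auto
  also have "\<dots> = (1/(2*\<Lambda>)) * ?W + ?R / 2" using L by simp
  finally have "integral {-1..1} (\<lambda>x. w x * r x) \<le> (1/(2*\<Lambda>)) * ?W + ?R / 2" unfolding wr .
  moreover have "integral {-1..1} (\<lambda>x. w x * r x) = ?R"
  proof -
    have "?R = integral {-1..1} (\<lambda>x. (1 * w x + (-1) * uu ?J (cf w) 0 x) * r x)"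
      by (simp add: power2_eq_square r_def)
    also have "\<dots> = 1 * integral {-1..1} (\<lambda>x. w x * r x) + (-1) * integral {-1..1} (\<lambda>x. uu ?J (cf w) 0 x * r x)"
      by (rule integral_L2_lincomb[OF H(6) uu_L2 rL])
    also have "integral {-1..1} (\<lambda>x. uu ?J (cf w) 0 x * r x) = integral {-1..1} (\<lambda>x. r x * uu ?J (cf w) 0 x)"
      by (simp only: mult.commute)
    also have "\<dots> = (\<Sum>k\<in>?J. cf w k * exp (- (k * 0)) * cf r k)" by (rule integral_mult_uu[OF rL J(1)])
    also have "\<dots> = 0" by (intro sum.neutral ballI) (simp only: cfr mult_zero_right)
    finally show ?thesis by simp
  qed
  ultimately have "?R \<le> (1/(2*\<Lambda>)) * ?W + ?R / 2" by simp
  then have "?R \<le> ?W / \<Lambda>" by (simp add: field_simps)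
  then show ?thesis by (simp only: Q)
qed

lemma complete_for_H10:
  assumes "H10_deriv w w'"
  shows "complete_for w"
  unfolding complete_for_def
proof (intro allI impI)
  fix \<epsilon> :: real assume e: "0 < \<epsilon>"
  let ?W = "integral {-1..1} (\<lambda>x. (w' x)\<^sup>2 + V x * (w x)\<^sup>2)"
  define \<Lambda> where "\<Lambda> = (\<bar>?W\<bar> + 1) / \<epsilon>"
  have L: "0 < \<Lambda>" using e by (simp add: \<Lambda>_def)
  have "defect {l \<in> E. l \<le> \<Lambda>} w \<le> ?W / \<Lambda>" by (rule H10_defect_le[OF assms L])
  also have "\<dots> < \<epsilon>"
  proof -
    have "?W < \<epsilon> * \<Lambda>" using e by (simp add: \<Lambda>_def)
    then show ?thesis using L by (simp add: pos_divide_less_eq)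
  qed
  finally show "\<exists>J. finite J \<and> J \<subseteq> E \<and> defect J w < \<epsilon>" using finite_eig by (intro exI[of _ "{l \<in> E. l \<le> \<Lambda>}"]) auto
qed

lemma complete_for_limit:
  assumes f: "L2 f" and app: "\<And>\<epsilon>. 0 < \<epsilon> \<Longrightarrow> \<exists>w. L2 w \<and> complete_for w \<and> integral {-1..1} (\<lambda>x. (f x - w x)\<^sup>2) < \<epsilon>"
  shows "complete_for f"
  unfolding complete_for_def
proof (intro allI impI)
  fix \<epsilon> :: real assume e: "0 < \<epsilon>"
  obtain w where w: "L2 w" "complete_for w" "integral {-1..1} (\<lambda>x. (f x - w x)\<^sup>2) < \<epsilon> / 4" using app[of "\<epsilon> / 4"] e by auto
  obtain J where J: "finite J" "J \<subseteq> E" "defect J w < \<epsilon> / 4" using w(2) e unfolding complete_for_def by (metis divide_pos_pos zero_less_numeral)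
  have "defect J f < \<epsilon>" using defect_add_le[OF f w(1) J(1,2)] w(3) J(3) by linarith
  then show "\<exists>J. finite J \<and> J \<subseteq> E \<and> defect J f < \<epsilon>" using J by blast
qed

end

section \<open>Spectral representation of weak solutions\<close>

lemma AE_lborel_interval_point:
  fixes p q :: real
  assumes "AE x in lborel. P x" "p < q"
  shows "\<exists>x. p < x \<and> x < q \<and> P x"
proof (rule ccontr)
  assume "\<not> ?thesis"
  then have sub: "{p<..<q} \<subseteq> {x. \<not> P x}" by auto
  obtain N where N: "{x \<in> space lborel. \<not> P x} \<subseteq> N" "emeasure lborel N = 0" "N \<in> sets lborel"
    using assms(1) by (rule AE_E)
  have "emeasure lborel {p<..<q} \<le> emeasure lborel N"
    using sub N by (intro emeasure_mono) auto
  then show False using N(2) assms(2) by simp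
qed

lemma L2_cong:
  assumes "\<And>x. x \<in> {-1..1} \<Longrightarrow> f x = g x" "L2 g"
  shows "L2 f"
proof -
  have "(\<lambda>x. indicat_real {-1..1} x *\<^sub>R f x) = (\<lambda>x. indicat_real {-1..1} x *\<^sub>R g x)"
    "(\<lambda>x. indicat_real {-1..1} x *\<^sub>R (f x)\<^sup>2) = (\<lambda>x. indicat_real {-1..1} x *\<^sub>R (g x)\<^sup>2)"
    using assms(1) by (auto simp: indicator_def)
  then show ?thesis using assms(2) by (simp add: L2_def set_borel_measurable_def set_integrable_def)
qed

text \<open>Truncation to [-1,1] is needed because solutions must be Borel measurable on the whole
  plane, whereas the shooting function is uncontrolled outside the interval.\<close>

lemma H10_deriv_of_C1:
  assumes u: "\<And>x. x \<in> {-1..1} \<Longrightarrow> (u has_real_derivative u' x) (at x within {-1..1})"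
    and u': "continuous_on {-1..1} u'" and bc: "u (-1) = 0" "u 1 = 0"
  shows "H10_deriv (\<lambda>x. indicat_real {-1..1} x * u x) (\<lambda>x. indicat_real {-1..1} x * u' x)"
  unfolding H10_deriv_def
proof (intro conjI ballI)
  show "L2 (\<lambda>x. indicat_real {-1..1} x * u' x)" by (rule L2_cong[OF _ L2_cont[OF u']]) simp
  fix x :: real assume x: "x \<in> {-1..1}"
  have c: "continuous_on {-1..x} (\<lambda>x. indicat_real {-1..1} x * u' x)"
    using continuous_on_subset[OF u', of "{-1..x}"] x by (rule_tac continuous_on_eq[where f = u']) auto
  have "(LBINT y=ereal (-1)..ereal x. indicat_real {-1..1} y * u' y) = integral {-1..x} (\<lambda>y. indicat_real {-1..1} y * u' y)"
    by (rule interval_integral_eq_integral) (use x c borel_integrable_atLeastAtMost' in auto)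
  also have "\<dots> = integral {-1..x} u'" by (rule integral_cong) (use x in auto)
  also have "(u' has_integral (u x - u (-1))) {-1..x}"
    by (rule ftc) (use x in \<open>auto intro!: has_field_derivative_subset[OF u]\<close>)
  then have "integral {-1..x} u' = u x" using bc by (simp add: integral_unique)
  finally show "indicat_real {-1..1} x * u x = (LBINT y=-1..ereal x. indicat_real {-1..1} y * u' y)"
    using x by (simp add: one_ereal_def)
qed (simp add: bc)

lemma borel_measurable_clamped:
  fixes f :: "real \<Rightarrow> real"
  assumes "continuous_on {-1..1} f"
  shows "(\<lambda>x. indicat_real {-1..1} x * f x) \<in> borel_measurable borel"
  using borel_measurable_continuous_on_indicator[of "{-1..1}" f] assms by simp

context sturm
begin

definition dphi :: "real \<Rightarrow> real \<Rightarrow> real" where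
  "dphi k x = dy k x / sqrt (nrm k)"

lemma phi_deriv:
  assumes "x \<in> {-1..1}"
  shows "(phi k has_real_derivative dphi k x) (at x within {-1..1})"
    "(dphi k has_real_derivative (V x - k) * phi k x) (at x within {-1..1})"
  using DERIV_cdivide[OF y_deriv[OF assms], of k "sqrt (nrm k)"] DERIV_cdivide[OF dy_deriv[OF assms], of k "sqrt (nrm k)"]
  by (simp_all add: phi_def[abs_def] dphi_def[abs_def])

lemma dphi_cont: "continuous_on {-1..1} (dphi k)"
  by (rule DERIV_continuous_on[OF phi_deriv(2)])

lemma phi_bc: "phi k (-1) = 0" "k \<in> E \<Longrightarrow> phi k 1 = 0"
  by (auto simp: phi_def E_def)

lemma cf_sq_le:
  assumes "L2 f" "k \<in> E"
  shows "(cf f k)\<^sup>2 \<le> integral {-1..1} (\<lambda>x. (f x)\<^sup>2)"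
  using defect_nonneg[OF assms(1), of "{k}"] assms(2) by (simp add: defect_def)

lemma cf_diff:
  assumes "L2 f" "L2 g"
  shows "cf (\<lambda>x. f x - g x) k = cf f k - cf g k"
  using integral_L2_lincomb[OF assms L2_cont[OF phi_cont], of 1 "-1" k] by (simp add: cf_def)

lemma weak_form_eig:
  assumes k: "k \<in> E" and w: "H10_deriv w w'"
  shows "integral {-1..1} (\<lambda>x. w' x * dphi k x + V x * w x * phi k x) = k * cf w k"
proof -
  note H = H10_D[OF w]
  have Vw: "L2 (\<lambda>x. V x * w x)" by (intro L2_cont continuous_intros V_cont H)
  have "integral {-1..1} (\<lambda>x. w' x * dphi k x) = - integral {-1..1} (\<lambda>x. w x * ((V x - k) * phi k x))"
    by (rule H10_by_parts[OF w phi_deriv(2)]) (assumption, intro continuous_intros V_cont phi_cont)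
  moreover have "integral {-1..1} (\<lambda>x. w x * ((V x - k) * phi k x)) = integral {-1..1} (\<lambda>x. (1 * (V x * w x) + (- k) * w x) * phi k x)"
    by (intro integral_cong) (simp add: algebra_simps)
  moreover have "\<dots> = 1 * integral {-1..1} (\<lambda>x. V x * w x * phi k x) + (- k) * integral {-1..1} (\<lambda>x. w x * phi k x)"
    by (rule integral_L2_lincomb[OF Vw H(6) L2_cont[OF phi_cont]])
  moreover have "integral {-1..1} (\<lambda>x. w' x * dphi k x + V x * w x * phi k x)
      = integral {-1..1} (\<lambda>x. w' x * dphi k x) + integral {-1..1} (\<lambda>x. V x * w x * phi k x)"
    by (rule integral_add[OF L2_integrable[OF H(1) L2_cont[OF dphi_cont]] L2_integrable[OF Vw L2_cont[OF phi_cont]]])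
  ultimately show ?thesis by (simp add: cf_def)
qed

text \<open>Testing with the eigenfunction turns the weak formulation into c(t) = c0 - k times the
  primitive of c. Continuity in L^2 makes c continuous, so this integral equation can be
  differentiated.\<close>

lemma weak_sol_coefficients:
  assumes Vn: "\<And>x. x \<in> {-1..1} \<Longrightarrow> V x = (real n * pi)\<^sup>2 * \<bar>x\<bar> powr (2 * \<gamma>)"
    and ws: "weak_sol \<gamma> n T g0 g" and k: "k \<in> E" and T: "0 < T" and t: "t \<in> {0..T}"
  shows "cf (g t) k = cf (g 0) k * exp (- (k * t))"
proof -
  let ?\<phi> = "\<lambda>x. indicat_real {-1..1} x * phi k x" and ?\<psi> = "\<lambda>x. indicat_real {-1..1} x * dphi k x"
  have m1: "case_prod g \<in> borel_measurable (borel \<Otimes>\<^sub>M borel)" and gL: "\<And>t. t \<in> {0..T} \<Longrightarrow> L2 (g t)"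
    and gc: "\<And>t. t \<in> {0..T} \<Longrightarrow> ((\<lambda>s. LBINT x=-1..1. (g s x - g t x)\<^sup>2) \<longlongrightarrow> 0) (at t within {0..T})"
    using ws unfolding weak_sol_def borel_prod by auto
  obtain gx where m2: "case_prod gx \<in> borel_measurable (borel \<Otimes>\<^sub>M borel)"
    and gxH: "AE t in lborel. t \<in> {0..T} \<longrightarrow> H10_deriv (g t) (gx t)"
    and id: "\<And>\<phi> \<psi> t. H10_deriv \<phi> \<psi> \<Longrightarrow> t \<in> {0..T} \<Longrightarrow>
                (LBINT x=-1..1. g t x * \<phi> x) - (LBINT x=-1..1. g0 x * \<phi> x)
                + (LBINT s=0..ereal t. (LBINT x=-1..1.
                     gx s x * \<psi> x + (real n * pi)^2 * \<bar>x\<bar> powr (2*\<gamma>) * g s x * \<phi> x)) = 0"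
    using ws unfolding weak_sol_def borel_prod by blast
  define c where "c s = cf (g s) k" for s
  have cc: "continuous_on {0..T} c"
    unfolding continuous_on_def
  proof
    fix t assume t: "t \<in> {0..T}"
    have "((\<lambda>s. c s - c t) \<longlongrightarrow> 0) (at t within {0..T})"
    proof (rule Lim_null_comparison)
      show "\<forall>\<^sub>F s in at t within {0..T}. norm (c s - c t) \<le> sqrt (LBINT x=-1..1. (g s x - g t x)\<^sup>2)"
        unfolding eventually_at_filter
      proof (rule always_eventually, intro allI impI)
        fix s assume s: "s \<in> {0..T}"
        have d: "L2 (\<lambda>x. g s x - g t x)" by (rule L2_diff[OF gL[OF s] gL[OF t]])
        have "(c s - c t)\<^sup>2 \<le> integral {-1..1} (\<lambda>x. (g s x - g t x)\<^sup>2)"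
          using cf_sq_le[OF d k] unfolding cf_diff[OF gL[OF s] gL[OF t]] c_def .
        also have "\<dots> = (LBINT x=-1..1. (g s x - g t x)\<^sup>2)" by (rule L2_LBINT_sq[OF d, symmetric])
        finally show "norm (c s - c t) \<le> sqrt (LBINT x=-1..1. (g s x - g t x)\<^sup>2)"
          using real_le_rsqrt[of "\<bar>c s - c t\<bar>"] by simp
      qed
      show "((\<lambda>s. sqrt (LBINT x=-1..1. (g s x - g t x)\<^sup>2)) \<longlongrightarrow> 0) (at t within {0..T})"
        using tendsto_real_sqrt[OF gc[OF t]] by simp
    qed
    then show "(c \<longlongrightarrow> c t) (at t within {0..T})" by (simp add: LIM_zero_iff)
  qed
  define F where "F s = (LBINT x=-1..1. gx s x * ?\<psi> x + (real n * pi)^2 * \<bar>x\<bar> powr (2*\<gamma>) * g s x * ?\<phi> x)" for s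
  \<comment> \<open>The slices lie in the form domain only for almost every time. Measurability of F
    permits its replacement by k c(s) under the time integral.\<close>
  have Fm: "F \<in> borel_measurable borel"
  proof -
    note [measurable] = m1 m2 borel_measurable_clamped[OF phi_cont, of k] borel_measurable_clamped[OF dphi_cont, of k]
    show ?thesis
      unfolding F_def[abs_def] interval_lebesgue_integral_def set_lebesgue_integral_def by measurable
  qed
  have Fae: "AE s in lborel. s \<in> {0..T} \<longrightarrow> F s = k * c s"
    using gxH
  proof eventually_elim
    case (elim s)
    show ?case
    proof
      assume s: "s \<in> {0..T}"
      with elim have H: "H10_deriv (g s) (gx s)" by simp
      note HH = H10_D[OF H]
      have L: "L2 ?\<psi>" "L2 (\<lambda>x. (real n * pi)^2 * \<bar>x\<bar> powr (2*\<gamma>) * ?\<phi> x)"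
        by (rule L2_cong[OF _ L2_cont[OF dphi_cont[of k]]], simp)
           (rule L2_cong[where g = "\<lambda>x. V x * phi k x"], simp add: Vn, intro L2_cont continuous_intros V_cont phi_cont)
      have "set_integrable lborel {-1..1} (\<lambda>x. gx s x * ?\<psi> x + g s x * ((real n * pi)^2 * \<bar>x\<bar> powr (2*\<gamma>) * ?\<phi> x))"
        by (rule set_integral_add(1)[OF L2_mult[OF HH(1) L(1)] L2_mult[OF gL[OF s] L(2)]])
      moreover have e: "(\<lambda>x. gx s x * ?\<psi> x + g s x * ((real n * pi)^2 * \<bar>x\<bar> powr (2*\<gamma>) * ?\<phi> x))
          = (\<lambda>x. gx s x * ?\<psi> x + (real n * pi)^2 * \<bar>x\<bar> powr (2*\<gamma>) * g s x * ?\<phi> x)"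
        by (rule ext) (simp only: mult_ac)
      ultimately have "F s = integral {-1..1} (\<lambda>x. gx s x * ?\<psi> x + (real n * pi)^2 * \<bar>x\<bar> powr (2*\<gamma>) * g s x * ?\<phi> x)"
        unfolding F_def by (intro LBINT_eq_integral) simp
      also have "\<dots> = integral {-1..1} (\<lambda>x. gx s x * dphi k x + V x * g s x * phi k x)"
        by (intro integral_cong) (simp add: Vn)
      also have "\<dots> = k * c s" unfolding c_def by (rule weak_form_eig[OF k H])
      finally show "F s = k * c s" .
    qed
  qed
  have LI: "(LBINT s=0..ereal t. F s) = integral {0..t} (\<lambda>s. k * c s)" if t: "t \<in> {0..T}" for t
  proof -
    let ?G = "\<lambda>s. indicat_real {0..T} s * (k * c s)"
    have Gm: "?G \<in> borel_measurable borel"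
      using borel_measurable_continuous_on_indicator[of "{0..T}" "\<lambda>s. k * c s"] cc
      by (simp add: continuous_intros)
    have "(LBINT s=ereal 0..ereal t. F s) = (LBINT s=ereal 0..ereal t. ?G s)"
    proof (rule interval_integral_cong_AE[OF Fm Gm])
      show "AE s \<in> einterval (min (ereal 0) (ereal t)) (max (ereal 0) (ereal t)) in lborel. F s = ?G s"
        using Fae
      proof eventually_elim
        case (elim s)
        then show ?case using t by (auto simp: einterval_iff min_def max_def)
      qed
    qed
    also have "\<dots> = integral {0..t} ?G"
    proof (rule interval_integral_eq_integral)
      have "continuous_on {0..t} (\<lambda>s. k * c s)" using t by (intro continuous_intros continuous_on_subset[OF cc]) auto
      then have "continuous_on {0..t} ?G" by (rule continuous_on_eq) (use t in auto)
      then show "set_integrable lborel {0..t} ?G" by (rule borel_integrable_atLeastAtMost')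
    qed (use t in auto)
    also have "\<dots> = integral {0..t} (\<lambda>s. k * c s)" by (rule integral_cong) (use t in auto)
    finally show ?thesis by (simp add: zero_ereal_def)
  qed
  have H\<phi>: "H10_deriv ?\<phi> ?\<psi>"
    by (rule H10_deriv_of_C1[OF phi_deriv(1) dphi_cont phi_bc(1) phi_bc(2)[OF k]])
  have \<phi>L: "L2 ?\<phi>" by (rule L2_cong[OF _ L2_cont[OF phi_cont[of k]]]) simp
  have cL: "(LBINT x=-1..1. g t x * ?\<phi> x) = c t" if t: "t \<in> {0..T}" for t
    unfolding L2_LBINT[OF gL[OF t] \<phi>L] c_def cf_def by (rule integral_cong) simp
  define c0 where "c0 = (LBINT x=-1..1. g0 x * ?\<phi> x)"
  have eq: "c t = c0 - integral {0..t} (\<lambda>s. k * c s)" if t: "t \<in> {0..T}" for t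
    using id[OF H\<phi> t] LI[OF t] cL[OF t] unfolding F_def c0_def by simp
  have dc: "(c has_real_derivative - (k * c t)) (at t within {0..T})" if t: "t \<in> {0..T}" for t
  proof -
    have "((\<lambda>t. c0 - integral {0..t} (\<lambda>s. k * c s)) has_real_derivative - (k * c t)) (at t within {0..T})"
      by (auto intro!: derivative_eq_intros integral_has_real_derivative continuous_intros cc t simp del: atLeastAtMost_iff)
    then show ?thesis
      unfolding has_field_derivative_def by (rule has_derivative_transform[OF t, rotated]) (rule eq)
  qed
  have "((\<lambda>s. 0) has_integral (c t * exp (k * t) - c 0 * exp (k * 0))) {0..t}"
  proof (rule ftc[where F = "\<lambda>s. c s * exp (k * s)" and f = "\<lambda>s. 0"])
    fix s assume s: "s \<in> {0..t}"
    have "(c has_real_derivative - (k * c s)) (at s within {0..t})"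
      by (rule has_field_derivative_subset[OF dc]) (use s t in auto)
    then show "((\<lambda>s. c s * exp (k * s)) has_real_derivative 0) (at s within {0..t})"
      by (auto intro!: derivative_eq_intros)
  qed (use t in auto)
  then have "c t * exp (k * t) - c 0 * exp (k * 0) = 0" using has_integral_unique[OF _ has_integral_0] by blast
  then have "c t * exp (k * t) = c 0" by simp
  then have "c t * exp (k * t) * exp (- (k * t)) = c 0 * exp (- (k * t))" by simp
  then show ?thesis by (simp add: c_def mult.assoc exp_add[symmetric])
qed

text \<open>A given slice need not belong to H^1_0, but arbitrarily close times have slices that do,
  and continuity in L^2 carries completeness over.\<close>

lemma weak_sol_complete:
  assumes ws: "weak_sol \<gamma> n T g0 g" and T: "0 < T" and t: "t \<in> {0..T}"
  shows "complete_for (g t)"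
proof -
  have gL: "\<And>t. t \<in> {0..T} \<Longrightarrow> L2 (g t)"
    and gc: "\<And>t. t \<in> {0..T} \<Longrightarrow> ((\<lambda>s. LBINT x=-1..1. (g s x - g t x)\<^sup>2) \<longlongrightarrow> 0) (at t within {0..T})"
    using ws unfolding weak_sol_def by auto
  obtain gx where gxH: "AE t in lborel. t \<in> {0..T} \<longrightarrow> H10_deriv (g t) (gx t)"
    using ws unfolding weak_sol_def by blast
  show ?thesis
  proof (rule complete_for_limit[OF gL[OF t]])
    fix \<epsilon> :: real assume e: "0 < \<epsilon>"
    have "\<forall>\<^sub>F s in at t within {0..T}. dist (LBINT x=-1..1. (g s x - g t x)\<^sup>2) 0 < \<epsilon>"
      using gc[OF t] e by (rule tendstoD)
    then obtain d where d: "0 < d" "\<And>s. s \<in> {0..T} \<Longrightarrow> s \<noteq> t \<Longrightarrow> dist s t < d \<Longrightarrow> dist (LBINT x=-1..1. (g s x - g t x)\<^sup>2) 0 < \<epsilon>"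
      unfolding eventually_at by blast
    \<comment> \<open>An interval of admissible times on one side of t, to the left when t = T; a
      property valid almost everywhere holds at some point of it.\<close>
    obtain p q where pq: "p < q" "{p<..<q} \<subseteq> {0..T}" "\<And>s. s \<in> {p<..<q} \<Longrightarrow> s \<noteq> t \<and> dist s t < d"
    proof (cases "t < T")
      case True
      show thesis by (rule that[of t "min T (t + d)"]) (use True d t in \<open>auto simp: dist_real_def\<close>)
    next
      case False
      show thesis by (rule that[of "max 0 (t - d)" t]) (use False d t T in \<open>auto simp: dist_real_def\<close>)
    qed
    obtain s where s: "p < s" "s < q" "s \<in> {0..T} \<longrightarrow> H10_deriv (g s) (gx s)"
      using AE_lborel_interval_point[OF gxH pq(1)] by blast
    have sT: "s \<in> {0..T}" using s pq by auto
    have H: "H10_deriv (g s) (gx s)" using s sT by simp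
    have "dist (LBINT x=-1..1. (g s x - g t x)\<^sup>2) 0 < \<epsilon>" using d(2)[OF sT] pq(3)[of s] s by auto
    moreover have "(LBINT x=-1..1. (g s x - g t x)\<^sup>2) = integral {-1..1} (\<lambda>x. (g t x - g s x)\<^sup>2)"
      unfolding L2_LBINT_sq[OF L2_diff[OF gL[OF sT] gL[OF t]]] by (simp add: power2_commute)
    ultimately have "integral {-1..1} (\<lambda>x. (g t x - g s x)\<^sup>2) < \<epsilon>" by (simp add: dist_real_def)
    then show "\<exists>w. L2 w \<and> complete_for w \<and> integral {-1..1} (\<lambda>x. (g t x - w x)\<^sup>2) < \<epsilon>"
      using complete_for_H10[OF H] gL[OF sT] by blast
  qed
qed

section \<open>From finite eigenfunction sums to weak solutions\<close>

definition spectral_sol :: "real \<Rightarrow> (real \<Rightarrow> real \<Rightarrow> real) \<Rightarrow> bool" where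
  "spectral_sol T g \<longleftrightarrow> (\<forall>t\<in>{0..T}. L2 (g t) \<and> complete_for (g t) \<and>
      (\<forall>k\<in>E. cf (g t) k = cf (g 0) k * exp (- (k * t))))"

lemma spectral_solD:
  assumes "spectral_sol T g" "t \<in> {0..T}"
  shows "L2 (g t)" "complete_for (g t)" "k \<in> E \<Longrightarrow> cf (g t) k = cf (g 0) k * exp (- (k * t))"
  using assms unfolding spectral_sol_def by blast+

text \<open>Each squared coefficient decreases in time, and completeness of the later slice bounds
  its defect by finitely many of them. With I empty this is the decay of the norm; with a fixed I it
  gives an approximation uniform in time.\<close>

lemma spectral_sol_defect:
  assumes g: "spectral_sol T g" and st: "0 \<le> s" "s \<le> t" "t \<le> T" and I: "finite I" "I \<subseteq> E"
  shows "defect I (g t) \<le> defect I (g s)"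
proof (rule field_le_epsilon)
  fix \<epsilon> :: real assume e: "0 < \<epsilon>"
  have gs: "L2 (g s)" "L2 (g t)" "complete_for (g t)"
    by (rule spectral_solD[OF g], use st in simp)+
  obtain J0 where J0: "finite J0" "J0 \<subseteq> E" "defect J0 (g t) < \<epsilon>" using gs(3) e unfolding complete_for_def by (elim allE[of _ \<epsilon>]) auto
  define J where "J = J0 \<union> I"
  have J: "finite J" "J \<subseteq> E" "I \<subseteq> J" using J0 I by (auto simp: J_def)
  have d1: "defect J (g t) < \<epsilon>" using defect_mono[OF J(1), of J0 "g t"] J0(3) unfolding J_def by simp
  have dd: "defect I f = defect J f + (\<Sum>k\<in>J-I. (cf f k)\<^sup>2)" for f
    unfolding defect_def using sum.subset_diff[OF J(3,1), of "\<lambda>k. (cf f k)\<^sup>2"] by simp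
  have d2: "(\<Sum>k\<in>J-I. (cf (g t) k)\<^sup>2) \<le> (\<Sum>k\<in>J-I. (cf (g s) k)\<^sup>2)"
  proof (rule sum_mono)
    fix k assume "k \<in> J - I"
    then have k: "k \<in> E" using J by auto
    have k0: "0 < k" using eig_ge[OF k] by simp
    have "cf (g t) k = cf (g 0) k * exp (- (k * t))" "cf (g s) k = cf (g 0) k * exp (- (k * s))"
      by (rule spectral_solD(3)[OF g _ k], use st in simp)+
    moreover have "exp (- (k * t)) \<le> exp (- (k * s))" using k0 st by simp
    moreover have "(cf (g 0) k)\<^sup>2 * (exp (- (k * t)))\<^sup>2 \<le> (cf (g 0) k)\<^sup>2 * (exp (- (k * s)))\<^sup>2"
      if "exp (- (k * t)) \<le> exp (- (k * s))"
      using that by (intro mult_left_mono power_mono) auto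
    ultimately show "(cf (g t) k)\<^sup>2 \<le> (cf (g s) k)\<^sup>2"
      by (simp only: power_mult_distrib)
  qed
  have "0 \<le> defect J (g s)" by (rule defect_nonneg[OF gs(1) J(1,2)])
  then show "defect I (g t) \<le> defect I (g s) + \<epsilon>" unfolding dd[of "g t"] dd[of "g s"] using d1 d2 by linarith
qed

lemma spectral_sol_norm_mono:
  assumes "spectral_sol T g" "0 \<le> s" "s \<le> t" "t \<le> T"
  shows "integral {-1..1} (\<lambda>x. (g t x)\<^sup>2) \<le> integral {-1..1} (\<lambda>x. (g s x)\<^sup>2)"
  using spectral_sol_defect[OF assms, of "{}"] by (simp add: defect_def)

text \<open>Joint measurability makes the local mass measurable in t, and decay of the norm bounds
  it by the initial energy.\<close>

lemma local_mass_integrable: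
  assumes g: "spectral_sol T g" and gm: "case_prod g \<in> borel_measurable borel"
    and ab: "-1 \<le> a" "a \<le> b" "b \<le> 1" and T: "0 \<le> T"
  shows "(\<lambda>t. integral {a..b} (\<lambda>x. (g t x)\<^sup>2)) integrable_on {0..T}"
    and "(LBINT t=0..ereal T. (LBINT x=ereal a..ereal b. (g t x)\<^sup>2)) = integral {0..T} (\<lambda>t. integral {a..b} (\<lambda>x. (g t x)\<^sup>2))"
proof -
  define G where "G t = (LBINT x=ereal a..ereal b. (g t x)\<^sup>2)" for t
  have Gm: "G \<in> borel_measurable borel"
  proof -
    have [measurable]: "case_prod g \<in> borel_measurable (borel \<Otimes>\<^sub>M borel)" using gm by (simp add: borel_prod)
    show ?thesis unfolding G_def[abs_def] interval_lebesgue_integral_def set_lebesgue_integral_def by measurable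
  qed
  have GI: "G t = integral {a..b} (\<lambda>x. (g t x)\<^sup>2)" if t: "t \<in> {0..T}" for t
  proof -
    have si: "set_integrable lborel {-1..1} (\<lambda>x. (g t x)\<^sup>2)"
      using spectral_solD(1)[OF g t] by (simp add: L2_def)
    have "set_integrable lborel {a..b} (\<lambda>x. (g t x)\<^sup>2)"
      by (rule set_integrable_subset[OF si]) (use ab in auto)
    then show ?thesis unfolding G_def by (intro interval_integral_eq_integral ab)
  qed
  define N where "N = integral {-1..1} (\<lambda>x. (g 0 x)\<^sup>2)"
  have Gb: "\<bar>G t\<bar> \<le> N" if t: "t \<in> {0..T}" for t
  proof -
    have L: "L2 (g t)" by (rule spectral_solD(1)[OF g t])
    have i: "(\<lambda>x. (g t x)\<^sup>2) integrable_on {a..b}"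
      using integrable_on_subinterval[OF L2_sq_integrable[OF L], of a b] ab by auto
    have "integral {a..b} (\<lambda>x. (g t x)\<^sup>2) \<le> integral {-1..1} (\<lambda>x. (g t x)\<^sup>2)"
      using ab by (intro integral_subset_le i L2_sq_integrable[OF L]) auto
    also have "\<dots> \<le> N" unfolding N_def using t by (intro spectral_sol_norm_mono[OF g]) auto
    finally show ?thesis using integral_nonneg[OF i] GI[OF t] by simp
  qed
  have SI: "set_integrable lborel {0..T} G"
    unfolding set_integrable_def
  proof (rule integrableI_bounded_set[where A = "{0..T}" and B = N])
    show "(\<lambda>x. indicat_real {0..T} x *\<^sub>R G x) \<in> borel_measurable lborel" using Gm by measurable
    show "AE x\<in>{0..T} in lborel. norm (indicat_real {0..T} x *\<^sub>R G x) \<le> N" using Gb by (intro AE_I2) auto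
  qed (use T in \<open>auto simp: indicator_def\<close>)
  have "(LBINT t=ereal 0..ereal T. G t) = integral {0..T} G" by (rule interval_integral_eq_integral[OF T SI])
  moreover have "integral {0..T} G = integral {0..T} (\<lambda>t. integral {a..b} (\<lambda>x. (g t x)\<^sup>2))"
    by (rule integral_cong) (rule GI)
  ultimately show "(LBINT t=0..ereal T. (LBINT x=ereal a..ereal b. (g t x)\<^sup>2)) = integral {0..T} (\<lambda>t. integral {a..b} (\<lambda>x. (g t x)\<^sup>2))"
    unfolding G_def by (simp add: zero_ereal_def)
  have "G integrable_on {0..T}" by (rule set_borel_integral_eq_integral(1)[OF SI])
  then show "(\<lambda>t. integral {a..b} (\<lambda>x. (g t x)\<^sup>2)) integrable_on {0..T}"
    by (rule integrable_eq) (rule GI)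
qed

text \<open>One finite set J chosen at time 0 serves all later times. The squared triangle
  inequality on (a,b) costs the factor 2.\<close>

lemma spectral_sol_observability:
  assumes g: "spectral_sol T g" and gm: "case_prod g \<in> borel_measurable borel" and T: "0 \<le> T"
    and ab: "-1 \<le> a" "a \<le> b" "b \<le> 1" and C: "0 \<le> C"
    and fin: "\<And>J c. finite J \<Longrightarrow> J \<subseteq> E \<Longrightarrow> (\<Sum>k\<in>J. (c k * exp (- (k * T)))\<^sup>2) \<le> C * obs a b T J c"
  shows "integral {-1..1} (\<lambda>x. (g T x)\<^sup>2) \<le> 2 * C * integral {0..T} (\<lambda>t. integral {a..b} (\<lambda>x. (g t x)\<^sup>2))"
proof (rule field_le_epsilon)
  fix \<delta> :: real assume \<delta>: "0 < \<delta>"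
  \<comment> \<open>The errors add up to \<epsilon> at the final time and 2CT\<epsilon> in the
    observation, normalised here to \<delta>.\<close>
  define \<epsilon> where "\<epsilon> = \<delta> / (2 * C * T + 1)"
  have K: "0 < 2 * C * T + 1" using C T by (simp add: add_nonneg_pos)
  have e: "0 < \<epsilon>" using \<delta> K by (simp add: \<epsilon>_def)
  have sub: "{a..b} \<subseteq> {-1..1}" using ab by auto
  let ?O = "integral {0..T} (\<lambda>t. integral {a..b} (\<lambda>x. (g t x)\<^sup>2))"
  obtain J where J: "finite J" "J \<subseteq> E" "defect J (g 0) < \<epsilon>"
    using spectral_solD(2)[OF g, of 0] T e unfolding complete_for_def by (auto elim!: allE[of _ \<epsilon>])
  define c where "c = cf (g 0)"
  have dt: "defect J (g t) < \<epsilon>" if "t \<in> {0..T}" for t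
    using spectral_sol_defect[OF g, of 0 t J] J that by auto
  have ct: "cf (g t) k = c k * exp (- (k * t))" if "t \<in> {0..T}" "k \<in> J" for t k
    unfolding c_def by (rule spectral_solD(3)[OF g that(1)]) (use J that in auto)
  have "obs a b T J c \<le> integral {0..T} (\<lambda>t. 2 * integral {a..b} (\<lambda>x. (g t x)\<^sup>2) + 2 * \<epsilon>)"
    unfolding obs_def
  proof (rule integral_le)
    show "(\<lambda>t. integral {a..b} (\<lambda>x. (uu J c t x)\<^sup>2)) integrable_on {0..T}"
      by (intro integrable_continuous_real local_mass_cont sub)
    show "(\<lambda>t. 2 * integral {a..b} (\<lambda>x. (g t x)\<^sup>2) + 2 * \<epsilon>) integrable_on {0..T}"
      by (rule integrable_add[OF integrable_on_mult_right[OF local_mass_integrable(1)[OF g gm ab T]] integrable_const_ivl])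
    fix t assume t: "t \<in> {0..T}"
    have L: "L2 (g t)" by (rule spectral_solD(1)[OF g t])
    have Ld: "L2 (\<lambda>x. g t x - uu J c t x)" by (rule L2_diff[OF L uu_L2])
    have ii: "(\<lambda>x. (f x)\<^sup>2) integrable_on {a..b}" if "L2 f" for f
      using integrable_on_subinterval[OF L2_sq_integrable[OF that] sub] .
    have "integral {a..b} (\<lambda>x. (uu J c t x)\<^sup>2) \<le> integral {a..b} (\<lambda>x. 2 * (g t x)\<^sup>2 + 2 * (g t x - uu J c t x)\<^sup>2)"
    proof (rule integral_le)
      fix x
      have "0 \<le> (2 * g t x - uu J c t x)\<^sup>2" by simp
      then show "(uu J c t x)\<^sup>2 \<le> 2 * (g t x)\<^sup>2 + 2 * (g t x - uu J c t x)\<^sup>2"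
        by (simp add: power2_eq_square algebra_simps)
    qed (rule ii[OF uu_L2], rule integrable_add[OF integrable_on_mult_right[OF ii[OF L]] integrable_on_mult_right[OF ii[OF Ld]]])
    also have "\<dots> = integral {a..b} (\<lambda>x. 2 * (g t x)\<^sup>2) + integral {a..b} (\<lambda>x. 2 * (g t x - uu J c t x)\<^sup>2)"
      by (rule integral_add[OF integrable_on_mult_right[OF ii[OF L]] integrable_on_mult_right[OF ii[OF Ld]]])
    also have "\<dots> = 2 * integral {a..b} (\<lambda>x. (g t x)\<^sup>2) + 2 * integral {a..b} (\<lambda>x. (g t x - uu J c t x)\<^sup>2)"
      by (simp only: integral_mult_right)
    also have "integral {a..b} (\<lambda>x. (g t x - uu J c t x)\<^sup>2) \<le> integral {-1..1} (\<lambda>x. (g t x - uu J c t x)\<^sup>2)"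
      by (rule integral_subset_le[OF sub ii[OF Ld] L2_sq_integrable[OF Ld]]) simp
    also have "\<dots> = defect J (g t)" by (rule distance_to_uu[OF L J(1,2) ct[OF t]])
    finally show "integral {a..b} (\<lambda>x. (uu J c t x)\<^sup>2) \<le> 2 * integral {a..b} (\<lambda>x. (g t x)\<^sup>2) + 2 * \<epsilon>"
      using dt[OF t] by linarith
  qed
  also have "\<dots> = integral {0..T} (\<lambda>t. 2 * integral {a..b} (\<lambda>x. (g t x)\<^sup>2)) + integral {0..T} (\<lambda>t. 2 * \<epsilon>)"
    by (rule integral_add[OF integrable_on_mult_right[OF local_mass_integrable(1)[OF g gm ab T]] integrable_const_ivl])
  also have "\<dots> = 2 * ?O + 2 * \<epsilon> * T" using T by simp
  finally have "C * obs a b T J c \<le> C * (2 * ?O + 2 * \<epsilon> * T)" using C by (rule mult_left_mono)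
  moreover have "(\<Sum>k\<in>J. (cf (g T) k)\<^sup>2) \<le> C * obs a b T J c"
    using fin[OF J(1,2), of c] ct[of T] T by simp
  moreover have "integral {-1..1} (\<lambda>x. (g T x)\<^sup>2) < (\<Sum>k\<in>J. (cf (g T) k)\<^sup>2) + \<epsilon>"
    using dt[of T] T by (simp add: defect_def)
  ultimately have "integral {-1..1} (\<lambda>x. (g T x)\<^sup>2) \<le> C * (2 * ?O + 2 * \<epsilon> * T) + \<epsilon>" by linarith
  also have "\<dots> = 2 * C * ?O + \<epsilon> * (2 * C * T + 1)" by (simp add: algebra_simps)
  also have "\<epsilon> * (2 * C * T + 1) = \<delta>" using K by (simp add: \<epsilon>_def)
  finally show "integral {-1..1} (\<lambda>x. (g T x)\<^sup>2) \<le> 2 * C * ?O + \<delta>" .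
qed

section \<open>Size and localisation of the first eigenvalue\<close>


lemma eig_ge_of_log_deriv:
  assumes k: "k \<in> E"
    and \<Phi>: "\<And>x. x \<in> {-1..1} \<Longrightarrow> (\<Phi> has_real_derivative \<Phi>' x) (at x within {-1..1})"
    and \<Phi>': "continuous_on {-1..1} \<Phi>'"
    and m: "\<And>x. x \<in> {-1..1} \<Longrightarrow> m \<le> \<Phi>' x - (\<Phi> x)\<^sup>2 + V x"
  shows "m \<le> k"
proof -
  note D = DA_D[OF DA_eig[OF k]]
  have "m * nrm k \<le> k * nrm k"
    using form_lower_bound[OF D(1) D(7) D(3) D(4) \<Phi> \<Phi>' m] unfolding eig_energy[OF k] nrm_def by simp
  then show ?thesis using nrm_pos[of k] by simp
qed

text \<open>The spectral gap read with an empty set of modes: if no eigenvalue were at most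
  \<Lambda>, orthogonality would be vacuous and any test function would satisfy the gap
  inequality.\<close>

lemma eig_exists_le:
  assumes u: "DA u u' h" and L: "0 < \<Lambda>"
    and lt: "integral {-1..1} (\<lambda>x. (h x)\<^sup>2) < \<Lambda>\<^sup>2 * integral {-1..1} (\<lambda>x. (u x)\<^sup>2)"
  shows "\<exists>l\<in>E. l \<le> \<Lambda>"
proof (rule ccontr)
  assume "\<not> ?thesis"
  then have "orth {l \<in> E. l \<le> \<Lambda>} h" unfolding orth_def by auto
  from spectral_gap[OF L refl u this] lt show False by simp
qed

text \<open>Where \<open>V\<close> exceeds the eigenvalue, \<open>w = y\<^sup>2\<close> satisfies \<open>w'' \<ge> k\<^sup>2 w\<close> and decreases, so \<open>w'\<^sup>2 - k\<^sup>2 w\<^sup>2\<close>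
  decreases to \<open>0\<close> at \<open>1\<close>.\<close>

lemma eig_decay:
  assumes l: "l \<in> E" and k: "0 \<le> k" and c: "-1 \<le> c"
    and big: "\<And>x. c \<le> x \<Longrightarrow> x \<le> 1 \<Longrightarrow> l + k\<^sup>2 / 2 \<le> V x"
    and zx: "c \<le> z" "z \<le> x" "x \<le> 1"
  shows "(y l x)\<^sup>2 \<le> exp (- (k * (x - z))) * (y l z)\<^sup>2"
proof -
  define w where "w s = (y l s)\<^sup>2" for s
  define w1 where "w1 s = 2 * y l s * dy l s" for s
  define w2 where "w2 s = 2 * (dy l s)\<^sup>2 + 2 * (V s - l) * (y l s)\<^sup>2" for s
  have dw: "(w has_real_derivative w1 s) (at s within {-1..1})" if "s \<in> {-1..1}" for s
    unfolding w_def[abs_def] w1_def by (auto intro!: derivative_eq_intros y_deriv[OF that])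
  have dw1: "(w1 has_real_derivative w2 s) (at s within {-1..1})" if "s \<in> {-1..1}" for s
    unfolding w1_def[abs_def] w2_def
    by (auto intro!: derivative_eq_intros y_deriv[OF that] dy_deriv[OF that] simp: power2_eq_square algebra_simps)
  have w1_1: "w1 1 = 0" "w 1 = 0" using l by (auto simp: w1_def w_def E_def)
  have w0: "0 \<le> w s" for s by (simp add: w_def)
  have w2ge: "k\<^sup>2 * w s \<le> w2 s" if "c \<le> s" "s \<le> 1" for s
  proof -
    have "k\<^sup>2 * (y l s)\<^sup>2 \<le> (2 * (V s - l)) * (y l s)\<^sup>2"
      using big[OF that] by (intro mult_right_mono) auto
    then show ?thesis by (simp add: w_def w2_def add_increasing)
  qed
  have w1neg: "w1 s \<le> 0" if s: "c \<le> s" "s \<le> 1" for s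
  proof -
    have "w1 s \<le> w1 1"
    proof (rule deriv_mono[where F = w1 and f = w2 and a = s and b = 1])
      fix r assume r: "r \<in> {s..1}"
      show "(w1 has_real_derivative w2 r) (at r within {s..1})"
        by (rule has_field_derivative_subset[OF dw1]) (use r s c in auto)
      have "0 \<le> k\<^sup>2 * w r" using w0[of r] by simp
      then show "0 \<le> w2 r" using w2ge[of r] r s by auto
    qed (use s in simp)
    then show ?thesis using w1_1 by simp
  qed
  have en: "k * w s \<le> - w1 s" if s: "c \<le> s" "s \<le> 1" for s
  proof -
    have "- ((w1 s)\<^sup>2 - k\<^sup>2 * (w s)\<^sup>2) \<le> - ((w1 1)\<^sup>2 - k\<^sup>2 * (w 1)\<^sup>2)"
    proof (rule deriv_mono[where F = "\<lambda>s. - ((w1 s)\<^sup>2 - k\<^sup>2 * (w s)\<^sup>2)" and a = s and b = 1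
        and f = "\<lambda>r. 2 * (- w1 r) * (w2 r - k\<^sup>2 * w r)"])
      fix r assume r: "r \<in> {s..1}"
      have 1: "(w1 has_real_derivative w2 r) (at r within {s..1})"
        by (rule has_field_derivative_subset[OF dw1]) (use r s c in auto)
      have 2: "(w has_real_derivative w1 r) (at r within {s..1})"
        by (rule has_field_derivative_subset[OF dw]) (use r s c in auto)
      show "((\<lambda>s. - ((w1 s)\<^sup>2 - k\<^sup>2 * (w s)\<^sup>2)) has_real_derivative 2 * (- w1 r) * (w2 r - k\<^sup>2 * w r)) (at r within {s..1})"
        by (auto intro!: derivative_eq_intros 1 2 simp: algebra_simps)
      show "0 \<le> 2 * (- w1 r) * (w2 r - k\<^sup>2 * w r)"
        using w1neg[of r] w2ge[of r] r s by (intro mult_nonneg_nonneg) auto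
    qed (use s in simp)
    then have "(k * w s)\<^sup>2 \<le> (- w1 s)\<^sup>2" using w1_1 by (simp add: power_mult_distrib)
    then show ?thesis by (rule power2_le_imp_le) (use w1neg[OF s] in simp)
  qed
  have "- (w z * exp (k * z)) \<le> - (w x * exp (k * x))"
  proof (rule deriv_mono[where F = "\<lambda>s. - (w s * exp (k * s))" and a = z and b = x
        and f = "\<lambda>r. (- w1 r - k * w r) * exp (k * r)"])
    fix r assume r: "r \<in> {z..x}"
    have 2: "(w has_real_derivative w1 r) (at r within {z..x})"
      by (rule has_field_derivative_subset[OF dw]) (use r zx c in auto)
    show "((\<lambda>s. - (w s * exp (k * s))) has_real_derivative (- w1 r - k * w r) * exp (k * r)) (at r within {z..x})"
      by (auto intro!: derivative_eq_intros 2 simp: algebra_simps)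
    show "0 \<le> (- w1 r - k * w r) * exp (k * r)"
      using en[of r] r zx by (intro mult_nonneg_nonneg) auto
  qed (use zx in simp)
  then have "w x * exp (k * x) \<le> w z * exp (k * z)" by simp
  then have "w x * exp (k * x) * exp (- (k * x)) \<le> w z * exp (k * z) * exp (- (k * x))"
    by (rule mult_right_mono) simp
  moreover have "w x * exp (k * x) * exp (- (k * x)) = w x"
    by (simp add: mult.assoc exp_add[symmetric])
  moreover have "w z * exp (k * z) * exp (- (k * x)) = exp (- (k * (x - z))) * w z"
  proof -
    have "exp (k * z) * exp (- (k * x)) = exp (- (k * (x - z)))"
      by (simp add: exp_add[symmetric] algebra_simps)
    then show ?thesis by (metis mult.assoc mult.commute)
  qed
  ultimately have "w x \<le> exp (- (k * (x - z))) * w z" by linarith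
  then show ?thesis by (simp only: w_def)
qed

text \<open>The value at x >= a is compared with the values on [a/2, 3a/4], which lie at distance at
  least a/4. Averaging there costs 4/a and uses that the eigenfunction has total mass 1.\<close>

lemma eig_local_mass_le:
  assumes l: "l \<in> E" and k: "0 \<le> k" and ab: "0 < a" "a < b" "b < 1"
    and big: "\<And>x. a / 2 \<le> x \<Longrightarrow> x \<le> 1 \<Longrightarrow> l + k\<^sup>2 / 2 \<le> V x"
  shows "integral {a..b} (\<lambda>x. (phi l x)\<^sup>2) \<le> 4 / a * exp (- (k * a / 4))"
proof -
  have sub: "{a..b} \<subseteq> {-1..1}" "{a/2..3*a/4} \<subseteq> {-1..1}" using ab by auto
  have pt: "(phi l x)\<^sup>2 \<le> 4 / a * exp (- (k * a / 4))" if x: "x \<in> {a..b}" for x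
  proof -
    have "a / 4 * (phi l x)\<^sup>2 = integral {a/2..3*a/4} (\<lambda>z. (phi l x)\<^sup>2)" using ab by simp
    also have "\<dots> \<le> integral {a/2..3*a/4} (\<lambda>z. exp (- (k * a / 4)) * (phi l z)\<^sup>2)"
    proof (intro integral_cont_mono continuous_intros phi_cont_sub sub)
      fix z assume z: "z \<in> {a/2..3*a/4}"
      have "(y l x)\<^sup>2 \<le> exp (- (k * (x - z))) * (y l z)\<^sup>2"
        by (rule eig_decay[where c = "a / 2", OF l k]) (use big z x ab in auto)
      also have "\<dots> \<le> exp (- (k * a / 4)) * (y l z)\<^sup>2"
      proof (intro mult_right_mono)
        have "k * (a / 4) \<le> k * (x - z)" using z x k by (intro mult_left_mono) auto
        then show "exp (- (k * (x - z))) \<le> exp (- (k * a / 4))" by simp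
      qed simp
      finally show "(phi l x)\<^sup>2 \<le> exp (- (k * a / 4)) * (phi l z)\<^sup>2"
        using nrm_pos[of l] by (simp add: phi_def power_divide divide_right_mono)
    qed
    also have "\<dots> = exp (- (k * a / 4)) * integral {a/2..3*a/4} (\<lambda>z. (phi l z)\<^sup>2)" by (rule integral_mult_right)
    also have "\<dots> \<le> exp (- (k * a / 4)) * 1"
    proof (intro mult_left_mono)
      have "integral {a/2..3*a/4} (\<lambda>z. (phi l z)\<^sup>2) \<le> integral {-1..1} (\<lambda>z. (phi l z)\<^sup>2)"
        by (intro integral_subset_le sub integrable_continuous_real continuous_intros phi_cont_sub) auto
      also have "\<dots> = 1" using phi_orth[OF l l] by (simp add: power2_eq_square)
      finally show "integral {a/2..3*a/4} (\<lambda>z. (phi l z)\<^sup>2) \<le> 1" .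
    qed simp
    finally show ?thesis using ab by (simp add: field_simps)
  qed
  have "integral {a..b} (\<lambda>x. (phi l x)\<^sup>2) \<le> integral {a..b} (\<lambda>x. 4 / a * exp (- (k * a / 4)))"
    by (intro integral_cont_mono continuous_intros phi_cont_sub sub pt) (use ab in auto)
  also have "\<dots> = (b - a) * (4 / a * exp (- (k * a / 4)))" using ab by simp
  also have "\<dots> \<le> 1 * (4 / a * exp (- (k * a / 4)))" using ab by (intro mult_right_mono) auto
  finally show ?thesis by simp
qed

section \<open>Weak solutions of the model problem\<close>

lemma weak_sol_spectral:
  assumes Vn: "\<And>x. x \<in> {-1..1} \<Longrightarrow> V x = (real n * pi)\<^sup>2 * \<bar>x\<bar> powr (2 * \<gamma>)"
    and ws: "weak_sol \<gamma> n T g0 g" and T: "0 < T"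
  shows "spectral_sol T g" "case_prod g \<in> borel_measurable borel"
proof -
  show "case_prod g \<in> borel_measurable borel" using ws by (simp add: weak_sol_def)
  have "\<And>t. t \<in> {0..T} \<Longrightarrow> L2 (g t)" using ws by (simp add: weak_sol_def)
  then show "spectral_sol T g"
    unfolding spectral_sol_def
    using weak_sol_complete[OF ws T] weak_sol_coefficients[OF Vn ws _ T] by blast
qed

lemma weak_sol_observability:
  assumes Vn: "\<And>x. x \<in> {-1..1} \<Longrightarrow> V x = (real n * pi)\<^sup>2 * \<bar>x\<bar> powr (2 * \<gamma>)"
    and ws: "weak_sol \<gamma> n T g0 g" and T: "0 < T"
    and ab: "-1 \<le> a" "a \<le> b" "b \<le> 1" and C: "0 \<le> C"
    and fin: "\<And>J c. finite J \<Longrightarrow> J \<subseteq> E \<Longrightarrow> (\<Sum>k\<in>J. (c k * exp (- (k * T)))\<^sup>2) \<le> C * obs a b T J c"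
  shows "(LBINT x=-1..1. (g T x)\<^sup>2) \<le> 2 * C * (LBINT t=0..ereal T. (LBINT x=ereal a..ereal b. (g t x)\<^sup>2))"
proof -
  have s1: "spectral_sol T g" by (rule weak_sol_spectral(1)[OF Vn ws T])
  have s2: "case_prod g \<in> borel_measurable borel" by (rule weak_sol_spectral(2)[OF Vn ws T])
  note s = s1 s2
  have T0: "0 \<le> T" "T \<in> {0..T}" using T by auto
  show ?thesis
    unfolding local_mass_integrable(2)[OF s ab T0(1)] L2_LBINT_sq[OF spectral_solD(1)[OF s(1) T0(2)]]
    by (rule spectral_sol_observability[OF s T0(1) ab C fin])
qed

lemma weak_sol_observability_mono:
  assumes Vn: "\<And>x. x \<in> {-1..1} \<Longrightarrow> V x = (real n * pi)\<^sup>2 * \<bar>x\<bar> powr (2 * \<gamma>)"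
    and ws: "weak_sol \<gamma> n T' g0 g" and T: "0 < T" "T \<le> T'"
    and ab: "-1 \<le> a" "a \<le> b" "b \<le> 1"
  shows "(LBINT x=-1..1. (g T' x)\<^sup>2) \<le> (LBINT x=-1..1. (g T x)\<^sup>2)"
    and "(LBINT t=0..ereal T. (LBINT x=ereal a..ereal b. (g t x)\<^sup>2)) \<le> (LBINT t=0..ereal T'. (LBINT x=ereal a..ereal b. (g t x)\<^sup>2))"
proof -
  have T': "0 < T'" "0 \<le> T'" using T by auto
  have s1: "spectral_sol T' g" by (rule weak_sol_spectral(1)[OF Vn ws T'(1)])
  have s2: "case_prod g \<in> borel_measurable borel" by (rule weak_sol_spectral(2)[OF Vn ws T'(1)])
  note s = s1 s2
  have sT: "spectral_sol T g" 
    unfolding spectral_sol_def by (intro ballI conjI spectral_solD[OF s(1)]) (use T in auto)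
  have L: "L2 (g T)" "L2 (g T')" by (rule spectral_solD(1)[OF s(1)], use T in auto)+
  show "(LBINT x=-1..1. (g T' x)\<^sup>2) \<le> (LBINT x=-1..1. (g T x)\<^sup>2)"
    unfolding L2_LBINT_sq[OF L(1)] L2_LBINT_sq[OF L(2)]
    by (rule spectral_sol_norm_mono[OF s(1)]) (use T in auto)
  have T0: "0 \<le> T" using T by simp
  have sub: "{0..T} \<subseteq> {0..T'}" using T by auto
  have nonneg: "0 \<le> integral {a..b} (\<lambda>x. (g t x)\<^sup>2)" if t: "t \<in> {0..T'}" for t
  proof -
    have "(\<lambda>x. (g t x)\<^sup>2) integrable_on {a..b}"
      by (rule integrable_on_subinterval[OF L2_sq_integrable[OF spectral_solD(1)[OF s(1) t]]]) (use ab in auto)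
    then show ?thesis by (rule integral_nonneg) simp
  qed
  show "(LBINT t=0..ereal T. (LBINT x=ereal a..ereal b. (g t x)\<^sup>2)) \<le> (LBINT t=0..ereal T'. (LBINT x=ereal a..ereal b. (g t x)\<^sup>2))"
    unfolding local_mass_integrable(2)[OF s ab T'(2)] local_mass_integrable(2)[OF sT s(2) ab T0]
    by (rule integral_subset_le[OF sub local_mass_integrable(1)[OF sT s(2) ab T0] local_mass_integrable(1)[OF s ab T'(2)]])
       (use nonneg in blast)
qed

section \<open>Separated solutions, on which the observability inequality is tested\<close>

definition eig_sol :: "real \<Rightarrow> real \<Rightarrow> real \<Rightarrow> real" where
  "eig_sol l t x = indicat_real {-1..1} x * (exp (- (l * t)) * phi l x)"

lemma eig_sol_L2: "L2 (eig_sol l t)"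
proof (rule L2_cong)
  show "eig_sol l t x = exp (- (l * t)) * phi l x" if "x \<in> {-1..1}" for x using that by (simp add: eig_sol_def)
  show "L2 (\<lambda>x. exp (- (l * t)) * phi l x)" by (intro L2_cont continuous_intros phi_cont)
qed

lemma eig_sol_weak_sol:
  assumes Vn: "\<And>x. x \<in> {-1..1} \<Longrightarrow> V x = (real n * pi)\<^sup>2 * \<bar>x\<bar> powr (2 * \<gamma>)"
    and l: "l \<in> E" and T: "0 < T"
  shows "weak_sol \<gamma> n T (eig_sol l 0) (eig_sol l)"
proof -
  define gx where "gx t x = indicat_real {-1..1} x * (exp (- (l * t)) * dphi l x)" for t x
  have l0: "0 < l" using eig_ge[OF l] by simp
  have p0: "(\<lambda>x. indicat_real {-1..1} x * phi l x) \<in> borel_measurable borel" by (rule borel_measurable_clamped[OF phi_cont])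
  have p1: "(\<lambda>x. indicat_real {-1..1} x * dphi l x) \<in> borel_measurable borel" by (rule borel_measurable_clamped[OF dphi_cont])
  have m1: "case_prod (eig_sol l) \<in> borel_measurable borel"
  proof -
    note [measurable] = p0
    have "(\<lambda>(t, x). exp (- (l * t)) * (indicat_real {-1..1} x * phi l x)) \<in> borel_measurable (borel \<Otimes>\<^sub>M borel)" by measurable
    moreover have "(\<lambda>(t, x). exp (- (l * t)) * (indicat_real {-1..1} x * phi l x)) = case_prod (eig_sol l)"
      by (auto simp: eig_sol_def fun_eq_iff)
    ultimately show ?thesis by (simp add: borel_prod)
  qed
  have m2: "case_prod gx \<in> borel_measurable borel"
  proof -
    note [measurable] = p1
    have "(\<lambda>(t, x). exp (- (l * t)) * (indicat_real {-1..1} x * dphi l x)) \<in> borel_measurable (borel \<Otimes>\<^sub>M borel)" by measurable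
    moreover have "(\<lambda>(t, x). exp (- (l * t)) * (indicat_real {-1..1} x * dphi l x)) = case_prod gx"
      by (auto simp: gx_def fun_eq_iff)
    ultimately show ?thesis by (simp add: borel_prod)
  qed
  have H: "H10_deriv (eig_sol l t) (gx t)" for t
    unfolding eig_sol_def[abs_def] gx_def[abs_def]
  proof (rule H10_deriv_of_C1)
    show "((\<lambda>x. exp (- (l * t)) * phi l x) has_real_derivative exp (- (l * t)) * dphi l x) (at x within {-1..1})"
      if "x \<in> {-1..1}" for x
      by (auto intro!: derivative_eq_intros phi_deriv(1)[OF that])
    show "continuous_on {-1..1} (\<lambda>x. exp (- (l * t)) * dphi l x)" by (intro continuous_intros dphi_cont)
  qed (use phi_bc l in auto)
  have sq: "(LBINT x=-1..1. (eig_sol l s x - eig_sol l t x)\<^sup>2) = (exp (- (l * s)) - exp (- (l * t)))\<^sup>2" for s t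
  proof -
    have "(LBINT x=-1..1. (eig_sol l s x - eig_sol l t x)\<^sup>2) = integral {-1..1} (\<lambda>x. (eig_sol l s x - eig_sol l t x)\<^sup>2)"
      by (rule L2_LBINT_sq[OF L2_diff[OF eig_sol_L2 eig_sol_L2]])
    also have "\<dots> = integral {-1..1} (\<lambda>x. (exp (- (l * s)) - exp (- (l * t)))\<^sup>2 * (phi l x * phi l x))"
      by (intro integral_cong) (simp add: eig_sol_def power2_eq_square algebra_simps)
    also have "\<dots> = (exp (- (l * s)) - exp (- (l * t)))\<^sup>2 * integral {-1..1} (\<lambda>x. phi l x * phi l x)" by (rule integral_mult_right)
    finally show ?thesis using phi_orth[OF l l] by simp
  qed
  have gxsq: "(LBINT x=-1..1. (gx t x)\<^sup>2) = (exp (- (l * t)))\<^sup>2 * integral {-1..1} (\<lambda>x. (dphi l x)\<^sup>2)" for t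
  proof -
    have "(LBINT x=-1..1. (gx t x)\<^sup>2) = integral {-1..1} (\<lambda>x. (gx t x)\<^sup>2)" by (rule L2_LBINT_sq[OF H10_D(1)[OF H]])
    also have "\<dots> = integral {-1..1} (\<lambda>x. (exp (- (l * t)))\<^sup>2 * (dphi l x)\<^sup>2)"
      by (intro integral_cong) (simp add: gx_def power_mult_distrib)
    finally show ?thesis by (simp only: integral_mult_right)
  qed
  have int: "interval_lebesgue_integrable lborel 0 (ereal T) (\<lambda>t. (LBINT x=-1..1. (gx t x)\<^sup>2))"
  proof -
    have "set_integrable lborel {0..T} (\<lambda>t. (LBINT x=-1..1. (gx t x)\<^sup>2))"
      unfolding gxsq by (rule borel_integrable_atLeastAtMost') (intro continuous_intros)
    then have "set_integrable lborel (einterval 0 (ereal T)) (\<lambda>t. (LBINT x=-1..1. (gx t x)\<^sup>2))"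
      by (rule set_integrable_subset) (auto simp: einterval_iff zero_ereal_def[symmetric])
    then show ?thesis using T by (simp add: interval_lebesgue_integrable_def)
  qed
  have id: "(LBINT x=-1..1. eig_sol l t x * \<phi> x) - (LBINT x=-1..1. eig_sol l 0 x * \<phi> x)
       + (LBINT s=0..ereal t. (LBINT x=-1..1. gx s x * \<psi> x + (real n * pi)^2 * \<bar>x\<bar> powr (2*\<gamma>) * eig_sol l s x * \<phi> x)) = 0"
    if \<phi>: "H10_deriv \<phi> \<psi>" and t: "t \<in> {0..T}" for \<phi> \<psi> t
  proof -
    note HH = H10_D[OF \<phi>]
    define A where "A = cf \<phi> l"
    have 1: "(LBINT x=-1..1. eig_sol l s x * \<phi> x) = exp (- (l * s)) * A" for s
    proof -
      have "(LBINT x=-1..1. eig_sol l s x * \<phi> x) = integral {-1..1} (\<lambda>x. eig_sol l s x * \<phi> x)"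
        by (rule L2_LBINT[OF eig_sol_L2 HH(6)])
      also have "\<dots> = integral {-1..1} (\<lambda>x. exp (- (l * s)) * (\<phi> x * phi l x))"
        by (intro integral_cong) (simp add: eig_sol_def)
      finally show ?thesis by (simp only: integral_mult_right A_def cf_def)
    qed
    have 2: "(LBINT x=-1..1. gx s x * \<psi> x + (real n * pi)^2 * \<bar>x\<bar> powr (2*\<gamma>) * eig_sol l s x * \<phi> x) = exp (- (l * s)) * (l * A)" for s
    proof -
      have L: "L2 (\<lambda>x. (real n * pi)^2 * \<bar>x\<bar> powr (2*\<gamma>) * eig_sol l s x)"
      proof (rule L2_cong)
        show "(real n * pi)^2 * \<bar>x\<bar> powr (2*\<gamma>) * eig_sol l s x = V x * (exp (- (l * s)) * phi l x)" if "x \<in> {-1..1}" for x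
          using that by (simp add: Vn eig_sol_def)
        show "L2 (\<lambda>x. V x * (exp (- (l * s)) * phi l x))" by (intro L2_cont continuous_intros V_cont phi_cont)
      qed
      have "(LBINT x=-1..1. gx s x * \<psi> x + (real n * pi)^2 * \<bar>x\<bar> powr (2*\<gamma>) * eig_sol l s x * \<phi> x)
         = integral {-1..1} (\<lambda>x. gx s x * \<psi> x + (real n * pi)^2 * \<bar>x\<bar> powr (2*\<gamma>) * eig_sol l s x * \<phi> x)"
        by (rule LBINT_eq_integral[OF set_integral_add(1)[OF L2_mult[OF H10_D(1)[OF H] HH(1)] L2_mult[OF L HH(6)]]])
      also have "\<dots> = integral {-1..1} (\<lambda>x. exp (- (l * s)) * (\<psi> x * dphi l x + V x * \<phi> x * phi l x))"
        by (intro integral_cong) (simp add: gx_def eig_sol_def Vn algebra_simps)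
      also have "\<dots> = exp (- (l * s)) * (l * A)"
        unfolding integral_mult_right weak_form_eig[OF l \<phi>] A_def ..
      finally show ?thesis .
    qed
    have t0: "0 \<le> t" using t by simp
    have "(LBINT s=ereal 0..ereal t. exp (- (l * s)) * (l * A)) = integral {0..t} (\<lambda>s. exp (- (l * s)) * (l * A))"
      by (rule interval_integral_eq_integral[OF t0], rule borel_integrable_atLeastAtMost') (intro continuous_intros)
    also have "\<dots> = (1 - exp (- (l * t))) / l * (l * A)"
      by (rule integral_unique[OF has_integral_mult_left[OF integral_exp_neg[OF l0 t0]]])
    also have "\<dots> = (1 - exp (- (l * t))) * A" using l0 by simp
    finally have 3: "(LBINT s=0..ereal t. exp (- (l * s)) * (l * A)) = (1 - exp (- (l * t))) * A" by (simp add: zero_ereal_def)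
    show ?thesis unfolding 1 2 3 by (simp add: algebra_simps)
  qed
  have lim: "((\<lambda>s. LBINT x=-1..1. (eig_sol l s x - eig_sol l t x)\<^sup>2) \<longlongrightarrow> 0) (at t within {0..T})" for t
  proof -
    have "((\<lambda>s. (exp (- (l * s)) - exp (- (l * t)))\<^sup>2) \<longlongrightarrow> (exp (- (l * t)) - exp (- (l * t)))\<^sup>2) (at t within {0..T})"
      by (intro tendsto_intros)
    then show ?thesis unfolding sq by simp
  qed
  have z: "(LBINT x=-1..1. (eig_sol l 0 x - eig_sol l 0 x)\<^sup>2) = 0" unfolding sq by simp
  show ?thesis
    unfolding weak_sol_def
    by (intro conjI ballI m1 eig_sol_L2 lim z exI[of _ gx] m2 int allI impI id AE_I2 H)
qed


text \<open>The norm at time T is known exactly for a separated solution. In the observation the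
  decay in time is dropped, which leaves the factor T.\<close>

lemma observability_eigenfunction:
  assumes Vn: "\<And>x. x \<in> {-1..1} \<Longrightarrow> V x = (real n * pi)\<^sup>2 * \<bar>x\<bar> powr (2 * \<gamma>)"
    and l: "l \<in> E" and T: "0 < T" and ab: "0 < a" "a < b" "b < 1" and C: "0 < C"
    and ob: "\<And>g0 g. L2 g0 \<Longrightarrow> weak_sol \<gamma> n T g0 g \<Longrightarrow> (LBINT x=-1..1. (g T x)\<^sup>2)
          \<le> C * (LBINT t=0..ereal T. (LBINT x=ereal a..ereal b. (g t x)\<^sup>2))"
  shows "exp (- (2 * l * T)) \<le> C * T * integral {a..b} (\<lambda>x. (phi l x)\<^sup>2)"
proof -
  have ws: "weak_sol \<gamma> n T (eig_sol l 0) (eig_sol l)" by (rule eig_sol_weak_sol[OF Vn l T])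
  have s1: "spectral_sol T (eig_sol l)" by (rule weak_sol_spectral(1)[OF Vn ws T])
  have s2: "case_prod (eig_sol l) \<in> borel_measurable borel" by (rule weak_sol_spectral(2)[OF Vn ws T])
  note s = s1 s2
  have T0: "0 \<le> T" using T by simp
  have ab': "-1 \<le> a" "a \<le> b" "b \<le> 1" using ab by auto
  have l0: "0 < l" using eig_ge[OF l] by simp
  let ?B = "integral {a..b} (\<lambda>x. (phi l x)\<^sup>2)"
  have B0: "0 \<le> ?B"
    using ab by (intro integral_nonneg integrable_continuous_real continuous_intros phi_cont_sub) auto
  have m: "integral S (\<lambda>x. (eig_sol l t x)\<^sup>2) = exp (- (2 * l * t)) * integral S (\<lambda>x. (phi l x)\<^sup>2)" if "S \<subseteq> {-1..1}" for S t
  proof -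
    have "integral S (\<lambda>x. (eig_sol l t x)\<^sup>2) = integral S (\<lambda>x. exp (- (2 * l * t)) * (phi l x)\<^sup>2)"
    proof (intro integral_cong)
      fix x assume "x \<in> S"
      then have "x \<in> {-1..1}" using that by auto
      then show "(eig_sol l t x)\<^sup>2 = exp (- (2 * l * t)) * (phi l x)\<^sup>2"
        by (simp add: eig_sol_def power_mult_distrib exp_double[symmetric] mult.assoc)
    qed
    then show ?thesis by (simp only: integral_mult_right)
  qed
  have "exp (- (2 * l * T)) = (LBINT x=-1..1. (eig_sol l T x)\<^sup>2)"
    unfolding L2_LBINT_sq[OF eig_sol_L2] m[OF order_refl] using phi_orth[OF l l] by (simp add: power2_eq_square)
  also have "\<dots> \<le> C * integral {0..T} (\<lambda>t. integral {a..b} (\<lambda>x. (eig_sol l t x)\<^sup>2))"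
    using ob[OF eig_sol_L2 ws] unfolding local_mass_integrable(2)[OF s ab' T0] .
  also have "\<dots> \<le> C * integral {0..T} (\<lambda>t. ?B)"
  proof (rule mult_left_mono[OF integral_le[OF local_mass_integrable(1)[OF s ab' T0] integrable_const_ivl]])
    fix t assume t: "t \<in> {0..T}"
    have "integral {a..b} (\<lambda>x. (eig_sol l t x)\<^sup>2) = exp (- (2 * l * t)) * ?B" by (rule m) (use ab in auto)
    also have "\<dots> \<le> 1 * ?B" using t l0 B0 by (intro mult_right_mono) auto
    finally show "integral {a..b} (\<lambda>x. (eig_sol l t x)\<^sup>2) \<le> ?B" by simp
  qed (use C in simp)
  also have "\<dots> = C * T * ?B" using T by simp
  finally show ?thesis .
qed

end

lemma weak_sol_restrict:
  assumes ws: "weak_sol \<gamma> n T' g0 g" and T: "0 < T" "T \<le> T'"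
  shows "weak_sol \<gamma> n T g0 g"
proof -
  have sub: "{0..T} \<subseteq> {0..T'}" using T by auto
  have 1: "case_prod g \<in> borel_measurable borel" "\<And>t. t \<in> {0..T'} \<Longrightarrow> L2 (g t)"
    "\<And>t. t \<in> {0..T'} \<Longrightarrow> ((\<lambda>s. LBINT x=-1..1. (g s x - g t x)^2) \<longlongrightarrow> 0) (at t within {0..T'})"
    "(LBINT x=-1..1. (g 0 x - g0 x)^2) = 0"
    using ws unfolding weak_sol_def by blast+
  obtain gx where gx: "case_prod gx \<in> borel_measurable borel"
    "AE t in lborel. t \<in> {0..T'} \<longrightarrow> H10_deriv (g t) (gx t)"
    "interval_lebesgue_integrable lborel 0 (ereal T') (\<lambda>t. (LBINT x=-1..1. (gx t x)^2))"
    "\<And>\<phi> \<psi> t. H10_deriv \<phi> \<psi> \<Longrightarrow> t \<in> {0..T'} \<Longrightarrow>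
                (LBINT x=-1..1. g t x * \<phi> x) - (LBINT x=-1..1. g0 x * \<phi> x)
                + (LBINT s=0..ereal t. (LBINT x=-1..1.
                     gx s x * \<psi> x + (real n * pi)^2 * \<bar>x\<bar> powr (2*\<gamma>) * g s x * \<phi> x)) = 0"
    using ws unfolding weak_sol_def by blast
  have ae: "AE t in lborel. t \<in> {0..T} \<longrightarrow> H10_deriv (g t) (gx t)"
    using gx(2) by eventually_elim (use T in auto)
  have int: "interval_lebesgue_integrable lborel 0 (ereal T) (\<lambda>t. (LBINT x=-1..1. (gx t x)^2))"
  proof -
    have "set_integrable lborel (einterval 0 (ereal T')) (\<lambda>t. (LBINT x=-1..1. (gx t x)^2))"
      using gx(3) T by (simp add: interval_lebesgue_integrable_def)
    then have "set_integrable lborel (einterval 0 (ereal T)) (\<lambda>t. (LBINT x=-1..1. (gx t x)^2))"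
      by (rule set_integrable_subset) (use T in \<open>auto simp: einterval_iff intro: less_le_trans\<close>)
    then show ?thesis using T by (simp add: interval_lebesgue_integrable_def)
  qed
  have lim: "((\<lambda>s. LBINT x=-1..1. (g s x - g t x)^2) \<longlongrightarrow> 0) (at t within {0..T})" if "t \<in> {0..T}" for t
    using tendsto_within_subset[OF 1(3) sub] that sub by auto
  show ?thesis
    unfolding weak_sol_def
  proof (intro conjI ballI exI[of _ gx] allI impI)
    show "(LBINT x=-1..1. g t x * \<phi> x) - (LBINT x=-1..1. g0 x * \<phi> x)
                + (LBINT s=0..ereal t. (LBINT x=-1..1.
                     gx s x * \<psi> x + (real n * pi)^2 * \<bar>x\<bar> powr (2*\<gamma>) * g s x * \<phi> x)) = 0"
      if "H10_deriv \<phi> \<psi>" "t \<in> {0..T}" for \<phi> \<psi> t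
      using gx(4)[OF that(1)] that(2) sub by blast
  qed (use 1 gx(1) ae int lim sub in auto)
qed

section \<open>The potential \<open>(n \<pi>)\<^sup>2 |x|\<^sup>2\<^sup>\<gamma>\<close>\<close>

definition pot :: "real \<Rightarrow> nat \<Rightarrow> real \<Rightarrow> real" where
  "pot \<gamma> n x = (real n * pi)\<^sup>2 * \<bar>x\<bar> powr (2 * \<gamma>)"

locale grushin =
  fixes \<gamma> :: real and n :: nat
  assumes gamma_pos: "0 < \<gamma>" and n_pos: "1 \<le> n"
begin

lemma nu_ge_1: "1 \<le> real n * pi"
proof -
  have "1 * 1 \<le> real n * pi" using n_pos pi_ge_two by (intro mult_mono) auto
  then show ?thesis by simp
qed

sublocale sturm "pot \<gamma> n" "real n * pi"
proof
  show "continuous_on {-1..1} (pot \<gamma> n)"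
    unfolding pot_def[abs_def] using gamma_pos by (intro continuous_intros continuous_on_powr') auto
  fix x :: real assume x: "x \<in> {-1..1}"
  show "0 \<le> pot \<gamma> n x" by (simp add: pot_def)
  have "\<bar>x\<bar> powr (2 * \<gamma>) \<le> 1 powr (2 * \<gamma>)" using x gamma_pos by (intro powr_mono2) auto
  then show "pot \<gamma> n x \<le> (real n * pi)\<^sup>2" by (simp add: pot_def mult_left_le)
qed (rule nu_ge_1)

lemma pot_eq: "pot \<gamma> n x = (real n * pi)\<^sup>2 * \<bar>x\<bar> powr (2 * \<gamma>)"
  by (simp add: pot_def)

text \<open>\<Phi> is minus the logarithmic derivative of the trial ground state (1 + \<beta>^2
  x^2)^(-1/2). Its width is set by r = \<open>\<nu>\<close>^(1/(1+gamma)), since at |x| = 1/r the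
  potential equals r^2; the bound is \<beta>^2/4 = r^2/16.\<close>

lemma eig_lower_bound:
  assumes k: "k \<in> E"
  shows "(real n * pi) powr (2 / (1 + \<gamma>)) / 16 \<le> k"
proof -
  let ?\<nu> = "real n * pi"
  define r where "r = ?\<nu> powr (1 / (1 + \<gamma>))"
  have nu0: "0 < ?\<nu>" using nu_ge_1 by linarith
  have r0: "0 < r" using nu0 n_pos by (simp add: r_def)
  define \<beta> where "\<beta> = r / 2"
  have b0: "0 < \<beta>" using r0 by (simp add: \<beta>_def)
  have r2: "r\<^sup>2 = ?\<nu> powr (2 / (1 + \<gamma>))"
    unfolding r_def power2_eq_square powr_add[symmetric] by (simp add: add_divide_distrib[symmetric])
  have pr: "?\<nu>\<^sup>2 * (1 / r) powr (2 * \<gamma>) = r\<^sup>2"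
  proof -
    have "(1 / r) powr (2 * \<gamma>) = ?\<nu> powr (- (2 * \<gamma> / (1 + \<gamma>)))"
    proof -
      have "1 / r = ?\<nu> powr (- (1 / (1 + \<gamma>)))" by (simp add: r_def powr_minus divide_inverse)
      then have "(1 / r) powr (2 * \<gamma>) = ?\<nu> powr (- (1 / (1 + \<gamma>)) * (2 * \<gamma>))" by (simp only: powr_powr)
      then show ?thesis by simp
    qed
    then have "?\<nu>\<^sup>2 * (1 / r) powr (2 * \<gamma>) = ?\<nu> powr 2 * ?\<nu> powr (- (2 * \<gamma> / (1 + \<gamma>)))"
      using nu0 by (simp add: powr_numeral)
    also have "\<dots> = ?\<nu> powr (2 + - (2 * \<gamma> / (1 + \<gamma>)))" by (rule powr_add[symmetric])
    also have "2 + - (2 * \<gamma> / (1 + \<gamma>)) = 2 / (1 + \<gamma>)" using gamma_pos by (simp add: field_simps)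
    finally show ?thesis using r2 by simp
  qed
  define D where "D x = 1 + \<beta>\<^sup>2 * x\<^sup>2" for x :: real
  have D1: "1 \<le> D x" for x by (simp add: D_def)
  define \<Phi> where "\<Phi> x = \<beta>\<^sup>2 * x / D x" for x
  define \<Phi>' where "\<Phi>' x = \<beta>\<^sup>2 * (1 - \<beta>\<^sup>2 * x\<^sup>2) / (D x)\<^sup>2" for x
  have Dnz: "D x \<noteq> 0" for x using D1[of x] by linarith
  have "\<beta>\<^sup>2 / 4 \<le> k"
  proof (rule eig_ge_of_log_deriv[OF k, where \<Phi> = \<Phi> and \<Phi>' = \<Phi>'])
    fix x :: real assume x: "x \<in> {-1..1}"
    have dD: "(D has_real_derivative 2 * \<beta>\<^sup>2 * x) (at x within {-1..1})"
      unfolding D_def[abs_def] by (auto intro!: derivative_eq_intros)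
    have "(\<Phi> has_real_derivative ((\<beta>\<^sup>2 * D x - \<beta>\<^sup>2 * x * (2 * \<beta>\<^sup>2 * x)) / (D x * D x))) (at x within {-1..1})"
      unfolding \<Phi>_def[abs_def] by (auto intro!: derivative_eq_intros dD Dnz)
    also have "(\<beta>\<^sup>2 * D x - \<beta>\<^sup>2 * x * (2 * \<beta>\<^sup>2 * x)) / (D x * D x) = \<Phi>' x"
      by (simp add: \<Phi>'_def D_def power2_eq_square algebra_simps)
    finally show "(\<Phi> has_real_derivative \<Phi>' x) (at x within {-1..1})" .
    define s where "s = \<beta>\<^sup>2 * x\<^sup>2"
    have s0: "0 \<le> s" by (simp add: s_def)
    have eq: "\<Phi>' x - (\<Phi> x)\<^sup>2 = \<beta>\<^sup>2 * ((1 - 2 * s) / (1 + s)\<^sup>2)"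
    proof -
      have "(\<Phi> x)\<^sup>2 = \<beta>\<^sup>2 * s / (1 + s)\<^sup>2" by (simp add: \<Phi>_def D_def s_def power_divide power_mult_distrib power2_eq_square)
      moreover have "\<Phi>' x = \<beta>\<^sup>2 * (1 - s) / (1 + s)\<^sup>2" by (simp add: \<Phi>'_def D_def s_def)
      ultimately have "\<Phi>' x - (\<Phi> x)\<^sup>2 = (\<beta>\<^sup>2 * (1 - s) - \<beta>\<^sup>2 * s) / (1 + s)\<^sup>2" by (simp only: diff_divide_distrib)
      then show ?thesis by (simp add: algebra_simps)
    qed
    show "\<beta>\<^sup>2 / 4 \<le> \<Phi>' x - (\<Phi> x)\<^sup>2 + pot \<gamma> n x"
    \<comment> \<open>Inside |x| <= 1/r the trial function contributes at least \<beta>^2/4. Outside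
      it contributes no less than -\<beta>^2, and the potential exceeds 4\<beta>^2.\<close>
    proof (cases "s \<le> 1/4")
      case True
      have "s\<^sup>2 \<le> (1/4)\<^sup>2" using True s0 by (intro power_mono)
      then have "(1 + s)\<^sup>2 \<le> 4 * (1 - 2 * s)" using True by (simp add: power2_eq_square algebra_simps)
      then have "1/4 \<le> (1 - 2 * s) / (1 + s)\<^sup>2" using s0 by (simp add: field_simps)
      then have "\<beta>\<^sup>2 * (1/4) \<le> \<beta>\<^sup>2 * ((1 - 2 * s) / (1 + s)\<^sup>2)" by (rule mult_left_mono) simp
      moreover have "0 \<le> pot \<gamma> n x" by (simp add: pot_def)
      ultimately show ?thesis unfolding eq by simp
    next
      case False
      have "(\<beta> * \<bar>x\<bar>)\<^sup>2 = s" by (simp add: s_def power_mult_distrib)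
      then have "(1/2)\<^sup>2 < (\<beta> * \<bar>x\<bar>)\<^sup>2" using False by (simp add: power_divide)
      then have "1/2 < \<beta> * \<bar>x\<bar>" using b0 by (intro power_less_imp_less_base[of "1/2" 2]) auto
      then have "1 / r \<le> \<bar>x\<bar>" using r0 by (simp add: \<beta>_def field_simps)
      then have "(1 / r) powr (2 * \<gamma>) \<le> \<bar>x\<bar> powr (2 * \<gamma>)" using gamma_pos r0 by (intro powr_mono2) auto
      then have "?\<nu>\<^sup>2 * (1 / r) powr (2 * \<gamma>) \<le> pot \<gamma> n x" unfolding pot_def by (rule mult_left_mono) simp
      then have p: "4 * \<beta>\<^sup>2 \<le> pot \<gamma> n x" unfolding pr by (simp add: \<beta>_def power_divide)
      have "- 1 \<le> (1 - 2 * s) / (1 + s)\<^sup>2"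
      proof -
        have "0 < (1 + s)\<^sup>2" using s0 by simp
        moreover have "- 1 * (1 + s)\<^sup>2 \<le> 1 - 2 * s" by (simp add: power2_eq_square algebra_simps)
        ultimately show ?thesis by (simp only: pos_le_divide_eq)
      qed
      then have "\<beta>\<^sup>2 * (- 1) \<le> \<beta>\<^sup>2 * ((1 - 2 * s) / (1 + s)\<^sup>2)" by (rule mult_left_mono) simp
      then show ?thesis using p zero_le_power2[of \<beta>] unfolding eq by linarith
    qed
  next
    show "continuous_on {-1..1} \<Phi>'"
      unfolding \<Phi>'_def[abs_def] using Dnz by (intro continuous_intros) (auto simp: D_def[abs_def] intro!: continuous_intros)
  qed
  then show ?thesis using r2 by (simp add: \<beta>_def power_divide)
qed

lemma observability_each:
  assumes T: "0 < T" and ab: "0 < a" "a < b" "b < 1"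
  shows "\<exists>C>0. \<forall>g0 g. weak_sol \<gamma> n T g0 g \<longrightarrow> (LBINT x=-1..1. (g T x)\<^sup>2)
          \<le> C * (LBINT t=0..ereal T. (LBINT x=ereal a..ereal b. (g t x)\<^sup>2))"
proof -
  have ab': "-1 \<le> a" "a < b" "b \<le> 1" "b - a \<le> 1" "a \<le> b" using ab by auto
  obtain C where C: "C \<ge> 0" "\<And>J c. finite J \<Longrightarrow> J \<subseteq> E \<Longrightarrow>
     (\<Sum>k\<in>J. (c k * exp (- (k * T)))\<^sup>2) \<le> C * obs a b T J c"
    using obsv_any_time[OF T ab'(1-4)] unfolding obsv_def by auto
  \<comment> \<open>\<open>obsv\<close> allows the constant 0, while a positive one is
    wanted.\<close>
  have C': "(\<Sum>k\<in>J. (c k * exp (- (k * T)))\<^sup>2) \<le> (C + 1) * obs a b T J c" if "finite J" "J \<subseteq> E" for J c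
  proof -
    have "0 \<le> obs a b T J c" using ab by (intro obs_nonneg) auto
    then show ?thesis using C(2)[OF that, of c] by (simp add: distrib_right)
  qed
  show ?thesis
  proof (intro exI[of _ "2 * (C + 1)"] conjI allI impI)
    show "0 < 2 * (C + 1)" using C by simp
    fix g0 g assume ws: "weak_sol \<gamma> n T g0 g"
    show "(LBINT x=-1..1. (g T x)\<^sup>2) \<le> 2 * (C + 1) * (LBINT t=0..ereal T. (LBINT x=ereal a..ereal b. (g t x)\<^sup>2))"
      by (rule weak_sol_observability[OF _ ws T ab'(1,5,3) _ C']) (use C in \<open>auto simp: pot_eq\<close>)
  qed
qed

text \<open>\<open>small\<close> is the smallness condition of \<open>high_modes\<close> for the
  whole spectrum, with \<open>eig_lower_bound\<close> as the threshold. No mode is discarded, so the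
  constant 2 is independent of n.\<close>

lemma observability_by_dissipation:
  assumes T: "0 < T" and ab: "0 < a" "a < b" "b < 1"
    and small: "1024 / ((cutoff_mass 0 1)\<^sup>2 * cutoff_mass a b) *
      exp (178 * (real n * pi) - (real n * pi) powr (2 / (1 + \<gamma>)) / 16 * T + 15842 / T) * (184 * (real n * pi) / T) \<le> 1/4"
    and ws: "weak_sol \<gamma> n T g0 g"
  shows "(LBINT x=-1..1. (g T x)\<^sup>2) \<le> 2 * (LBINT t=0..ereal T. (LBINT x=ereal a..ereal b. (g t x)\<^sup>2))"
proof -
  have ab': "-1 \<le> a" "a < b" "b \<le> 1" "b - a \<le> 1" "a \<le> b" using ab by auto
  have T0: "0 \<le> T" using T by simp
  have fin: "(\<Sum>k\<in>J. (c k * exp (- (k * T)))\<^sup>2) \<le> 1 * obs a b T J c" if J: "finite J" "J \<subseteq> E" for J c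
  proof -
    have "(\<Sum>k\<in>J. exp (- (2 * k * T)) * Mb a b k) \<le> 1/4"
      by (rule order_trans[OF mode_sum_le[OF J T] small]) (use J eig_lower_bound ab in auto)
    then have "(\<Sum>k\<in>J. (c k * exp (- (k * T)))\<^sup>2) \<le> obs a b T J c" by (rule high_modes[OF J T0 ab'(1-4)])
    then show ?thesis by simp
  qed
  have "(LBINT x=-1..1. (g T x)\<^sup>2) \<le> 2 * 1 * (LBINT t=0..ereal T. (LBINT x=ereal a..ereal b. (g t x)\<^sup>2))"
    by (rule weak_sol_observability[OF _ ws T ab'(1,5,3) _ fin]) (auto simp: pot_eq)
  then show ?thesis by simp
qed

end

section \<open>A compactly supported test function for the first eigenvalue\<close>

lemma has_real_derivative_max_sq:
  "((\<lambda>z. (max 0 z)\<^sup>2) has_real_derivative 2 * max 0 z) (at z)" for z :: real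
proof -
  consider "z > 0" | "z < 0" | "z = 0" by linarith
  then show ?thesis
  proof cases
    case 1
    have "((\<lambda>z. z\<^sup>2) has_real_derivative 2 * max 0 z) (at z)"
      using 1 by (auto intro!: derivative_eq_intros)
    then show ?thesis
      by (rule has_field_derivative_transform_within_open[where S = "{0<..}"]) (use 1 in auto)
  next
    case 2
    have "((\<lambda>z::real. 0) has_real_derivative 2 * max 0 z) (at z)" using 2 by simp
    then show ?thesis
      by (rule has_field_derivative_transform_within_open[where S = "{..<0}"]) (use 2 in auto)
  next
    case 3
    have "((\<lambda>h. ((max 0 h)\<^sup>2 - (max 0 (0::real))\<^sup>2) / (h - 0)) \<longlongrightarrow> 0) (at 0)"
    proof (rule Lim_null_comparison)
      show "\<forall>\<^sub>F h in at 0. norm (((max 0 h)\<^sup>2 - (max 0 (0::real))\<^sup>2) / (h - 0)) \<le> \<bar>h\<bar>"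
        by (rule always_eventually) (auto simp: max_def power2_eq_square)
      show "((\<lambda>h::real. \<bar>h\<bar>) \<longlongrightarrow> 0) (at 0)" by (rule tendsto_rabs_zero) (rule tendsto_ident_at)
    qed
    then show ?thesis using 3 by (simp add: has_field_derivative_iff)
  qed
qed

text \<open>The test function must have a continuous second derivative, and the cube is the lowest
  integer power of the positive part that has one.\<close>

lemma has_real_derivative_max_cube:
  "((\<lambda>z. (max 0 z) ^ 3) has_real_derivative 3 * (max 0 z)\<^sup>2) (at z)" for z :: real
proof -
  have eq: "(max 0 z) ^ 3 = z * (max 0 z)\<^sup>2" for z :: real
    by (auto simp: max_def power2_eq_square power3_eq_cube)
  have "((\<lambda>z. z * (max 0 z)\<^sup>2) has_real_derivative (1 * (max 0 z)\<^sup>2 + (2 * max 0 z) * z)) (at z)"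
    by (rule DERIV_mult[OF DERIV_ident has_real_derivative_max_sq])
  moreover have "1 * (max 0 z)\<^sup>2 + (2 * max 0 z) * z = 3 * (max 0 z)\<^sup>2"
    by (auto simp: max_def power2_eq_square)
  ultimately show ?thesis unfolding eq by (simp only:)
qed

context grushin
begin

text \<open>The test function is the cube of the positive part of \<delta>^2 - x^2. At the width
  \<delta> = n^(-1/(1+gamma)) the potential and the second derivative have the same size, so A u is
  of order \<delta>^(-2) u in norm.\<close>

lemma small_eigenvalue: "\<exists>l\<in>E. l \<le> 155 * real n powr (2 / (1 + \<gamma>))"
proof -
  define \<delta> where "\<delta> = real n powr (- (1 / (1 + \<gamma>)))"
  have n1: "1 \<le> real n" using n_pos by simp
  have d0: "0 < \<delta>" using n1 by (simp add: \<delta>_def)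
  have d1: "\<delta> \<le> 1"
    using powr_mono[of "- (1 / (1 + \<gamma>))" 0 "real n"] n1 gamma_pos by (simp add: \<delta>_def)
  have dinv: "1 / \<delta>\<^sup>2 = real n powr (2 / (1 + \<gamma>))"
  proof -
    have "\<delta>\<^sup>2 = real n powr (- (2 / (1 + \<gamma>)))" using n1 by (simp add: \<delta>_def powr_power)
    then show ?thesis using n1 by (simp add: powr_minus divide_inverse)
  qed
  have dn: "(real n)\<^sup>2 * \<delta> powr (2 * \<gamma>) * \<delta>\<^sup>2 = 1"
  proof -
    have "\<delta> powr (2 * \<gamma>) = real n powr (- (2 * \<gamma> / (1 + \<gamma>)))" using n1 by (simp add: \<delta>_def powr_powr)
    moreover have "\<delta>\<^sup>2 = real n powr (- (2 / (1 + \<gamma>)))" using n1 by (simp add: \<delta>_def powr_power)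
    moreover have "(real n)\<^sup>2 = real n powr 2" using n1 by (simp add: powr_numeral)
    ultimately have "(real n)\<^sup>2 * \<delta> powr (2 * \<gamma>) * \<delta>\<^sup>2 = real n powr (2 + - (2 * \<gamma> / (1 + \<gamma>)) + - (2 / (1 + \<gamma>)))"
      by (simp only: powr_add)
    also have "2 + - (2 * \<gamma> / (1 + \<gamma>)) + - (2 / (1 + \<gamma>)) = 0" using gamma_pos by (simp add: field_simps)
    finally show ?thesis using n1 by simp
  qed
  define W where "W x = max 0 (\<delta>\<^sup>2 - x\<^sup>2)" for x :: real
  define u where "u x = (W x) ^ 3" for x
  define u1 where "u1 x = - 6 * x * (W x)\<^sup>2" for x
  define u2 where "u2 x = - 6 * (W x)\<^sup>2 + 24 * x\<^sup>2 * W x" for x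
  define h where "h x = pot \<gamma> n x * u x - u2 x" for x
  have Wc: "continuous_on S W" for S unfolding W_def[abs_def] by (intro continuous_intros)
  have di: "((\<lambda>x. \<delta>\<^sup>2 - x\<^sup>2) has_real_derivative - 2 * x) (at x within S)" for x S
    by (auto intro!: derivative_eq_intros)
  have du: "(u has_real_derivative u1 x) (at x within S)" for x S
    using DERIV_chain2[OF has_real_derivative_max_cube di, of x S]
    by (simp add: u_def[abs_def] u1_def W_def[abs_def] mult_ac)
  have dW2: "((\<lambda>x. (W x)\<^sup>2) has_real_derivative - 4 * x * W x) (at x within S)" for x S
    using DERIV_chain2[OF has_real_derivative_max_sq di, of x S]
    by (simp add: W_def[abs_def] mult_ac)
  have du1: "(u1 has_real_derivative u2 x) (at x within S)" for x S
  proof -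
    have "((\<lambda>x. (- 6 * x) * (W x)\<^sup>2) has_real_derivative ((- 6) * (W x)\<^sup>2 + (- 4 * x * W x) * (- 6 * x))) (at x within S)"
      by (rule DERIV_mult[OF _ dW2]) (auto intro!: derivative_eq_intros)
    moreover have "(- 6) * (W x)\<^sup>2 + (- 4 * x * W x) * (- 6 * x) = u2 x"
      by (simp add: u2_def power2_eq_square)
    ultimately show ?thesis unfolding u1_def[abs_def] by (simp only:)
  qed
  have W1: "W 1 = 0" "W (-1) = 0" using d0 d1 by (auto simp: W_def power_le_one)
  have hc: "continuous_on {-1..1} h"
    unfolding h_def[abs_def] u_def[abs_def] u2_def[abs_def] by (intro continuous_intros V_cont Wc)
  have DAu: "DA u u1 h"
    unfolding DA_def using hc du du1 W1 by (auto simp: h_def u_def)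
  have out: "h x = 0" if "x \<notin> {-\<delta>..\<delta>}" for x
  proof -
    have "\<delta> < \<bar>x\<bar>" using that by auto
    then have "\<delta>\<^sup>2 < \<bar>x\<bar>\<^sup>2" using d0 by (intro power_strict_mono) auto
    then show ?thesis by (simp add: h_def u_def u2_def W_def)
  qed
  \<comment> \<open>46 = 16 + 6 + 24: the potential term, by \<open>dn\<close> and pi < 4, and the
    two terms of the second derivative.\<close>
  have hb: "\<bar>h x\<bar> \<le> 46 * \<delta> ^ 4" if x: "x \<in> {-\<delta>..\<delta>}" for x
  proof -
    have ax: "\<bar>x\<bar> \<le> \<delta>" using x by auto
    then have x2: "x\<^sup>2 \<le> \<delta>\<^sup>2" using power_mono[of "\<bar>x\<bar>" \<delta> 2] by simp
    have W: "0 \<le> W x" "W x \<le> \<delta>\<^sup>2" by (auto simp: W_def)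
    have "\<bar>x\<bar> powr (2 * \<gamma>) \<le> \<delta> powr (2 * \<gamma>)" using ax gamma_pos by (intro powr_mono2) auto
    then have "pot \<gamma> n x \<le> pi\<^sup>2 * ((real n)\<^sup>2 * \<delta> powr (2 * \<gamma>))"
      unfolding pot_def by (simp add: power_mult_distrib mult_left_mono mult.assoc mult.left_commute)
    moreover have "u x \<le> (\<delta>\<^sup>2) ^ 3" unfolding u_def using W by (intro power_mono) auto
    moreover have "0 \<le> pot \<gamma> n x" "0 \<le> u x" using W by (auto simp: pot_def u_def)
    ultimately have "pot \<gamma> n x * u x \<le> (pi\<^sup>2 * ((real n)\<^sup>2 * \<delta> powr (2 * \<gamma>))) * (\<delta>\<^sup>2) ^ 3"
      by (intro mult_mono) auto
    also have "\<dots> = pi\<^sup>2 * ((real n)\<^sup>2 * \<delta> powr (2 * \<gamma>) * \<delta>\<^sup>2) * \<delta> ^ 4"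
      by (simp add: power_mult[symmetric] power_add[symmetric] mult.assoc)
    also have "\<dots> = pi\<^sup>2 * \<delta> ^ 4" using dn by simp
    also have "\<dots> \<le> 16 * \<delta> ^ 4"
    proof (intro mult_right_mono)
      have "pi\<^sup>2 \<le> 4\<^sup>2" using pi_less_4 pi_ge_zero by (intro power_mono) auto
      then show "pi\<^sup>2 \<le> 16" by simp
    qed (use d0 in simp)
    finally have 1: "pot \<gamma> n x * u x \<le> 16 * \<delta> ^ 4" "0 \<le> pot \<gamma> n x * u x" using W by (auto simp: pot_def u_def)
    have "(W x)\<^sup>2 \<le> (\<delta>\<^sup>2)\<^sup>2" using W by (intro power_mono) auto
    then have 2: "(W x)\<^sup>2 \<le> \<delta> ^ 4" "0 \<le> (W x)\<^sup>2" by (auto simp: power_mult[symmetric])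
    have "x\<^sup>2 * W x \<le> \<delta>\<^sup>2 * \<delta>\<^sup>2" using x2 W by (intro mult_mono) auto
    then have 3: "x\<^sup>2 * W x \<le> \<delta> ^ 4" "0 \<le> x\<^sup>2 * W x" using W by (auto simp: power_add[symmetric])
    have "h x = pot \<gamma> n x * u x + 6 * (W x)\<^sup>2 - 24 * (x\<^sup>2 * W x)" by (simp add: h_def u2_def)
    then show ?thesis using 1 2 3 unfolding abs_le_iff by linarith
  qed
  have sub: "{-\<delta>..\<delta>} \<subseteq> {-1..1}" using d1 by auto
  have cd: "continuous_on {-\<delta>..\<delta>} h" by (rule continuous_on_subset[OF hc sub])
  have "((\<lambda>x. (h x)\<^sup>2) has_integral integral {-\<delta>..\<delta>} (\<lambda>x. (h x)\<^sup>2)) {-\<delta>..\<delta>}"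
    by (intro integrable_integral integrable_continuous_real continuous_intros cd)
  then have "((\<lambda>x. (h x)\<^sup>2) has_integral integral {-\<delta>..\<delta>} (\<lambda>x. (h x)\<^sup>2)) {-1..1}"
    by (rule has_integral_on_superset) (use out sub in auto)
  then have "integral {-1..1} (\<lambda>x. (h x)\<^sup>2) = integral {-\<delta>..\<delta>} (\<lambda>x. (h x)\<^sup>2)" by (rule integral_unique)
  also have "\<dots> \<le> integral {-\<delta>..\<delta>} (\<lambda>x. (46 * \<delta> ^ 4)\<^sup>2)"
  proof (intro integral_cont_mono continuous_intros cd)
    fix x assume "x \<in> {-\<delta>..\<delta>}"
    then have "\<bar>h x\<bar> \<le> \<bar>46 * \<delta> ^ 4\<bar>" using hb[of x] d0 by simp
    then show "(h x)\<^sup>2 \<le> (46 * \<delta> ^ 4)\<^sup>2" by (simp only: abs_le_square_iff)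
  qed
  also have "\<dots> = 4232 * \<delta> ^ 9"
    using d0 by (simp add: power_mult_distrib power_mult[symmetric] power_Suc[symmetric] del: power_Suc)
  finally have H: "integral {-1..1} (\<lambda>x. (h x)\<^sup>2) \<le> 4232 * \<delta> ^ 9" .
  have uc: "continuous_on S u" for S unfolding u_def[abs_def] by (intro continuous_intros Wc)
  have "729 / 4096 * \<delta> ^ 13 = integral {-\<delta>/2..\<delta>/2} (\<lambda>x. ((3/4 * \<delta>\<^sup>2) ^ 3)\<^sup>2)"
    using d0 by (simp add: power_mult_distrib power_divide power_mult[symmetric]) (simp add: eval_nat_numeral)
  also have "\<dots> \<le> integral {-\<delta>/2..\<delta>/2} (\<lambda>x. (u x)\<^sup>2)"
  proof (intro integral_cont_mono continuous_intros uc)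
    fix x assume x: "x \<in> {-\<delta>/2..\<delta>/2}"
    then have "\<bar>x\<bar> \<le> \<delta> / 2" by auto
    then have "x\<^sup>2 \<le> (\<delta> / 2)\<^sup>2" using power_mono[of "\<bar>x\<bar>" "\<delta>/2" 2] by simp
    then have "3/4 * \<delta>\<^sup>2 \<le> \<delta>\<^sup>2 - x\<^sup>2" by (simp add: power_divide)
    also have "\<dots> \<le> W x" by (simp add: W_def)
    finally have "3/4 * \<delta>\<^sup>2 \<le> W x" .
    then show "((3/4 * \<delta>\<^sup>2) ^ 3)\<^sup>2 \<le> (u x)\<^sup>2" unfolding u_def by (intro power_mono) auto
  qed
  also have "\<dots> \<le> integral {-1..1} (\<lambda>x. (u x)\<^sup>2)"
    using d1 d0 by (intro integral_subset_le integrable_continuous_real continuous_intros uc) auto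
  finally have U: "729 / 4096 * \<delta> ^ 13 \<le> integral {-1..1} (\<lambda>x. (u x)\<^sup>2)" .
  \<comment> \<open>155 is the least integer with 155^2 * (3/4)^6 > 2 * 46^2, the bounds just found
    for the norms of u and h.\<close>
  define \<Lambda> where "\<Lambda> = 155 * (1 / \<delta>\<^sup>2)"
  have "4232 * \<delta> ^ 9 < \<Lambda>\<^sup>2 * (729 / 4096 * \<delta> ^ 13)"
  proof -
    have "\<Lambda>\<^sup>2 * (729 / 4096 * \<delta> ^ 13) = 155\<^sup>2 * 729 / 4096 * \<delta> ^ 9"
      using d0 by (simp add: \<Lambda>_def power_mult_distrib power_divide field_simps)
    moreover have "4232 * \<delta> ^ 9 < 155\<^sup>2 * 729 / 4096 * \<delta> ^ 9" using d0 by simp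
    ultimately show ?thesis by (simp only:)
  qed
  also have "\<dots> \<le> \<Lambda>\<^sup>2 * integral {-1..1} (\<lambda>x. (u x)\<^sup>2)" by (intro mult_left_mono U) simp
  finally have "integral {-1..1} (\<lambda>x. (h x)\<^sup>2) < \<Lambda>\<^sup>2 * integral {-1..1} (\<lambda>x. (u x)\<^sup>2)" using H by linarith
  moreover have "0 < \<Lambda>" using d0 by (simp add: \<Lambda>_def)
  ultimately have "\<exists>l\<in>E. l \<le> \<Lambda>" by (intro eig_exists_le[OF DAu])
  then show ?thesis by (simp only: \<Lambda>_def dinv)
qed

text \<open>The first mode has eigenvalue \<open>O(n\<^bsup>2/(1+\<gamma>)\<^esup>)\<close> and mass \<open>e\<^bsup>-cn\<^esup>\<close> on \<open>[a,b]\<close>.\<close>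

lemma observability_cost:
  assumes T: "0 < T" and ab: "0 < a" "a < b" "b < 1" and C: "0 < C"
    and ob: "\<And>g0 g. L2 g0 \<Longrightarrow> weak_sol \<gamma> n T g0 g \<Longrightarrow> (LBINT x=-1..1. (g T x)\<^sup>2)
          \<le> C * (LBINT t=0..ereal T. (LBINT x=ereal a..ereal b. (g t x)\<^sup>2))"
    and large: "155 * real n powr (2 / (1 + \<gamma>)) \<le> (real n * (a / 2) powr \<gamma>)\<^sup>2"
  shows "exp (real n * ((a / 2) powr \<gamma> * a / 4) - 310 * T * real n powr (2 / (1 + \<gamma>))) \<le> C * T * (4 / a)"
proof -
  obtain l where l: "l \<in> E" "l \<le> 155 * real n powr (2 / (1 + \<gamma>))" using small_eigenvalue by blast
  \<comment> \<open>At x >= a/2 the potential is at least pi^2 k^2 >= 2 k^2, while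
    \<open>large\<close> gives l <= k^2; this leaves the excess over l that exponential decay
    requires.\<close>
  define k where "k = real n * (a / 2) powr \<gamma>"
  have k0: "0 \<le> k" by (simp add: k_def)
  have big: "l + k\<^sup>2 / 2 \<le> pot \<gamma> n x" if x: "a / 2 \<le> x" "x \<le> 1" for x
  proof -
    have "(a / 2) powr (2 * \<gamma>) \<le> \<bar>x\<bar> powr (2 * \<gamma>)" using x ab gamma_pos by (intro powr_mono2) auto
    then have "(real n * pi)\<^sup>2 * (a / 2) powr (2 * \<gamma>) \<le> pot \<gamma> n x" unfolding pot_def by (rule mult_left_mono) simp
    moreover have "(real n * pi)\<^sup>2 * (a / 2) powr (2 * \<gamma>) = pi\<^sup>2 * k\<^sup>2"
      using ab by (simp add: k_def power_mult_distrib powr_power mult_ac)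
    moreover have "2 * k\<^sup>2 \<le> pi\<^sup>2 * k\<^sup>2"
    proof (rule mult_right_mono)
      have "2\<^sup>2 \<le> pi\<^sup>2" using pi_ge_two by (intro power_mono) auto
      then show "2 \<le> pi\<^sup>2" by simp
    qed simp
    moreover have "l \<le> k\<^sup>2" using l(2) large by (simp add: k_def)
    moreover have "0 \<le> k\<^sup>2" by simp
    ultimately show ?thesis by linarith
  qed
  have "exp (- (2 * l * T)) \<le> C * T * integral {a..b} (\<lambda>x. (phi l x)\<^sup>2)"
    by (rule observability_eigenfunction[OF _ l(1) T ab C ob]) (auto simp: pot_eq)
  also have "\<dots> \<le> C * T * (4 / a * exp (- (k * a / 4)))"
    using C T by (intro mult_left_mono eig_local_mass_le[OF l(1) k0 ab big]) auto
  finally have A: "exp (- (2 * l * T)) \<le> C * T * (4 / a) * exp (- (k * a / 4))" by (simp add: mult.assoc)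
  have "2 * l * T \<le> 310 * T * real n powr (2 / (1 + \<gamma>))"
    using mult_right_mono[OF l(2), of "2 * T"] T by (simp add: mult_ac)
  then have "exp (k * a / 4 - 310 * T * real n powr (2 / (1 + \<gamma>))) \<le> exp (k * a / 4 + - (2 * l * T))" by simp
  also have "\<dots> = exp (- (2 * l * T)) * exp (k * a / 4)" by (simp only: exp_add mult.commute)
  also have "\<dots> \<le> C * T * (4 / a) * exp (- (k * a / 4)) * exp (k * a / 4)" using A by (intro mult_right_mono) auto
  also have "\<dots> = C * T * (4 / a)" by (simp add: mult.assoc exp_add[symmetric])
  finally show ?thesis by (simp add: k_def mult.assoc)
qed

end

section \<open>The three regimes\<close>

lemma local_mass_LBINT_nonneg:
  assumes "0 \<le> T" "a \<le> b"
  shows "0 \<le> (LBINT t=0..ereal T. (LBINT x=ereal a..ereal b. (g t x :: real)\<^sup>2))"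
  using assms unfolding interval_lebesgue_integral_def set_lebesgue_integral_def
  by (auto intro!: Bochner_Integration.integral_nonneg simp: zero_ereal_def)

text \<open>One factor exp(-\<nu>) pays for the \<nu> of the mode sum, the other for K <=
  \<nu>/4.\<close>

lemma dissipation_beats_cost:
  fixes K \<nu> X :: real
  assumes "0 \<le> K" "4 * K \<le> \<nu>" "X \<le> - 2 * \<nu>"
  shows "K * exp X * \<nu> \<le> 1/4"
proof -
  have nu: "0 \<le> \<nu>" using assms by linarith
  have "\<nu> \<le> exp \<nu>" using exp_ge_add_one_self[of \<nu>] by linarith
  then have "\<nu> * \<nu> \<le> exp \<nu> * exp \<nu>" using nu by (intro mult_mono) auto
  then have e: "\<nu> * \<nu> * exp (- 2 * \<nu>) \<le> 1"
    using mult_right_mono[of "\<nu> * \<nu>" "exp \<nu> * exp \<nu>" "exp (- 2 * \<nu>)"] by (simp add: exp_add[symmetric])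
  have "K * exp X * \<nu> \<le> (\<nu> / 4) * exp (- 2 * \<nu>) * \<nu>"
    using assms nu by (intro mult_mono) auto
  also have "\<dots> = (\<nu> * \<nu> * exp (- 2 * \<nu>)) / 4" by simp
  also have "\<dots> \<le> 1/4" using e by simp
  finally show ?thesis .
qed

lemma observable_subcritical:
  assumes ab: "0 < a" "a < b" "b < 1" and \<gamma>: "0 < \<gamma>" "\<gamma> < 1" and T: "0 < T"
  shows "observable \<gamma> a b T"
proof -
  define C0 where "C0 = 1024 / ((cutoff_mass 0 1)\<^sup>2 * cutoff_mass a b)"
  have C0: "0 < C0" using cutoff_mass_pos[OF ab(2)] cutoff_mass_pos[of 0 1] by (simp add: C0_def)
  define Kc where "Kc = C0 * exp (15842 / T) * (184 / T)"
  have Kc: "0 < Kc" using C0 T by (simp add: Kc_def)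
  define q where "q = 2 / (1 + \<gamma>) - 1"
  have q: "0 < q" using \<gamma> by (simp add: q_def field_simps)
  \<comment> \<open>The first entry is the condition of \<open>dissipation_beats_cost\<close>. The
    second makes \<nu>^q at least 2880/T, where 2880 = 16(178 + 2) and 1/16 comes from
    \<open>eig_lower_bound\<close>; q > 0 is the excess of 2/(1+gamma) over 1.\<close>
  define M where "M = max (4 * Kc) ((2880 / T) powr (1 / q))"
  obtain N :: nat where N: "M < real N" using reals_Archimedean2 by blast
  have big: "(LBINT x=-1..1. (g T x)\<^sup>2) \<le> 2 * (LBINT t=0..ereal T. (LBINT x=ereal a..ereal b. (g t x)\<^sup>2))"
    if n: "n \<ge> 1" "n \<ge> N" and ws: "weak_sol \<gamma> n T g0 g" for n g0 g
  proof -
    interpret grushin \<gamma> n using \<gamma> n by unfold_locales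
    let ?\<nu> = "real n * pi"
    have nN: "M < ?\<nu>"
    proof -
      have "M < real n * 1" using N n by simp
      also have "\<dots> \<le> ?\<nu>" using pi_ge_two by (intro mult_left_mono) auto
      finally show ?thesis .
    qed
    have nu0: "0 < ?\<nu>" using nu_ge_1 by linarith
    have "2880 / T = ((2880 / T) powr (1 / q)) powr q" using T q by (simp add: powr_powr)
    also have "\<dots> \<le> ?\<nu> powr q" using nN q by (intro powr_mono2) (auto simp: M_def)
    finally have pq: "2880 / T \<le> ?\<nu> powr q" .
    have "?\<nu> powr (2 / (1 + \<gamma>)) = ?\<nu> powr (1 + q)" by (simp add: q_def)
    also have "\<dots> = ?\<nu> * ?\<nu> powr q" using nu0 by (simp add: powr_add)
    also have "\<dots> \<ge> ?\<nu> * (2880 / T)" using pq nu0 by (intro mult_left_mono) auto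
    finally have "?\<nu> * (2880 / T) * (T / 16) \<le> ?\<nu> powr (2 / (1 + \<gamma>)) * (T / 16)" using T by (intro mult_right_mono) auto
    then have ex: "178 * ?\<nu> - ?\<nu> powr (2 / (1 + \<gamma>)) / 16 * T \<le> - 2 * ?\<nu>" using T by (simp add: field_simps)
    have "C0 * exp (178 * ?\<nu> - ?\<nu> powr (2 / (1 + \<gamma>)) / 16 * T + 15842 / T) * (184 * ?\<nu> / T)
        = Kc * exp (178 * ?\<nu> - ?\<nu> powr (2 / (1 + \<gamma>)) / 16 * T) * ?\<nu>"
      unfolding Kc_def exp_add by (simp add: mult_ac)
    also have "\<dots> \<le> 1/4" using Kc nN ex by (intro dissipation_beats_cost) (auto simp: M_def)
    finally show ?thesis unfolding C0_def by (rule observability_by_dissipation[OF T ab _ ws])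
  qed
  \<comment> \<open>The n below N have constants of their own, and their sum dominates each of
    them.\<close>
  have "\<forall>n::nat. \<exists>C>0. n \<ge> 1 \<longrightarrow> (\<forall>g0 g. weak_sol \<gamma> n T g0 g \<longrightarrow> (LBINT x=-1..1. (g T x)\<^sup>2)
          \<le> C * (LBINT t=0..ereal T. (LBINT x=ereal a..ereal b. (g t x)\<^sup>2)))"
  proof
    fix n :: nat
    show "\<exists>C>0. n \<ge> 1 \<longrightarrow> (\<forall>g0 g. weak_sol \<gamma> n T g0 g \<longrightarrow> (LBINT x=-1..1. (g T x)\<^sup>2)
          \<le> C * (LBINT t=0..ereal T. (LBINT x=ereal a..ereal b. (g t x)\<^sup>2)))"
    proof (cases "n \<ge> 1")
      case True
      interpret grushin \<gamma> n using \<gamma> True by unfold_locales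
      show ?thesis using observability_each[OF T ab] by blast
    qed (auto intro: exI[of _ 1])
  qed
  then obtain Cn where Cn: "\<And>n. 0 < Cn n" "\<And>n g0 g. n \<ge> 1 \<Longrightarrow> weak_sol \<gamma> n T g0 g \<Longrightarrow> (LBINT x=-1..1. (g T x)\<^sup>2)
          \<le> Cn n * (LBINT t=0..ereal T. (LBINT x=ereal a..ereal b. (g t x)\<^sup>2))"
    by metis
  define C where "C = 2 + (\<Sum>n<N. Cn n)"
  have Cge: "2 \<le> C" "n < N \<Longrightarrow> Cn n \<le> C" for n
  proof -
    have pos: "0 \<le> Cn n" for n using Cn(1)[of n] by simp
    show "2 \<le> C" unfolding C_def using pos by (simp add: sum_nonneg)
    show "Cn n \<le> C" if "n < N"
      unfolding C_def using member_le_sum[of n "{..<N}" Cn] pos that by simp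
  qed
  show ?thesis
    unfolding observable_def
  proof (intro exI[of _ C] conjI allI impI)
    show "0 < C" using Cge(1) by simp
    fix n :: nat and g0 g assume n: "1 \<le> n" and ws: "weak_sol \<gamma> n T g0 g"
    let ?O = "LBINT t=0..ereal T. (LBINT x=ereal a..ereal b. (g t x)\<^sup>2)"
    have O0: "0 \<le> ?O" using T ab by (intro local_mass_LBINT_nonneg) auto
    show "(LBINT x=-1..1. (g T x)\<^sup>2) \<le> C * ?O"
    proof (cases "n < N")
      case True
      then show ?thesis using Cn(2)[OF n ws] mult_right_mono[OF Cge(2)[OF True] O0] by linarith
    next
      case False
      then show ?thesis using big[OF n _ ws] mult_right_mono[OF Cge(1) O0] by linarith
    qed
  qed
qed

lemma observable_critical_large_time:
  assumes ab: "0 < a" "a < b" "b < 1"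
  shows "\<exists>T0>0. \<forall>T\<ge>T0. observable 1 a b T"
proof -
  define C0 where "C0 = 1024 / ((cutoff_mass 0 1)\<^sup>2 * cutoff_mass a b)"
  have C0: "0 < C0" using cutoff_mass_pos[OF ab(2)] cutoff_mass_pos[of 0 1] by (simp add: C0_def)
  define Kc where "Kc = C0 * exp 6"
  have Kc: "0 < Kc" using C0 by (simp add: Kc_def)
  \<comment> \<open>At gamma = 1 the eigenvalue bound is \<nu>/16, so time 2880 already gives the
    rate -2\<nu>. The excess z >= 4 Kc then shrinks Kc exp(-z) to at most 1/4, uniformly in
    n.\<close>
  define T0 where "T0 = 2880 + 64 * Kc"
  have "observable 1 a b T" if T: "T0 \<le> T" for T
  proof -
    have T1: "2880 \<le> T" "0 < T" using T Kc by (auto simp: T0_def)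
    define z where "z = (T - 2880) / 16"
    have z: "4 * Kc \<le> z" using T by (simp add: z_def T0_def)
    have Kz: "4 * (Kc * exp (- z)) \<le> 1"
    proof -
      have "z \<le> exp z" using exp_ge_add_one_self[of z] by linarith
      then have "4 * Kc \<le> exp z" using z by linarith
      then show ?thesis by (simp add: exp_minus field_simps)
    qed
    have "(LBINT x=-1..1. (g T x)\<^sup>2) \<le> 2 * (LBINT t=0..ereal T. (LBINT x=ereal a..ereal b. (g t x)\<^sup>2))"
      if n: "n \<ge> 1" and ws: "weak_sol 1 n T g0 g" for n g0 g
    proof -
      interpret grushin 1 n using n by unfold_locales auto
      let ?\<nu> = "real n * pi"
      have nu: "1 \<le> ?\<nu>" by (rule nu_ge_1)
      have "1 * z \<le> ?\<nu> * z" using nu z Kc by (intro mult_right_mono) auto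
      then have ex: "178 * ?\<nu> - ?\<nu> powr (2 / (1 + 1)) / 16 * T \<le> - z + - 2 * ?\<nu>"
        using nu by (simp add: z_def field_simps)
      have "C0 * exp (178 * ?\<nu> - ?\<nu> powr (2 / (1 + 1)) / 16 * T + 15842 / T) * (184 * ?\<nu> / T)
          \<le> C0 * exp ((- z + - 2 * ?\<nu>) + 6) * ?\<nu>"
      proof (intro mult_mono)
        have "15842 / T \<le> 6" using T1 by (simp add: field_simps)
        then show "exp (178 * ?\<nu> - ?\<nu> powr (2 / (1 + 1)) / 16 * T + 15842 / T) \<le> exp ((- z + - 2 * ?\<nu>) + 6)" using ex by simp
        have "184 * ?\<nu> \<le> T * ?\<nu>" using T1 nu by (intro mult_right_mono) auto
        then show "184 * ?\<nu> / T \<le> ?\<nu>" using T1 by (simp add: field_simps)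
      qed (use C0 T1 nu in auto)
      also have "\<dots> = (Kc * exp (- z)) * exp (- 2 * ?\<nu>) * ?\<nu>"
        unfolding Kc_def exp_add by (simp only: mult_ac)
      also have "\<dots> \<le> 1/4" using Kc Kz nu by (intro dissipation_beats_cost) auto
      finally show ?thesis unfolding C0_def by (rule observability_by_dissipation[OF T1(2) ab _ ws])
    qed
    then show ?thesis unfolding observable_def by (intro exI[of _ 2]) auto
  qed
  moreover have "0 < T0" using Kc by (simp add: T0_def)
  ultimately show ?thesis by blast
qed

text \<open>\<open>N\<close> says that decay in time consumes at most half of the concentration
  exponent of the first mode. The other half grows linearly in n and outruns any constant.\<close>

lemma not_observable:
  assumes ab: "0 < a" "a < b" "b < 1" and \<gamma>: "1 \<le> \<gamma>" and T: "0 < T"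
    and N: "\<And>n. N \<le> n \<Longrightarrow> 310 * T * real n powr (2 / (1 + \<gamma>)) \<le> real n * ((a / 2) powr \<gamma> * a / 4) / 2"
  shows "\<not> observable \<gamma> a b T"
proof
  assume "observable \<gamma> a b T"
  then obtain C where C: "0 < C" "\<And>n g0 g. 1 \<le> n \<Longrightarrow> L2 g0 \<Longrightarrow> weak_sol \<gamma> n T g0 g \<Longrightarrow> (LBINT x=-1..1. (g T x)\<^sup>2)
          \<le> C * (LBINT t=0..ereal T. (LBINT x=ereal a..ereal b. (g t x)\<^sup>2))"
    unfolding observable_def by blast
  define q where "q = (a / 2) powr \<gamma> * a / 4"
  define r where "r = (a / 2) powr \<gamma>"
  have q0: "0 < q" "0 < r" using ab by (auto simp: q_def r_def)
  \<comment> \<open>Three thresholds: the validity of \<open>N\<close>, the condition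
    \<open>large\<close> of \<open>observability_cost\<close>, and the point where exp x > x
    contradicts the constant C T 4/a.\<close>
  define M where "M = max (max (real N) (155 / r\<^sup>2)) (2 * (C * T * (4 / a)) / q)"
  obtain n :: nat where n: "max M 1 < real n" using reals_Archimedean2 by blast
  have nN: "N \<le> n" "1 \<le> n" and nr: "155 / r\<^sup>2 \<le> real n" and nq: "2 * (C * T * (4 / a)) / q < real n"
    using n by (auto simp: M_def)
  interpret grushin \<gamma> n using \<gamma> nN by unfold_locales auto
  have large: "155 * real n powr (2 / (1 + \<gamma>)) \<le> (real n * (a / 2) powr \<gamma>)\<^sup>2"
  proof -
    have "real n powr (2 / (1 + \<gamma>)) \<le> real n powr 1" using \<gamma> nN by (intro powr_mono) (auto simp: field_simps)
    then have "155 * real n powr (2 / (1 + \<gamma>)) \<le> 155 * real n" using nN by simp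
    also have "\<dots> \<le> (real n * r\<^sup>2) * real n" using nr q0 by (intro mult_right_mono) (auto simp: field_simps)
    finally show ?thesis by (simp add: r_def power_mult_distrib power2_eq_square mult_ac)
  qed
  have "exp (real n * q - 310 * T * real n powr (2 / (1 + \<gamma>))) \<le> C * T * (4 / a)"
    unfolding q_def by (rule observability_cost[OF T ab C(1) C(2)[OF nN(2)] large])
  moreover have "real n * q / 2 \<le> real n * q - 310 * T * real n powr (2 / (1 + \<gamma>))"
    using N[OF nN(1)] unfolding q_def[symmetric] by linarith
  moreover have "real n * q / 2 < exp (real n * q / 2)" using exp_ge_add_one_self[of "real n * q / 2"] by linarith
  ultimately have "real n * q / 2 < C * T * (4 / a)" by (meson exp_le_cancel_iff less_le_trans order_trans)
  moreover have "C * T * (4 / a) < real n * q / 2" 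
  proof -
    have "2 * (C * T * (4 / a)) < real n * q" using nq q0 by (simp only: pos_divide_less_eq)
    then show ?thesis by linarith
  qed
  ultimately show False by simp
qed

lemma not_observable_supercritical:
  assumes ab: "0 < a" "a < b" "b < 1" and \<gamma>: "1 < \<gamma>" and T: "0 < T"
  shows "\<not> observable \<gamma> a b T"
proof -
  define q where "q = (a / 2) powr \<gamma> * a / 4"
  have q0: "0 < q" using ab by (simp add: q_def)
  define s where "s = 1 - 2 / (1 + \<gamma>)"
  have s: "0 < s" using \<gamma> by (simp add: s_def field_simps)
  define M where "M = (620 * T / q) powr (1 / s)"
  obtain N :: nat where N: "max M 1 < real N" using reals_Archimedean2 by blast
  show ?thesis
  proof (rule not_observable[OF ab _ T, where N = N])
    fix n assume n: "N \<le> n"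
    have nM: "M < real n" "1 < real n" using N n by auto
    have "620 * T / q = M powr s" using T q0 s by (simp add: M_def powr_powr)
    also have "\<dots> \<le> real n powr s" using nM s by (intro powr_mono2) (auto simp: M_def)
    finally have "620 * T \<le> q * real n powr s" using q0 by (simp add: field_simps)
    then have "620 * T * real n powr (2 / (1 + \<gamma>)) \<le> q * real n powr s * real n powr (2 / (1 + \<gamma>))" by (rule mult_right_mono) simp
    also have "\<dots> = q * real n powr (s + 2 / (1 + \<gamma>))" by (simp add: powr_add)
    also have "\<dots> = q * real n" using nM by (simp add: s_def)
    finally show "310 * T * real n powr (2 / (1 + \<gamma>)) \<le> real n * ((a / 2) powr \<gamma> * a / 4) / 2" by (simp add: q_def mult_ac)
  qed (use \<gamma> in simp)
qed

lemma not_observable_critical_small_time: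
  assumes ab: "0 < a" "a < b" "b < 1"
  shows "\<exists>T1>0. \<forall>T. 0 < T \<and> T \<le> T1 \<longrightarrow> \<not> observable 1 a b T"
proof -
  define q where "q = (a / 2) powr 1 * a / 4"
  have q0: "0 < q" using ab by (simp add: q_def)
  have "\<not> observable 1 a b T" if T: "0 < T" "T \<le> q / 620" for T
  proof (rule not_observable[OF ab _ T(1), where N = 0])
    fix n :: nat
    have "310 * T * real n \<le> q / 2 * real n" using T by (intro mult_right_mono) auto
    then show "310 * T * real n powr (2 / (1 + 1)) \<le> real n * ((a / 2) powr 1 * a / 4) / 2" by (simp add: q_def mult_ac)
  qed simp
  then show ?thesis using q0 by (intro exI[of _ "q / 620"]) auto
qed

text \<open>Over a longer time the final norm only decreases and the observation only increases.
  This makes the set of observable times upward closed, so that its infimum is a threshold.\<close>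

lemma observable_mono:
  assumes ab: "0 < a" "a < b" "b < 1" and \<gamma>: "0 < \<gamma>" and T: "0 < T" "T \<le> T'" and ob: "observable \<gamma> a b T"
  shows "observable \<gamma> a b T'"
proof -
  obtain C where C: "0 < C" "\<And>n g0 g. 1 \<le> n \<Longrightarrow> L2 g0 \<Longrightarrow> weak_sol \<gamma> n T g0 g \<Longrightarrow> (LBINT x=-1..1. (g T x)\<^sup>2)
          \<le> C * (LBINT t=0..ereal T. (LBINT x=ereal a..ereal b. (g t x)\<^sup>2))"
    using ob unfolding observable_def by blast
  show ?thesis
    unfolding observable_def
  proof (intro exI[of _ C] conjI allI impI C(1))
    fix n :: nat and g0 g assume n: "1 \<le> n" and g0: "L2 g0" and ws: "weak_sol \<gamma> n T' g0 g"
    interpret grushin \<gamma> n using \<gamma> n by unfold_locales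
    have ab': "-1 \<le> a" "a \<le> b" "b \<le> 1" using ab by auto
    have m1: "(LBINT x=-1..1. (g T' x)\<^sup>2) \<le> (LBINT x=-1..1. (g T x)\<^sup>2)"
      by (rule weak_sol_observability_mono(1)[OF pot_eq ws T ab'])
    have m2: "(LBINT t=0..ereal T. (LBINT x=ereal a..ereal b. (g t x)\<^sup>2)) \<le> (LBINT t=0..ereal T'. (LBINT x=ereal a..ereal b. (g t x)\<^sup>2))"
      by (rule weak_sol_observability_mono(2)[OF pot_eq ws T ab'])
    have "(LBINT x=-1..1. (g T x)\<^sup>2) \<le> C * (LBINT t=0..ereal T. (LBINT x=ereal a..ereal b. (g t x)\<^sup>2))"
      by (rule C(2)[OF n g0 weak_sol_restrict[OF ws T]])
    also have "\<dots> \<le> C * (LBINT t=0..ereal T'. (LBINT x=ereal a..ereal b. (g t x)\<^sup>2))"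
      using m2 C(1) by (intro mult_left_mono) auto
    finally show "(LBINT x=-1..1. (g T' x)\<^sup>2) \<le> C * (LBINT t=0..ereal T'. (LBINT x=ereal a..ereal b. (g t x)\<^sup>2))"
      using m1 by linarith
  qed
qed

theorem theorem2p2:
  fixes a b :: real
  assumes "0 < a" and "a < b" and "b < 1"
  shows "(\<forall>\<gamma>. 0 < \<gamma> \<and> \<gamma> < 1 \<longrightarrow> (\<forall>T>0. observable \<gamma> a b T))
       \<and> (\<exists>Tstar>0. (\<forall>T>Tstar. observable 1 a b T)
                    \<and> (\<forall>T. 0 < T \<and> T < Tstar \<longrightarrow> \<not> observable 1 a b T))
       \<and> (\<forall>\<gamma>>1. \<forall>T>0. \<not> observable \<gamma> a b T)"
proof (intro conjI)
  show "\<forall>\<gamma>. 0 < \<gamma> \<and> \<gamma> < 1 \<longrightarrow> (\<forall>T>0. observable \<gamma> a b T)"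
    using observable_subcritical[OF assms] by blast
  show "\<forall>\<gamma>>1. \<forall>T>0. \<not> observable \<gamma> a b T"
    using not_observable_supercritical[OF assms] by blast
  obtain T0 where T0: "0 < T0" "\<And>T. T0 \<le> T \<Longrightarrow> observable 1 a b T"
    using observable_critical_large_time[OF assms] by blast
  obtain T1 where T1: "0 < T1" "\<And>T. 0 < T \<Longrightarrow> T \<le> T1 \<Longrightarrow> \<not> observable 1 a b T"
    using not_observable_critical_small_time[OF assms] by blast
  \<comment> \<open>The critical time is the infimum of \<open>S\<close>: the large-time result
    makes \<open>S\<close> nonempty, and the small-time result keeps the infimum at least T1 >
    0.\<close>
  define S where "S = {T. 0 < T \<and> observable 1 a b T}"
  have ne: "S \<noteq> {}" using T0 unfolding S_def by (auto intro!: exI[of _ T0])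
  have bd: "bdd_below S" unfolding S_def by (rule bdd_belowI[of _ 0]) auto
  show "\<exists>Tstar>0. (\<forall>T>Tstar. observable 1 a b T) \<and> (\<forall>T. 0 < T \<and> T < Tstar \<longrightarrow> \<not> observable 1 a b T)"
  proof (intro exI[of _ "Inf S"] conjI allI impI)
    have "T1 \<le> Inf S"
      by (rule cInf_greatest[OF ne]) (use T1(2) in \<open>force simp: S_def not_le\<close>)
    then show "0 < Inf S" using T1(1) by simp
    show "observable 1 a b T" if T: "Inf S < T" for T
    proof -
      obtain U where U: "U \<in> S" "U < T" using cInf_lessD[OF ne T] by blast
      show ?thesis using U by (intro observable_mono[OF assms, of 1 U T]) (auto simp: S_def)
    qed
    show "\<not> observable 1 a b T" if T: "0 < T \<and> T < Inf S" for T
    proof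
      assume "observable 1 a b T"
      then have "T \<in> S" using T by (simp add: S_def)
      then have "Inf S \<le> T" by (rule cInf_lower[OF _ bd])
      then show False using T by simp
    qed
  qed
qed

end
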